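(* Let $V,W$ be irreducible representations of $G_0$ and $k>0$ an integer. Fix an irreducible component $R_i\subset S^k\mathfrak g_{-1}\otimes V^*\otimes W[\delta]$, consider the corresponding Casimir eigenvalue $\beta_i^0$, and one of the other Casimir eigenvalues $\beta_i^j$, $1\le j\le n_i$ (all depending on $\delta\in\mathbb R$). Then there is exactly one value of $\delta$ for which $\beta_i^0=\beta_i^j$. Hence there are at most $n_i$ many values of $\delta$ for which $\gamma_i=0$, and at most $\sum_in_i$ critical weights.
   Context: $\mathfrak g=\mathfrak g_{-1}\oplus\mathfrak g_0\oplus\mathfrak g_1$ is a $|1|$-graded simple Lie algebra ($[\mathfrak g_i,\mathfrak g_j]\subset\mathfrak g_{i+j}$), $\mathfrak p=\mathfrak g_0\oplus\mathfrak g_1$, $G$ is a Lie group with Lie algebra $\mathfrak g$, $P\subset G$ is a subgroup lying between the normalizer $N_G(\mathfrak p)$ and its identity component, and $G_0\subset P$ is the subgroup of elements whose adjoint action preserves the grading; $n=\dim\mathfrak g_{-1}$. $G_0$ is reductive with one-dimensional center, and $P$ is the semidirect product of $G_0$ and $P_+=\exp(\mathfrak g_1)$; representations of $G_0$ are regarded as representations of $P$ via $P\to P/P_+\cong G_0$. All representations are finite dimensional and the center of $G_0$ acts diagonalizably. $\mathbb R[w]$ ($w\in\mathbb R$) is the one-dimensional representation $g\mapsto|\det(\mathrm{Ad}(g)|_{\mathfrak g_{-1}})|^{w/n}$ of $G_0$; for a representation $X$ put $X[w]=X\otimes\mathbb R[w]$. Casimir eigenvalue. Choose a Cartan subalgebra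 $\mathfrak h$ of $\mathfrak g_{\mathbb C}$ contained in $(\mathfrak g_0)_{\mathbb C}$ and positive roots such that all root spaces in $(\mathfrak g_1)_{\mathbb C}$ are positive. Highest and lowest weights of irreducible representations of $\mathfrak g_0$ are defined by passing to complexifications. Let $\langle\ ,\ \rangle$ be the inner product on the real span of weights induced by the Killing form and $\rho$ half the sum of the positive roots of $\mathfrak g_{\mathbb C}$. The Casimir eigenvalue of an irreducible representation with lowest weight $-\lambda$ is $\langle\lambda,\lambda+2\rho\rangle=\|\lambda\|^2+2\langle\lambda,\rho\rangle$. Modules. Let $\tilde{\mathbb V}=S^k\mathfrak g\otimes V^*\otimes W[\delta]$ with the $P$-invariant filtration $\tilde{\mathbb V}^\ell$, $-k\le\ell\le k$, spanned by $a_1\cdots a_k\otimes x$ with $a_j\in\mathfrak g^{i_j}$, $\sum i_j\ge\ell$ (where $\mathfrak g^1=\mathfrak g_1$, $\mathfrak g^0=\mathfrak p$, $\mathfrak g^{-1}=\mathfrak g$), and put $\mathbb V=\tilde{\mathbb V}/\tilde{\mathbb V}^1$ with the induced filtration. Decompose $S^k\mathfrak g_{-1}\otimes V^*\otimes W[\delta]=\bigoplus_iR_i$ into irreducible $G_0$-representations; view $R_i\subset\mathbb V$ as a $G_0$-subspace and let $S_i\subset\mathbb V$ be the $P$-submodule generated by $R_i$, with the induced filtration; its quotient by the largest proper filtration component is $R_i$. All consecutive filtration quotients are completely reducible representations of $G_0$. Changing $\delta$ amounts to tensoring all of these modules with a one-dimensional representation $\mathbb R[w]$, so the decompositions (and the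 index $i$) do not depend on $\delta$ apart from this tensor factor. $\beta_i^0$ is the Casimir eigenvalue of $R_i$, and $\beta_i^1,\dots,\beta_i^{n_i}$ are the different Casimir eigenvalues, regarded as functions of $\delta$, of the irreducible components of the other quotients of consecutive filtration components of $S_i$. Put $\gamma_i=\prod_{j=1}^{n_i}(\beta_i^0-\beta_i^j)$. A weight $\delta$ is critical if $\gamma_i=0$ for at least one $i$. *)

theory Defs
  imports "HOL-Analysis.Analysis" "HOL-Algebra.Group" "HOL-Library.Function_Algebras"
begin

text \<open>Pointwise real vector space structure on functions; it carries the concrete model of
  \<open>S\<^sup>k \<gg> \<otimes> V* \<otimes> W\<close> used below.\<close>

instantiation "fun" :: (type, real_vector) real_vector
begin
definition scaleR_fun_def: "scaleR r f = (\<lambda>x. r *\<^sub>R f x)"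
instance
  by standard (simp_all add: scaleR_fun_def plus_fun_def fun_eq_iff scaleR_add_right scaleR_add_left)
end


section \<open>Linear algebra\<close>

definition trace_of :: "('a::euclidean_space \<Rightarrow> 'a) \<Rightarrow> real" where
  "trace_of f = (\<Sum>b\<in>Basis. f b \<bullet> b)"

text \<open>Leibniz formula for the determinant of an endomorphism of the subspace \<open>S\<close>; the value does
  not depend on the basis.\<close>

definition det_on :: "'a::euclidean_space set \<Rightarrow> ('a \<Rightarrow> 'a) \<Rightarrow> real" where
  "det_on S f = (let B = (SOME B. independent B \<and> span B = S) in
     \<Sum>p | p permutes B. of_int (sign p) * (\<Prod>b\<in>B. representation B (f b) (p b)))"

definition diagonalizable :: "('a::real_vector \<Rightarrow> 'a) \<Rightarrow> bool" where
  "diagonalizable f \<longleftrightarrow> span {v. \<exists>c. f v = c *\<^sub>R v} = UNIV"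

text \<open>The complexification of a real vector space \<open>X\<close> is modelled by \<open>X \<times> X\<close>, the pair
  \<open>(x, y)\<close> standing for \<open>x + \<i> y\<close>.\<close>

definition cscale :: "complex \<Rightarrow> 'x::real_vector \<times> 'x \<Rightarrow> 'x \<times> 'x" where
  "cscale c X = (Re c *\<^sub>R fst X - Im c *\<^sub>R snd X, Re c *\<^sub>R snd X + Im c *\<^sub>R fst X)"

text \<open>Complex bilinear extension of a real bilinear map.\<close>

definition cbil :: "('a \<Rightarrow> 'x \<Rightarrow> 'y::real_vector) \<Rightarrow> 'a \<times> 'a \<Rightarrow> 'x \<times> 'x \<Rightarrow> 'y \<times> 'y" where
  "cbil B Z X = (B (fst Z) (fst X) - B (snd Z) (snd X), B (fst Z) (snd X) + B (snd Z) (fst X))"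


section \<open>Graded Lie algebras\<close>

definition lie_algebra :: "('a::real_vector \<Rightarrow> 'a \<Rightarrow> 'a) \<Rightarrow> bool" where
  "lie_algebra br \<longleftrightarrow> bilinear br \<and> (\<forall>x. br x x = 0) \<and>
     (\<forall>x y z. br x (br y z) + br y (br z x) + br z (br x y) = 0)"

definition simple_lie_algebra :: "('a::real_vector \<Rightarrow> 'a \<Rightarrow> 'a) \<Rightarrow> bool" where
  "simple_lie_algebra br \<longleftrightarrow> lie_algebra br \<and> (\<exists>x y. br x y \<noteq> 0) \<and>
     (\<forall>I. subspace I \<and> (\<forall>x. \<forall>y\<in>I. br x y \<in> I) \<longrightarrow> I = {0} \<or> I = UNIV)"

definition one_grading :: "('a::real_vector \<Rightarrow> 'a \<Rightarrow> 'a) \<Rightarrow> (int \<Rightarrow> 'a set) \<Rightarrow> bool" where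
  "one_grading br gr \<longleftrightarrow>
     (\<forall>i. subspace (gr i)) \<and> (\<forall>i. i \<notin> {-1, 0, 1} \<longrightarrow> gr i = {0}) \<and>
     gr (-1) \<noteq> {0} \<and> gr 1 \<noteq> {0} \<and>
     (\<forall>x. \<exists>!t. t \<in> gr (-1) \<times> gr 0 \<times> gr 1 \<and> x = fst t + fst (snd t) + snd (snd t)) \<and>
     (\<forall>i j. \<forall>x\<in>gr i. \<forall>y\<in>gr j. br x y \<in> gr (i + j))"

definition filtr :: "(int \<Rightarrow> 'a::real_vector set) \<Rightarrow> int \<Rightarrow> 'a set" where
  "filtr gr i = span (\<Union>j\<in>{i..1}. gr j)"

definition killing :: "('a::euclidean_space \<Rightarrow> 'a \<Rightarrow> 'a) \<Rightarrow> 'a \<Rightarrow> 'a \<Rightarrow> real" where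
  "killing br x y = trace_of (\<lambda>z. br x (br y z))"

definition ckilling :: "('a::euclidean_space \<Rightarrow> 'a \<Rightarrow> 'a) \<Rightarrow> 'a \<times> 'a \<Rightarrow> 'a \<times> 'a \<Rightarrow> complex" where
  "ckilling br X Y = (let Z = cbil (killing br) X Y in Complex (fst Z) (snd Z))"

definition csubspace :: "('x::real_vector \<times> 'x) set \<Rightarrow> bool" where
  "csubspace S \<longleftrightarrow> subspace S \<and> (\<forall>c. \<forall>X\<in>S. cscale c X \<in> S)"

text \<open>Cartan subalgebras of the semisimple complexification: maximal abelian subalgebras acting
  diagonalizably. The set of eigenvectors is stable under complex scalars, so its real span is its
  complex span.\<close>

definition cartan_subalgebra :: "('a::euclidean_space \<Rightarrow> 'a \<Rightarrow> 'a) \<Rightarrow> ('a \<times> 'a) set \<Rightarrow> bool" where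
  "cartan_subalgebra br h \<longleftrightarrow> csubspace h \<and>
     (\<forall>H\<in>h. \<forall>H'\<in>h. cbil br H H' = 0) \<and>
     (\<forall>X. (\<forall>H\<in>h. cbil br H X = 0) \<longrightarrow> X \<in> h) \<and>
     (\<forall>H\<in>h. span {X. \<exists>c. cbil br H X = cscale c X} = UNIV)"

text \<open>Linear functionals on \<open>h\<close> are extended by \<open>0\<close> off \<open>h\<close> in order to make them unique as
  functions.\<close>

definition cdual :: "('a::real_vector \<times> 'a) set \<Rightarrow> ('a \<times> 'a \<Rightarrow> complex) set" where
  "cdual h = {\<mu>. (\<forall>X\<in>h. \<forall>Y\<in>h. \<mu> (X + Y) = \<mu> X + \<mu> Y) \<and>
                 (\<forall>c. \<forall>X\<in>h. \<mu> (cscale c X) = c * \<mu> X) \<and> (\<forall>X. X \<notin> h \<longrightarrow> \<mu> X = 0)}"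

definition root_space ::
  "('a::real_vector \<Rightarrow> 'a \<Rightarrow> 'a) \<Rightarrow> ('a \<times> 'a) set \<Rightarrow> ('a \<times> 'a \<Rightarrow> complex) \<Rightarrow> ('a \<times> 'a) set" where
  "root_space br h \<alpha> = {X. \<forall>H\<in>h. cbil br H X = cscale (\<alpha> H) X}"

definition roots ::
  "('a::real_vector \<Rightarrow> 'a \<Rightarrow> 'a) \<Rightarrow> ('a \<times> 'a) set \<Rightarrow> ('a \<times> 'a \<Rightarrow> complex) set" where
  "roots br h = {\<alpha> \<in> cdual h. (\<exists>H\<in>h. \<alpha> H \<noteq> 0) \<and> root_space br h \<alpha> \<noteq> {0}}"

text \<open>Positive systems are cut out by regular elements.\<close>

definition positive_system ::
  "('a::real_vector \<Rightarrow> 'a \<Rightarrow> 'a) \<Rightarrow> ('a \<times> 'a) set \<Rightarrow> ('a \<times> 'a \<Rightarrow> complex) set \<Rightarrow> bool" where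
  "positive_system br h \<Phi> \<longleftrightarrow> (\<exists>H\<^sub>0\<in>h. (\<forall>\<alpha>\<in>roots br h. Re (\<alpha> H\<^sub>0) \<noteq> 0) \<and>
     \<Phi> = {\<alpha> \<in> roots br h. Re (\<alpha> H\<^sub>0) > 0})"

definition half_sum :: "('a \<times> 'a \<Rightarrow> complex) set \<Rightarrow> 'a \<times> 'a \<Rightarrow> complex" where
  "half_sum \<Phi> H = (\<Sum>\<alpha>\<in>\<Phi>. \<alpha> H) / 2"

definition weight_dual ::
  "('a::euclidean_space \<Rightarrow> 'a \<Rightarrow> 'a) \<Rightarrow> ('a \<times> 'a) set \<Rightarrow> ('a \<times> 'a \<Rightarrow> complex) \<Rightarrow> 'a \<times> 'a" where
  "weight_dual br h \<mu> = (THE T. T \<in> h \<and> (\<forall>H\<in>h. ckilling br T H = \<mu> H))"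

text \<open>The Killing form is real (and positive definite) on the real span of the weights; taking
  the real part makes the inner product real valued as a function.\<close>

definition weight_inner ::
  "('a::euclidean_space \<Rightarrow> 'a \<Rightarrow> 'a) \<Rightarrow> ('a \<times> 'a) set \<Rightarrow>
   ('a \<times> 'a \<Rightarrow> complex) \<Rightarrow> ('a \<times> 'a \<Rightarrow> complex) \<Rightarrow> real" where
  "weight_inner br h \<mu> \<nu> = Re (ckilling br (weight_dual br h \<mu>) (weight_dual br h \<nu>))"


section \<open>Lie groups\<close>

text \<open>\<open>f\<close> is of class \<open>C\<^sup>m\<close> on the open set \<open>S\<close>.\<close>

primrec C_class ::
  "nat \<Rightarrow> 'a::real_normed_vector set \<Rightarrow> ('a \<Rightarrow> 'b::real_normed_vector) \<Rightarrow> bool" where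
  "C_class 0 S f \<longleftrightarrow> continuous_on S f"
| "C_class (Suc m) S f \<longleftrightarrow> (\<exists>f'. (\<forall>x\<in>S. (f has_derivative f' x) (at x)) \<and>
     (\<forall>v. C_class m S (\<lambda>x. f' x v)))"

definition smooth_on :: "'a::real_normed_vector set \<Rightarrow> ('a \<Rightarrow> 'b::real_normed_vector) \<Rightarrow> bool" where
  "smooth_on S f \<longleftrightarrow> (\<forall>m. C_class m S f)"

type_synonym ('g, 'a) chart = "'g set \<times> ('g \<Rightarrow> 'a)"

definition smooth_atlas :: "'g topology \<Rightarrow> ('g, 'a::euclidean_space) chart set \<Rightarrow> bool" where
  "smooth_atlas T A \<longleftrightarrow>
     (\<forall>(U, \<phi>)\<in>A. openin T U \<and> open (\<phi> ` U) \<and>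
        homeomorphic_map (subtopology T U) (top_of_set (\<phi> ` U)) \<phi>) \<and>
     \<Union>(fst ` A) = topspace T \<and>
     (\<forall>(U, \<phi>)\<in>A. \<forall>(V, \<psi>)\<in>A. smooth_on (\<phi> ` (U \<inter> V)) (\<psi> \<circ> inv_into U \<phi>))"

definition lie_group ::
  "'g monoid \<Rightarrow> 'g topology \<Rightarrow> ('g, 'a::euclidean_space) chart set \<Rightarrow> bool" where
  "lie_group G T A \<longleftrightarrow> group G \<and> topspace T = carrier G \<and>
     Hausdorff_space T \<and> second_countable T \<and> smooth_atlas T A \<and>
     continuous_map (prod_topology T T) T (\<lambda>(x, y). x \<otimes>\<^bsub>G\<^esub> y) \<and>
     continuous_map T T (\<lambda>x. inv\<^bsub>G\<^esub> x) \<and>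
     (\<forall>(U, \<phi>)\<in>A. \<forall>(V, \<psi>)\<in>A. \<forall>(W, \<theta>)\<in>A.
        smooth_on {(\<phi> x, \<psi> y) | x y. x \<in> U \<and> y \<in> V \<and> x \<otimes>\<^bsub>G\<^esub> y \<in> W}
          (\<lambda>(u, v). \<theta> (inv_into U \<phi> u \<otimes>\<^bsub>G\<^esub> inv_into V \<psi> v))) \<and>
     (\<forall>(U, \<phi>)\<in>A. \<forall>(V, \<psi>)\<in>A.
        smooth_on {\<phi> x | x. x \<in> U \<and> inv\<^bsub>G\<^esub> x \<in> V} (\<lambda>u. \<psi> (inv\<^bsub>G\<^esub> (inv_into U \<phi> u))))"

text \<open>Real-valued or vector-valued functions that are smooth on an arbitrary subset \<open>S\<close> of a
  manifold, i.e. locally restrictions of smooth functions; for an embedded submanifold \<open>S\<close> these are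
  the smooth functions on \<open>S\<close>.\<close>

definition smooth_on_subset ::
  "('g, 'a::euclidean_space) chart set \<Rightarrow> 'g set \<Rightarrow> ('g \<Rightarrow> 'b::real_normed_vector) \<Rightarrow> bool" where
  "smooth_on_subset A S f \<longleftrightarrow> (\<forall>g\<in>S. \<exists>(U, \<phi>)\<in>A. \<exists>N F. g \<in> U \<and> open N \<and> \<phi> g \<in> N \<and>
     N \<subseteq> \<phi> ` U \<and> smooth_on N F \<and> (\<forall>x\<in>S \<inter> U. \<phi> x \<in> N \<longrightarrow> F (\<phi> x) = f x))"

definition one_parameter_subgroup ::
  "'g monoid \<Rightarrow> 'g topology \<Rightarrow> ('g, 'a::euclidean_space) chart set \<Rightarrow> (real \<Rightarrow> 'g) \<Rightarrow> bool" where
  "one_parameter_subgroup G T A \<gamma> \<longleftrightarrow> (\<forall>s t. \<gamma> (s + t) = \<gamma> s \<otimes>\<^bsub>G\<^esub> \<gamma> t) \<and>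
     continuous_map euclideanreal T \<gamma> \<and> (\<forall>(U, \<phi>)\<in>A. smooth_on {t. \<gamma> t \<in> U} (\<phi> \<circ> \<gamma>))"

text \<open>A Lie group together with a graded Lie algebra on the whole type \<open>'a\<close>, an exponential map, a
  subgroup \<open>P\<close> and the choices entering the definition of Casimir eigenvalues. The chart \<open>chart1\<close>
  around the unit serves to identify the tangent space at the unit with \<open>'a\<close>.\<close>

record ('g, 'a) graded_pair =
  bracket :: "'a \<Rightarrow> 'a \<Rightarrow> 'a"
  grade :: "int \<Rightarrow> 'a set"
  Grp :: "'g monoid"
  Gtop :: "'g topology"
  charts :: "('g, 'a) chart set"
  chart1 :: "('g, 'a) chart"
  expo :: "'a \<Rightarrow> 'g"
  Psub :: "'g set"
  cartan :: "('a \<times> 'a) set"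
  posroots :: "('a \<times> 'a \<Rightarrow> complex) set"

definition chart_at_1 :: "('g, 'a) graded_pair \<Rightarrow> 'g \<Rightarrow> 'a" where
  "chart_at_1 K = snd (chart1 K)"

definition param_at_1 :: "('g, 'a) graded_pair \<Rightarrow> 'a \<Rightarrow> 'g" where
  "param_at_1 K = inv_into (fst (chart1 K)) (snd (chart1 K))"

text \<open>The adjoint action: derivative at the unit of the conjugation by \<open>g\<close>.\<close>

definition Ad :: "('g, 'a::euclidean_space) graded_pair \<Rightarrow> 'g \<Rightarrow> 'a \<Rightarrow> 'a" where
  "Ad K g = frechet_derivative
     (\<lambda>u. chart_at_1 K (g \<otimes>\<^bsub>Grp K\<^esub> param_at_1 K u \<otimes>\<^bsub>Grp K\<^esub> inv\<^bsub>Grp K\<^esub> g))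
     (at (chart_at_1 K \<one>\<^bsub>Grp K\<^esub>))"

text \<open>The bracket of the Lie algebra of \<open>G\<close> is the derivative of \<open>Ad\<close> at the unit.\<close>

definition has_lie_algebra :: "('g, 'a::euclidean_space) graded_pair \<Rightarrow> bool" where
  "has_lie_algebra K \<longleftrightarrow> chart1 K \<in> charts K \<and> \<one>\<^bsub>Grp K\<^esub> \<in> fst (chart1 K) \<and>
     (\<forall>y. ((\<lambda>u. Ad K (param_at_1 K u) y) has_derivative (\<lambda>x. bracket K x y))
            (at (chart_at_1 K \<one>\<^bsub>Grp K\<^esub>)))"

text \<open>\<open>t \<mapsto> exp (t x)\<close> is the unique one-parameter subgroup with initial velocity \<open>x\<close>.\<close>

definition is_exponential :: "('g, 'a::euclidean_space) graded_pair \<Rightarrow> bool" where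
  "is_exponential K \<longleftrightarrow> (\<forall>x \<gamma>.
     (one_parameter_subgroup (Grp K) (Gtop K) (charts K) \<gamma> \<and>
      ((chart_at_1 K \<circ> \<gamma>) has_vector_derivative x) (at 0)) \<longleftrightarrow> \<gamma> = (\<lambda>t. expo K (t *\<^sub>R x)))"

definition parabolic :: "('g, 'a::real_vector) graded_pair \<Rightarrow> 'a set" where
  "parabolic K = filtr (grade K) 0"

definition normalizer_p :: "('g, 'a::euclidean_space) graded_pair \<Rightarrow> 'g set" where
  "normalizer_p K = {g \<in> carrier (Grp K). Ad K g ` parabolic K = parabolic K}"

definition G0 :: "('g, 'a::euclidean_space) graded_pair \<Rightarrow> 'g set" where
  "G0 K = {g \<in> Psub K. \<forall>i. Ad K g ` grade K i \<subseteq> grade K i}"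

definition center_G0 :: "('g, 'a::euclidean_space) graded_pair \<Rightarrow> 'g set" where
  "center_G0 K = {z \<in> G0 K. \<forall>g\<in>G0 K. z \<otimes>\<^bsub>Grp K\<^esub> g = g \<otimes>\<^bsub>Grp K\<^esub> z}"

text \<open>The dimension of a closed subgroup is that of its Lie algebra, which consists of all \<open>x\<close> whose
  one-parameter subgroup lies in it.\<close>

definition graded_pair_setting :: "('g, 'a::euclidean_space) graded_pair \<Rightarrow> bool" where
  "graded_pair_setting K \<longleftrightarrow>
     simple_lie_algebra (bracket K) \<and> one_grading (bracket K) (grade K) \<and>
     lie_group (Grp K) (Gtop K) (charts K) \<and> has_lie_algebra K \<and> is_exponential K \<and>
     subgroup (Psub K) (Grp K) \<and> Psub K \<subseteq> normalizer_p K \<and>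
     connected_component_of_set (subtopology (Gtop K) (normalizer_p K)) \<one>\<^bsub>Grp K\<^esub> \<subseteq> Psub K \<and>
     dim {x. \<forall>t::real. expo K (t *\<^sub>R x) \<in> center_G0 K} = 1 \<and>
     cartan_subalgebra (bracket K) (cartan K) \<and> cartan K \<subseteq> grade K 0 \<times> grade K 0 \<and>
     positive_system (bracket K) (cartan K) (posroots K) \<and>
     (\<forall>\<alpha>\<in>roots (bracket K) (cartan K).
        root_space (bracket K) (cartan K) \<alpha> \<subseteq> grade K 1 \<times> grade K 1 \<longrightarrow> \<alpha> \<in> posroots K)"


section \<open>Representations of \<open>G\<^sub>0\<close>\<close>

definition G0_rep ::
  "('g, 'a::euclidean_space) graded_pair \<Rightarrow> ('g \<Rightarrow> 'v::euclidean_space \<Rightarrow> 'v) \<Rightarrow> bool" where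
  "G0_rep K \<sigma> \<longleftrightarrow> (\<forall>g\<in>G0 K. linear (\<sigma> g)) \<and> \<sigma> \<one>\<^bsub>Grp K\<^esub> = id \<and>
     (\<forall>g\<in>G0 K. \<forall>g'\<in>G0 K. \<sigma> (g \<otimes>\<^bsub>Grp K\<^esub> g') = \<sigma> g \<circ> \<sigma> g') \<and>
     (\<forall>v. smooth_on_subset (charts K) (G0 K) (\<lambda>g. \<sigma> g v)) \<and>
     (\<forall>z\<in>center_G0 K. diagonalizable (\<sigma> z))"

definition irreducible_G0_rep ::
  "('g, 'a::euclidean_space) graded_pair \<Rightarrow> ('g \<Rightarrow> 'v::euclidean_space \<Rightarrow> 'v) \<Rightarrow> bool" where
  "irreducible_G0_rep K \<sigma> \<longleftrightarrow> G0_rep K \<sigma> \<and>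
     (\<forall>U. subspace U \<and> (\<forall>g\<in>G0 K. \<sigma> g ` U \<subseteq> U) \<longrightarrow> U = {0} \<or> U = UNIV)"

text \<open>The projection \<open>P \<rightarrow> P/P\<^sub>+ \<cong> G\<^sub>0\<close> with \<open>P\<^sub>+ = exp (\<gg>\<^sub>1)\<close>.\<close>

definition levi_part :: "('g, 'a::euclidean_space) graded_pair \<Rightarrow> 'g \<Rightarrow> 'g" where
  "levi_part K p = (THE g. g \<in> G0 K \<and> (\<exists>z\<in>grade K 1. p = g \<otimes>\<^bsub>Grp K\<^esub> expo K z))"

text \<open>The character defining \<open>\<real>[w]\<close>.\<close>

definition density_char :: "('g, 'a::euclidean_space) graded_pair \<Rightarrow> real \<Rightarrow> 'g \<Rightarrow> real" where
  "density_char K w g = \<bar>det_on (grade K (-1)) (Ad K g)\<bar> powr (w / real (dim (grade K (-1))))"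


section \<open>The module \<open>S\<^sup>k \<gg> \<otimes> V* \<otimes> W[\<delta>]\<close>\<close>

text \<open>\<open>S\<^sup>k \<gg>\<close> is realized as the space of homogeneous polynomials of degree \<open>k\<close> on the dual of \<open>\<gg>\<close>,
  so elements of the tensor product become functions of \<open>\<xi>\<close> in the dual of \<open>\<gg>\<close> and \<open>v\<close> in \<open>V\<close> with
  values in \<open>W\<close>. The following is \<open>a\<^sub>1 \<cdots> a\<^sub>k \<otimes> f \<otimes> w\<close>.\<close>

type_synonym ('a, 'v, 'w) tens = "('a \<Rightarrow>\<^sub>L real) \<Rightarrow> 'v \<Rightarrow> 'w"

definition tensor ::
  "'a::euclidean_space list \<Rightarrow> ('v \<Rightarrow> real) \<Rightarrow> 'w::real_vector \<Rightarrow> ('a, 'v, 'w) tens" where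
  "tensor as f w = (\<lambda>\<xi> v. (prod_list (map (blinfun_apply \<xi>) as) * f v) *\<^sub>R w)"

definition symbol_space ::
  "('g, 'a::euclidean_space) graded_pair \<Rightarrow> nat \<Rightarrow> ('a, 'v::euclidean_space, 'w::euclidean_space) tens set" where
  "symbol_space K k = span {tensor as f w | as f w.
     length as = k \<and> linear f \<and> set as \<subseteq> grade K (-1)}"

definition filtration ::
  "('g, 'a::euclidean_space) graded_pair \<Rightarrow> nat \<Rightarrow> int \<Rightarrow>
   ('a, 'v::euclidean_space, 'w::euclidean_space) tens set" where
  "filtration K k l = span {tensor as f w | as f w. length as = k \<and> linear f \<and>
     (\<exists>is. length is = k \<and> sum_list is \<ge> l \<and>
        (\<forall>j<k. is ! j \<in> {-1, 0, 1} \<and> as ! j \<in> filtr (grade K) (is ! j)))}"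

definition act ::
  "('g, 'a::euclidean_space) graded_pair \<Rightarrow> ('g \<Rightarrow> 'v::euclidean_space \<Rightarrow> 'v) \<Rightarrow>
   ('g \<Rightarrow> 'w::euclidean_space \<Rightarrow> 'w) \<Rightarrow> real \<Rightarrow> 'g \<Rightarrow> ('a, 'v, 'w) tens \<Rightarrow> ('a, 'v, 'w) tens" where
  "act K \<sigma> \<tau> \<delta> p F = (let g = levi_part K p in
     (\<lambda>\<xi> v. density_char K \<delta> g *\<^sub>R
        \<tau> g (F (Blinfun (\<lambda>x. \<xi> (Ad K p x))) (\<sigma> (inv\<^bsub>Grp K\<^esub> g) v))))"

text \<open>The corresponding infinitesimal action of \<open>\<gg>\<^sub>0\<close>.\<close>

definition dact ::
  "('g, 'a::euclidean_space) graded_pair \<Rightarrow> ('g \<Rightarrow> 'v::euclidean_space \<Rightarrow> 'v) \<Rightarrow>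
   ('g \<Rightarrow> 'w::euclidean_space \<Rightarrow> 'w) \<Rightarrow> real \<Rightarrow> 'a \<Rightarrow> ('a, 'v, 'w) tens \<Rightarrow> ('a, 'v, 'w) tens" where
  "dact K \<sigma> \<tau> \<delta> x F =
     (\<lambda>\<xi> v. vector_derivative (\<lambda>t. act K \<sigma> \<tau> \<delta> (expo K (t *\<^sub>R x)) F \<xi> v) (at 0))"

definition invariant_subspace ::
  "('g, 'a::euclidean_space) graded_pair \<Rightarrow> ('g \<Rightarrow> 'v::euclidean_space \<Rightarrow> 'v) \<Rightarrow>
   ('g \<Rightarrow> 'w::euclidean_space \<Rightarrow> 'w) \<Rightarrow> real \<Rightarrow> 'g set \<Rightarrow> ('a, 'v, 'w) tens set \<Rightarrow> bool" where
  "invariant_subspace K \<sigma> \<tau> \<delta> Q U \<longleftrightarrow> subspace U \<and> (\<forall>p\<in>Q. act K \<sigma> \<tau> \<delta> p ` U \<subseteq> U)"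

text \<open>Quotient modules are encoded by pairs \<open>B \<subseteq> A\<close> of subspaces, with submodules of \<open>A / B\<close>
  corresponding to the submodules between \<open>B\<close> and \<open>A\<close>.\<close>

definition irreducible_quotient ::
  "('g, 'a::euclidean_space) graded_pair \<Rightarrow> ('g \<Rightarrow> 'v::euclidean_space \<Rightarrow> 'v) \<Rightarrow>
   ('g \<Rightarrow> 'w::euclidean_space \<Rightarrow> 'w) \<Rightarrow> real \<Rightarrow>
   ('a, 'v, 'w) tens set \<Rightarrow> ('a, 'v, 'w) tens set \<Rightarrow> bool" where
  "irreducible_quotient K \<sigma> \<tau> \<delta> A B \<longleftrightarrow>
     invariant_subspace K \<sigma> \<tau> \<delta> (G0 K) A \<and> invariant_subspace K \<sigma> \<tau> \<delta> (G0 K) B \<and> B \<subset> A \<and>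
     (\<forall>U. invariant_subspace K \<sigma> \<tau> \<delta> (G0 K) U \<and> B \<subseteq> U \<and> U \<subseteq> A \<longrightarrow> U = B \<or> U = A)"

text \<open>Lowest weights of the complexification of \<open>A / B\<close> as a representation of \<open>\<gg>\<^sub>0\<close>: the weights of
  vectors annihilated by all negative root spaces of \<open>(\<gg>\<^sub>0)\<^sub>\<complex>\<close>.\<close>

definition lowest_weight ::
  "('g, 'a::euclidean_space) graded_pair \<Rightarrow> ('g \<Rightarrow> 'v::euclidean_space \<Rightarrow> 'v) \<Rightarrow>
   ('g \<Rightarrow> 'w::euclidean_space \<Rightarrow> 'w) \<Rightarrow> real \<Rightarrow>
   ('a, 'v, 'w) tens set \<Rightarrow> ('a, 'v, 'w) tens set \<Rightarrow> ('a \<times> 'a \<Rightarrow> complex) \<Rightarrow> bool" where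
  "lowest_weight K \<sigma> \<tau> \<delta> A B \<mu> \<longleftrightarrow> \<mu> \<in> cdual (cartan K) \<and> (\<exists>X \<in> A \<times> A. X \<notin> B \<times> B \<and>
     (\<forall>H\<in>cartan K. cbil (dact K \<sigma> \<tau> \<delta>) H X - cscale (\<mu> H) X \<in> B \<times> B) \<and>
     (\<forall>\<alpha>\<in>posroots K. \<forall>Z \<in> root_space (bracket K) (cartan K) (\<lambda>H. - \<alpha> H) \<inter> (grade K 0 \<times> grade K 0).
        cbil (dact K \<sigma> \<tau> \<delta>) Z X \<in> B \<times> B))"

text \<open>An irreducible representation of \<open>G\<^sub>0\<close> may have several lowest weights (\<open>G\<^sub>0\<close> need not be connected
  and complexifications need not be irreducible), but all of them give the same value.\<close>

definition casimir_eigenvalue ::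
  "('g, 'a::euclidean_space) graded_pair \<Rightarrow> ('g \<Rightarrow> 'v::euclidean_space \<Rightarrow> 'v) \<Rightarrow>
   ('g \<Rightarrow> 'w::euclidean_space \<Rightarrow> 'w) \<Rightarrow> real \<Rightarrow>
   ('a, 'v, 'w) tens set \<Rightarrow> ('a, 'v, 'w) tens set \<Rightarrow> real" where
  "casimir_eigenvalue K \<sigma> \<tau> \<delta> A B = (THE c. \<exists>\<nu>. lowest_weight K \<sigma> \<tau> \<delta> A B (\<lambda>H. - \<nu> H) \<and>
     c = weight_inner (bracket K) (cartan K) \<nu> (\<lambda>H. \<nu> H + 2 * half_sum (posroots K) H))"


section \<open>Decompositions and critical weights\<close>

text \<open>The underlying spaces do not depend on the weight, and the actions for different weights differ
  by a nowhere vanishing character, so the submodules below are the same for all values of the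
  reference weight \<open>d\<close>; only Casimir eigenvalues vary with the weight.\<close>

definition irreducible_decomposition ::
  "('g, 'a::euclidean_space) graded_pair \<Rightarrow> ('g \<Rightarrow> 'v::euclidean_space \<Rightarrow> 'v) \<Rightarrow>
   ('g \<Rightarrow> 'w::euclidean_space \<Rightarrow> 'w) \<Rightarrow> nat \<Rightarrow> real \<Rightarrow> nat \<Rightarrow> (nat \<Rightarrow> ('a, 'v, 'w) tens set) \<Rightarrow> bool" where
  "irreducible_decomposition K \<sigma> \<tau> k d m R \<longleftrightarrow>
     (\<forall>i<m. irreducible_quotient K \<sigma> \<tau> d (R i) {0}) \<and>
     span (\<Union>i<m. R i) = symbol_space K k \<and>
     (\<forall>i<m. R i \<inter> span (\<Union>j\<in>{..<m} - {i}. R j) = {0})"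

text \<open>Preimage in \<open>S\<^sup>k \<gg> \<otimes> V* \<otimes> W[d]\<close> of the \<open>P\<close>-submodule of the quotient by the filtration
  component of degree \<open>1\<close> that is generated by \<open>R\<close>.\<close>

definition generated_submodule ::
  "('g, 'a::euclidean_space) graded_pair \<Rightarrow> ('g \<Rightarrow> 'v::euclidean_space \<Rightarrow> 'v) \<Rightarrow>
   ('g \<Rightarrow> 'w::euclidean_space \<Rightarrow> 'w) \<Rightarrow> nat \<Rightarrow> real \<Rightarrow> ('a, 'v, 'w) tens set \<Rightarrow> ('a, 'v, 'w) tens set" where
  "generated_submodule K \<sigma> \<tau> k d R =
     \<Inter>{U. invariant_subspace K \<sigma> \<tau> d (Psub K) U \<and> R \<union> filtration K k 1 \<subseteq> U}"

text \<open>The functions \<open>\<beta>\<^sub>i\<^sup>1, \<dots>\<close>: the lowest filtration degree \<open>-k\<close> is left out.\<close>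

definition other_casimirs ::
  "('g, 'a::euclidean_space) graded_pair \<Rightarrow> ('g \<Rightarrow> 'v::euclidean_space \<Rightarrow> 'v) \<Rightarrow>
   ('g \<Rightarrow> 'w::euclidean_space \<Rightarrow> 'w) \<Rightarrow> nat \<Rightarrow> real \<Rightarrow> ('a, 'v, 'w) tens set \<Rightarrow> (real \<Rightarrow> real) set" where
  "other_casimirs K \<sigma> \<tau> k d R = {(\<lambda>\<delta>. casimir_eigenvalue K \<sigma> \<tau> \<delta> A B) | A B l.
     l \<in> {- int k <.. 0} \<and>
     B = generated_submodule K \<sigma> \<tau> k d R \<inter> filtration K k (l + 1) \<and>
     A \<subseteq> generated_submodule K \<sigma> \<tau> k d R \<inter> filtration K k l \<and>
     irreducible_quotient K \<sigma> \<tau> d A B}"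

definition gamma_prod ::
  "('g, 'a::euclidean_space) graded_pair \<Rightarrow> ('g \<Rightarrow> 'v::euclidean_space \<Rightarrow> 'v) \<Rightarrow>
   ('g \<Rightarrow> 'w::euclidean_space \<Rightarrow> 'w) \<Rightarrow> nat \<Rightarrow> real \<Rightarrow> ('a, 'v, 'w) tens set \<Rightarrow> real \<Rightarrow> real" where
  "gamma_prod K \<sigma> \<tau> k d R \<delta> =
     (\<Prod>\<beta>\<in>other_casimirs K \<sigma> \<tau> k d R. casimir_eigenvalue K \<sigma> \<tau> \<delta> R {0} - \<beta> \<delta>)"

definition critical_weight ::
  "('g, 'a::euclidean_space) graded_pair \<Rightarrow> ('g \<Rightarrow> 'v::euclidean_space \<Rightarrow> 'v) \<Rightarrow>
   ('g \<Rightarrow> 'w::euclidean_space \<Rightarrow> 'w) \<Rightarrow> nat \<Rightarrow> real \<Rightarrow> nat \<Rightarrow> (nat \<Rightarrow> ('a, 'v, 'w) tens set) \<Rightarrow> real \<Rightarrow> bool" where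
  "critical_weight K \<sigma> \<tau> k d m R \<delta> \<longleftrightarrow> (\<exists>i<m. gamma_prod K \<sigma> \<tau> k d (R i) \<delta> = 0)"

end

theory Submission
  imports Defs "HOL-Computational_Algebra.Fundamental_Theorem_Algebra"
begin

text \<open>The grading element \<open>E\<close> is central in \<open>\<gg>\<^sub>0\<close>, and \<open>exp (t E)\<close> is central in \<open>G\<^sub>0\<close>, so \<open>E\<close> acts by scalars on
  \<open>V\<close> and \<open>W\<close> and hence by \<open>l + const - \<delta>\<close> on the filtration quotients of degree \<open>l\<close>. Twisting by \<open>\<real>[w]\<close>
  shifts lowest weights by a multiple of the Killing dual of \<open>E\<close>. Therefore the Casimir eigenvalue on a
  quotient of degree \<open>l\<close> is a quadratic polynomial in \<open>\<delta>\<close> whose quadratic term does not depend on the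
  quotient and whose linear term depends on \<open>l\<close> only, strictly monotonically. The difference of the
  Casimir eigenvalues of \<open>R\<^sub>i\<close>, of degree \<open>-k\<close>, and of a component of degree \<open>l > -k\<close> is thus an affine
  function of \<open>\<delta>\<close> with slope proportional to \<open>l + k \<noteq> 0\<close>.

  The Casimir eigenvalue is well defined: \<open>\<langle>\<nu>, \<nu> + 2\<rho>\<rangle>\<close> is, up to the scalar by which \<open>E\<close> acts, the eigenvalue
  on a lowest weight vector of the operator \<open>\<Sum> b \<cdot> b*\<close> over dual bases of \<open>\<gg>\<^sub>0\<close>, which commutes with
  \<open>G\<^sub>0\<close>. The same operator bounds the number of Casimir eigenvalues on a given filtration quotient.\<close>

section \<open>Calculus of differentiability classes\<close>

text \<open>Two obstacles shape the proof. First, a Casimir eigenvalue is a description over lowest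
  weights, so a lowest weight must exist and all of them must give the same number. Second, the
  Casimir operator of grade 0 must be compared with \<open>2 * half_sum\<close>, which involves all
  positive roots. Those of grade 0 arise from commuting root vectors past a lowest weight vector;
  those of grade 1 add up to half of \<kappa>(E, H) because root spaces are lines. Nondegeneracy of
  the Killing form and multiplicity one are therefore derived from simplicity and the Cartan
  subalgebra, by trace identities. The constant \<open>1 / (2 * dim_neg)\<close> has the same
  source: \<kappa>(E, x) is -2 times the trace of ad x on \<open>gr (-1)\<close>, and \<real>[w]
  divides by the dimension. On the analytic side Ad(exp x) is treated as the solution of a linear
  differential equation, and the module, a space of functions without a norm, through finitely many
  evaluations.\<close>

lemma C_class_subset: "C_class m T f \<Longrightarrow> S \<subseteq> T \<Longrightarrow> C_class m S f"
proof (induction m arbitrary: f)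
  case 0 then show ?case by (auto intro: continuous_on_subset)
next
  case (Suc m)
  then obtain f' where "\<forall>x\<in>T. (f has_derivative f' x) (at x)" "\<forall>v. C_class m T (\<lambda>x. f' x v)" by auto
  then show ?case using Suc by (auto intro!: exI[of _ f'])
qed

text \<open>Derivatives are taken in the full filter \<open>at x\<close>, so agreement on
  \<open>S\<close> carries over to derivatives because \<open>S\<close> is open.\<close>

lemma C_class_cong:
  assumes "open S" "\<And>x. x \<in> S \<Longrightarrow> f x = g x"
  shows "C_class m S f \<longleftrightarrow> C_class m S g"
proof -
  have *: "C_class m S g" if f: "C_class m S f" and fg: "\<And>x. x \<in> S \<Longrightarrow> f x = g x"
    for f g :: "'a \<Rightarrow> 'b"
  proof (cases m)
    case 0 then show ?thesis using f fg by (auto cong: continuous_on_cong)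
  next
    case (Suc n)
    then obtain f' where f': "\<forall>x\<in>S. (f has_derivative f' x) (at x)" "\<forall>v. C_class n S (\<lambda>x. f' x v)"
      using f by auto
    have "\<forall>x\<in>S. (g has_derivative f' x) (at x)"
      using f'(1) fg has_derivative_transform_within_open[OF _ assms(1)] by blast
    then show ?thesis using Suc f' by auto
  qed
  show ?thesis using *[of f g] *[of g f] assms by auto
qed

lemma C_class_continuous_on: "C_class m S f \<Longrightarrow> continuous_on S f"
  by (cases m) (auto intro!: continuous_at_imp_continuous_on dest!: has_derivative_continuous bspec)

lemma C_class_Suc_imp: "C_class (Suc m) S f \<Longrightarrow> C_class m S f"
proof (induction m arbitrary: f)
  case 0 then show ?case using C_class_continuous_on[of "Suc 0" S f] by simp
next
  case (Suc m)
  then obtain f' where "\<forall>x\<in>S. (f has_derivative f' x) (at x)" "\<forall>v. C_class (Suc m) S (\<lambda>x. f' x v)"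
    by auto
  then have "\<forall>v. C_class m S (\<lambda>x. f' x v)" using Suc.IH by blast
  with \<open>\<forall>x\<in>S. (f has_derivative f' x) (at x)\<close> show ?case by auto
qed

lemma C_class_const: "C_class m S (\<lambda>x. c)"
proof (induction m arbitrary: c)
  case (Suc m) then show ?case by (auto intro!: exI[of _ "\<lambda>x v. 0"])
qed simp

lemma C_class_add: "C_class m S f \<Longrightarrow> C_class m S g \<Longrightarrow> C_class m S (\<lambda>x. f x + g x)"
proof (induction m arbitrary: f g)
  case 0 then show ?case by (auto intro: continuous_intros)
next
  case (Suc m)
  then obtain f' g' where "\<forall>x\<in>S. (f has_derivative f' x) (at x)" "\<forall>v. C_class m S (\<lambda>x. f' x v)"
    "\<forall>x\<in>S. (g has_derivative g' x) (at x)" "\<forall>v. C_class m S (\<lambda>x. g' x v)" by auto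
  then show ?case using Suc.IH
    by (auto intro!: exI[of _ "\<lambda>x v. f' x v + g' x v"] has_derivative_add)
qed

lemma C_class_sum:
  "(\<And>i. i \<in> I \<Longrightarrow> C_class m S (f i)) \<Longrightarrow> C_class m S (\<lambda>x. \<Sum>i\<in>I. f i x)"
  by (induction I rule: infinite_finite_induct) (auto intro: C_class_add C_class_const)

lemma C_class_scaleR:
  fixes a :: "'e::real_normed_vector \<Rightarrow> real"
  shows "C_class m S a \<Longrightarrow> C_class m S f \<Longrightarrow> C_class m S (\<lambda>x. a x *\<^sub>R f x)"
proof (induction m arbitrary: a f)
  case 0 then show ?case by (auto intro: continuous_intros)
next
  case (Suc m)
  then obtain a' f' where "\<forall>x\<in>S. (a has_derivative a' x) (at x)" "\<forall>v. C_class m S (\<lambda>x. a' x v)"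
    "\<forall>x\<in>S. (f has_derivative f' x) (at x)" "\<forall>v. C_class m S (\<lambda>x. f' x v)" by auto
  moreover have "C_class m S a" "C_class m S f" using Suc.prems C_class_Suc_imp by blast+
  ultimately show ?case using Suc.IH
    by (auto intro!: exI[of _ "\<lambda>x v. a x *\<^sub>R f' x v + a' x v *\<^sub>R f x"] has_derivative_scaleR C_class_add)
qed

lemma C_class_bounded_linear:
  assumes "bounded_linear L"
  shows "C_class m S f \<Longrightarrow> C_class m S (\<lambda>x. L (f x))"
proof (induction m arbitrary: f)
  case 0 then show ?case using bounded_linear.continuous_on[OF assms] by simp
next
  case (Suc m)
  then obtain f' where f': "\<forall>x\<in>S. (f has_derivative f' x) (at x)" "\<forall>v. C_class m S (\<lambda>x. f' x v)"
    by auto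
  have "\<forall>x\<in>S. ((\<lambda>x. L (f x)) has_derivative (\<lambda>v. L (f' x v))) (at x)"
    using f'(1) bounded_linear.has_derivative[OF assms] by blast
  moreover have "\<forall>v. C_class m S (\<lambda>x. L (f' x v))" using f'(2) Suc.IH by blast
  ultimately show ?case unfolding C_class.simps by (intro exI[of _ "\<lambda>x v. L (f' x v)"]) blast
qed

lemma C_class_compose:
  fixes g :: "'e::real_normed_vector \<Rightarrow> 'f::euclidean_space" and f :: "'f \<Rightarrow> 'b::real_normed_vector"
  assumes "open S" "g ` S \<subseteq> T"
  shows "C_class m S g \<Longrightarrow> C_class m T f \<Longrightarrow> C_class m S (\<lambda>x. f (g x))"
proof (induction m arbitrary: f)
  case 0 then show ?case using continuous_on_compose2[of T f S g] assms(2) unfolding C_class.simps by blast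
next
  case (Suc m)
  from Suc.prems obtain f' g' where fg: "\<forall>x\<in>T. (f has_derivative f' x) (at x)" "\<forall>v. C_class m T (\<lambda>x. f' x v)"
    "\<forall>x\<in>S. (g has_derivative g' x) (at x)" "\<forall>v. C_class m S (\<lambda>x. g' x v)"
    unfolding C_class.simps by (elim exE conjE) (rule that)
  have g: "C_class m S g" by (rule C_class_Suc_imp[OF Suc.prems(1)])
  have "((\<lambda>x. f (g x)) has_derivative (\<lambda>v. f' (g x) (g' x v))) (at x)" if "x \<in> S" for x
  proof (rule has_derivative_compose[of g])
    show "(g has_derivative g' x) (at x)" "(f has_derivative f' (g x)) (at (g x))"
      using that fg(1,3) assms(2) by blast+
  qed
  moreover have "C_class m S (\<lambda>x. f' (g x) (g' x v))" for v
  proof (rule iffD1[OF C_class_cong[OF assms(1)]])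
    \<comment> \<open>The direction \<open>g' x v\<close> moves with \<open>x\<close>, whereas the
      class of \<open>f'\<close> is known for fixed directions. Expanding in a basis separates the
      two.\<close>
    show "C_class m S (\<lambda>x. \<Sum>b\<in>Basis. (g' x v \<bullet> b) *\<^sub>R f' (g x) b)"
    proof (intro C_class_sum C_class_scaleR)
      fix b :: 'f
      show "C_class m S (\<lambda>x. g' x v \<bullet> b)"
        using fg(4) C_class_bounded_linear[OF bounded_linear_inner_left] by blast
      show "C_class m S (\<lambda>x. f' (g x) b)" using Suc.IH[OF g] fg(2) by blast
    qed
    show "(\<Sum>b\<in>Basis. (g' x v \<bullet> b) *\<^sub>R f' (g x) b) = f' (g x) (g' x v)" if "x \<in> S" for x
    proof -
      have "linear (f' (g x))" using fg(1) assms(2) that has_derivative_linear by blast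
      then have "(\<Sum>b\<in>Basis. (g' x v \<bullet> b) *\<^sub>R f' (g x) b)
        = f' (g x) (\<Sum>b\<in>Basis. (g' x v \<bullet> b) *\<^sub>R b)" by (simp only: linear_sum linear_cmul)
      then show ?thesis by (simp only: euclidean_representation)
    qed
  qed
  ultimately show ?case
    unfolding C_class.simps by (intro exI[of _ "\<lambda>x v. f' (g x) (g' x v)"]) blast
qed

lemma C_class_Pair_const:
  fixes g :: "'e::real_normed_vector \<Rightarrow> 'f::real_normed_vector"
  assumes "C_class m S g"
  shows "C_class m S (\<lambda>x. (c, g x))" "C_class m S (\<lambda>x. (g x, c))"
proof -
  show "C_class m S (\<lambda>x. (c, g x))"
    using C_class_add[OF C_class_const[of m S "(c, 0)"]
        C_class_bounded_linear[OF bounded_linear_Pair[OF bounded_linear_zero bounded_linear_ident] assms]]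
    by simp
  show "C_class m S (\<lambda>x. (g x, c))"
    using C_class_add[OF C_class_const[of m S "(0, c)"]
        C_class_bounded_linear[OF bounded_linear_Pair[OF bounded_linear_ident bounded_linear_zero] assms]]
    by simp
qed

text \<open>The local derivatives are existential witnesses that vary with the neighbourhood;
  uniqueness of the Frechet derivative glues them into one function \<open>D\<close>.\<close>

lemma C_class_local:
  assumes "\<And>x. x \<in> S \<Longrightarrow> \<exists>T. open T \<and> x \<in> T \<and> C_class m T f"
  shows "C_class m S f"
  using assms
proof (induction m arbitrary: f)
  case 0
  have "isCont f x" if x: "x \<in> S" for x
  proof -
    obtain T where "open T" "x \<in> T" "continuous_on T f" using 0[OF x] by auto
    then show ?thesis using continuous_on_eq_continuous_at by blast
  qed
  then show ?case by (simp add: continuous_at_imp_continuous_on)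
next
  case (Suc m)
  define D where "D = (\<lambda>x. frechet_derivative f (at x))"
  have *: "\<exists>T. open T \<and> x \<in> T \<and> (\<forall>y\<in>T. (f has_derivative D y) (at y)) \<and> C_class m T (\<lambda>x. D x v)"
    if x: "x \<in> S" for x v
  proof -
    obtain T f' where T: "open T" "x \<in> T" "\<forall>y\<in>T. (f has_derivative f' y) (at y)"
      "C_class m T (\<lambda>x. f' x v)" using Suc.prems[OF x] by auto
    have D: "f' y = D y" if "y \<in> T" for y
      unfolding D_def using T(3) that by (intro frechet_derivative_at) blast
    then have "\<forall>y\<in>T. (f has_derivative D y) (at y)" using T(3) by simp
    moreover have "C_class m T (\<lambda>x. D x v)"
      by (rule iffD1[OF C_class_cong[OF T(1)] T(4)]) (simp add: D)
    ultimately show ?thesis using T(1,2) by blast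
  qed
  have "C_class m S (\<lambda>x. D x v)" for v
  proof (rule Suc.IH)
    fix x assume "x \<in> S"
    from *[OF this, of v] show "\<exists>T. open T \<and> x \<in> T \<and> C_class m T (\<lambda>x. D x v)" by iprover
  qed
  moreover have "(f has_derivative D x) (at x)" if x: "x \<in> S" for x
    using *[OF x, of 0] x by blast
  ultimately show ?case unfolding C_class.simps by blast
qed

lemma smooth_on_imp_has_derivative:
  assumes "smooth_on S f" "x \<in> S"
  obtains f' where "(f has_derivative f') (at x)"
proof -
  have "C_class (Suc 0) S f" using assms(1) unfolding smooth_on_def by blast
  then obtain f' where "\<forall>x\<in>S. (f has_derivative f' x) (at x)" unfolding C_class.simps by blast
  with assms(2) show ?thesis by (intro that[of "f' x"]) blast
qed

section \<open>Smooth maps into a Lie group\<close>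

locale lie_grp =
  fixes G :: "'g monoid" (structure) and T :: "'g topology" and A :: "('g, 'a::euclidean_space) chart set"
  assumes lie_group: "lie_group G T A"
begin

sublocale group G using lie_group by (simp add: lie_group_def)

lemma topspace_eq: "topspace T = carrier G" using lie_group by (simp add: lie_group_def)

lemma continuous_mult: "continuous_map (prod_topology T T) T (\<lambda>(x, y). x \<otimes> y)"
  using lie_group by (simp add: lie_group_def)

lemma atlas: "smooth_atlas T A" using lie_group by (simp add: lie_group_def)

lemma chart_openin: "(U, \<phi>) \<in> A \<Longrightarrow> openin T U"
  and chart_open_image: "(U, \<phi>) \<in> A \<Longrightarrow> open (\<phi> ` U)"
  and chart_homeo: "(U, \<phi>) \<in> A \<Longrightarrow> homeomorphic_map (subtopology T U) (top_of_set (\<phi> ` U)) \<phi>"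
  using atlas unfolding smooth_atlas_def by blast+

lemma chart_subset: "(U, \<phi>) \<in> A \<Longrightarrow> U \<subseteq> carrier G"
  using chart_openin openin_subset topspace_eq by blast

lemma chart_inj: assumes "(U, \<phi>) \<in> A" shows "inj_on \<phi> U"
proof -
  have "topspace (subtopology T U) = U" using chart_subset[OF assms] by (auto simp: topspace_eq)
  then show ?thesis using homeomorphic_imp_injective_map[OF chart_homeo[OF assms]] by metis
qed

lemma chart_exists: assumes "x \<in> carrier G" obtains U \<phi> where "(U, \<phi>) \<in> A" "x \<in> U"
proof -
  have "\<Union>(fst ` A) = topspace T" using atlas unfolding smooth_atlas_def by (elim conjE)
  then have "x \<in> \<Union>(fst ` A)" using assms topspace_eq by simp
  then obtain c where "c \<in> A" "x \<in> fst c" by blast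
  then show ?thesis by (intro that[of "fst c" "snd c"]) simp_all
qed

lemma chart_change: "(U, \<phi>) \<in> A \<Longrightarrow> (V, \<psi>) \<in> A \<Longrightarrow> smooth_on (\<phi> ` (U \<inter> V)) (\<psi> \<circ> inv_into U \<phi>)"
proof -
  assume *: "(U, \<phi>) \<in> A" "(V, \<psi>) \<in> A"
  have "\<forall>c\<in>A. \<forall>d\<in>A. smooth_on (snd c ` (fst c \<inter> fst d)) (snd d \<circ> inv_into (fst c) (snd c))"
    using atlas by (simp add: smooth_atlas_def case_prod_beta)
  from bspec[OF bspec[OF this *(1)] *(2)] show ?thesis by simp
qed

lemma mult_smooth:
  assumes "(U, \<phi>) \<in> A" "(V, \<psi>) \<in> A" "(W, \<theta>) \<in> A"
  shows "smooth_on {(\<phi> x, \<psi> y) | x y. x \<in> U \<and> y \<in> V \<and> x \<otimes> y \<in> W}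
          (\<lambda>(u, v). \<theta> (inv_into U \<phi> u \<otimes> inv_into V \<psi> v))"
proof -
  have "\<forall>c\<in>A. \<forall>d\<in>A. \<forall>f\<in>A.
    smooth_on {(snd c x, snd d y) | x y. x \<in> fst c \<and> y \<in> fst d \<and> x \<otimes> y \<in> fst f}
      (\<lambda>(u, v). snd f (inv_into (fst c) (snd c) u \<otimes> inv_into (fst d) (snd d) v))"
    using lie_group by (simp add: lie_group_def case_prod_beta)
  from bspec[OF bspec[OF bspec[OF this assms(1)] assms(2)] assms(3)] show ?thesis by simp
qed

text \<open>One notion for one-parameter subgroups, inverse charts and their conjugates: the source
  is an open subset of a normed space, so no smooth structure on a product or on a subgroup is
  needed to conjugate them.\<close>

definition smooth_into :: "'e::real_normed_vector set \<Rightarrow> ('e \<Rightarrow> 'g) \<Rightarrow> bool" where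
  "smooth_into S \<Gamma> \<longleftrightarrow> open S \<and> continuous_map (top_of_set S) T \<Gamma> \<and>
     (\<forall>(U, \<phi>)\<in>A. smooth_on {s \<in> S. \<Gamma> s \<in> U} (\<phi> \<circ> \<Gamma>))"

lemma smooth_into_carrier: "smooth_into S \<Gamma> \<Longrightarrow> s \<in> S \<Longrightarrow> \<Gamma> s \<in> carrier G"
  unfolding smooth_into_def continuous_map_def topspace_eq by auto

lemma open_preimage:
  assumes "open S" "continuous_map (top_of_set S) T \<Gamma>" "openin T U"
  shows "open {s \<in> S. \<Gamma> s \<in> U}"
  using openin_continuous_map_preimage[OF assms(2,3)] assms(1) openin_open_eq by auto

text \<open>Smoothness of multiplication is given in pairs of charts. Near each point both factors
  are put into charts, one of them constantly, and the local statements are glued by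
  \<open>C_class_local\<close>.\<close>

lemma smooth_into_mult_const:
  assumes \<Gamma>: "smooth_into S \<Gamma>" and g: "g \<in> carrier G"
  shows "smooth_into S (\<lambda>s. g \<otimes> \<Gamma> s)" "smooth_into S (\<lambda>s. \<Gamma> s \<otimes> g)"
proof -
  have S: "open S" and cont: "continuous_map (top_of_set S) T \<Gamma>"
    and sm: "\<And>U \<phi>. (U, \<phi>) \<in> A \<Longrightarrow> smooth_on {s \<in> S. \<Gamma> s \<in> U} (\<phi> \<circ> \<Gamma>)"
    using \<Gamma> unfolding smooth_into_def by blast+
  have c: "continuous_map (top_of_set S) T (\<lambda>s. g)" using g by (simp add: topspace_eq)
  have cl: "continuous_map (top_of_set S) T (\<lambda>s. g \<otimes> \<Gamma> s)"
    using continuous_map_compose[OF _ continuous_mult, of "top_of_set S" "\<lambda>s. (g, \<Gamma> s)"] c cont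
    by (simp add: o_def continuous_map_pairedI)
  have cr: "continuous_map (top_of_set S) T (\<lambda>s. \<Gamma> s \<otimes> g)"
    using continuous_map_compose[OF _ continuous_mult, of "top_of_set S" "\<lambda>s. (\<Gamma> s, g)"] c cont
    by (simp add: o_def continuous_map_pairedI)
  obtain U \<phi> where U: "(U, \<phi>) \<in> A" "g \<in> U" using chart_exists[OF g] .
  have "C_class m {s \<in> S. g \<otimes> \<Gamma> s \<in> W} (\<theta> \<circ> (\<lambda>s. g \<otimes> \<Gamma> s)) \<and>
        C_class m {s \<in> S. \<Gamma> s \<otimes> g \<in> W} (\<theta> \<circ> (\<lambda>s. \<Gamma> s \<otimes> g))" if W: "(W, \<theta>) \<in> A" for m W \<theta>
  proof (intro conjI C_class_local)
    fix s0 assume "s0 \<in> {s \<in> S. g \<otimes> \<Gamma> s \<in> W}"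
    then have s0: "s0 \<in> S" "g \<otimes> \<Gamma> s0 \<in> W" by auto
    obtain V \<psi> where V: "(V, \<psi>) \<in> A" "\<Gamma> s0 \<in> V" using chart_exists[OF smooth_into_carrier[OF \<Gamma> s0(1)]] .
    define N where "N = {s \<in> S. \<Gamma> s \<in> V} \<inter> {s \<in> S. g \<otimes> \<Gamma> s \<in> W}"
    have N: "open N" unfolding N_def
      by (intro open_Int open_preimage S cont cl chart_openin[OF V(1)] chart_openin[OF W])
    have "C_class m {s \<in> S. \<Gamma> s \<in> V} (\<psi> \<circ> \<Gamma>)" using sm[OF V(1)] unfolding smooth_on_def by blast
    then have "C_class m N (\<psi> \<circ> \<Gamma>)" by (rule C_class_subset) (simp add: N_def)
    from C_class_Pair_const(1)[OF this]
    have h: "C_class m N (\<lambda>s. (\<phi> g, (\<psi> \<circ> \<Gamma>) s))" .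
    have M: "C_class m {(\<phi> x, \<psi> y) | x y. x \<in> U \<and> y \<in> V \<and> x \<otimes> y \<in> W}
          (\<lambda>(u, v). \<theta> (inv_into U \<phi> u \<otimes> inv_into V \<psi> v))"
      using mult_smooth[OF U(1) V(1) W] unfolding smooth_on_def by blast
    have sub: "(\<lambda>s. (\<phi> g, (\<psi> \<circ> \<Gamma>) s)) ` N \<subseteq> {(\<phi> x, \<psi> y) | x y. x \<in> U \<and> y \<in> V \<and> x \<otimes> y \<in> W}"
      using U by (auto simp: N_def)
    have "C_class m N (\<theta> \<circ> (\<lambda>s. g \<otimes> \<Gamma> s))"
      by (rule iffD1[OF C_class_cong[OF N] C_class_compose[OF N sub h M]])
        (simp add: N_def U V(1) chart_inj inv_into_f_f)
    then show "\<exists>T. open T \<and> s0 \<in> T \<and> C_class m T (\<theta> \<circ> (\<lambda>s. g \<otimes> \<Gamma> s))"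
      using N s0 V by (intro exI[of _ N]) (simp add: N_def)
  next
    fix s0 assume "s0 \<in> {s \<in> S. \<Gamma> s \<otimes> g \<in> W}"
    then have s0: "s0 \<in> S" "\<Gamma> s0 \<otimes> g \<in> W" by auto
    obtain V \<psi> where V: "(V, \<psi>) \<in> A" "\<Gamma> s0 \<in> V" using chart_exists[OF smooth_into_carrier[OF \<Gamma> s0(1)]] .
    define N where "N = {s \<in> S. \<Gamma> s \<in> V} \<inter> {s \<in> S. \<Gamma> s \<otimes> g \<in> W}"
    have N: "open N" unfolding N_def
      by (intro open_Int open_preimage S cont cr chart_openin[OF V(1)] chart_openin[OF W])
    have "C_class m {s \<in> S. \<Gamma> s \<in> V} (\<psi> \<circ> \<Gamma>)" using sm[OF V(1)] unfolding smooth_on_def by blast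
    then have "C_class m N (\<psi> \<circ> \<Gamma>)" by (rule C_class_subset) (simp add: N_def)
    from C_class_Pair_const(2)[OF this]
    have h: "C_class m N (\<lambda>s. ((\<psi> \<circ> \<Gamma>) s, \<phi> g))" .
    have M: "C_class m {(\<psi> x, \<phi> y) | x y. x \<in> V \<and> y \<in> U \<and> x \<otimes> y \<in> W}
          (\<lambda>(u, v). \<theta> (inv_into V \<psi> u \<otimes> inv_into U \<phi> v))"
      using mult_smooth[OF V(1) U(1) W] unfolding smooth_on_def by blast
    have sub: "(\<lambda>s. ((\<psi> \<circ> \<Gamma>) s, \<phi> g)) ` N \<subseteq> {(\<psi> x, \<phi> y) | x y. x \<in> V \<and> y \<in> U \<and> x \<otimes> y \<in> W}"
      using U by (auto simp: N_def)
    have "C_class m N (\<theta> \<circ> (\<lambda>s. \<Gamma> s \<otimes> g))"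
      by (rule iffD1[OF C_class_cong[OF N] C_class_compose[OF N sub h M]])
        (simp add: N_def U V(1) chart_inj inv_into_f_f)
    then show "\<exists>T. open T \<and> s0 \<in> T \<and> C_class m T (\<theta> \<circ> (\<lambda>s. \<Gamma> s \<otimes> g))"
      using N s0 V by (intro exI[of _ N]) (simp add: N_def)
  qed
  then show "smooth_into S (\<lambda>s. g \<otimes> \<Gamma> s)" "smooth_into S (\<lambda>s. \<Gamma> s \<otimes> g)"
    unfolding smooth_into_def smooth_on_def using S cl cr by blast+
qed

lemma smooth_into_conj:
  assumes "smooth_into S \<Gamma>" "g \<in> carrier G"
  shows "smooth_into S (\<lambda>s. g \<otimes> \<Gamma> s \<otimes> inv g)"
  using smooth_into_mult_const(2)[OF smooth_into_mult_const(1)[OF assms] inv_closed[OF assms(2)]] .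

lemma smooth_into_chart_inverse:
  assumes U: "(U, \<phi>) \<in> A"
  shows "smooth_into (\<phi> ` U) (inv_into U \<phi>)"
proof -
  have cont: "continuous_map (top_of_set (\<phi> ` U)) T (inv_into U \<phi>)"
  proof -
    obtain g where g: "homeomorphic_maps (subtopology T U) (top_of_set (\<phi> ` U)) \<phi> g"
      using chart_homeo[OF U] unfolding homeomorphic_map_maps by blast
    then have c: "continuous_map (top_of_set (\<phi> ` U)) T g"
      and eq: "\<And>x. x \<in> U \<Longrightarrow> g (\<phi> x) = x"
      using chart_subset[OF U] unfolding homeomorphic_maps_def
      by (auto simp: topspace_subtopology topspace_eq continuous_map_in_subtopology)
    then show ?thesis
      by (auto intro!: continuous_map_eq[OF c] simp: inv_into_f_f[OF chart_inj[OF U]])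
  qed
  moreover have "{s \<in> \<phi> ` U. inv_into U \<phi> s \<in> V} = \<phi> ` (U \<inter> V)" for V
    by (auto simp: inv_into_f_f[OF chart_inj[OF U]])
  ultimately show ?thesis
    unfolding smooth_into_def using chart_open_image[OF U] chart_change[OF U] by auto
qed

lemma smooth_into_differentiable:
  assumes "smooth_into S \<Gamma>" "s \<in> S" "(U, \<phi>) \<in> A" "\<Gamma> s \<in> U"
  obtains D where "((\<lambda>s. \<phi> (\<Gamma> s)) has_derivative D) (at s)"
proof -
  have "smooth_on {s \<in> S. \<Gamma> s \<in> U} (\<phi> \<circ> \<Gamma>)" using assms(1,3) unfolding smooth_into_def by blast
  from smooth_on_imp_has_derivative[OF this, of s] assms that show ?thesis by (auto simp: o_def)
qed

lemma one_parameter_subgroup_smooth_into: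
  "one_parameter_subgroup G T A \<gamma> \<longleftrightarrow> (\<forall>s t. \<gamma> (s + t) = \<gamma> s \<otimes> \<gamma> t) \<and> smooth_into UNIV \<gamma>"
  unfolding one_parameter_subgroup_def smooth_into_def by simp

lemma one_parameter_subgroup_0:
  assumes "one_parameter_subgroup G T A \<gamma>" shows "\<gamma> 0 = \<one>"
proof -
  have "\<gamma> 0 \<in> carrier G" "\<gamma> (0 + 0) = \<gamma> 0 \<otimes> \<gamma> 0"
    using assms smooth_into_carrier[of UNIV \<gamma> 0] unfolding one_parameter_subgroup_smooth_into by blast+
  then show ?thesis by (metis add.right_neutral l_cancel_one)
qed

lemma one_parameter_subgroup_conj:
  assumes "one_parameter_subgroup G T A \<gamma>" "g \<in> carrier G"
  shows "one_parameter_subgroup G T A (\<lambda>t. g \<otimes> \<gamma> t \<otimes> inv g)"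
proof -
  have sm: "smooth_into UNIV \<gamma>" and h: "\<And>s t. \<gamma> (s + t) = \<gamma> s \<otimes> \<gamma> t"
    using assms(1) unfolding one_parameter_subgroup_smooth_into by auto
  have c: "\<gamma> t \<in> carrier G" for t using smooth_into_carrier[OF sm] by simp
  have cancel: "inv g \<otimes> (g \<otimes> z) = z" if "z \<in> carrier G" for z
    using that assms(2) by (simp flip: m_assoc)
  have "g \<otimes> \<gamma> (s + t) \<otimes> inv g = (g \<otimes> \<gamma> s \<otimes> inv g) \<otimes> (g \<otimes> \<gamma> t \<otimes> inv g)" for s t
    using c assms(2) by (simp add: h m_assoc cancel)
  then show ?thesis
    unfolding one_parameter_subgroup_smooth_into using smooth_into_conj[OF sm assms(2)] by blast
qed

end

section \<open>Linear differential equations and quotients\<close>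

text \<open>A linear map with kernel exactly \<open>S\<close> and values in the same space, serving
  as the quotient map by \<open>S\<close>. It sends a basis of \<open>S\<close> to 0 and fixes the
  remaining vectors of an extended basis.\<close>

lemma subspace_quotient_map:
  fixes S :: "'x::real_vector set"
  assumes "subspace S"
  shows "\<exists>Q :: 'x \<Rightarrow> 'x. linear Q \<and> (\<forall>x\<in>S. Q x = 0) \<and> (\<forall>x. x - Q x \<in> S)"
proof -
  obtain B where B: "B \<subseteq> S" "independent B" "S \<subseteq> span B"
    using basis_exists[of S] by metis
  define B' where "B' = extend_basis B"
  have B': "B \<subseteq> B'" "independent B'" "span B' = UNIV"
    using B(2) by (simp_all add: B'_def extend_basis_superset independent_extend_basis span_extend_basis)
  obtain Q where Q: "linear Q" "\<forall>b\<in>B'. Q b = (if b \<in> B then 0 else b)"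
    using linear_independent_extend[OF B'(2), of "\<lambda>b. if b \<in> B then 0 else b"] by blast
  have "Q x = 0" if "x \<in> S" for x
  proof -
    have "x \<in> span B" using that B by blast
    moreover have "Q b = 0" if "b \<in> B" for b using Q(2) B'(1) that by auto
    ultimately show ?thesis using linear_eq_0_on_span[OF Q(1)] by blast
  qed
  moreover have "x - Q x \<in> S" for x
  proof -
    have "x \<in> span B'" using B' by simp
    then show ?thesis
    proof (induction rule: span_induct)
      case base
      show ?case
        unfolding subspace_def mem_Collect_eq
        using subspace_0[OF assms] subspace_add[OF assms] subspace_scale[OF assms]
        by (auto simp: linear_0[OF Q(1)] linear_add[OF Q(1)] linear_scale[OF Q(1)] add_diff_add
            simp flip: scaleR_right_diff_distrib)
    next
      case (step x)
      show ?case
      proof (cases "x \<in> B")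
        case True
        then show ?thesis using Q(2) step B(1) by auto
      next
        case False
        then show ?thesis using Q(2) step subspace_0[OF assms] by auto
      qed
    qed
  qed
  ultimately show ?thesis using Q(1) by blast
qed

text \<open>Gronwall: with \<open>B\<close> a bound for \<open>M\<close>, the function
  \<open>f s = |w s|^2 exp (- 2 B s)\<close> is nonincreasing and starts at 0.\<close>

lemma linear_ode_zero:
  fixes w :: "real \<Rightarrow> 'x::euclidean_space"
  assumes M: "linear M" and w: "\<And>s. (w has_vector_derivative M (w s)) (at s)" and 0: "w 0 = 0"
  shows "w s = 0"
proof -
  have main: "w s = 0"
    if M: "linear M" and w: "\<And>s. (w has_vector_derivative M (w s)) (at s)" and 0: "w 0 = 0" and "s \<ge> 0"
    for M and w :: "real \<Rightarrow> 'x" and s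
  proof -
    obtain B where B: "\<And>x. norm (M x) \<le> B * norm x"
      using linear_bounded[OF M] by blast
    define f where "f = (\<lambda>s. (w s \<bullet> w s) * exp (- (2 * B * s)))"
    have "f s \<le> f 0"
    proof (rule DERIV_nonpos_imp_nonincreasing[OF \<open>s \<ge> 0\<close>])
      fix t :: real
      have inner: "((\<lambda>s. w s \<bullet> w s) has_real_derivative 2 * (w t \<bullet> M (w t))) (at t)"
        using has_derivative_inner[OF w[of t, unfolded has_vector_derivative_def] w[of t, unfolded has_vector_derivative_def]]
        unfolding has_field_derivative_def
        by (rule has_derivative_eq_rhs) (simp add: fun_eq_iff inner_commute[of "M (w t)"])
      have d: "(f has_real_derivative 2 * (w t \<bullet> M (w t)) * exp (- (2 * B * t))
            + (w t \<bullet> w t) * (exp (- (2 * B * t)) * - (2 * B))) (at t)"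
        unfolding f_def by (rule derivative_eq_intros inner refl | simp)+
      have "w t \<bullet> M (w t) \<le> norm (w t) * (B * norm (w t))"
        using norm_cauchy_schwarz[of "w t" "M (w t)"] mult_left_mono[OF B[of "w t"], of "norm (w t)"] by simp
      then have "w t \<bullet> M (w t) \<le> B * (w t \<bullet> w t)"
        by (simp add: dot_square_norm power2_eq_square algebra_simps)
      then have "(2 * (w t \<bullet> M (w t)) - 2 * B * (w t \<bullet> w t)) * exp (- (2 * B * t)) \<le> 0"
        by (intro mult_nonpos_nonneg) simp_all
      then have "2 * (w t \<bullet> M (w t)) * exp (- (2 * B * t))
            + (w t \<bullet> w t) * (exp (- (2 * B * t)) * - (2 * B)) \<le> 0" by (simp add: algebra_simps)
      then show "\<exists>y. DERIV f t :> y \<and> y \<le> 0" using d by blast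
    qed
    then have "(w s \<bullet> w s) * exp (- (2 * B * s)) \<le> 0" using 0 by (simp add: f_def)
    then have "w s \<bullet> w s \<le> 0" by (simp add: mult_le_0_iff)
    then show ?thesis using inner_gt_zero_iff[of "w s"] by linarith
  qed
  show ?thesis
  proof (cases "s \<ge> 0")
    case True then show ?thesis using main[OF M w 0] by blast
  next
    case False
    \<comment> \<open>Reversing time gives a solution for the operator - M, which is why
      \<open>main\<close> is stated for an arbitrary operator.\<close>
    have "((\<lambda>s. w (- s)) has_vector_derivative - M (w (- t))) (at t)" for t
      using vector_diff_chain_at[of uminus "-1" t w "M (w (- t))"] w[of "-t"]
        has_vector_derivative_minus[OF has_vector_derivative_id[of "at t"]]
      by (simp add: o_def)
    then have "w (- (- s)) = 0"
      using main[of "\<lambda>x. - M x" "\<lambda>s. w (- s)" "- s"] False 0 M linear_compose_neg[OF M] by simp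
    then show ?thesis by simp
  qed
qed

text \<open>Modulo \<open>S\<close> the curve solves a linear equation again, because
  \<open>L\<close> preserves \<open>S\<close> and so \<open>Q L\<close> does not see the difference
  of \<open>u\<close> and \<open>Q u\<close>. Its initial value there is 0.\<close>

lemma linear_ode_invariant:
  fixes u :: "real \<Rightarrow> 'x::euclidean_space"
  assumes S: "subspace S" and L: "linear L" "\<And>x. x \<in> S \<Longrightarrow> L x \<in> S"
    and u: "\<And>s. (u has_vector_derivative L (u s)) (at s)" and 0: "u 0 \<in> S"
  shows "u s \<in> S"
proof -
  obtain Q where Q: "linear Q" "\<forall>x\<in>S. Q x = 0" "\<forall>x. x - Q x \<in> S"
    using subspace_quotient_map[OF S] by blast
  have "((\<lambda>s. Q (u s)) has_vector_derivative Q (L (Q (u t)))) (at t)" for t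
  proof -
    have "Q (L (u t - Q (u t))) = 0"
      by (rule bspec[OF Q(2) L(2)[OF spec[OF Q(3)]]])
    then have eq: "Q (L (u t)) = Q (L (Q (u t)))"
      unfolding linear_diff[OF Q(1)] linear_diff[OF L(1)] right_minus_eq .
    show ?thesis
      unfolding eq[symmetric]
      by (rule bounded_linear.has_vector_derivative[OF _ u]) (simp add: Q(1) linear_linear)
  qed
  then have "Q (u s) = 0"
    using linear_ode_zero[of "\<lambda>x. Q (L x)" "\<lambda>s. Q (u s)"] linear_compose[OF L(1) Q(1)] bspec[OF Q(2) 0]
    by (simp add: o_def)
  then show ?thesis using spec[OF Q(3), of "u s"] by simp
qed

section \<open>Adjoint action and exponential map\<close>

lemma has_derivative_transform_nhds:
  assumes "(f has_derivative f') (at x)" "eventually (\<lambda>y. f y = g y) (nhds x)"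
  shows "(g has_derivative f') (at x)"
  using assms(1)
proof (rule has_derivative_transform_eventually)
  show "\<forall>\<^sub>F y in at x. f y = g y" using assms(2) unfolding eventually_at_filter by (rule eventually_mono) simp
  show "f x = g x" using assms(2) by (rule eventually_nhds_x_imp_x)
qed simp

locale lie_pair =
  fixes K :: "('g, 'a::euclidean_space) graded_pair"
  assumes setting: "graded_pair_setting K"
begin

abbreviation "G \<equiv> Grp K"
abbreviation "br \<equiv> bracket K"
abbreviation "gr \<equiv> grade K"

sublocale lie_grp G "Gtop K" "charts K"
  using setting by unfold_locales (simp add: graded_pair_setting_def)

notation mult (infixl "\<cdot>" 70)

definition "e1 = chart_at_1 K \<one>\<^bsub>G\<^esub>"
definition "U1 = fst (chart1 K)"

lemma chart1: "(U1, chart_at_1 K) \<in> charts K" "\<one>\<^bsub>G\<^esub> \<in> U1"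
  and Ad_has_derivative: "((\<lambda>u. Ad K (param_at_1 K u) y) has_derivative (\<lambda>x. br x y)) (at e1)"
  using setting by (simp_all add: graded_pair_setting_def has_lie_algebra_def U1_def chart_at_1_def e1_def)

lemma param_chart: "x \<in> U1 \<Longrightarrow> param_at_1 K (chart_at_1 K x) = x"
  using inv_into_f_f[OF chart_inj[OF chart1(1)]] by (simp add: param_at_1_def U1_def chart_at_1_def)

lemma smooth_into_param: "smooth_into (chart_at_1 K ` U1) (param_at_1 K)"
  using smooth_into_chart_inverse[OF chart1(1)] by (simp add: param_at_1_def U1_def chart_at_1_def)

lemma param_e1: "param_at_1 K e1 = \<one>\<^bsub>G\<^esub>" "e1 \<in> chart_at_1 K ` U1"
  using param_chart chart1(2) by (simp_all add: e1_def)

text \<open>\<open>frechet_derivative\<close> is a choice operator, so \<open>Ad\<close> has its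
  meaning only once the conjugation is known to be differentiable in the chart.\<close>

lemma conj_has_derivative:
  assumes g: "g \<in> carrier G"
  shows "((\<lambda>u. chart_at_1 K (g \<otimes>\<^bsub>G\<^esub> param_at_1 K u \<otimes>\<^bsub>G\<^esub> inv\<^bsub>G\<^esub> g)) has_derivative Ad K g) (at e1)"
proof -
  have sm: "smooth_into (chart_at_1 K ` U1) (\<lambda>u. g \<otimes>\<^bsub>G\<^esub> param_at_1 K u \<otimes>\<^bsub>G\<^esub> inv\<^bsub>G\<^esub> g)"
    by (rule smooth_into_conj[OF smooth_into_param g])
  have "g \<otimes>\<^bsub>G\<^esub> param_at_1 K e1 \<otimes>\<^bsub>G\<^esub> inv\<^bsub>G\<^esub> g \<in> U1" using g by (simp add: param_e1 chart1)
  from smooth_into_differentiable[OF sm param_e1(2) chart1(1) this] obtain D where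
    D: "((\<lambda>u. chart_at_1 K (g \<otimes>\<^bsub>G\<^esub> param_at_1 K u \<otimes>\<^bsub>G\<^esub> inv\<^bsub>G\<^esub> g)) has_derivative D) (at e1)" .
  then have "D = Ad K g" unfolding Ad_def e1_def by (rule frechet_derivative_at)
  with D show ?thesis by simp
qed

lemma linear_Ad: "g \<in> carrier G \<Longrightarrow> linear (Ad K g)"
  using conj_has_derivative has_derivative_linear by blast

lemma eventually_in_U1:
  assumes "smooth_into S \<Gamma>" "s \<in> S" "\<Gamma> s \<in> U1"
  shows "eventually (\<lambda>s. s \<in> S \<and> \<Gamma> s \<in> U1) (nhds s)"
proof -
  have "open {s \<in> S. \<Gamma> s \<in> U1}"
    using assms(1) open_preimage[OF _ _ chart_openin[OF chart1(1)]] unfolding smooth_into_def by blast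
  from eventually_nhds_in_open[OF this, of s] assms show ?thesis by simp
qed

lemma Ad_mult:
  assumes "g \<in> carrier G" "h \<in> carrier G"
  shows "Ad K (g \<otimes>\<^bsub>G\<^esub> h) = Ad K g \<circ> Ad K h"
proof -
  let ?C = "\<lambda>g u. chart_at_1 K (g \<otimes>\<^bsub>G\<^esub> param_at_1 K u \<otimes>\<^bsub>G\<^esub> inv\<^bsub>G\<^esub> g)"
  have h1: "?C h e1 = e1" using assms by (simp add: param_e1) (simp add: e1_def)
  have "((\<lambda>u. ?C g (?C h u)) has_derivative (\<lambda>v. Ad K g (Ad K h v))) (at e1)"
    by (rule has_derivative_compose[OF conj_has_derivative[OF assms(2)]])
      (use conj_has_derivative[OF assms(1)] h1 in simp)
  \<comment> \<open>The charted conjugations compose correctly only where the intermediate point is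
    still in \<open>U1\<close>, since there \<open>param_at_1\<close> undoes the chart.\<close>
  moreover have "eventually (\<lambda>u. ?C g (?C h u) = ?C (g \<otimes>\<^bsub>G\<^esub> h) u) (nhds e1)"
  proof -
    have "h \<otimes>\<^bsub>G\<^esub> param_at_1 K e1 \<otimes>\<^bsub>G\<^esub> inv\<^bsub>G\<^esub> h \<in> U1" using assms by (simp add: param_e1 chart1)
    from eventually_in_U1[OF smooth_into_conj[OF smooth_into_param assms(2)] param_e1(2) this]
    show ?thesis
    proof (rule eventually_mono)
      fix u assume u: "u \<in> chart_at_1 K ` U1 \<and> h \<otimes>\<^bsub>G\<^esub> param_at_1 K u \<otimes>\<^bsub>G\<^esub> inv\<^bsub>G\<^esub> h \<in> U1"
      then have "param_at_1 K u \<in> carrier G"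
        using smooth_into_carrier[OF smooth_into_param] by blast
      then show "?C g (?C h u) = ?C (g \<otimes>\<^bsub>G\<^esub> h) u"
        using u assms by (simp add: param_chart m_assoc inv_mult_group)
    qed
  qed
  ultimately have "(?C (g \<otimes>\<^bsub>G\<^esub> h) has_derivative (\<lambda>v. Ad K g (Ad K h v))) (at e1)"
    by (rule has_derivative_transform_nhds)
  from has_derivative_unique[OF conj_has_derivative this] show ?thesis using assms by (auto simp: o_def)
qed

lemma Ad_one: "Ad K \<one>\<^bsub>G\<^esub> = id"
proof -
  have "((\<lambda>u. u) has_derivative Ad K \<one>\<^bsub>G\<^esub>) (at e1)"
  proof (rule has_derivative_transform_within_open[OF conj_has_derivative])
    show "open (chart_at_1 K ` U1)" using chart_open_image[OF chart1(1)] .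
    fix u assume "u \<in> chart_at_1 K ` U1"
    then obtain x where "x \<in> U1" "u = chart_at_1 K x" by blast
    moreover have "x \<in> carrier G" using \<open>x \<in> U1\<close> chart_subset[OF chart1(1)] by blast
    ultimately show "chart_at_1 K (\<one>\<^bsub>G\<^esub> \<otimes>\<^bsub>G\<^esub> param_at_1 K u \<otimes>\<^bsub>G\<^esub> inv\<^bsub>G\<^esub> \<one>\<^bsub>G\<^esub>) = u"
      by (simp add: param_chart)
  qed (simp_all add: param_e1)
  from has_derivative_unique[OF this has_derivative_ident] show ?thesis by (simp add: id_def)
qed

lemma Ad_inv: 
  assumes "g \<in> carrier G" 
  shows "Ad K (inv\<^bsub>G\<^esub> g) (Ad K g x) = x" "Ad K g (Ad K (inv\<^bsub>G\<^esub> g) x) = x"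
  using fun_cong[OF Ad_mult[of "inv\<^bsub>G\<^esub> g" g], of x] fun_cong[OF Ad_mult[of g "inv\<^bsub>G\<^esub> g"], of x] assms Ad_one by auto

lemma expo_one_parameter: "one_parameter_subgroup G (Gtop K) (charts K) (\<lambda>t. expo K (t *\<^sub>R x))"
  and expo_velocity: "((\<lambda>t. chart_at_1 K (expo K (t *\<^sub>R x))) has_vector_derivative x) (at 0)"
  using setting by (auto simp: graded_pair_setting_def is_exponential_def o_def)

lemma expo_smooth: "smooth_into UNIV (\<lambda>t. expo K (t *\<^sub>R x))"
  using expo_one_parameter[of x] unfolding one_parameter_subgroup_smooth_into by blast

lemma expo_carrier: "expo K x \<in> carrier G"
  using smooth_into_carrier[OF expo_smooth[of x], of 1] by simp

lemma expo_add: "expo K ((s + t) *\<^sub>R x) = expo K (s *\<^sub>R x) \<otimes>\<^bsub>G\<^esub> expo K (t *\<^sub>R x)"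
  using expo_one_parameter[of x] unfolding one_parameter_subgroup_smooth_into by blast

lemma expo_0: "expo K 0 = \<one>\<^bsub>G\<^esub>"
  using one_parameter_subgroup_0[OF expo_one_parameter[of 0]] by simp

lemma expo_minus: "expo K (- x) = inv\<^bsub>G\<^esub> expo K x"
  using expo_add[of "-1" 1 x] inv_equality[of "expo K (- x)" "expo K x"] expo_carrier expo_0 by simp

lemma eventually_expo_U1: "eventually (\<lambda>t. expo K (t *\<^sub>R x) \<in> U1) (nhds 0)"
  using eventually_in_U1[OF expo_smooth, of 0 x] by (simp add: expo_0 chart1)

text \<open>Both sides are one-parameter subgroups with velocity \<open>Ad K g x\<close>, and
  \<open>is_exponential\<close> includes uniqueness.\<close>

lemma expo_conj:
  assumes g: "g \<in> carrier G"
  shows "g \<otimes>\<^bsub>G\<^esub> expo K (t *\<^sub>R x) \<otimes>\<^bsub>G\<^esub> inv\<^bsub>G\<^esub> g = expo K (t *\<^sub>R Ad K g x)"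
proof -
  let ?\<gamma> = "\<lambda>t. g \<otimes>\<^bsub>G\<^esub> expo K (t *\<^sub>R x) \<otimes>\<^bsub>G\<^esub> inv\<^bsub>G\<^esub> g"
  let ?C = "\<lambda>u. chart_at_1 K (g \<otimes>\<^bsub>G\<^esub> param_at_1 K u \<otimes>\<^bsub>G\<^esub> inv\<^bsub>G\<^esub> g)"
  have "((\<lambda>t. ?C (chart_at_1 K (expo K (t *\<^sub>R x)))) has_derivative (\<lambda>t. Ad K g (t *\<^sub>R x))) (at 0)"
    by (rule has_derivative_compose[OF expo_velocity[unfolded has_vector_derivative_def]])
      (use conj_has_derivative[OF g] in \<open>simp add: expo_0 e1_def\<close>)
  then have "((\<lambda>t. chart_at_1 K (?\<gamma> t)) has_derivative (\<lambda>t. Ad K g (t *\<^sub>R x))) (at 0)"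
    by (rule has_derivative_transform_nhds)
      (use eventually_expo_U1[of x] in \<open>rule eventually_mono\<close>, simp add: param_chart)
  then have "((chart_at_1 K \<circ> ?\<gamma>) has_vector_derivative Ad K g x) (at 0)"
    by (simp add: has_vector_derivative_def o_def linear_scale[OF linear_Ad[OF g]])
  moreover have "one_parameter_subgroup G (Gtop K) (charts K) ?\<gamma>"
    by (rule one_parameter_subgroup_conj[OF expo_one_parameter g])
  ultimately have "?\<gamma> = (\<lambda>t. expo K (t *\<^sub>R Ad K g x))"
    using setting unfolding graded_pair_setting_def is_exponential_def by blast
  then show ?thesis by (simp add: fun_eq_iff)
qed

lemma Ad_expo_deriv_0: "((\<lambda>t. Ad K (expo K (t *\<^sub>R x)) y) has_vector_derivative br x y) (at 0)"
proof -
  have lin: "linear (\<lambda>x. br x y)" using Ad_has_derivative has_derivative_linear by blast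
  have "((\<lambda>t. Ad K (param_at_1 K (chart_at_1 K (expo K (t *\<^sub>R x)))) y) has_derivative (\<lambda>t. br (t *\<^sub>R x) y)) (at 0)"
    by (rule has_derivative_compose[OF expo_velocity[unfolded has_vector_derivative_def]])
      (use Ad_has_derivative in \<open>simp add: expo_0 e1_def\<close>)
  then have "((\<lambda>t. Ad K (expo K (t *\<^sub>R x)) y) has_derivative (\<lambda>t. br (t *\<^sub>R x) y)) (at 0)"
    by (rule has_derivative_transform_nhds)
      (use eventually_expo_U1[of x] in \<open>rule eventually_mono\<close>, simp add: param_chart)
  then show ?thesis by (simp add: has_vector_derivative_def linear_scale[OF lin])
qed

text \<open>Translating the derivative at 0 by the homomorphism property gives the linear equation
  u' = [x, u] at all times, the input for the lemmas on linear differential equations.\<close>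

lemma Ad_expo_deriv:
  "((\<lambda>t. Ad K (expo K (t *\<^sub>R x)) y) has_vector_derivative br x (Ad K (expo K (s *\<^sub>R x)) y)) (at s)"
proof -
  have "((\<lambda>t. Ad K (expo K ((t - s) *\<^sub>R x)) (Ad K (expo K (s *\<^sub>R x)) y)) has_vector_derivative
      br x (Ad K (expo K (s *\<^sub>R x)) y)) (at s)"
    using vector_diff_chain_at[of "\<lambda>t. t - s" 1 s, OF _ ,of "\<lambda>t. Ad K (expo K (t *\<^sub>R x)) (Ad K (expo K (s *\<^sub>R x)) y)"]
      Ad_expo_deriv_0 by (simp add: o_def has_vector_derivative_diff_const)
  moreover have "Ad K (expo K ((t - s) *\<^sub>R x)) (Ad K (expo K (s *\<^sub>R x)) y) = Ad K (expo K (t *\<^sub>R x)) y" for t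
    using Ad_mult[OF expo_carrier expo_carrier, of "(t - s) *\<^sub>R x" "s *\<^sub>R x"] expo_add[of "t - s" s x] by simp
  ultimately show ?thesis by simp
qed

end

section \<open>Compatibility of the adjoint action with bracket and grading; the subgroup
  \<open>G0\<close>\<close>

context lie_pair begin

lemma lie_algebra: "lie_algebra br" and one_grading: "one_grading br gr"
  using setting by (simp_all add: graded_pair_setting_def simple_lie_algebra_def)

lemma bilinear_br: "bilinear br" using lie_algebra by (simp add: lie_algebra_def)

lemmas br_linear_right = bilinear_br[unfolded bilinear_def, THEN conjunct1, rule_format]
lemmas br_linear_left = bilinear_br[unfolded bilinear_def, THEN conjunct2, rule_format]

lemma subspace_gr: "subspace (gr i)" and br_gr: "x \<in> gr i \<Longrightarrow> y \<in> gr j \<Longrightarrow> br x y \<in> gr (i + j)"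
  using one_grading unfolding one_grading_def by blast+

text \<open>This takes the place of the power series Ad(exp x) = exp(ad x): the orbit of
  \<open>y\<close> solves the linear equation generated by ad x.\<close>

lemma Ad_expo_invariant:
  assumes "subspace S" "\<And>y. y \<in> S \<Longrightarrow> br x y \<in> S" "y \<in> S"
  shows "Ad K (expo K x) y \<in> S"
proof -
  have "Ad K (expo K (1 *\<^sub>R x)) y \<in> S"
    by (rule linear_ode_invariant[OF assms(1) br_linear_right assms(2) Ad_expo_deriv])
      (simp_all add: expo_0 Ad_one assms)
  then show ?thesis by simp
qed

text \<open>Differentiate the identity Ad(g) Ad(exp(t x)) = Ad(exp(t Ad(g) x)) Ad(g), applied to
  \<open>y\<close>, at t = 0.\<close>

lemma Ad_br:
  assumes g: "g \<in> carrier G"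
  shows "Ad K g (br x y) = br (Ad K g x) (Ad K g y)"
proof -
  have "Ad K g (Ad K (expo K (t *\<^sub>R x)) y) = Ad K (expo K (t *\<^sub>R Ad K g x)) (Ad K g y)" for t
  proof -
    have "g \<otimes>\<^bsub>G\<^esub> expo K (t *\<^sub>R x) = expo K (t *\<^sub>R Ad K g x) \<otimes>\<^bsub>G\<^esub> g"
      using expo_conj[OF g, of t x, symmetric] g expo_carrier by (simp add: m_assoc)
    then show ?thesis
      using Ad_mult[OF g expo_carrier[of "t *\<^sub>R x"]] Ad_mult[OF expo_carrier[of "t *\<^sub>R Ad K g x"] g]
      by (simp add: fun_eq_iff)
  qed
  moreover have "((\<lambda>t. Ad K g (Ad K (expo K (t *\<^sub>R x)) y)) has_vector_derivative Ad K g (br x y)) (at 0)"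
    using bounded_linear.has_vector_derivative[OF _ Ad_expo_deriv_0] linear_Ad[OF g]
    by (simp add: linear_conv_bounded_linear)
  ultimately show ?thesis
    using Ad_expo_deriv_0[of "Ad K g x" "Ad K g y"] vector_derivative_unique_at by (simp add: vector_derivative_at)
qed

lemma Ad_expo_gr: "x \<in> gr 0 \<Longrightarrow> y \<in> gr i \<Longrightarrow> Ad K (expo K x) y \<in> gr i"
  by (rule Ad_expo_invariant[OF subspace_gr]) (use br_gr[of x 0] in force)+

lemma expo_normalizer:
  assumes x: "x \<in> gr 0"
  shows "expo K x \<in> normalizer_p K"
proof -
  have sub: "Ad K (expo K x) y \<in> parabolic K" if "y \<in> parabolic K" "x \<in> gr 0" for x y
  proof -
    have S: "parabolic K = span (gr 0 \<union> gr 1)"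
    proof -
      have "{0..1::int} = {0, 1}" by auto
      then show ?thesis by (simp add: parabolic_def filtr_def)
    qed
    show ?thesis
    proof (rule Ad_expo_invariant[OF _ _ that(1)])
      fix y assume "y \<in> parabolic K"
      then show "br x y \<in> parabolic K" unfolding S
      proof (induction rule: span_induct)
        case base
        show ?case using linear_subspace_vimage[OF br_linear_right subspace_span, of x] by (simp add: vimage_def)
      next
        case (step y)
        then show ?case using br_gr[OF that(2), where j=0 and y=y] br_gr[OF that(2), where j=1 and y=y] by (auto intro: span_base)
      qed
    qed (simp add: S)
  qed
  have "y \<in> Ad K (expo K x) ` parabolic K" if "y \<in> parabolic K" for y
  proof (rule image_eqI[OF _ sub[OF that]])
    show "- x \<in> gr 0" by (rule subspace_neg[OF subspace_gr x])
    show "y = Ad K (expo K x) (Ad K (expo K (- x)) y)"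
      by (simp add: expo_minus Ad_inv expo_carrier)
  qed
  with sub[OF _ x] have "Ad K (expo K x) ` parabolic K = parabolic K" by blast
  then show ?thesis by (simp add: normalizer_p_def expo_carrier)
qed

text \<open>The path exp(t x) joins the unit to exp(x) inside the normalizer, so exp(x) is in its
  identity component, which \<open>Psub K\<close> contains.\<close>

lemma expo_Psub:
  assumes x: "x \<in> gr 0" shows "expo K x \<in> Psub K"
proof -
  have "continuous_map euclideanreal (Gtop K) (\<lambda>t. expo K (t *\<^sub>R x))"
    using expo_one_parameter[of x] by (simp add: one_parameter_subgroup_def)
  moreover have "expo K (t *\<^sub>R x) \<in> normalizer_p K" for t
    by (intro expo_normalizer subspace_scale[OF subspace_gr x])
  ultimately have c: "continuous_map euclideanreal (subtopology (Gtop K) (normalizer_p K)) (\<lambda>t. expo K (t *\<^sub>R x))"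
    by (auto simp: continuous_map_in_subtopology)
  have "connectedin (subtopology (Gtop K) (normalizer_p K)) ((\<lambda>t. expo K (t *\<^sub>R x)) ` UNIV)"
    by (rule connectedin_continuous_map_image[OF c]) simp
  then have "connected_component_of (subtopology (Gtop K) (normalizer_p K)) (expo K (0 *\<^sub>R x)) (expo K (1 *\<^sub>R x))"
    unfolding connected_component_of_def by blast
  moreover have "connected_component_of_set (subtopology (Gtop K) (normalizer_p K)) \<one>\<^bsub>G\<^esub> \<subseteq> Psub K"
    using setting by (simp add: graded_pair_setting_def)
  ultimately show ?thesis by (auto simp: expo_0)
qed

lemma expo_G0: "x \<in> gr 0 \<Longrightarrow> expo K x \<in> G0 K"
  using expo_Psub Ad_expo_gr by (auto simp: G0_def)

lemma subgroup_Psub: "subgroup (Psub K) G"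
  using setting by (simp add: graded_pair_setting_def)

lemma G0_carrier: "g \<in> G0 K \<Longrightarrow> g \<in> carrier G"
  using subgroup.subset[OF subgroup_Psub] by (auto simp: G0_def)

lemma Ad_G0: "g \<in> G0 K \<Longrightarrow> x \<in> gr i \<Longrightarrow> Ad K g x \<in> gr i"
  by (auto simp: G0_def)

text \<open>Membership in \<open>G0\<close> asks for an inclusion of each grade into itself.
  Inverting it requires equality, which follows by comparing dimensions.\<close>

lemma inv_G0: assumes "g \<in> G0 K" shows "inv\<^bsub>G\<^esub> g \<in> G0 K"
proof -
  have g: "g \<in> carrier G" using G0_carrier assms by blast
  have "Ad K (inv\<^bsub>G\<^esub> g) x \<in> gr i" if "x \<in> gr i" for x i
  proof -
    let ?h = "Ad K (inv\<^bsub>G\<^esub> g)"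
    have lin: "linear ?h" using linear_Ad g by simp
    have "gr i = ?h ` gr i"
    proof (rule subspace_dim_equal)
      show "subspace (?h ` gr i)" by (intro linear_subspace_image lin subspace_gr)
      show "gr i \<subseteq> ?h ` gr i"
      proof
        fix y assume "y \<in> gr i"
        then show "y \<in> ?h ` gr i" using Ad_G0[OF assms] by (intro image_eqI[of _ _ "Ad K g y"]) (simp_all add: Ad_inv g)
      qed
      show "dim (?h ` gr i) \<le> dim (gr i)" by (rule dim_image_le[OF lin])
    qed (rule subspace_gr)
    then show ?thesis using that by blast
  qed
  then show ?thesis using subgroup.m_inv_closed[OF subgroup_Psub] assms by (auto simp: G0_def)
qed

lemma mult_G0: "g \<in> G0 K \<Longrightarrow> h \<in> G0 K \<Longrightarrow> g \<otimes>\<^bsub>G\<^esub> h \<in> G0 K"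
proof -
  assume gh: "g \<in> G0 K" "h \<in> G0 K"
  have "Ad K (g \<otimes>\<^bsub>G\<^esub> h) x \<in> gr i" if "x \<in> gr i" for x i
    using Ad_G0[OF gh(1) Ad_G0[OF gh(2) that]] Ad_mult gh G0_carrier by simp
  then show ?thesis using subgroup.m_closed[OF subgroup_Psub] gh by (auto simp: G0_def)
qed

lemma one_G0: "\<one>\<^bsub>G\<^esub> \<in> G0 K"
  using expo_G0[of 0] subspace_0[OF subspace_gr] by (simp add: expo_0)

end

section \<open>Complexification\<close>

text \<open>Opens the general theory of bases, spans and representations over complex scalars for
  the pair model of the complexification.\<close>

interpretation C: vector_space cscale
  by unfold_locales
    (simp_all add: cscale_def prod_eq_iff algebra_simps scaleR_add_right scaleR_diff_right)

text \<open>Pairs stand for complex vectors here; quantifiers over them must not be split into real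
  and imaginary parts by the simplifier.\<close>

declare split_paired_All [simp del] split_paired_Ex [simp del]

lemma cscale_of_real: "cscale (of_real r) X = r *\<^sub>R X" by (simp add: cscale_def prod_eq_iff)

lemma cscale_numeral_minus_1: "cscale (- 1) X = - X" by (simp add: cscale_def prod_eq_iff)

definition clinear :: "('x::real_vector \<times> 'x \<Rightarrow> 'y::real_vector \<times> 'y) \<Rightarrow> bool" where
  "clinear L \<longleftrightarrow> (\<forall>X Y. L (X + Y) = L X + L Y) \<and> (\<forall>c X. L (cscale c X) = cscale c (L X))"

lemma clinear_add: "clinear L \<Longrightarrow> L (X + Y) = L X + L Y"
  and clinear_cscale: "clinear L \<Longrightarrow> L (cscale c X) = cscale c (L X)"
  unfolding clinear_def by blast+

lemma clinear_scaleR: "clinear L \<Longrightarrow> L (r *\<^sub>R X) = r *\<^sub>R L X"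
  using clinear_cscale[of L "of_real r" X] by (simp add: cscale_of_real)

lemma clinear_imp_linear: "clinear L \<Longrightarrow> linear L"
  by (intro linearI) (simp_all add: clinear_add clinear_scaleR)

lemma clinear_0: "clinear L \<Longrightarrow> L 0 = 0"
  and clinear_minus: "clinear L \<Longrightarrow> L (- X) = - L X"
  and clinear_diff: "clinear L \<Longrightarrow> L (X - Y) = L X - L Y"
  and clinear_sum: "clinear L \<Longrightarrow> L (\<Sum>i\<in>I. F i) = (\<Sum>i\<in>I. L (F i))"
  using clinear_imp_linear linear_0 linear_neg linear_diff linear_sum by blast+

lemma clinear_compose: "clinear L \<Longrightarrow> clinear M \<Longrightarrow> clinear (\<lambda>X. L (M X))"
  by (simp add: clinear_def)

lemma clinear_add_fun: "clinear L \<Longrightarrow> clinear M \<Longrightarrow> clinear (\<lambda>X. L X + M X)"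
  by (simp add: clinear_def C.scale_right_distrib)

lemma clinear_sum_fun: "(\<And>i. i \<in> I \<Longrightarrow> clinear (L i)) \<Longrightarrow> clinear (\<lambda>X. \<Sum>i\<in>I. L i X)"
  by (simp add: clinear_def sum.distrib C.scale_sum_right)

lemma clinear_cscale_functional:
  "(\<And>X Y. \<mu> (X + Y) = \<mu> X + \<mu> Y) \<Longrightarrow> (\<And>c X. \<mu> (cscale c X) = c * \<mu> X) \<Longrightarrow> clinear (\<lambda>X. cscale (\<mu> X) Z)"
  by (simp add: clinear_def C.scale_left_distrib)

lemma clinear_cbil:
  assumes "bilinear B"
  shows "clinear (\<lambda>X. cbil B Z X)" "clinear (\<lambda>Z. cbil B Z X)"
  using assms by (simp_all add: clinear_def cbil_def cscale_def bilinear_ladd bilinear_radd bilinear_lsub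
      bilinear_rsub bilinear_lmul bilinear_rmul algebra_simps)

lemma cbil_real: assumes "bilinear B" shows "cbil B (x, 0) (y, 0) = (B x y, 0)"
  using assms by (simp add: cbil_def bilinear_rzero bilinear_lzero)

lemma pair_eq_sum: "X = (fst X, 0) + cscale \<i> (snd X, 0)"
  by (simp add: cscale_def prod_eq_iff)

lemma clinear_eqI:
  assumes "clinear L" "clinear M" "\<And>x. L (x, 0) = M (x, 0)" shows "L X = M X"
proof -
  have *: "N X = N (fst X, 0) + cscale \<i> (N (snd X, 0))" if "clinear N" for N :: "'a \<times> 'a \<Rightarrow> 'b \<times> 'b"
    by (subst pair_eq_sum[of X]) (simp only: clinear_add[OF that] clinear_cscale[OF that])
  show ?thesis unfolding *[OF assms(1)] *[OF assms(2)] assms(3) ..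
qed

definition coord :: "'x::euclidean_space \<Rightarrow> 'x \<times> 'x \<Rightarrow> complex" where
  "coord b X = Complex (fst X \<bullet> b) (snd X \<bullet> b)"

lemma coord_add: "coord b (X + Y) = coord b X + coord b Y"
  and coord_cscale: "coord b (cscale c X) = c * coord b X"
  by (simp_all add: coord_def complex_eq_iff cscale_def algebra_simps inner_add_left inner_diff_left)

lemma coord_0: "coord b 0 = 0" using coord_cscale[of b 0 0] by simp

lemma coord_sum: "coord b (\<Sum>i\<in>I. F i) = (\<Sum>i\<in>I. coord b (F i))"
  by (induction I rule: infinite_finite_induct) (simp_all add: coord_0 coord_add)

lemma coord_expand: "(\<Sum>b\<in>Basis. cscale (coord b X) (b, 0)) = X"
proof -
  have "(\<Sum>b\<in>Basis. cscale (coord b X) (b, 0)) = (\<Sum>b\<in>Basis. ((fst X \<bullet> b) *\<^sub>R b, (snd X \<bullet> b) *\<^sub>R b))"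
    by (simp add: cscale_def coord_def)
  also have "\<dots> = (\<Sum>b\<in>Basis. (fst X \<bullet> b) *\<^sub>R b, \<Sum>b\<in>Basis. (snd X \<bullet> b) *\<^sub>R b)"
    by (simp add: sum_prod)
  finally show ?thesis by (simp add: euclidean_representation)
qed

definition ctrace :: "('x::euclidean_space \<times> 'x \<Rightarrow> 'x \<times> 'x) \<Rightarrow> complex" where
  "ctrace L = (\<Sum>b\<in>Basis. coord b (L (b, 0)))"

lemma ctrace_add: "ctrace (\<lambda>X. L X + M X) = ctrace L + ctrace M"
  and ctrace_cscale: "ctrace (\<lambda>X. cscale c (L X)) = c * ctrace L"
  by (simp_all add: ctrace_def coord_add coord_cscale sum.distrib sum_distrib_left)

lemma ctrace_sum: "ctrace (\<lambda>X. \<Sum>i\<in>I. L i X) = (\<Sum>i\<in>I. ctrace (L i))"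
  by (simp add: ctrace_def coord_sum) (rule sum.swap)

lemma ctrace_diff: "ctrace (\<lambda>X. L X - M X) = ctrace L - ctrace M"
proof -
  have "coord b (X - Y) = coord b X - coord b Y" for b and X Y :: "'a \<times> 'a"
    using coord_add[of b "X - Y" Y] by simp
  then show ?thesis by (simp add: ctrace_def sum_subtractf)
qed

lemma ctrace_commute:
  fixes L M :: "'x::euclidean_space \<times> 'x \<Rightarrow> 'x \<times> 'x"
  assumes L: "clinear L" and M: "clinear M"
  shows "ctrace (\<lambda>X. L (M X)) = ctrace (\<lambda>X. M (L X))"
proof -
  have *: "coord b (L (M (b, 0))) = (\<Sum>c\<in>Basis. coord c (M (b, 0)) * coord b (L (c, 0)))"
    if "clinear L" for L M :: "'x \<times> 'x \<Rightarrow> 'x \<times> 'x" and b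
  proof -
    have "L (M (b, 0)) = (\<Sum>c\<in>Basis. cscale (coord c (M (b, 0))) (L (c, 0)))"
      by (subst coord_expand[of "M (b, 0)", symmetric]) (simp add: clinear_sum[OF that] clinear_cscale[OF that])
    then show ?thesis by (simp add: coord_sum coord_cscale)
  qed
  show ?thesis
    unfolding ctrace_def *[OF L] *[OF M] by (subst sum.swap) (simp add: mult.commute)
qed

lemma ctrace_rank_one:
  assumes "\<And>X Y. \<mu> (X + Y) = \<mu> X + \<mu> Y" "\<And>c X. \<mu> (cscale c X) = c * \<mu> X"
  shows "ctrace (\<lambda>X. cscale (\<mu> X) Z) = \<mu> Z"
proof -
  have s: "\<mu> (\<Sum>i\<in>I. F i) = (\<Sum>i\<in>I. \<mu> (F i))" for I :: "'a set" and F
    using assms(2)[of 0 0] by (induction I rule: infinite_finite_induct) (simp_all add: assms)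
  have "\<mu> Z = \<mu> (\<Sum>b\<in>Basis. cscale (coord b Z) (b, 0))" by (simp add: coord_expand)
  then show ?thesis by (simp add: ctrace_def coord_cscale s assms(2) mult.commute)
qed

lemma C_span_Basis: "C.span ((\<lambda>b. (b, 0)) ` (Basis :: 'x::euclidean_space set)) = UNIV"
proof -
  have "(\<Sum>b\<in>Basis. cscale (coord b X) (b, 0)) \<in> C.span ((\<lambda>b. (b, 0)) ` Basis)" for X :: "'x \<times> 'x"
    by (rule C.span_sum, rule C.span_scale, rule C.span_base, rule imageI)
  from UNIV_eq_I[OF this[unfolded coord_expand]] show ?thesis ..
qed

text \<open>The trace of an idempotent is its rank: \<open>P\<close> is a sum of rank one maps along
  a basis of its range, each of trace 1. Traces of weight projections thereby become natural
  numbers, so positivity arguments apply to them.\<close>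

lemma ctrace_projection:
  fixes P :: "'x::euclidean_space \<times> 'x \<Rightarrow> 'x \<times> 'x"
  assumes P: "clinear P" and idem: "\<And>X. P (P X) = P X"
  shows "\<exists>n::nat. ctrace P = of_nat n \<and> (n = 0 \<longrightarrow> (\<forall>X. P X = 0))"
proof -
  obtain B where B: "B \<subseteq> range P" "C.independent B" "range P \<subseteq> C.span B" "card B = C.dim (range P)"
    using C.basis_exists[of "range P"] .
  have fin: "finite B" 
    using C.independent_span_bound[OF finite_imageI[OF finite_Basis] B(2), of "\<lambda>b. (b, 0)"]
    unfolding C_span_Basis by blast
  have span: "P X \<in> C.span B" for X using B(3) by blast
  define \<mu> where "\<mu> b X = C.representation B (P X) b" for b X
  have eq: "P X = (\<Sum>b\<in>B. cscale (\<mu> b X) b)" for X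
    using C.sum_representation_eq[OF B(2) span fin subset_refl] by (simp add: \<mu>_def)
  have \<mu>: "\<mu> b (X + Y) = \<mu> b X + \<mu> b Y" "\<mu> b (cscale c X) = c * \<mu> b X" for b c X Y
    using C.representation_add[OF B(2) span span] C.representation_scale[OF B(2) span]
    by (simp_all add: \<mu>_def clinear_add[OF P] clinear_cscale[OF P])
  have "\<mu> b b = 1" if "b \<in> B" for b
  proof -
    have "P b = b" using that B(1) idem by auto
    then show ?thesis using C.representation_basis[OF B(2) that] by (simp add: \<mu>_def)
  qed
  then have "ctrace (\<lambda>X. \<Sum>b\<in>B. cscale (\<mu> b X) b) = of_nat (card B)"
    unfolding ctrace_sum using ctrace_rank_one[of "\<mu> b" b for b] \<mu> by simp
  moreover have "P X = 0" if "card B = 0" for X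
    using eq[of X] that fin by simp
  ultimately show ?thesis unfolding eq[symmetric] by (intro exI[of _ "card B"]) blast
qed

lemma span_Union_subspaces:
  fixes E :: "'i \<Rightarrow> 'x::real_vector set"
  assumes E: "\<And>i. subspace (E i)" and X: "X \<in> span (\<Union>i\<in>I. E i)"
  shows "\<exists>F Y. finite F \<and> F \<subseteq> I \<and> (\<forall>i\<in>F. Y i \<in> E i) \<and> X = (\<Sum>i\<in>F. Y i)"
  using X
proof (induction rule: span_induct_alt)
  case base
  show ?case by (rule exI[of _ "{}"]) simp
next
  case (step c x y)
  then obtain F Y where F: "finite F" "F \<subseteq> I" "\<forall>i\<in>F. Y i \<in> E i" "y = (\<Sum>i\<in>F. Y i)" by blast
  obtain i where i: "i \<in> I" "x \<in> E i" using step by blast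
  define Y' where "Y' = (\<lambda>j. (if j \<in> F then Y j else 0) + (if j = i then c *\<^sub>R x else 0))"
  have "(\<Sum>j\<in>insert i F. Y' j) = (\<Sum>j\<in>insert i F. if j \<in> F then Y j else 0) + c *\<^sub>R x"
    using F(1) by (simp add: Y'_def sum.distrib)
  also have "(\<Sum>j\<in>insert i F. if j \<in> F then Y j else 0) = y"
    using F(1) by (simp add: F(4) sum.If_cases Int_insert_left insert_absorb)
  finally have "c *\<^sub>R x + y = (\<Sum>j\<in>insert i F. Y' j)" by (simp add: add.commute)
  moreover have "\<forall>j\<in>insert i F. Y' j \<in> E j"
    using F(3) i subspace_add[OF E] subspace_scale[OF E] subspace_0[OF E] by (simp add: Y'_def)
  ultimately show ?case
    using F(1,2) i(1) by (intro exI[of _ "insert i F"] exI[of _ Y']) simp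
qed

lemma csubspaceD:
  assumes "csubspace S"
  shows "subspace S" "0 \<in> S" "X \<in> S \<Longrightarrow> Y \<in> S \<Longrightarrow> X + Y \<in> S" "X \<in> S \<Longrightarrow> Y \<in> S \<Longrightarrow> X - Y \<in> S"
    "X \<in> S \<Longrightarrow> cscale c X \<in> S"
  using assms subspace_0 subspace_add subspace_diff unfolding csubspace_def by blast+

lemma csubspaceI:
  assumes "0 \<in> S" "\<And>X Y. X \<in> S \<Longrightarrow> Y \<in> S \<Longrightarrow> X + Y \<in> S" "\<And>c X. X \<in> S \<Longrightarrow> cscale c X \<in> S"
  shows "csubspace S"
  using assms assms(3)[where c="of_real _"] unfolding csubspace_def subspace_def cscale_of_real by blast

text \<open>Apply \<open>L - c\<close> to remove the component of eigenvalue \<open>c\<close>.\<close>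

lemma eigen_components:
  assumes L: "clinear L" and S: "csubspace S" "\<And>X. X \<in> S \<Longrightarrow> L X \<in> S"
    and "finite C" "\<forall>c\<in>C. L (Y c) = cscale c (Y c)" "(\<Sum>c\<in>C. Y c) \<in> S"
  shows "\<forall>c\<in>C. Y c \<in> S"
  using assms(4-6)
proof (induction C arbitrary: Y rule: finite_induct)
  case empty then show ?case by simp
next
  case (insert a C)
  have "(\<Sum>c\<in>C. cscale (c - a) (Y c)) = L (\<Sum>c\<in>insert a C. Y c) - cscale a (\<Sum>c\<in>insert a C. Y c)"
    using insert.hyps insert.prems(1)
    by (simp add: clinear_add[OF L] clinear_sum[OF L] C.scale_right_distrib C.scale_sum_right
        C.scale_left_diff_distrib sum_subtractf)
  also have "\<dots> \<in> S" using csubspaceD(4,5)[OF S(1)] S(2) insert.prems(2) by blast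
  finally have mem: "\<forall>c\<in>C. cscale (c - a) (Y c) \<in> S"
    using insert.prems(1) by (intro insert.IH) (simp_all add: clinear_cscale[OF L] C.scale_left_commute)
  have "cscale (1 / (c - a)) (cscale (c - a) (Y c)) \<in> S" if "c \<in> C" for c
    by (rule csubspaceD(5)[OF S(1) bspec[OF mem that]])
  moreover have "cscale (1 / (c - a)) (cscale (c - a) (Y c)) = Y c" if "c \<in> C" for c
    using that insert.hyps(2) by (cases "c = a") simp_all
  ultimately have *: "\<forall>c\<in>C. Y c \<in> S" by simp
  then have "(\<Sum>c\<in>C. Y c) \<in> S" by (intro subspace_sum csubspaceD(1)[OF S(1)]) simp
  then have "(\<Sum>c\<in>insert a C. Y c) - (\<Sum>c\<in>C. Y c) \<in> S"
    by (rule csubspaceD(4)[OF S(1) insert.prems(2)])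
  then have "Y a \<in> S" using insert.hyps by simp
  with * show ?case by simp
qed

text \<open>A commutator has trace zero on a subspace that both operators preserve. With
  \<open>L P\<close> and \<open>M P\<close> in place of \<open>L\<close> and \<open>M\<close> this
  is commutativity of the trace, and the inner \<open>P\<close> drops out by invariance.\<close>

lemma ctrace_commutator_invariant:
  fixes L M P :: "'x::euclidean_space \<times> 'x \<Rightarrow> 'x \<times> 'x"
  assumes "clinear L" "clinear M" "clinear P"
    and L: "\<And>X. P (L (P X)) = L (P X)" and M: "\<And>X. P (M (P X)) = M (P X)"
  shows "ctrace (\<lambda>X. L (M (P X)) - M (L (P X))) = 0"
proof -
  have "ctrace (\<lambda>X. L (P (M (P X)))) = ctrace (\<lambda>X. M (P (L (P X))))"
    by (rule ctrace_commute) (simp_all add: assms clinear_compose)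
  then show ?thesis by (simp add: L M ctrace_diff)
qed

section \<open>Root decomposition\<close>

lemma cdual_eqI:
  assumes "\<alpha> \<in> cdual h" "\<beta> \<in> cdual h" "\<And>H. H \<in> h \<Longrightarrow> \<alpha> H = \<beta> H"
  shows "\<alpha> = \<beta>"
proof
  fix H show "\<alpha> H = \<beta> H" using assms by (cases "H \<in> h") (simp_all add: cdual_def)
qed

locale cartan_lie =
  fixes br :: "'a::euclidean_space \<Rightarrow> 'a \<Rightarrow> 'a" and h :: "('a \<times> 'a) set"
  assumes simple: "simple_lie_algebra br" and cartan: "cartan_subalgebra br h"
begin

abbreviation "bc \<equiv> cbil br"
abbreviation "rs \<equiv> root_space br h"
abbreviation "\<kappa> \<equiv> ckilling br"

lemma bilinear_br: "bilinear br" and br_self: "br x x = 0"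
  and br_jacobi: "br x (br y z) + br y (br z x) + br z (br x y) = 0"
  using simple by (simp_all add: simple_lie_algebra_def lie_algebra_def)

lemmas br_simps = bilinear_ladd[OF bilinear_br] bilinear_radd[OF bilinear_br] bilinear_lsub[OF bilinear_br]
  bilinear_rsub[OF bilinear_br] bilinear_lneg[OF bilinear_br] bilinear_rneg[OF bilinear_br]
  bilinear_lzero[OF bilinear_br] bilinear_rzero[OF bilinear_br]
  bilinear_lmul[OF bilinear_br] bilinear_rmul[OF bilinear_br]

lemma br_antisym: "br x y = - br y x"
  using br_self[of "x + y"] br_self[of x] br_self[of y] by (simp add: br_simps eq_neg_iff_add_eq_0 add.commute)

lemma br_br: "br (br x y) z = br x (br y z) - br y (br x z)"
  using br_jacobi[of x y z] br_antisym[of z x] br_antisym[of z "br x y"] by (simp add: br_simps algebra_simps)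

lemmas clinear_bc = clinear_cbil(1)[OF bilinear_br]
lemmas clinear_bc' = clinear_cbil(2)[OF bilinear_br]

lemmas bc_simps = clinear_add[OF clinear_bc] clinear_add[OF clinear_bc'] clinear_cscale[OF clinear_bc]
  clinear_cscale[OF clinear_bc'] clinear_0[OF clinear_bc] clinear_0[OF clinear_bc']
  clinear_minus[OF clinear_bc] clinear_minus[OF clinear_bc'] clinear_diff[OF clinear_bc] clinear_diff[OF clinear_bc']

lemma bc_antisym: "bc X Y = - bc Y X"
  using br_antisym[of "fst X"] br_antisym[of "snd X"] by (simp add: cbil_def)

lemma bc_bc: "bc (bc X Y) Z = bc X (bc Y Z) - bc Y (bc X Z)"
  by (simp add: cbil_def br_simps br_br prod_eq_iff)

lemma csubspace_h: "csubspace h" and bc_h: "H \<in> h \<Longrightarrow> H' \<in> h \<Longrightarrow> bc H H' = 0"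
  and h_maximal: "(\<And>H. H \<in> h \<Longrightarrow> bc H X = 0) \<Longrightarrow> X \<in> h"
  and h_diag: "H \<in> h \<Longrightarrow> span {X. \<exists>c. bc H X = cscale c X} = UNIV"
  using cartan unfolding cartan_subalgebra_def by blast+

lemma bc_commute: assumes "H \<in> h" "H' \<in> h" shows "bc H (bc H' X) = bc H' (bc H X)"
  using bc_bc[of H H' X] bc_h[OF assms] by (simp add: bc_simps)

text \<open>A joint eigenvector for \<open>Hs\<close> is split into eigenvectors of one more
  \<open>H\<close>. The eigenspaces of the old elements are stable under \<open>H\<close>, so by
  \<open>eigen_components\<close> the pieces stay inside them.\<close>

lemma joint_diag:
  assumes "finite Hs" "Hs \<subseteq> h"
  shows "span {X. \<forall>H\<in>Hs. \<exists>c. bc H X = cscale c X} = UNIV"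
  using assms
proof (induction Hs rule: finite_induct)
  case empty then show ?case by simp
next
  case (insert H Hs)
  let ?J = "{X. \<forall>H\<in>Hs. \<exists>c. bc H X = cscale c X}"
  let ?J' = "{X. \<forall>H\<in>insert H Hs. \<exists>c. bc H X = cscale c X}"
  have "X \<in> span ?J'" if X: "X \<in> ?J" for X
  proof -
    have "{X. \<exists>c. bc H X = cscale c X} = (\<Union>c\<in>UNIV. {X. bc H X = cscale c X})" by blast
    then have "X \<in> span (\<Union>c\<in>UNIV. {X. bc H X = cscale c X})" using h_diag[of H] insert.prems by simp
    moreover have "subspace {X. bc H X = cscale c X}" for c
      by (rule csubspaceD(1), rule csubspaceI) (simp_all add: bc_simps C.scale_right_distrib C.scale_left_commute)
    ultimately obtain F Y where F: "finite F" "\<forall>c\<in>F. bc H (Y c) = cscale c (Y c)" "X = (\<Sum>c\<in>F. Y c)"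
      using span_Union_subspaces[of "\<lambda>c. {X. bc H X = cscale c X}" X UNIV] by blast
    have "Y c \<in> ?J'" if c: "c \<in> F" for c
    proof -
      have "\<exists>c'. bc H' (Y c) = cscale c' (Y c)" if H': "H' \<in> Hs" for H'
      proof -
        obtain c' where c': "bc H' X = cscale c' X" using X H' by blast
        have "\<forall>c\<in>F. Y c \<in> {X. bc H' X = cscale c' X}"
        proof (rule eigen_components[OF clinear_bc[of H] _ _ F(1,2)])
          show "csubspace {X. bc H' X = cscale c' X}"
            by (rule csubspaceI) (simp_all add: bc_simps C.scale_right_distrib C.scale_left_commute)
          show "(\<Sum>c\<in>F. Y c) \<in> {X. bc H' X = cscale c' X}" using F(3) c' by simp
          fix Z assume "Z \<in> {X. bc H' X = cscale c' X}"
          then show "bc H Z \<in> {X. bc H' X = cscale c' X}"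
            using bc_commute[of H' H Z] insert.prems H' by (auto simp: bc_simps)
        qed
        then show ?thesis using c by blast
      qed
      then show ?thesis using F(2) c by blast
    qed
    then show ?thesis unfolding F(3) by (intro span_sum span_base)
  qed
  then have "span ?J \<subseteq> span ?J'" by (intro span_minimal) (auto)
  then show ?case using insert.IH insert.prems by auto
qed

lemma subspace_rs: "csubspace (rs \<alpha>)"
  unfolding root_space_def
  by (rule csubspaceI) (simp_all add: bc_simps C.scale_right_distrib C.scale_left_commute)

lemma rs_bc: "X \<in> rs \<alpha> \<Longrightarrow> H \<in> h \<Longrightarrow> bc H X = cscale (\<alpha> H) X"
  by (simp add: root_space_def)

text \<open>\<open>joint_diag\<close> is applied to a finite real basis of \<open>h\<close>; an
  eigenvector for the basis is one for all of \<open>h\<close>, and its eigenvalues form a complex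
  linear functional.\<close>

lemma span_root_spaces: "span (\<Union>\<alpha>\<in>cdual h. rs \<alpha>) = UNIV"
proof -
  obtain B where B: "B \<subseteq> h" "independent B" "h \<subseteq> span B" "card B = dim h" using basis_exists[of h] .
  have fin: "finite B" using B(2) by (rule independent_imp_finite)
  have "X \<in> (\<Union>\<alpha>\<in>cdual h. rs \<alpha>)" if X: "\<forall>H\<in>B. \<exists>c. bc H X = cscale c X" and "X \<noteq> 0" for X
  proof -
    have ex: "\<exists>c. bc H X = cscale c X" if "H \<in> h" for H
    proof -
      have "H \<in> span B" using that B by blast
      then show ?thesis
      proof (induction rule: span_induct_alt)
        case base show ?case by (rule exI[of _ 0]) (simp add: bc_simps)
      next
        case (step r x y)
        then obtain c d where "bc x X = cscale c X" "bc y X = cscale d X" using X by blast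
        then show ?case
          by (intro exI[of _ "of_real r * c + d"])
            (simp add: bc_simps C.scale_left_distrib flip: cscale_of_real)
      qed
    qed
    define \<alpha> where "\<alpha> H = (if H \<in> h then SOME c. bc H X = cscale c X else 0)" for H
    have \<alpha>: "bc H X = cscale (\<alpha> H) X" if "H \<in> h" for H
      using someI_ex[OF ex[OF that]] that by (simp add: \<alpha>_def)
    have inj: "c = d" if "cscale c X = cscale d X" for c d using that \<open>X \<noteq> 0\<close> by simp
    have "\<alpha> \<in> cdual h"
      unfolding cdual_def mem_Collect_eq
    proof (intro conjI ballI allI impI)
      fix H H' assume H: "H \<in> h" "H' \<in> h"
      have "cscale (\<alpha> (H + H')) X = cscale (\<alpha> H + \<alpha> H') X"
        unfolding \<alpha>[OF csubspaceD(3)[OF csubspace_h H], symmetric] C.scale_left_distrib \<alpha>[OF H(1), symmetric] \<alpha>[OF H(2), symmetric]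
        by (simp add: bc_simps)
      then show "\<alpha> (H + H') = \<alpha> H + \<alpha> H'" by (rule inj)
    next
      fix c H assume H: "H \<in> h"
      have "cscale (\<alpha> (cscale c H)) X = cscale (c * \<alpha> H) X"
        unfolding \<alpha>[OF csubspaceD(5)[OF csubspace_h H], symmetric] C.scale_scale[symmetric] \<alpha>[OF H, symmetric]
        by (simp add: bc_simps)
      then show "\<alpha> (cscale c H) = c * \<alpha> H" by (rule inj)
    qed (simp add: \<alpha>_def)
    then show ?thesis using \<alpha> by (auto simp: root_space_def)
  qed
  then have "{X. \<forall>H\<in>B. \<exists>c. bc H X = cscale c X} \<subseteq> span (\<Union>\<alpha>\<in>cdual h. rs \<alpha>)"
    by (auto intro: span_base simp: span_0) (metis span_base span_0 UN_I)
  then have "span {X. \<forall>H\<in>B. \<exists>c. bc H X = cscale c X} \<subseteq> span (\<Union>\<alpha>\<in>cdual h. rs \<alpha>)"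
    by (intro span_minimal) auto
  then show ?thesis using joint_diag[OF fin B(1)] by auto
qed

text \<open>Applying ad H - \<beta>(H), with \<open>H\<close> separating \<alpha> from \<beta>,
  removes the \<beta> term and multiplies the \<alpha> term by a nonzero scalar.\<close>

lemma root_spaces_independent:
  assumes "finite F" "F \<subseteq> cdual h" "\<forall>\<alpha>\<in>F. Y \<alpha> \<in> rs \<alpha>" "(\<Sum>\<alpha>\<in>F. Y \<alpha>) = 0"
  shows "\<forall>\<alpha>\<in>F. Y \<alpha> = 0"
  using assms
proof (induction F arbitrary: Y rule: finite_induct)
  case empty then show ?case by simp
next
  case (insert \<beta> F)
  have "Y \<alpha> = 0" if \<alpha>: "\<alpha> \<in> F" for \<alpha>
  proof -
    have "\<alpha> \<noteq> \<beta>" "\<alpha> \<in> cdual h" "\<beta> \<in> cdual h" using \<alpha> insert by auto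
    then have "\<exists>H\<in>h. \<alpha> H \<noteq> \<beta> H" using cdual_eqI[of \<alpha> h \<beta>] by blast
    then obtain H where H: "H \<in> h" "\<alpha> H \<noteq> \<beta> H" by blast
    have "(\<Sum>\<alpha>\<in>F. cscale (\<alpha> H - \<beta> H) (Y \<alpha>)) = bc H (\<Sum>\<alpha>\<in>insert \<beta> F. Y \<alpha>) - cscale (\<beta> H) (\<Sum>\<alpha>\<in>insert \<beta> F. Y \<alpha>)"
    proof -
      have "(\<Sum>\<alpha>\<in>F. bc H (Y \<alpha>)) = (\<Sum>\<alpha>\<in>F. cscale (\<alpha> H) (Y \<alpha>))"
        using insert.prems(2) H(1) by (intro sum.cong) (auto intro: rs_bc)
      moreover have "bc H (Y \<beta>) = cscale (\<beta> H) (Y \<beta>)" using insert.prems(2) H(1) by (auto intro: rs_bc)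
      ultimately show ?thesis
        using insert.hyps
        by (simp add: bc_simps clinear_sum[OF clinear_bc] C.scale_right_distrib C.scale_sum_right
            C.scale_left_diff_distrib sum_subtractf)
    qed
    also have "\<dots> = 0" using insert.prems(3) by (simp add: bc_simps)
    finally have "\<forall>\<alpha>\<in>F. cscale (\<alpha> H - \<beta> H) (Y \<alpha>) = 0"
      using insert.prems csubspaceD(5)[OF subspace_rs] by (intro insert.IH) auto
    then show ?thesis using \<alpha> H(2) by auto
  qed
  then show ?case using insert by simp
qed

end

section \<open>Finiteness of the set of weights and the weight projections\<close>

context cartan_lie begin

text \<open>The roots together with 0, whose weight space is \<open>h\<close>. Including 0 lets one
  sum over \<open>Wt\<close> decompose the whole complexified algebra.\<close>

definition "Wt = {\<alpha> \<in> cdual h. rs \<alpha> \<noteq> {0}}"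

lemma Wt_cdual: "\<alpha> \<in> Wt \<Longrightarrow> \<alpha> \<in> cdual h" by (simp add: Wt_def)

lemma in_WtI: "X \<in> rs \<alpha> \<Longrightarrow> X \<noteq> 0 \<Longrightarrow> \<alpha> \<in> cdual h \<Longrightarrow> \<alpha> \<in> Wt"
  by (auto simp: Wt_def)

text \<open>A basis has components in finitely many weight spaces, indexed by \<open>F0\<close>. A
  nonzero vector of any other weight would be a sum of vectors of weights in \<open>F0\<close>,
  against independence.\<close>

lemma finite_Wt: "finite Wt"
proof -
  define Q where "Q X F \<longleftrightarrow> finite F \<and> F \<subseteq> cdual h \<and> (\<exists>Y. (\<forall>\<alpha>\<in>F. Y \<alpha> \<in> rs \<alpha>) \<and> X = (\<Sum>\<alpha>\<in>F. Y \<alpha>))" for X F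
  have "\<forall>X. \<exists>F. Q X F"
    using span_Union_subspaces[OF csubspaceD(1)[OF subspace_rs], where I="cdual h"] span_root_spaces
    unfolding Q_def by simp
  from choice[OF this] obtain F where FQ: "\<forall>X. Q X (F X)" ..
  have F: "finite (F X)" "F X \<subseteq> cdual h" "\<exists>Y. (\<forall>\<alpha>\<in>F X. Y \<alpha> \<in> rs \<alpha>) \<and> X = (\<Sum>\<alpha>\<in>F X. Y \<alpha>)" for X
    using FQ unfolding Q_def by blast+
  define F0 where "F0 = (\<Union>b\<in>Basis. F b)"
  have F0: "finite F0" "F0 \<subseteq> cdual h" using F(2) unfolding F0_def by (simp add: F(1), blast)
  have basis: "\<exists>Y. (\<forall>\<alpha>\<in>F0. Y \<alpha> \<in> rs \<alpha>) \<and> b = (\<Sum>\<alpha>\<in>F0. Y \<alpha>)" if b: "b \<in> Basis" for b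
  proof -
    obtain Y where Y: "\<forall>\<alpha>\<in>F b. Y \<alpha> \<in> rs \<alpha>" "b = (\<Sum>\<alpha>\<in>F b. Y \<alpha>)" using F(3) by blast
    have "F b \<subseteq> F0" using b by (auto simp: F0_def)
    then have "b = (\<Sum>\<alpha>\<in>F0. if \<alpha> \<in> F b then Y \<alpha> else 0)"
      using F0(1) Y(2) by (simp add: sum.If_cases Int_absorb1)
    then show ?thesis
      using Y(1) csubspaceD(2)[OF subspace_rs]
      by (intro exI[of _ "\<lambda>\<alpha>. if \<alpha> \<in> F b then Y \<alpha> else 0"]) simp
  qed
  have all: "\<exists>Y. (\<forall>\<alpha>\<in>F0. Y \<alpha> \<in> rs \<alpha>) \<and> X = (\<Sum>\<alpha>\<in>F0. Y \<alpha>)" for X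
  proof -
    have "X \<in> span Basis" by simp
    then show ?thesis
    proof (induction rule: span_induct_alt)
      case base show ?case using csubspaceD(2)[OF subspace_rs] by (intro exI[of _ "\<lambda>_. 0"]) simp
    next
      case (step c x y)
      obtain Y where Y: "\<forall>\<alpha>\<in>F0. Y \<alpha> \<in> rs \<alpha>" "x = (\<Sum>\<alpha>\<in>F0. Y \<alpha>)" using basis[OF step(1)] by blast
      obtain Z where Z: "\<forall>\<alpha>\<in>F0. Z \<alpha> \<in> rs \<alpha>" "y = (\<Sum>\<alpha>\<in>F0. Z \<alpha>)" using step(2) by blast
      show ?case
        using Y Z csubspaceD(1)[OF subspace_rs] csubspaceD(3)[OF subspace_rs]
        by (intro exI[of _ "\<lambda>\<alpha>. c *\<^sub>R Y \<alpha> + Z \<alpha>"]) (simp add: sum.distrib scaleR_sum_right subspace_scale)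
    qed
  qed
  have "Wt \<subseteq> F0"
  proof
    fix \<beta> assume "\<beta> \<in> Wt"
    then obtain X where X: "X \<in> rs \<beta>" "X \<noteq> 0" "\<beta> \<in> cdual h"
      using csubspaceD(2)[OF subspace_rs] by (auto simp: Wt_def)
    show "\<beta> \<in> F0"
    proof (rule ccontr)
      assume n: "\<beta> \<notin> F0"
      obtain Y where Y: "\<forall>\<alpha>\<in>F0. Y \<alpha> \<in> rs \<alpha>" "X = (\<Sum>\<alpha>\<in>F0. Y \<alpha>)" using all by blast
      let ?Y = "\<lambda>\<alpha>. if \<alpha> = \<beta> then - X else Y \<alpha>"
      have "(\<Sum>\<alpha>\<in>F0. ?Y \<alpha>) = X" unfolding Y(2) using n by (intro sum.cong) auto
      then have "(\<Sum>\<alpha>\<in>insert \<beta> F0. ?Y \<alpha>) = 0" using n F0(1) by simp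
      moreover have "\<forall>\<alpha>\<in>insert \<beta> F0. ?Y \<alpha> \<in> rs \<alpha>"
        using Y(1) X(1) subspace_neg[OF csubspaceD(1)[OF subspace_rs]] by simp
      ultimately have "?Y \<beta> = 0"
        using root_spaces_independent[of "insert \<beta> F0" ?Y] F0 X(3) by blast
      then show False using X(2) by simp
    qed
  qed
  then show ?thesis using F0(1) finite_subset by blast
qed

lemma decomposition: "\<exists>Y. (\<forall>\<alpha>\<in>Wt. Y \<alpha> \<in> rs \<alpha>) \<and> X = (\<Sum>\<alpha>\<in>Wt. Y \<alpha>)"
proof -
  obtain F Y where F: "finite F" "F \<subseteq> cdual h" "\<forall>\<alpha>\<in>F. Y \<alpha> \<in> rs \<alpha>" "X = (\<Sum>\<alpha>\<in>F. Y \<alpha>)"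
    using span_Union_subspaces[where E=rs and I="cdual h" and X=X] csubspaceD(1)[OF subspace_rs]
    unfolding span_root_spaces by auto
  let ?Y = "\<lambda>\<alpha>. if \<alpha> \<in> F then Y \<alpha> else 0"
  have "X = (\<Sum>\<alpha>\<in>F \<union> Wt. ?Y \<alpha>)"
    unfolding F(4) using F(1) finite_Wt by (intro sum.mono_neutral_cong_left) auto
  also have "\<dots> = (\<Sum>\<alpha>\<in>Wt. ?Y \<alpha>)"
    using F finite_Wt by (intro sum.mono_neutral_right) (auto simp: Wt_def)
  finally show ?thesis
    using F(3) csubspaceD(2)[OF subspace_rs] by (intro exI[of _ ?Y]) simp
qed

text \<open>The choice is harmless because components are unique by
  \<open>root_spaces_independent\<close>. The value 0 outside \<open>Wt\<close> keeps formulas with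
  \<alpha> and -\<alpha> free of side conditions.\<close>

definition proj :: "('a \<times> 'a \<Rightarrow> complex) \<Rightarrow> 'a \<times> 'a \<Rightarrow> 'a \<times> 'a" where
  "proj \<alpha> X = (if \<alpha> \<in> Wt then (SOME Y. (\<forall>\<alpha>\<in>Wt. Y \<alpha> \<in> rs \<alpha>) \<and> X = (\<Sum>\<alpha>\<in>Wt. Y \<alpha>)) \<alpha> else 0)"

lemma proj_rs: "proj \<alpha> X \<in> rs \<alpha>" and sum_proj: "(\<Sum>\<alpha>\<in>Wt. proj \<alpha> X) = X"
proof -
  define Y where "Y = (SOME Y. (\<forall>\<alpha>\<in>Wt. Y \<alpha> \<in> rs \<alpha>) \<and> X = (\<Sum>\<alpha>\<in>Wt. Y \<alpha>))"
  have Y: "(\<forall>\<alpha>\<in>Wt. Y \<alpha> \<in> rs \<alpha>) \<and> X = (\<Sum>\<alpha>\<in>Wt. Y \<alpha>)"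
    unfolding Y_def by (rule someI_ex[OF decomposition])
  have p: "proj \<alpha> X = (if \<alpha> \<in> Wt then Y \<alpha> else 0)" for \<alpha> by (simp add: proj_def Y_def)
  show "proj \<alpha> X \<in> rs \<alpha>" unfolding p using conjunct1[OF Y] csubspaceD(2)[OF subspace_rs] by simp
  show "(\<Sum>\<alpha>\<in>Wt. proj \<alpha> X) = X" unfolding p using conjunct2[OF Y] by simp
qed

lemma proj_eqI:
  assumes "\<forall>\<alpha>\<in>Wt. Y \<alpha> \<in> rs \<alpha>" "X = (\<Sum>\<alpha>\<in>Wt. Y \<alpha>)" "\<alpha> \<in> Wt"
  shows "proj \<alpha> X = Y \<alpha>"
proof -
  have "\<forall>\<alpha>\<in>Wt. proj \<alpha> X - Y \<alpha> = 0"
  proof (rule root_spaces_independent[OF finite_Wt])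
    show "\<forall>\<alpha>\<in>Wt. proj \<alpha> X - Y \<alpha> \<in> rs \<alpha>"
      using assms(1) proj_rs csubspaceD(4)[OF subspace_rs] by blast
    show "(\<Sum>\<alpha>\<in>Wt. proj \<alpha> X - Y \<alpha>) = 0" using assms(2) by (simp add: sum_subtractf sum_proj)
  qed (auto simp: Wt_cdual)
  then show ?thesis using assms(3) by simp
qed

lemma proj_notin: "\<alpha> \<notin> Wt \<Longrightarrow> proj \<alpha> X = 0" by (simp add: proj_def)

lemma clinear_proj: "clinear (proj \<alpha>)"
proof (cases "\<alpha> \<in> Wt")
  case True
  have "proj \<alpha> (X + Y) = proj \<alpha> X + proj \<alpha> Y" for X Y
    using True csubspaceD(3)[OF subspace_rs] proj_rs
    by (intro proj_eqI[of "\<lambda>\<alpha>. proj \<alpha> X + proj \<alpha> Y"]) (simp_all add: sum.distrib sum_proj)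
  moreover have "proj \<alpha> (cscale c X) = cscale c (proj \<alpha> X)" for c X
    using True csubspaceD(5)[OF subspace_rs] proj_rs
    by (intro proj_eqI[of "\<lambda>\<alpha>. cscale c (proj \<alpha> X)"]) (simp_all add: sum_proj flip: C.scale_sum_right)
  ultimately show ?thesis by (simp add: clinear_def)
qed (simp add: clinear_def proj_notin)

lemma proj_same: assumes "X \<in> rs \<alpha>" "\<alpha> \<in> cdual h" shows "proj \<alpha> X = X"
  and proj_other: "\<beta> \<noteq> \<alpha> \<Longrightarrow> proj \<beta> X = 0"
proof -
  have *: "proj \<beta> X = (if \<beta> = \<alpha> then X else 0)" if "\<beta> \<in> Wt" for \<beta>
  proof (rule proj_eqI[of "\<lambda>\<beta>. if \<beta> = \<alpha> then X else 0", OF _ _ that])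
    show "\<forall>\<beta>\<in>Wt. (if \<beta> = \<alpha> then X else 0) \<in> rs \<beta>" using assms(1) csubspaceD(2)[OF subspace_rs] by simp
    show "X = (\<Sum>\<beta>\<in>Wt. if \<beta> = \<alpha> then X else 0)" using finite_Wt in_WtI[OF assms(1) _ assms(2)] by auto
  qed
  show "proj \<alpha> X = X" using *[of \<alpha>] in_WtI[OF assms(1) _ assms(2)] proj_notin by fastforce
  show "proj \<beta> X = 0" if "\<beta> \<noteq> \<alpha>" using *[of \<beta>] proj_notin that by fastforce
qed

lemma proj_proj: "proj \<alpha> (proj \<beta> X) = (if \<alpha> = \<beta> then proj \<beta> X else 0)"
  using proj_same[OF proj_rs] proj_other[OF proj_rs] proj_notin clinear_0[OF clinear_proj] Wt_cdual by metis

lemma bc_eq_sum: assumes "H \<in> h" shows "bc H X = (\<Sum>\<alpha>\<in>Wt. cscale (\<alpha> H) (proj \<alpha> X))"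
proof -
  have "bc H X = (\<Sum>\<alpha>\<in>Wt. bc H (proj \<alpha> X))"
    by (subst sum_proj[of X, symmetric]) (rule clinear_sum[OF clinear_bc])
  then show ?thesis using rs_bc[OF proj_rs assms] by simp
qed

lemma cdual_add: "\<alpha> \<in> cdual h \<Longrightarrow> \<beta> \<in> cdual h \<Longrightarrow> \<alpha> + \<beta> \<in> cdual h"
  and cdual_cmul: "\<alpha> \<in> cdual h \<Longrightarrow> (\<lambda>H. c * \<alpha> H) \<in> cdual h"
  and cdual_0: "0 \<in> cdual h"
  by (auto simp: cdual_def algebra_simps)

lemma cdual_minus: "\<alpha> \<in> cdual h \<Longrightarrow> - \<alpha> \<in> cdual h"
  using cdual_cmul[of \<alpha> "-1"] by (simp add: fun_Compl_def)

lemma cdual_sum: "(\<And>i. i \<in> I \<Longrightarrow> f i \<in> cdual h) \<Longrightarrow> (\<lambda>H. \<Sum>i\<in>I. f i H) \<in> cdual h"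
  by (simp add: cdual_def sum.distrib sum_distrib_left)

lemma bc_rs: assumes "X \<in> rs \<alpha>" "Y \<in> rs \<beta>" shows "bc X Y \<in> rs (\<alpha> + \<beta>)"
proof -
  have "bc H (bc X Y) = cscale (\<alpha> H + \<beta> H) (bc X Y)" if "H \<in> h" for H
    using bc_bc[of H X Y] rs_bc[OF assms(1) that] rs_bc[OF assms(2) that]
    by (simp add: bc_simps C.scale_left_distrib algebra_simps)
  then show ?thesis by (simp add: root_space_def)
qed

lemma rs_0: "rs 0 = h"
  using h_maximal bc_h by (auto simp: root_space_def bc_simps)

end

section \<open>The Killing form\<close>

context cartan_lie begin

lemma killing_add: "killing br (x + y) z = killing br x z + killing br y z"
    "killing br z (x + y) = killing br z x + killing br z y"
  and killing_scaleR: "killing br (r *\<^sub>R x) z = r * killing br x z" "killing br z (r *\<^sub>R x) = r * killing br z x"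
  by (simp_all add: killing_def trace_of_def br_simps inner_add_left sum.distrib sum_distrib_left)

lemma bilinear_killing: "bilinear (killing br)"
  by (simp add: bilinear_def linear_iff killing_add killing_scaleR)

lemma \<kappa>_ctrace: "\<kappa> X Y = ctrace (\<lambda>Z. bc X (bc Y Z))"
proof -
  have "bc X (bc Y (b, 0)) = (br (fst X) (br (fst Y) b) - br (snd X) (br (snd Y) b),
      br (fst X) (br (snd Y) b) + br (snd X) (br (fst Y) b))" for b
    by (simp add: cbil_def br_simps)
  then show ?thesis
    by (simp add: ckilling_def cbil_def ctrace_def coord_def killing_def trace_of_def complex_eq_iff
        inner_add_left inner_diff_left sum.distrib sum_subtractf)
qed

lemma \<kappa>_sym: "\<kappa> X Y = \<kappa> Y X"
  unfolding \<kappa>_ctrace by (rule ctrace_commute[OF clinear_bc clinear_bc])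

lemma \<kappa>_add: "\<kappa> (X + Y) Z = \<kappa> X Z + \<kappa> Y Z" "\<kappa> Z (X + Y) = \<kappa> Z X + \<kappa> Z Y"
  and \<kappa>_cscale: "\<kappa> (cscale c X) Z = c * \<kappa> X Z" "\<kappa> Z (cscale c X) = c * \<kappa> Z X"
  by (simp_all add: \<kappa>_ctrace bc_simps ctrace_add ctrace_cscale)

lemma \<kappa>_0: "\<kappa> 0 Z = 0" "\<kappa> Z 0 = 0"
  using \<kappa>_cscale(1)[of 0 0 Z] \<kappa>_cscale(2)[of Z 0 0] by simp_all

lemma \<kappa>_minus: "\<kappa> (- X) Z = - \<kappa> X Z" "\<kappa> Z (- X) = - \<kappa> Z X"
  using \<kappa>_cscale(1)[of "-1" X Z] \<kappa>_cscale(2)[of Z "-1" X] by (simp_all add: cscale_numeral_minus_1)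

lemma \<kappa>_sum: "\<kappa> (\<Sum>i\<in>I. F i) Z = (\<Sum>i\<in>I. \<kappa> (F i) Z)" "\<kappa> Z (\<Sum>i\<in>I. F i) = (\<Sum>i\<in>I. \<kappa> Z (F i))"
  by (induction I rule: infinite_finite_induct) (simp_all add: \<kappa>_0 \<kappa>_add)

lemma \<kappa>_invariant: "\<kappa> (bc X Y) Z = \<kappa> X (bc Y Z)"
proof -
  have "ctrace (\<lambda>W. bc Y (bc X (bc Z W))) = ctrace (\<lambda>W. bc X (bc Z (bc Y W)))"
    by (rule ctrace_commute[OF clinear_bc clinear_compose[OF clinear_bc clinear_bc]])
  then show ?thesis by (simp add: \<kappa>_ctrace bc_bc bc_simps ctrace_diff)
qed

lemma \<kappa>_real: "\<kappa> (x, 0) (y, 0) = of_real (killing br x y)"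
  by (simp add: ckilling_def cbil_real[OF bilinear_killing] complex_eq_iff)

lemma killing_sym: "killing br x y = killing br y x"
  using \<kappa>_sym[of "(x, 0)" "(y, 0)"] by (simp add: \<kappa>_real)

lemma killing_invariant: "killing br (br x y) z = killing br x (br y z)"
  using \<kappa>_invariant[of "(x, 0)" "(y, 0)" "(z, 0)"] by (simp add: cbil_real[OF bilinear_br] \<kappa>_real del: of_real_eq_iff flip: of_real_eq_iff[where 'a=complex])

text \<open>The dimension of the weight space, written as a trace because that is how it enters the
  identities below; \<open>root_mult_nat\<close> recovers integrality.\<close>

definition "root_mult \<alpha> = ctrace (proj \<alpha>)"

lemma root_mult_nat: "\<exists>n::nat. root_mult \<alpha> = of_nat n \<and> (\<alpha> \<in> Wt \<longrightarrow> n > 0)"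
proof -
  obtain n :: nat where n: "root_mult \<alpha> = of_nat n" "n = 0 \<longrightarrow> (\<forall>X. proj \<alpha> X = 0)"
    using ctrace_projection[OF clinear_proj, of \<alpha>] by (auto simp: proj_proj root_mult_def)
  have "n > 0" if "\<alpha> \<in> Wt"
  proof (rule ccontr)
    assume "\<not> n > 0"
    then have "proj \<alpha> X = 0" for X using n(2) by simp
    then have "rs \<alpha> \<subseteq> {0}" using proj_same[OF _ Wt_cdual[OF that]] by auto
    then show False using that csubspaceD(2)[OF subspace_rs] by (auto simp: Wt_def)
  qed
  with n show ?thesis by blast
qed

lemma root_mult_nat_choice: "\<exists>n :: _ \<Rightarrow> nat. \<forall>\<gamma>. root_mult \<gamma> = of_nat (n \<gamma>) \<and> (\<gamma> \<in> Wt \<longrightarrow> n \<gamma> > 0)"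
  by (rule choice) (use root_mult_nat in blast)

lemma ctrace_bc_proj: "H \<in> h \<Longrightarrow> ctrace (\<lambda>X. bc H (proj \<alpha> X)) = \<alpha> H * root_mult \<alpha>"
  using rs_bc[OF proj_rs] by (simp add: root_mult_def ctrace_cscale)

lemma \<kappa>_h: assumes "H \<in> h" "H' \<in> h" shows "\<kappa> H H' = (\<Sum>\<alpha>\<in>Wt. root_mult \<alpha> * (\<alpha> H * \<alpha> H'))"
proof -
  have "bc H (bc H' X) = (\<Sum>\<alpha>\<in>Wt. cscale (\<alpha> H * \<alpha> H') (proj \<alpha> X))" for X
    unfolding bc_eq_sum[OF assms(2)]
    by (simp add: clinear_sum[OF clinear_bc] bc_simps rs_bc[OF proj_rs assms(1)] mult.commute)
  then show ?thesis by (simp add: \<kappa>_ctrace ctrace_sum ctrace_cscale root_mult_def mult.commute)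
qed

lemma center_trivial_real: assumes "\<And>x. br z x = 0" shows "z = 0"
proof -
  let ?I = "{z. \<forall>x. br z x = 0}"
  have "subspace ?I" by (auto simp: subspace_def br_simps)
  moreover have "br x y \<in> ?I" if "y \<in> ?I" for x y using that br_antisym[of x y] by (simp add: br_simps)
  ultimately have "?I = {0} \<or> ?I = UNIV" using simple by (simp add: simple_lie_algebra_def)
  moreover have "?I \<noteq> UNIV" using simple by (auto simp: simple_lie_algebra_def)
  ultimately show ?thesis using assms by blast
qed

lemma center_trivial: assumes "\<And>X. bc Z X = 0" shows "Z = 0"
proof -
  have *: "br (fst Z) x = 0" "br (snd Z) x = 0" for x
    using assms[of "(x, 0)"] by (simp_all add: cbil_def br_simps prod_eq_iff)
  have "fst Z = 0" "snd Z = 0" by (rule center_trivial_real, rule *)+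
  then show ?thesis by (simp add: prod_eq_iff)
qed

lemma h_eq_0I: assumes "H \<in> h" "\<And>\<beta>. \<beta> \<in> Wt \<Longrightarrow> \<beta> H = 0" shows "H = 0"
proof (rule center_trivial)
  fix X
  have "cscale (\<beta> H) (proj \<beta> X) = 0" if "\<beta> \<in> Wt" for \<beta>
    unfolding assms(2)[OF that] by simp
  then show "bc H X = 0" unfolding bc_eq_sum[OF assms(1)] by (intro sum.neutral) blast
qed

text \<open>The trace of \<open>[e, f]\<close> on the \<open>\<alpha>\<close>-string through \<open>\<beta>\<close> vanishes.\<close>

lemma string_trace:
  assumes "e \<in> rs \<alpha>" "f \<in> rs (- \<alpha>)" "\<alpha> \<in> cdual h" "\<beta> \<in> cdual h"
  shows "(\<Sum>\<gamma>\<in>{\<gamma>\<in>Wt. \<exists>j::int. \<gamma> = \<beta> + (\<lambda>H. of_int j * \<alpha> H)}. \<gamma> (bc e f) * root_mult \<gamma>) = 0"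
proof -
  let ?S = "{\<gamma>\<in>Wt. \<exists>j::int. \<gamma> = \<beta> + (\<lambda>H. of_int j * \<alpha> H)}"
  have fin: "finite ?S" using finite_Wt by simp
  define P where "P X = (\<Sum>\<gamma>\<in>?S. proj \<gamma> X)" for X
  have cP: "clinear P" unfolding P_def by (intro clinear_sum_fun clinear_proj)
  have P: "P Y = Y" if "Y \<in> rs \<gamma>" "\<gamma> = \<beta> + (\<lambda>H. of_int j * \<alpha> H)" for Y \<gamma> and j :: int
  proof -
    have \<gamma>: "\<gamma> \<in> cdual h" using that assms cdual_add cdual_cmul by blast
    have "P Y = (\<Sum>\<delta>\<in>?S. if \<delta> = \<gamma> then Y else 0)"
      unfolding P_def using proj_same[OF that(1) \<gamma>] proj_other[OF that(1) \<gamma>] by (intro sum.cong) auto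
    also have "\<dots> = (if \<gamma> \<in> ?S then Y else 0)" using fin by (rule sum.delta)
    also have "\<dots> = Y" using that(2) in_WtI[OF that(1) _ \<gamma>] by auto
    finally show ?thesis .
  qed
  have inv: "P (bc x (P X)) = bc x (P X)" if x: "x \<in> rs (\<lambda>H. of_int i * \<alpha> H)" for x X and i :: int
  proof -
    have "P (bc x (proj \<gamma> X)) = bc x (proj \<gamma> X)" if \<gamma>: "\<gamma> \<in> ?S" for \<gamma>
    proof -
      obtain j :: int where j: "\<gamma> = \<beta> + (\<lambda>H. of_int j * \<alpha> H)" using \<gamma> by blast
      show ?thesis
        by (rule P[OF bc_rs[OF x proj_rs], of _ "i + j"]) (simp add: j fun_eq_iff algebra_simps)
    qed
    then show ?thesis
      unfolding P_def[of X] clinear_sum[OF clinear_bc] clinear_sum[OF cP] by simp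
  qed
  have "ctrace (\<lambda>X. bc e (bc f (P X)) - bc f (bc e (P X))) = 0"
    using inv[of e 1] inv[of f "-1"] assms(1,2)
    by (intro ctrace_commutator_invariant clinear_bc cP) (simp_all add: fun_Compl_def)
  then have "ctrace (\<lambda>X. bc (bc e f) (P X)) = 0" by (simp add: bc_bc)
  moreover have "bc e f \<in> h" using bc_rs[OF assms(1,2)] rs_0 by simp
  ultimately show ?thesis by (simp add: P_def clinear_sum[OF clinear_bc] ctrace_sum ctrace_bc_proj)
qed

text \<open>\<open>string_trace\<close> is a linear relation between \<beta>(H) and \<alpha>(H) for
  H = [e, f]. The coefficient \<open>M\<close> of \<beta>(H) is the total dimension of the string,
  hence positive, and all coefficients are integers, so the ratio is real.\<close>

lemma string_proportional:
  assumes "e \<in> rs \<alpha>" "f \<in> rs (- \<alpha>)" "\<alpha> \<in> cdual h" "\<beta> \<in> Wt"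
  shows "\<exists>q::real. \<beta> (bc e f) = of_real q * \<alpha> (bc e f)"
proof -
  let ?S = "{\<gamma>\<in>Wt. \<exists>j::int. \<gamma> = \<beta> + (\<lambda>H. of_int j * \<alpha> H)}"
  have fin: "finite ?S" using finite_Wt by simp
  define H where "H = bc e f"
  obtain n :: "_ \<Rightarrow> nat" where n: "\<And>\<gamma>. root_mult \<gamma> = of_nat (n \<gamma>)" "\<And>\<gamma>. \<gamma> \<in> Wt \<Longrightarrow> n \<gamma> > 0"
    using root_mult_nat_choice by blast
  have "\<forall>\<gamma>\<in>?S. \<exists>j::int. \<gamma> = \<beta> + (\<lambda>H. of_int j * \<alpha> H)" by blast
  from bchoice[OF this] obtain j :: "_ \<Rightarrow> int" where j: "\<forall>\<gamma>\<in>?S. \<gamma> = \<beta> + (\<lambda>H. of_int (j \<gamma>) * \<alpha> H)" ..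
  define M where "M = (\<Sum>\<gamma>\<in>?S. real (n \<gamma>))"
  define J where "J = (\<Sum>\<gamma>\<in>?S. real_of_int (j \<gamma>) * real (n \<gamma>))"
  have "\<beta> \<in> ?S" using assms(4) by (auto intro!: exI[of _ 0] simp: fun_eq_iff)
  then have "0 < M" unfolding M_def using n(2) fin by (intro sum_pos2[of _ \<beta>]) auto
  have "0 = (\<Sum>\<gamma>\<in>?S. \<gamma> H * root_mult \<gamma>)"
    using string_trace[OF assms(1,2,3) Wt_cdual[OF assms(4)]] by (simp add: H_def)
  also have "\<dots> = (\<Sum>\<gamma>\<in>?S. (\<beta> H + of_int (j \<gamma>) * \<alpha> H) * of_nat (n \<gamma>))"
  proof (intro sum.cong refl)
    fix \<gamma> assume "\<gamma> \<in> ?S"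
    from fun_cong[OF bspec[OF j this], of H] show "\<gamma> H * root_mult \<gamma> = (\<beta> H + of_int (j \<gamma>) * \<alpha> H) * of_nat (n \<gamma>)"
      by (simp add: n(1))
  qed
  also have "\<dots> = \<beta> H * of_real M + of_real J * \<alpha> H"
  proof -
    have "(\<beta> H + of_int (j \<gamma>) * \<alpha> H) * of_nat (n \<gamma>)
      = \<beta> H * of_real (real (n \<gamma>)) + of_real (real_of_int (j \<gamma>) * real (n \<gamma>)) * \<alpha> H" for \<gamma>
      by (simp add: algebra_simps)
    then show ?thesis by (simp only: M_def J_def sum.distrib sum_distrib_left sum_distrib_right of_real_sum)
  qed
  finally have "\<beta> H * of_real M = of_real (- J) * \<alpha> H" by (simp add: eq_neg_iff_add_eq_0)
  then have "\<beta> H = of_real (- J / M) * \<alpha> H" using \<open>0 < M\<close> by (simp add: field_simps)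
  then show ?thesis unfolding H_def by blast
qed

text \<open>If \<alpha> vanishes on [e, f], proportionality makes every weight vanish there, and an
  element of \<open>h\<close> killed by all weights is central.\<close>

lemma bracket_opposite_eq_0:
  assumes "e \<in> rs \<alpha>" "f \<in> rs (- \<alpha>)" "\<alpha> \<in> cdual h" "\<alpha> (bc e f) = 0"
  shows "bc e f = 0"
proof (rule h_eq_0I)
  show "bc e f \<in> h" using bc_rs[OF assms(1,2)] rs_0 by simp
  show "\<beta> (bc e f) = 0" if "\<beta> \<in> Wt" for \<beta>
    using string_proportional[OF assms(1-3) that] assms(4) by auto
qed

text \<open>A weak form of Cartan's criterion. If the form were 0, then \<kappa>(H, H) for H =
  [e, f] would be \<alpha>(H)^2 times a positive sum of squares of real ratios, so \<alpha>(H) = 0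
  and [e, f] = 0. Brackets then have no component in \<open>h\<close>, while a simple algebra is
  spanned by its brackets.\<close>

lemma killing_nonzero: "\<exists>x y. killing br x y \<noteq> 0"
proof (rule ccontr)
  assume "\<not> ?thesis"
  then have \<kappa>0: "\<kappa> X Y = 0" for X Y by (simp add: ckilling_def cbil_def complex_eq_iff)
  have bc0: "bc e f = 0" if ef: "e \<in> rs \<alpha>" "f \<in> rs (- \<alpha>)" "\<alpha> \<in> Wt" for e f \<alpha>
  proof (rule bracket_opposite_eq_0[OF ef(1,2) Wt_cdual[OF ef(3)]], rule ccontr)
    assume nz: "\<alpha> (bc e f) \<noteq> 0"
    have H: "bc e f \<in> h" using bc_rs[OF ef(1,2)] rs_0 by simp
    obtain n :: "_ \<Rightarrow> nat" where n: "\<And>\<gamma>. root_mult \<gamma> = of_nat (n \<gamma>)" "\<And>\<gamma>. \<gamma> \<in> Wt \<Longrightarrow> n \<gamma> > 0"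
      using root_mult_nat_choice by blast
    obtain q :: "_ \<Rightarrow> real" where q: "\<And>\<beta>. \<beta> \<in> Wt \<Longrightarrow> \<beta> (bc e f) = of_real (q \<beta>) * \<alpha> (bc e f)"
      using string_proportional[OF ef(1,2) Wt_cdual[OF ef(3)]] by metis
    have "q \<alpha> \<noteq> 0" using q[OF ef(3)] nz by auto
    then have pos: "0 < (\<Sum>\<beta>\<in>Wt. real (n \<beta>) * (q \<beta>)\<^sup>2)"
      using ef(3) n(2) finite_Wt by (intro sum_pos2[of _ \<alpha>]) auto
    have "0 = (\<Sum>\<beta>\<in>Wt. root_mult \<beta> * (\<beta> (bc e f) * \<beta> (bc e f)))" using \<kappa>_h[OF H H] \<kappa>0 by simp
    also have "\<dots> = (\<Sum>\<beta>\<in>Wt. of_real (real (n \<beta>) * (q \<beta>)\<^sup>2) * (\<alpha> (bc e f))\<^sup>2)"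
      by (intro sum.cong refl) (simp add: q n(1) power2_eq_square)
    also have "\<dots> = of_real (\<Sum>\<beta>\<in>Wt. real (n \<beta>) * (q \<beta>)\<^sup>2) * (\<alpha> (bc e f))\<^sup>2"
      by (simp add: sum_distrib_right)
    finally have "of_real (\<Sum>\<beta>\<in>Wt. real (n \<beta>) * (q \<beta>)\<^sup>2) = (0::complex)" using nz by simp
    then show False using pos by (simp only: of_real_eq_0_iff)
  qed
  \<comment> \<open>Only brackets of opposite weight vectors could contribute to the zero weight
    space, and these vanish by \<open>bc0\<close>.\<close>
  have proj_bc: "proj 0 (bc X Y) = 0" for X Y
  proof -
    have "proj 0 (bc (proj \<alpha> X) (proj \<beta> Y)) = 0" if "\<alpha> \<in> Wt" "\<beta> \<in> Wt" for \<alpha> \<beta>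
    proof (cases "\<beta> = - \<alpha>")
      case True
      then have "bc (proj \<alpha> X) (proj \<beta> Y) = 0" using bc0[OF proj_rs _ that(1)] proj_rs[of \<beta>] by simp
      then show ?thesis by (simp add: clinear_0[OF clinear_proj])
    next
      case False
      then have "0 \<noteq> \<alpha> + \<beta>" by (metis eq_neg_iff_add_eq_0 add.commute)
      then show ?thesis
        using proj_other[OF bc_rs[OF proj_rs proj_rs]] cdual_add Wt_cdual that by blast
    qed
    moreover have "bc X Y = (\<Sum>\<beta>\<in>Wt. \<Sum>\<alpha>\<in>Wt. bc (proj \<alpha> X) (proj \<beta> Y))"
      by (subst sum_proj[of X, symmetric], subst sum_proj[of Y, symmetric])
        (simp add: clinear_sum[OF clinear_bc] clinear_sum[OF clinear_bc'])
    ultimately show ?thesis by (simp add: clinear_sum[OF clinear_proj])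
  qed
  let ?I = "span {br x y | x y. True}"
  have brI: "br x y \<in> ?I" for x y by (rule span_base) blast
  then have "subspace ?I \<and> (\<forall>x. \<forall>y\<in>?I. br x y \<in> ?I)" by simp
  then have "?I = {0} \<or> ?I = UNIV" using simple by (simp add: simple_lie_algebra_def)
  moreover obtain u v where "br u v \<noteq> 0" using simple by (auto simp: simple_lie_algebra_def)
  ultimately have I: "x \<in> ?I" for x using brI[of u v] by auto
  have "proj 0 (x, 0) = 0" for x
    using I[of x]
  proof (induction rule: span_induct_alt)
    case base then show ?case using clinear_0[OF clinear_proj] by (simp add: zero_prod_def)
  next
    case (step c x y)
    then obtain u v where "x = br u v" by blast
    then have "proj 0 (x, 0) = 0" using proj_bc[of "(u, 0)" "(v, 0)"] by (simp add: cbil_real[OF bilinear_br])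
    moreover have eq: "(c *\<^sub>R x + y, 0::'a) = c *\<^sub>R (x, 0) + (y, 0)" by simp
    ultimately show ?case
      using step(2) unfolding eq clinear_add[OF clinear_proj] clinear_scaleR[OF clinear_proj] by (simp add: zero_fun_def)
  qed
  then have proj0: "proj 0 X = 0" for X
    using clinear_eqI[OF clinear_proj, of "\<lambda>_. 0" 0 X] by (simp add: clinear_def)
  have h0: "H = 0" if "H \<in> h" for H using proj_same[of H 0] that rs_0 cdual_0 proj0[of H] by simp
  \<comment> \<open>Once \<open>h\<close> is zero everything centralizes it, so maximality of
    \<open>h\<close> forces the whole algebra into \<open>h\<close>.\<close>
  have mem: "X \<in> h" for X
  proof (rule h_maximal)
    fix H assume "H \<in> h"
    then have "H = 0" by (rule h0)
    then show "bc H X = 0" by (simp add: bc_simps)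
  qed
  have "X = 0" for X :: "'a \<times> 'a" by (rule h0[OF mem])
  from this[of "(br u v, 0)"] show False using \<open>br u v \<noteq> 0\<close> by (simp add: zero_prod_def)
qed

lemma killing_nondegenerate: assumes "\<And>y. killing br x y = 0" shows "x = 0"
proof -
  let ?I = "{x. \<forall>y. killing br x y = 0}"
  have "subspace ?I" using killing_add(1) killing_scaleR(1) by (auto simp: subspace_def bilinear_lzero[OF bilinear_killing])
  moreover have "br x y \<in> ?I" if "y \<in> ?I" for x y
    using that br_antisym[of x y] by (simp add: bilinear_lneg[OF bilinear_killing] killing_invariant)
  ultimately have "?I = {0} \<or> ?I = UNIV" using simple by (simp add: simple_lie_algebra_def)
  moreover have "?I \<noteq> UNIV" using killing_nonzero by blast
  ultimately show ?thesis using assms by blast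
qed

lemma \<kappa>_nondegenerate: assumes "\<And>Y. \<kappa> X Y = 0" shows "X = 0"
proof -
  have *: "killing br (fst X) y = 0" "killing br (snd X) y = 0" for y
    using assms[of "(y, 0)"]
    by (simp_all add: ckilling_def cbil_def complex_eq_iff bilinear_rzero[OF bilinear_killing])
  have "fst X = 0" "snd X = 0" by (rule killing_nondegenerate, rule *)+
  then show ?thesis by (simp add: prod_eq_iff)
qed

end

section \<open>Duality under the Killing form and one-dimensionality of the root spaces\<close>

context cartan_lie begin

lemma \<kappa>_proj_orth: assumes "\<beta> \<noteq> - \<alpha>" shows "\<kappa> (proj \<alpha> X) (proj \<beta> Y) = 0"
proof (cases "\<alpha> \<in> Wt \<and> \<beta> \<in> Wt")
  case True
  then have cd: "\<alpha> + \<beta> \<in> cdual h" using Wt_cdual cdual_add by blast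
  have "\<exists>H\<in>h. \<alpha> H + \<beta> H \<noteq> 0"
  proof (rule ccontr)
    assume "\<not> ?thesis"
    then have "\<alpha> + \<beta> = 0" by (intro cdual_eqI[OF cd cdual_0]) simp
    then show False using assms by (simp add: add_eq_0_iff)
  qed
  then obtain H where H: "H \<in> h" "\<alpha> H + \<beta> H \<noteq> 0" by blast
  have "\<kappa> (bc H (proj \<alpha> X)) (proj \<beta> Y) = - \<kappa> (proj \<alpha> X) (bc H (proj \<beta> Y))"
    using \<kappa>_invariant[of "proj \<alpha> X" H "proj \<beta> Y"] bc_antisym[of H "proj \<alpha> X"] by (simp add: \<kappa>_minus)
  then have "(\<alpha> H + \<beta> H) * \<kappa> (proj \<alpha> X) (proj \<beta> Y) = 0"
    by (simp add: rs_bc[OF proj_rs H(1)] \<kappa>_cscale distrib_right)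
  then show ?thesis using H(2) by simp
qed (auto simp: proj_notin \<kappa>_0)

text \<open>The Killing adjoint of a weight projection is the projection to the opposite weight;
  this lets projections be moved between the two factors of a pair of dual bases.\<close>

lemma \<kappa>_proj: "\<kappa> (proj \<alpha> X) Y = \<kappa> X (proj (- \<alpha>) Y)"
proof -
  have "\<kappa> (proj \<alpha> X) Y = (\<Sum>\<beta>\<in>Wt. \<kappa> (proj \<alpha> X) (proj \<beta> Y))"
    unfolding \<kappa>_sum(2)[symmetric] sum_proj ..
  also have "\<dots> = (\<Sum>\<beta>\<in>Wt. if \<beta> = - \<alpha> then \<kappa> (proj \<alpha> X) (proj (- \<alpha>) Y) else 0)"
    by (intro sum.cong) (auto simp: \<kappa>_proj_orth)
  also have "\<dots> = \<kappa> (proj \<alpha> X) (proj (- \<alpha>) Y)"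
    using finite_Wt proj_notin[of "- \<alpha>" Y] by (auto simp: \<kappa>_0)
  also have "\<dots> = (\<Sum>\<beta>\<in>Wt. if \<beta> = \<alpha> then \<kappa> (proj \<alpha> X) (proj (- \<alpha>) Y) else 0)"
    using finite_Wt proj_notin[of \<alpha> X] by (auto simp: \<kappa>_0)
  also have "\<dots> = (\<Sum>\<beta>\<in>Wt. \<kappa> (proj \<beta> X) (proj (- \<alpha>) Y))"
    by (intro sum.cong) (auto simp: \<kappa>_proj_orth)
  also have "\<dots> = \<kappa> X (proj (- \<alpha>) Y)" unfolding \<kappa>_sum(1)[symmetric] sum_proj ..
  finally show ?thesis .
qed

lemma opposite_vector:
  assumes "X \<in> rs \<alpha>" "X \<noteq> 0" "\<alpha> \<in> cdual h"
  shows "\<exists>Y\<in>rs (- \<alpha>). \<kappa> X Y \<noteq> 0"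
proof -
  obtain Y where "\<kappa> X Y \<noteq> 0" using \<kappa>_nondegenerate assms(2) by blast
  then have "\<kappa> X (proj (- \<alpha>) Y) \<noteq> 0" using \<kappa>_proj[of \<alpha> X Y] proj_same[OF assms(1,3)] by simp
  then show ?thesis using proj_rs by blast
qed

lemma Wt_minus: assumes "\<alpha> \<in> Wt" shows "- \<alpha> \<in> Wt"
proof -
  obtain X where X: "X \<in> rs \<alpha>" "X \<noteq> 0" using assms csubspaceD(2)[OF subspace_rs] by (auto simp: Wt_def)
  obtain Y where "Y \<in> rs (- \<alpha>)" "\<kappa> X Y \<noteq> 0" using opposite_vector[OF X Wt_cdual[OF assms]] by blast
  then show ?thesis using in_WtI[of Y "- \<alpha>"] cdual_minus[OF Wt_cdual[OF assms]] \<kappa>_0 by metis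
qed

lemma killing_repr:
  assumes "linear f" shows "\<exists>x. \<forall>y. killing br x y = f y"
proof -
  define \<phi> where "\<phi> x = (\<Sum>b\<in>Basis. killing br x b *\<^sub>R b)" for x
  have lin: "linear (killing br x)" for x using bilinear_killing by (simp add: bilinear_def)
  have \<phi>: "\<phi> x \<bullet> y = killing br x y" for x y
  proof -
    have "\<phi> x \<bullet> y = (\<Sum>b\<in>Basis. killing br x ((b \<bullet> y) *\<^sub>R b))"
      by (simp add: \<phi>_def inner_sum_left killing_scaleR mult.commute)
    also have "\<dots> = killing br x y"
      unfolding linear_sum[OF lin, symmetric] inner_commute[of _ y] euclidean_representation ..
    finally show ?thesis .
  qed
  have "linear \<phi>" unfolding \<phi>_def linear_iff
    by (simp add: killing_add killing_scaleR scaleR_add_left sum.distrib scaleR_sum_right)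
  moreover have "x = 0" if x: "\<phi> x = 0" for x
  proof (rule killing_nondegenerate)
    show "killing br x y = 0" for y using \<phi>[of x y] x by simp
  qed
  ultimately have "surj \<phi>" by (intro linear_injective_imp_surjective) (auto simp: linear_injective_0)
  then obtain x where x: "\<phi> x = (\<Sum>b\<in>Basis. f b *\<^sub>R b)" by (metis surjD)
  have "killing br x y = f y" for y
  proof -
    have "killing br x y = (\<Sum>b\<in>Basis. f b *\<^sub>R b) \<bullet> y" by (simp add: x flip: \<phi>)
    also have "\<dots> = f (\<Sum>b\<in>Basis. (b \<bullet> y) *\<^sub>R b)"
      by (simp add: inner_sum_left linear_sum[OF assms] linear_scale[OF assms] mult.commute)
    finally show ?thesis unfolding inner_commute[of _ y] euclidean_representation .
  qed
  then show ?thesis by blast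
qed

text \<open>The elements \<open>killing_dual b\<close>, for \<open>b\<close> in
  \<open>Basis\<close>, form the basis dual to \<open>Basis\<close> under the Killing form.\<close>

definition killing_dual :: "'a \<Rightarrow> 'a" where "killing_dual b = (SOME x. \<forall>y. killing br x y = b \<bullet> y)"

lemma killing_killing_dual: "killing br (killing_dual b) y = b \<bullet> y"
  using someI_ex[OF killing_repr[of "\<lambda>y. b \<bullet> y"]]
  by (simp add: killing_dual_def linear_iff inner_add_right)

lemma \<kappa>_killing_dual: "\<kappa> (killing_dual b, 0) X = coord b X"
  by (simp add: ckilling_def cbil_def killing_killing_dual coord_def bilinear_lzero[OF bilinear_killing] inner_commute[of b])

lemma killing_dual_expand: "(\<Sum>b\<in>Basis. cscale (\<kappa> X (b, 0)) (killing_dual b, 0)) = X"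
proof -
  have "\<kappa> ((\<Sum>b\<in>Basis. cscale (\<kappa> X (b, 0)) (killing_dual b, 0)) - X) Y = 0" for Y
  proof -
    have "\<kappa> (\<Sum>b\<in>Basis. cscale (\<kappa> X (b, 0)) (killing_dual b, 0)) Y = (\<Sum>b\<in>Basis. \<kappa> X (cscale (coord b Y) (b, 0)))"
      by (simp add: \<kappa>_sum \<kappa>_cscale \<kappa>_killing_dual mult.commute)
    also have "\<dots> = \<kappa> X Y" unfolding \<kappa>_sum(2)[symmetric] coord_expand ..
    finally show ?thesis using \<kappa>_add(1)[of _ "- X" Y] by (simp add: \<kappa>_minus)
  qed
  from \<kappa>_nondegenerate[OF this] show ?thesis by simp
qed

text \<open>Transposition with respect to a form that need not be definite: both traces are written
  in the pair of dual bases, whose transition matrix \<open>killing_dual b \<bullet> c\<close> is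
  symmetric.\<close>

lemma trace_adjoint:
  assumes M: "linear M" and adj: "\<And>x y. killing br (L x) y = killing br x (M y)"
  shows "trace_of L = trace_of M"
proof -
  have sym: "killing_dual b \<bullet> c = killing_dual c \<bullet> b" for b c
    using killing_killing_dual[of c "killing_dual b"] killing_killing_dual[of b "killing_dual c"] killing_sym[of "killing_dual b" "killing_dual c"] by (simp add: inner_commute)
  have lin: "linear (killing br x)" "linear (\<lambda>x. killing br x y)" for x y
    using bilinear_killing by (simp_all add: bilinear_def)
  have "trace_of L = (\<Sum>b\<in>Basis. killing br b (M (killing_dual b)))"
    unfolding trace_of_def
  proof (intro sum.cong refl)
    fix b
    have "L b \<bullet> b = killing br (killing_dual b) (L b)" by (simp add: killing_killing_dual inner_commute)
    then show "L b \<bullet> b = killing br b (M (killing_dual b))" by (simp add: killing_sym[of "killing_dual b"] adj)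
  qed
  also have "\<dots> = (\<Sum>b\<in>Basis. killing br b (M (\<Sum>c\<in>Basis. (killing_dual b \<bullet> c) *\<^sub>R c)))"
    by (simp only: euclidean_representation)
  also have "\<dots> = (\<Sum>b\<in>Basis. \<Sum>c\<in>Basis. (killing_dual b \<bullet> c) * killing br b (M c))"
    by (simp add: linear_sum[OF M] linear_scale[OF M] linear_sum[OF lin(1)] killing_scaleR)
  also have "\<dots> = (\<Sum>c\<in>Basis. \<Sum>b\<in>Basis. (killing_dual c \<bullet> b) * killing br b (M c))"
    by (subst sum.swap) (simp add: sym)
  also have "\<dots> = (\<Sum>c\<in>Basis. killing br (\<Sum>b\<in>Basis. (killing_dual c \<bullet> b) *\<^sub>R b) (M c))"
    by (simp add: linear_sum[OF lin(2)] killing_scaleR)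
  also have "\<dots> = (\<Sum>c\<in>Basis. killing br (killing_dual c) (M c))" by (simp only: euclidean_representation)
  also have "\<dots> = trace_of M" by (simp add: trace_of_def killing_killing_dual inner_commute)
  finally show ?thesis .
qed

lemma \<kappa>_bracket: 
  assumes "f \<in> rs (- \<alpha>)" "H' \<in> h"
  shows "\<kappa> (bc e f) H' = \<alpha> H' * \<kappa> e f"
proof -
  have "bc f H' = cscale (\<alpha> H') f" 
    using bc_antisym[of f H'] rs_bc[OF assms] C.scale_minus_left[of "\<alpha> H'" f] by simp
  then show ?thesis by (simp add: \<kappa>_invariant \<kappa>_cscale)
qed

lemma opposite_triple:
  assumes "\<alpha> \<in> Wt" "\<alpha> \<noteq> 0"
  shows "\<exists>e\<in>rs \<alpha>. \<exists>f\<in>rs (- \<alpha>). \<kappa> e f \<noteq> 0 \<and> \<alpha> (bc e f) \<noteq> 0"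
proof -
  obtain e where e: "e \<in> rs \<alpha>" "e \<noteq> 0" using assms csubspaceD(2)[OF subspace_rs] by (auto simp: Wt_def)
  obtain f where f: "f \<in> rs (- \<alpha>)" "\<kappa> e f \<noteq> 0" using opposite_vector[OF e Wt_cdual[OF assms(1)]] by blast
  have "\<exists>H\<in>h. \<alpha> H \<noteq> 0"
    using cdual_eqI[OF Wt_cdual[OF assms(1)] cdual_0] assms(2) by auto
  then obtain H where H: "H \<in> h" "\<alpha> H \<noteq> 0" by blast
  have "\<kappa> (bc e f) H \<noteq> 0" using \<kappa>_bracket[OF f(1) H(1)] H(2) f(2) by simp
  then have "bc e f \<noteq> 0" using \<kappa>_0 by metis
  then have "\<alpha> (bc e f) \<noteq> 0" using bracket_opposite_eq_0[OF e(1) f(1) Wt_cdual[OF assms(1)]] by blast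
  then show ?thesis using e f by blast
qed

text \<open>The trace of \<open>[e, f]\<close> on the invariant subspace \<open>\<complex>f \<oplus> h \<oplus> \<gg>\<^sub>\<alpha> \<oplus> \<gg>\<^sub>2\<^sub>\<alpha> \<oplus> \<dots>\<close> vanishes.\<close>

lemma root_mult_eq_1:
  assumes "\<alpha> \<in> Wt" "\<alpha> \<noteq> 0"
  shows "root_mult \<alpha> = 1"
proof -
  obtain e f where e: "e \<in> rs \<alpha>" and f: "f \<in> rs (- \<alpha>)" and ef: "\<kappa> e f \<noteq> 0" "\<alpha> (bc e f) \<noteq> 0"
    using opposite_triple[OF assms] by blast
  define H where "H = bc e f"
  have H: "H \<in> h" using bc_rs[OF e f] rs_0 by (simp add: H_def)
  have \<alpha>H: "\<alpha> H \<noteq> 0" using ef(2) by (simp add: H_def)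
  have \<alpha>: "\<alpha> \<in> cdual h" "- \<alpha> \<in> cdual h" using Wt_cdual cdual_minus assms by blast+
  define ml where "ml j = (\<lambda>H. of_nat j * \<alpha> H)" for j :: nat
  have ml_cdual: "ml j \<in> cdual h" for j using cdual_cmul[OF \<alpha>(1)] by (simp add: ml_def)
  have ml_H: "ml j H = of_nat j * \<alpha> H" for j by (simp add: ml_def)
  have ml_inj: "i = j" if eq: "ml i = ml j" for i j
  proof -
    from fun_cong[OF eq, of H] have "of_nat i * \<alpha> H = of_nat j * \<alpha> H" by (simp only: ml_H)
    then show ?thesis using \<alpha>H by simp
  qed
  have ml_minus: "ml j \<noteq> - \<alpha>" for j
  proof
    assume "ml j = - \<alpha>"
    from fun_cong[OF this, of H] have "(of_nat j + 1) * \<alpha> H = 0" by (simp add: ml_H algebra_simps)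
    then show False using \<alpha>H of_nat_eq_0_iff[of "Suc j", where 'a=complex] by (simp add: add.commute)
  qed
  define S where "S = {\<gamma>\<in>Wt. \<exists>j. \<gamma> = ml j}"
  have fin: "finite S" using finite_Wt by (simp add: S_def)
  \<comment> \<open>Projection onto the line of the single vector \<open>f\<close>, not onto all of
    \<open>rs (- \<alpha>)\<close>, whose dimension is still unknown. Its functional \<kappa>(e, X)
    / \<kappa>(e, f) vanishes on the weight spaces indexed by \<open>S\<close>.\<close>
  define Pf where "Pf X = cscale (\<kappa> e X / \<kappa> e f) f" for X
  define P where "P X = Pf X + (\<Sum>\<gamma>\<in>S. proj \<gamma> X)" for X
  have cP: "clinear P"
    unfolding P_def Pf_def
    by (intro clinear_add_fun clinear_sum_fun clinear_proj clinear_cscale_functional)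
      (simp_all add: \<kappa>_add \<kappa>_cscale add_divide_distrib)
  have P_ml: "P Y = Y" if Y: "Y \<in> rs (ml j)" for Y j
  proof -
    have "\<kappa> (proj \<alpha> e) (proj (ml j) Y) = 0" by (rule \<kappa>_proj_orth[OF ml_minus])
    then have "Pf Y = 0" using proj_same[OF e \<alpha>(1)] proj_same[OF Y ml_cdual] by (simp add: Pf_def)
    moreover have "(\<Sum>\<gamma>\<in>S. proj \<gamma> Y) = (\<Sum>\<gamma>\<in>S. if \<gamma> = ml j then Y else 0)"
      using proj_same[OF Y ml_cdual] proj_other[OF Y ml_cdual] by (intro sum.cong) auto
    moreover have "\<dots> = Y" using fin in_WtI[OF Y _ ml_cdual] by (auto simp: S_def)
    ultimately show ?thesis by (simp add: P_def)
  qed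
  have P_f: "P (cscale c f) = cscale c f" for c
  proof -
    have "proj \<gamma> f = 0" if "\<gamma> \<in> S" for \<gamma>
      using that ml_minus proj_other[OF f \<alpha>(2), of \<gamma>] by (auto simp: S_def)
    then have "P f = f" using ef(1) by (simp add: P_def Pf_def)
    then show ?thesis by (simp add: clinear_cscale[OF cP])
  qed
  have e_inv: "P (bc e (P X)) = bc e (P X)" for X
  proof -
    have "P (bc e (proj \<gamma> X)) = bc e (proj \<gamma> X)" if \<gamma>: "\<gamma> \<in> S" for \<gamma>
    proof -
      obtain j where j: "\<gamma> = ml j" using \<gamma> by (auto simp: S_def)
      have "bc e (proj \<gamma> X) \<in> rs (\<alpha> + ml j)" using bc_rs[OF e proj_rs, of \<gamma> X] j by simp
      also have "\<alpha> + ml j = ml (Suc j)" by (simp add: ml_def fun_eq_iff algebra_simps)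
      finally show ?thesis by (rule P_ml)
    qed
    moreover have "P (bc e (Pf X)) = bc e (Pf X)"
    proof -
      have "H \<in> rs (ml 0)" using H rs_0 by (simp add: ml_def zero_fun_def)
      then show ?thesis using P_ml[of H 0] by (simp add: Pf_def bc_simps clinear_cscale[OF cP] H_def)
    qed
    ultimately show ?thesis
      by (simp add: P_def[of X] bc_simps clinear_sum[OF clinear_bc] clinear_add[OF cP] clinear_sum[OF cP])
  qed
  have f_inv: "P (bc f (P X)) = bc f (P X)" for X
  proof -
    have "P (bc f (proj \<gamma> X)) = bc f (proj \<gamma> X)" if \<gamma>: "\<gamma> \<in> S" for \<gamma>
    proof -
      obtain j where j: "\<gamma> = ml j" using \<gamma> by (auto simp: S_def)
      show ?thesis
      proof (cases j)
        \<comment> \<open>On \<open>h\<close> the operator ad f takes values in the line of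
          \<open>f\<close> itself, so the chosen line is enough for invariance.\<close>
        case 0
        then have "proj \<gamma> X \<in> h" using proj_rs[of \<gamma> X] rs_0 j by (simp add: ml_def zero_fun_def)
        then have "bc f (proj \<gamma> X) = cscale (\<alpha> (proj \<gamma> X)) f"
          using bc_antisym[of f "proj \<gamma> X"] rs_bc[OF f] by (simp add: C.scale_minus_left)
        then show ?thesis by (simp add: P_f)
      next
        case (Suc i)
        have "bc f (proj \<gamma> X) \<in> rs (- \<alpha> + ml j)" using bc_rs[OF f proj_rs, of \<gamma> X] j by simp
        also have "- \<alpha> + ml j = ml i" by (simp add: Suc ml_def fun_eq_iff algebra_simps)
        finally show ?thesis by (rule P_ml)
      qed
    qed
    moreover have "bc f (Pf X) = 0"
    proof -
      have "bc f f = 0"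
        using br_antisym[of "fst f" "snd f"] by (simp add: cbil_def br_self prod_eq_iff)
      then show ?thesis by (simp add: Pf_def bc_simps)
    qed
    ultimately show ?thesis
      by (simp add: P_def[of X] bc_simps clinear_sum[OF clinear_bc] clinear_0[OF cP] clinear_sum[OF cP])
  qed
  have "ctrace (\<lambda>X. bc e (bc f (P X)) - bc f (bc e (P X))) = 0"
    by (intro ctrace_commutator_invariant clinear_bc cP e_inv f_inv)
  then have "0 = ctrace (\<lambda>X. bc H (P X))" by (simp add: H_def bc_bc)
  also have "\<dots> = ctrace (\<lambda>X. cscale (\<kappa> e X / \<kappa> e f) (cscale (- \<alpha> H) f)) + (\<Sum>\<gamma>\<in>S. \<gamma> H * root_mult \<gamma>)"
  proof -
    have "bc H (P X) = cscale (\<kappa> e X / \<kappa> e f) (cscale (- \<alpha> H) f) + (\<Sum>\<gamma>\<in>S. bc H (proj \<gamma> X))" for X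
      using rs_bc[OF f H] by (simp add: P_def Pf_def bc_simps clinear_sum[OF clinear_bc])
    then show ?thesis by (simp only: ctrace_add ctrace_sum ctrace_bc_proj[OF H])
  qed
  also have "ctrace (\<lambda>X. cscale (\<kappa> e X / \<kappa> e f) (cscale (- \<alpha> H) f)) = - \<alpha> H"
    by (subst ctrace_rank_one) (use ef(1) in \<open>simp_all add: \<kappa>_add \<kappa>_cscale \<kappa>_minus add_divide_distrib\<close>)
  finally have sum: "(\<Sum>\<gamma>\<in>S. \<gamma> H * root_mult \<gamma>) = \<alpha> H" by simp
  obtain n :: "_ \<Rightarrow> nat" where n: "\<And>\<gamma>. root_mult \<gamma> = of_nat (n \<gamma>)" "\<And>\<gamma>. \<gamma> \<in> Wt \<Longrightarrow> n \<gamma> > 0"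
    using root_mult_nat_choice by blast
  have "\<forall>\<gamma>\<in>S. \<exists>j. \<gamma> = ml j" by (simp add: S_def)
  from bchoice[OF this] obtain j where j: "\<forall>\<gamma>\<in>S. \<gamma> = ml (j \<gamma>)" ..
  have \<alpha>ml: "\<alpha> = ml 1" by (simp add: ml_def)
  then have \<alpha>S: "\<alpha> \<in> S" using assms(1) by (auto simp: S_def)
  then have j\<alpha>: "j \<alpha> = 1" using bspec[OF j \<alpha>S] \<alpha>ml ml_inj[of 1 "j \<alpha>"] by simp
  have "(\<Sum>\<gamma>\<in>S. \<gamma> H * root_mult \<gamma>) = (\<Sum>\<gamma>\<in>S. of_nat (j \<gamma> * n \<gamma>) * \<alpha> H)"
  proof (intro sum.cong refl)
    fix \<gamma> assume "\<gamma> \<in> S"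
    from fun_cong[OF bspec[OF j this], of H] have "\<gamma> H = of_nat (j \<gamma>) * \<alpha> H" by (simp only: ml_H)
    then show "\<gamma> H * root_mult \<gamma> = of_nat (j \<gamma> * n \<gamma>) * \<alpha> H" by (simp add: n(1))
  qed
  also have "\<dots> = of_nat (\<Sum>\<gamma>\<in>S. j \<gamma> * n \<gamma>) * \<alpha> H" by (simp add: sum_distrib_right)
  \<comment> \<open>After cancelling \<alpha>(H) the trace identity reads: the sum of j times the
    dimension of the weight space j \<alpha>, over natural numbers j, is 1. The term j = 1 is at
    least 1 already.\<close>
  finally have "of_nat (\<Sum>\<gamma>\<in>S. j \<gamma> * n \<gamma>) = (of_nat 1 :: complex)" using \<alpha>H unfolding sum by simp
  then have one: "(\<Sum>\<gamma>\<in>S. j \<gamma> * n \<gamma>) = 1" by (simp only: of_nat_eq_iff)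
  have "j \<alpha> * n \<alpha> \<le> (\<Sum>\<gamma>\<in>S. j \<gamma> * n \<gamma>)" by (rule member_le_sum[OF \<alpha>S _ fin]) simp
  then have "n \<alpha> = 1" using one j\<alpha> n(2)[OF assms(1)] by simp
  then show ?thesis by (simp add: n(1))
qed

text \<open>The functional is extended to the whole algebra through the projection to
  \<open>h\<close> and represented by the Killing form; the component in \<open>h\<close> of the
  representative is the solution. It is unique because \<open>h\<close> is orthogonal to the other
  weight spaces.\<close>

lemma weight_dual_ex1:
  assumes \<mu>: "\<mu> \<in> cdual h"
  shows "\<exists>!T. T \<in> h \<and> (\<forall>H\<in>h. \<kappa> T H = \<mu> H)"
proof -
  define f where "f X = \<mu> (proj 0 X)" for X
  have p0: "proj 0 X \<in> h" for X using proj_rs[of 0 X] rs_0 by simp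
  have f: "f (X + Y) = f X + f Y" "f (cscale c X) = c * f X" for X Y c
    using \<mu> p0 by (simp_all add: f_def clinear_add[OF clinear_proj] clinear_cscale[OF clinear_proj] cdual_def)
  have fsum: "f (\<Sum>i\<in>I. F i) = (\<Sum>i\<in>I. f (F i))" for I :: "'a set" and F
    using f(2)[of 0 0] by (induction I rule: infinite_finite_induct) (simp_all add: f)
  define T where "T = (\<Sum>b\<in>Basis. cscale (f (b, 0)) (killing_dual b, 0))"
  have T: "\<kappa> T X = f X" for X
  proof -
    have "\<kappa> T X = (\<Sum>b\<in>Basis. f (cscale (coord b X) (b, 0)))"
      by (simp add: T_def \<kappa>_sum \<kappa>_cscale \<kappa>_killing_dual f(2) mult.commute)
    also have "\<dots> = f X" unfolding fsum[symmetric] coord_expand ..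
    finally show ?thesis .
  qed
  have "\<kappa> (proj 0 T) H = \<mu> H" if "H \<in> h" for H
    using that proj_same[of H 0] rs_0 cdual_0 by (simp add: \<kappa>_proj T f_def)
  moreover have "T1 = T2" if T12: "T1 \<in> h" "T2 \<in> h" "\<forall>H\<in>h. \<kappa> T1 H = \<kappa> T2 H" for T1 T2
  proof -
    have "T1 - T2 \<in> h" using csubspaceD(4)[OF csubspace_h] T12 by blast
    then have p: "proj 0 (T1 - T2) = T1 - T2" using proj_same rs_0 cdual_0 by simp
    have "\<kappa> (T1 - T2) Y = 0" for Y
    proof -
      have "\<kappa> (T1 - T2) Y = \<kappa> (T1 - T2) (proj 0 Y)" using \<kappa>_proj[of 0 "T1 - T2" Y] p by simp
      also have "\<dots> = 0" using T12(3) p0[of Y] \<kappa>_add(1)[of T1 "- T2" "proj 0 Y"] by (simp add: \<kappa>_minus)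
      finally show ?thesis .
    qed
    from \<kappa>_nondegenerate[OF this] show ?thesis by simp
  qed
  ultimately show ?thesis using p0 by metis
qed

lemma weight_dual_h: "\<mu> \<in> cdual h \<Longrightarrow> weight_dual br h \<mu> \<in> h"
  and \<kappa>_weight_dual: "\<mu> \<in> cdual h \<Longrightarrow> H \<in> h \<Longrightarrow> \<kappa> (weight_dual br h \<mu>) H = \<mu> H"
  using theI'[OF weight_dual_ex1, of \<mu>] by (simp_all add: weight_dual_def)

lemma weight_inner_eq:
  "\<mu> \<in> cdual h \<Longrightarrow> \<nu> \<in> cdual h \<Longrightarrow> weight_inner br h \<mu> \<nu> = Re (\<nu> (weight_dual br h \<mu>))"
  by (simp add: weight_inner_def \<kappa>_weight_dual weight_dual_h \<kappa>_sym[of "weight_dual br h \<mu>"])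

end

section \<open>The grading element\<close>

lemma trace_of_commute:
  fixes f g :: "'x::euclidean_space \<Rightarrow> 'x"
  assumes "linear f" "linear g"
  shows "trace_of (\<lambda>x. f (g x)) = trace_of (\<lambda>x. g (f x))"
proof -
  have *: "f (g b) \<bullet> b = (\<Sum>c\<in>Basis. (g b \<bullet> c) * (f c \<bullet> b))" if "linear f" for f g :: "'x \<Rightarrow> 'x" and b
  proof -
    have "f (g b) = f (\<Sum>c\<in>Basis. (g b \<bullet> c) *\<^sub>R c)" by (simp only: euclidean_representation)
    then show ?thesis by (simp add: linear_sum[OF that] linear_scale[OF that] inner_sum_left)
  qed
  show ?thesis
    unfolding trace_of_def
    by (simp only: *[OF assms(1), of g] *[OF assms(2), of f]) (subst sum.swap, simp only: mult.commute)
qed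

lemma trace_of_diff: "trace_of (\<lambda>x. f x - g x) = trace_of f - trace_of g"
  by (simp add: trace_of_def inner_diff_left sum_subtractf)

locale graded_cartan = cartan_lie br h for br :: "'a::euclidean_space \<Rightarrow> 'a \<Rightarrow> 'a" and h +
  fixes gr :: "int \<Rightarrow> 'a set" and \<Phi> :: "('a \<times> 'a \<Rightarrow> complex) set"
  assumes grading: "one_grading br gr" and h_gr0: "h \<subseteq> gr 0 \<times> gr 0"
    and positive: "positive_system br h \<Phi>"
    and positive_gr1: "\<And>\<alpha>. \<alpha> \<in> roots br h \<Longrightarrow> root_space br h \<alpha> \<subseteq> gr 1 \<times> gr 1 \<Longrightarrow> \<alpha> \<in> \<Phi>"
begin

lemma subspace_gr: "subspace (gr i)" and gr_trivial: "i \<notin> {-1, 0, 1} \<Longrightarrow> gr i = {0}"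
  and gr_minus1: "gr (- 1) \<noteq> {0}"
  and gr_ex1: "\<exists>!t. t \<in> gr (-1) \<times> gr 0 \<times> gr 1 \<and> x = fst t + fst (snd t) + snd (snd t)"
  and br_gr: "x \<in> gr i \<Longrightarrow> y \<in> gr j \<Longrightarrow> br x y \<in> gr (i + j)"
proof -
  note g = grading[unfolded one_grading_def]
  show "subspace (gr i)" using g by blast
  show "i \<notin> {-1, 0, 1} \<Longrightarrow> gr i = {0}" using g by (elim conjE) (erule allE, erule mp)
  show "gr (- 1) \<noteq> {0}" using g by (elim conjE)
  show "\<exists>!t. t \<in> gr (-1) \<times> gr 0 \<times> gr 1 \<and> x = fst t + fst (snd t) + snd (snd t)"
    using g by (elim conjE) (erule allE)
  show "x \<in> gr i \<Longrightarrow> y \<in> gr j \<Longrightarrow> br x y \<in> gr (i + j)" using g by blast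
qed

definition gt :: "'a \<Rightarrow> 'a \<times> 'a \<times> 'a" where
  "gt x = (THE t. t \<in> gr (-1) \<times> gr 0 \<times> gr 1 \<and> x = fst t + fst (snd t) + snd (snd t))"

definition grade_proj :: "int \<Rightarrow> 'a \<Rightarrow> 'a" where
  "grade_proj i x = (if i = -1 then fst (gt x) else if i = 0 then fst (snd (gt x)) else if i = 1 then snd (snd (gt x)) else 0)"

lemma gt: "gt x \<in> gr (-1) \<times> gr 0 \<times> gr 1" "x = fst (gt x) + fst (snd (gt x)) + snd (snd (gt x))"
  using theI'[OF gr_ex1, of x] unfolding gt_def by blast+

lemma grade_proj_gr: "grade_proj i x \<in> gr i"
  using gt(1)[of x] subspace_0[OF subspace_gr] by (simp add: grade_proj_def mem_Times_iff)

lemma grade_proj_sum: "grade_proj (-1) x + grade_proj 0 x + grade_proj 1 x = x"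
  using gt(2)[of x, symmetric] by (simp add: grade_proj_def)

lemma grade_proj_out: "i \<notin> {-1, 0, 1} \<Longrightarrow> grade_proj i x = 0" by (simp add: grade_proj_def)

lemma grade_proj_unique:
  assumes "a \<in> gr (-1)" "b \<in> gr 0" "c \<in> gr 1" "x = a + b + c"
  shows "grade_proj (-1) x = a" "grade_proj 0 x = b" "grade_proj 1 x = c"
proof -
  have "(a, b, c) \<in> gr (-1) \<times> gr 0 \<times> gr 1 \<and> x = fst (a, b, c) + fst (snd (a, b, c)) + snd (snd (a, b, c))"
    using assms by simp
  from the1_equality[OF gr_ex1 this] have eq: "gt x = (a, b, c)" by (simp only: gt_def)
  show "grade_proj (-1) x = a" unfolding grade_proj_def eq by simp
  show "grade_proj 0 x = b" unfolding grade_proj_def eq by simp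
  show "grade_proj 1 x = c" unfolding grade_proj_def eq by simp
qed

lemma linear_grade_proj: "linear (grade_proj i)"
proof -
  have "grade_proj i (x + y) = grade_proj i x + grade_proj i y" for x y
  proof -
    have "(grade_proj (-1) x + grade_proj 0 x + grade_proj 1 x) + (grade_proj (-1) y + grade_proj 0 y + grade_proj 1 y)
      = (grade_proj (-1) x + grade_proj (-1) y) + (grade_proj 0 x + grade_proj 0 y) + (grade_proj 1 x + grade_proj 1 y)" by simp
    then have "x + y = (grade_proj (-1) x + grade_proj (-1) y) + (grade_proj 0 x + grade_proj 0 y) + (grade_proj 1 x + grade_proj 1 y)"
      unfolding grade_proj_sum .
    note u = grade_proj_unique[OF subspace_add[OF subspace_gr grade_proj_gr grade_proj_gr] subspace_add[OF subspace_gr grade_proj_gr grade_proj_gr]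
        subspace_add[OF subspace_gr grade_proj_gr grade_proj_gr] this]
    consider "i = -1" | "i = 0" | "i = 1" | "i \<notin> {-1, 0, 1}" by blast
    then show ?thesis by cases (use u grade_proj_out in simp_all)
  qed
  moreover have "grade_proj i (c *\<^sub>R x) = c *\<^sub>R grade_proj i x" for c x
  proof -
    have "c *\<^sub>R (grade_proj (-1) x + grade_proj 0 x + grade_proj 1 x) = c *\<^sub>R grade_proj (-1) x + c *\<^sub>R grade_proj 0 x + c *\<^sub>R grade_proj 1 x"
      by (simp add: scaleR_add_right)
    then have "c *\<^sub>R x = c *\<^sub>R grade_proj (-1) x + c *\<^sub>R grade_proj 0 x + c *\<^sub>R grade_proj 1 x"
      unfolding grade_proj_sum .
    note u = grade_proj_unique[OF subspace_scale[OF subspace_gr grade_proj_gr] subspace_scale[OF subspace_gr grade_proj_gr]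
        subspace_scale[OF subspace_gr grade_proj_gr] this]
    consider "i = -1" | "i = 0" | "i = 1" | "i \<notin> {-1, 0, 1}" by blast
    then show ?thesis by cases (use u grade_proj_out in simp_all)
  qed
  ultimately show ?thesis by (simp add: linear_iff)
qed

lemma grade_proj_eq: assumes x: "x \<in> gr i" shows "grade_proj j x = (if j = i then x else 0)"
proof -
  have 0: "0 \<in> gr i" for i using subspace_0[OF subspace_gr] .
  consider "j \<notin> {-1, 0, 1}" | "i \<notin> {-1, 0, 1}" | "i = -1" "j \<in> {-1, 0, 1}" | "i = 0" "j \<in> {-1, 0, 1}" | "i = 1" "j \<in> {-1, 0, 1}"
    by blast
  then show ?thesis
  proof cases
    case 1
    then show ?thesis using grade_proj_out[of j x] gr_trivial[of j] x by auto
  next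
    case 2
    then show ?thesis using gr_trivial[of i] x linear_0[OF linear_grade_proj, of j] by simp
  next
    case 3
    then show ?thesis using grade_proj_unique[of x 0 0 x] x 0 by auto
  next
    case 4
    then show ?thesis using grade_proj_unique[of 0 x 0 x] x 0 by auto
  next
    case 5
    then show ?thesis using grade_proj_unique[of 0 0 x x] x 0 by auto
  qed
qed

definition D :: "'a \<Rightarrow> 'a" where "D x = grade_proj 1 x - grade_proj (-1) x"

lemma linear_D: "linear D"
  using linear_compose_sub[OF linear_grade_proj linear_grade_proj] by (simp add: D_def[abs_def])

lemma D_gr: assumes "x \<in> gr i" shows "D x = of_int i *\<^sub>R x"
proof (cases "i \<in> {-1, 0, 1}")
  case True
  then show ?thesis using grade_proj_eq[OF assms] by (auto simp: D_def)
next
  case False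
  then show ?thesis using gr_trivial[of i] assms linear_0[OF linear_D] by simp
qed

lemma sum_grade_proj: "(\<Sum>i\<in>{-1, 0, 1}. grade_proj i x) = x"
  using grade_proj_sum[of x] by (simp add: add.assoc)

lemma D_derivation: "D (br x y) = br (D x) y + br x (D y)"
proof -
  let ?I = "{-1, 0, 1} :: int set"
  have lin: "linear (\<lambda>x. br x y)" "linear (br x)" for x y
    using bilinear_br by (simp_all add: bilinear_def)
  have exp: "br x y = (\<Sum>i\<in>?I. \<Sum>j\<in>?I. br (grade_proj i x) (grade_proj j y))" for x y
  proof -
    have "br x y = br (\<Sum>i\<in>?I. grade_proj i x) (\<Sum>j\<in>?I. grade_proj j y)" by (simp only: sum_grade_proj)
    also have "\<dots> = (\<Sum>i\<in>?I. br (grade_proj i x) (\<Sum>j\<in>?I. grade_proj j y))" by (rule linear_sum[OF lin(1)])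
    finally show ?thesis by (simp only: linear_sum[OF lin(2)])
  qed
  have gpD: "grade_proj i (D x) = of_int i *\<^sub>R grade_proj i x" for i x
  proof -
    have "grade_proj i (grade_proj j x) = (if i = j then grade_proj i x else 0)" for j using grade_proj_eq[OF grade_proj_gr, of i j x] by simp
    then show ?thesis using grade_proj_out[of i x]
      by (cases "i \<in> ?I") (auto simp: D_def linear_diff[OF linear_grade_proj])
  qed
  have "D (br x y) = (\<Sum>i\<in>?I. \<Sum>j\<in>?I. D (br (grade_proj i x) (grade_proj j y)))"
    by (subst exp) (simp only: linear_sum[OF linear_D])
  also have "\<dots> = (\<Sum>i\<in>?I. \<Sum>j\<in>?I. br (grade_proj i (D x)) (grade_proj j y) + br (grade_proj i x) (grade_proj j (D y)))"
    by (intro sum.cong refl) (simp only: D_gr[OF br_gr[OF grade_proj_gr grade_proj_gr]] gpD br_simps of_int_add scaleR_add_left)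
  also have "\<dots> = br (D x) y + br x (D y)"
    unfolding sum.distrib exp[symmetric] ..
  finally show ?thesis .
qed

text \<open>If \<open>D\<close> equals ad E, this equation is the definition of the Killing form. It
  therefore singles out the only possible candidate.\<close>

definition E :: 'a where "E = (SOME E. \<forall>y. killing br E y = trace_of (\<lambda>z. D (br y z)))"

lemma killing_E: "killing br E y = trace_of (\<lambda>z. D (br y z))"
proof -
  have "linear (\<lambda>y. trace_of (\<lambda>z. D (br y z)))"
    by (simp add: linear_iff trace_of_def br_simps linear_add[OF linear_D] linear_scale[OF linear_D]
        inner_add_left sum.distrib sum_distrib_left)
  from someI_ex[OF killing_repr[OF this]] show ?thesis unfolding E_def by blast
qed

text \<open>The derivation \<open>D\<close> is inner because the Killing form is nondegenerate.\<close>

lemma br_E: "br E x = D x"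
proof -
  have lin: "linear (br x)" for x using bilinear_br by (simp add: bilinear_def)
  have "killing br (D x - br E x) y = 0" for y
  proof -
    have "killing br (D x) y = trace_of (\<lambda>z. D (br x (br y z)) - br x (D (br y z)))"
      unfolding killing_def by (rule arg_cong[of _ _ trace_of]) (simp add: fun_eq_iff D_derivation[of x])
    also have "\<dots> = trace_of (\<lambda>z. D (br x (br y z))) - trace_of (\<lambda>z. D (br y (br x z)))"
      using trace_of_commute[OF lin linear_compose[OF lin linear_D, of y], of x] by (simp add: trace_of_diff o_def)
    also have "\<dots> = trace_of (\<lambda>z. D (br (br x y) z))"
      by (simp add: br_br linear_diff[OF linear_D] trace_of_diff)
    also have "\<dots> = killing br (br E x) y" by (simp add: killing_invariant flip: killing_E)
    finally show ?thesis
      by (simp add: bilinear_lsub[OF bilinear_killing])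
  qed
  then have "D x - br E x = 0" by (rule killing_nondegenerate)
  then show ?thesis by simp
qed

text \<open>Since \<open>br E\<close> is \<open>D\<close>, the identity [E, E] = 0 says that the
  components of \<open>E\<close> in grades 1 and -1 coincide, so both are 0.\<close>

lemma E_gr0: "E \<in> gr 0"
proof -
  have "grade_proj 1 E = grade_proj (-1) E" using br_E[of E] br_self[of E] by (simp add: D_def)
  then have "grade_proj 1 (grade_proj 1 E) = grade_proj 1 (grade_proj (-1) E)" by simp
  then have "grade_proj 1 E = 0" using grade_proj_eq[OF grade_proj_gr, of 1 1 E] grade_proj_eq[OF grade_proj_gr, of 1 "-1" E] by simp
  then have "grade_proj 0 E = E" using grade_proj_sum[of E] \<open>grade_proj 1 E = grade_proj (-1) E\<close> by simp
  then show ?thesis using grade_proj_gr[of 0 E] by simp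
qed

lemma br_E_gr: "x \<in> gr i \<Longrightarrow> br E x = of_int i *\<^sub>R x"
  by (simp add: br_E D_gr)

definition Ec :: "'a \<times> 'a" where "Ec = (E, 0)"

lemma bc_Ec: "bc Ec X = (D (fst X), D (snd X))"
  by (simp add: Ec_def cbil_def br_E br_simps)

lemma Ec_h: "Ec \<in> h"
proof (rule h_maximal)
  fix H assume "H \<in> h"
  then have "fst H \<in> gr 0" "snd H \<in> gr 0" using h_gr0 by auto
  then have "bc Ec H = 0" by (simp add: bc_Ec D_gr zero_prod_def)
  then show "bc H Ec = 0" using bc_antisym[of H Ec] by simp
qed

lemma eigenvalue_grade:
  assumes "X \<noteq> 0" "bc Ec X = cscale c X"
  shows "\<exists>i\<in>{-1, 0, 1}. c = of_int i \<and> X \<in> gr i \<times> gr i"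
proof -
  have c: "grade_proj i (D x) = of_int i *\<^sub>R grade_proj i x" for i x
  proof -
    have "grade_proj i (grade_proj j x) = (if i = j then grade_proj i x else 0)" for j using grade_proj_eq[OF grade_proj_gr, of i j x] by simp
    then show ?thesis using grade_proj_out[of i x]
      by (cases "i \<in> {-1, 0, 1}") (auto simp: D_def linear_diff[OF linear_grade_proj])
  qed
  define Gp where "Gp i = (grade_proj i (fst X), grade_proj i (snd X))" for i
  have Gp: "cscale (of_int i) (Gp i) = cscale c (Gp i)" for i
  proof -
    have "cscale c (Gp i) = (grade_proj i (fst (cscale c X)), grade_proj i (snd (cscale c X)))"
      by (simp add: Gp_def cscale_def linear_add[OF linear_grade_proj] linear_diff[OF linear_grade_proj] linear_scale[OF linear_grade_proj])
    also have "\<dots> = cscale (of_int i) (Gp i)"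
      unfolding assms(2)[symmetric] by (simp add: bc_Ec c Gp_def cscale_def)
    finally show ?thesis by (rule sym)
  qed
  have sum: "Gp (-1) + Gp 0 + Gp 1 = X" using grade_proj_sum by (simp add: Gp_def prod_eq_iff)
  have "\<exists>i\<in>{-1, 0, 1}. Gp i \<noteq> 0" using sum assms(1) by auto
  then obtain i where i: "i \<in> {-1, 0, 1}" "Gp i \<noteq> 0" by blast
  then have ci: "c = of_int i" using Gp[of i] by simp
  have Gp0: "Gp j = 0" if "j \<noteq> i" for j using Gp[of j] that ci by simp
  consider "i = -1" | "i = 0" | "i = 1" using i(1) by blast
  then have "Gp i = X"
  proof cases
    case 1 then show ?thesis using sum Gp0[of 0] Gp0[of 1] by simp
  next
    case 2 then show ?thesis using sum Gp0[of "-1"] Gp0[of 1] by simp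
  next
    case 3 then show ?thesis using sum Gp0[of "-1"] Gp0[of 0] by simp
  qed
  moreover have "Gp i \<in> gr i \<times> gr i" using grade_proj_gr by (simp add: Gp_def)
  ultimately have "X \<in> gr i \<times> gr i" by simp
  then show ?thesis using i ci by blast
qed

lemma Wt_grade:
  assumes "\<alpha> \<in> Wt"
  shows "\<exists>i\<in>{-1, 0, 1}. \<alpha> Ec = of_int i \<and> rs \<alpha> \<subseteq> gr i \<times> gr i"
proof -
  obtain X where X: "X \<in> rs \<alpha>" "X \<noteq> 0" using assms csubspaceD(2)[OF subspace_rs] by (auto simp: Wt_def)
  obtain i where i: "i \<in> {-1, 0, 1}" "\<alpha> Ec = of_int i"
    using eigenvalue_grade[OF X(2) rs_bc[OF X(1) Ec_h]] by blast
  have "Y \<in> gr i \<times> gr i" if Y: "Y \<in> rs \<alpha>" for Y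
  proof (cases "Y = 0")
    case True then show ?thesis using subspace_0[OF subspace_gr] by (simp add: zero_prod_def)
  next
    case False
    from eigenvalue_grade[OF this rs_bc[OF Y Ec_h]] i show ?thesis by auto
  qed
  then show ?thesis using i by blast
qed

lemma roots_eq: "roots br h = Wt - {0}"
proof -
  have "(\<exists>H\<in>h. \<alpha> H \<noteq> 0) \<longleftrightarrow> \<alpha> \<noteq> 0" if "\<alpha> \<in> cdual h" for \<alpha>
    using cdual_eqI[OF that cdual_0] by auto
  then show ?thesis by (auto simp: roots_def Wt_def)
qed

definition H0 :: "'a \<times> 'a" where
  "H0 = (SOME H. H \<in> h \<and> (\<forall>\<alpha>\<in>roots br h. Re (\<alpha> H) \<noteq> 0) \<and> \<Phi> = {\<alpha> \<in> roots br h. Re (\<alpha> H) > 0})"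

lemma H0: "H0 \<in> h" "\<alpha> \<in> roots br h \<Longrightarrow> Re (\<alpha> H0) \<noteq> 0" "\<Phi> = {\<alpha> \<in> roots br h. Re (\<alpha> H0) > 0}"
proof -
  have "\<exists>H. H \<in> h \<and> (\<forall>\<alpha>\<in>roots br h. Re (\<alpha> H) \<noteq> 0) \<and> \<Phi> = {\<alpha> \<in> roots br h. Re (\<alpha> H) > 0}"
    using positive unfolding positive_system_def by blast
  from someI_ex[OF this, folded H0_def]
  show "H0 \<in> h" "\<alpha> \<in> roots br h \<Longrightarrow> Re (\<alpha> H0) \<noteq> 0" "\<Phi> = {\<alpha> \<in> roots br h. Re (\<alpha> H0) > 0}" by blast+
qed

lemma \<Phi>_iff: "\<alpha> \<in> \<Phi> \<longleftrightarrow> \<alpha> \<in> roots br h \<and> Re (\<alpha> H0) > 0"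
  by (subst H0(3)) simp

lemma \<Phi>_Wt: "\<alpha> \<in> \<Phi> \<Longrightarrow> \<alpha> \<in> Wt" "\<alpha> \<in> \<Phi> \<Longrightarrow> \<alpha> \<noteq> 0"
  by (simp_all add: \<Phi>_iff roots_eq)

lemma finite_\<Phi>: "finite \<Phi>" using finite_subset[OF _ finite_Wt] \<Phi>_Wt(1) by blast

lemma \<Phi>_minus: assumes "\<alpha> \<in> Wt" "\<alpha> \<noteq> 0" shows "- \<alpha> \<in> \<Phi> \<longleftrightarrow> \<alpha> \<notin> \<Phi>"
proof -
  have "\<alpha> \<in> roots br h" "- \<alpha> \<in> roots br h" using assms Wt_minus roots_eq by auto
  then show ?thesis using H0(2)[of \<alpha>] by (simp add: \<Phi>_iff) linarith
qed

lemma \<Phi>_grade1: assumes "\<alpha> \<in> Wt" "\<alpha> Ec = 1" shows "\<alpha> \<in> \<Phi>"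
proof (rule positive_gr1)
  show "\<alpha> \<in> roots br h" using assms by (auto simp: roots_eq)
  show "rs \<alpha> \<subseteq> gr 1 \<times> gr 1" using Wt_grade[OF assms(1)] assms(2) by auto
qed

lemma \<Phi>_grade_minus1: assumes "\<alpha> \<in> Wt" "\<alpha> Ec = -1" shows "\<alpha> \<notin> \<Phi>"
proof -
  have "- \<alpha> \<in> \<Phi>" by (rule \<Phi>_grade1) (simp_all add: assms Wt_minus)
  moreover have "\<alpha> \<noteq> 0" using assms(2) by auto
  ultimately show ?thesis using \<Phi>_minus[OF assms(1)] by blast
qed

text \<open>The positive roots of the reductive algebra of grade 0.\<close>

definition "Phi0 = {\<alpha>\<in>\<Phi>. \<alpha> Ec = 0}"

text \<open>\<kappa>(E, H) is the sum of \<alpha>(E) \<alpha>(H) over all weights, each counted once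
  by \<open>root_mult_eq_1\<close>. Only grades 1 and -1 contribute, and equally much, so the
  positive roots of grade 1 add up to \<kappa>(E, H) / 2.\<close>

lemma two_half_sum:
  assumes H: "H \<in> h"
  shows "2 * half_sum \<Phi> H = (\<Sum>\<alpha>\<in>Phi0. \<alpha> H) + \<kappa> Ec H / 2"
proof -
  let ?P = "{\<alpha>\<in>Wt. \<alpha> Ec = 1}" and ?N = "{\<alpha>\<in>Wt. \<alpha> Ec = -1}"
  have \<Phi>_split: "\<Phi> = Phi0 \<union> ?P"
  proof (intro equalityI subsetI)
    fix \<alpha> assume \<alpha>: "\<alpha> \<in> \<Phi>"
    then obtain i :: int where "i \<in> {-1, 0, 1}" "\<alpha> Ec = of_int i" using Wt_grade[OF \<Phi>_Wt(1)[OF \<alpha>]] by blast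
    then show "\<alpha> \<in> Phi0 \<union> ?P" using \<alpha> \<Phi>_Wt(1)[OF \<alpha>] \<Phi>_grade_minus1 by (auto simp: Phi0_def)
  qed (auto simp: Phi0_def \<Phi>_grade1)
  have fin: "finite ?P" "finite ?N" "finite Phi0" using finite_Wt finite_\<Phi> by (simp_all add: Phi0_def)
  have "2 * half_sum \<Phi> H = (\<Sum>\<alpha>\<in>\<Phi>. \<alpha> H)" by (simp add: half_sum_def)
  also have "\<dots> = (\<Sum>\<alpha>\<in>Phi0 \<union> ?P. \<alpha> H)" by (rule sum.cong[OF \<Phi>_split refl])
  also have "\<dots> = (\<Sum>\<alpha>\<in>Phi0. \<alpha> H) + (\<Sum>\<alpha>\<in>?P. \<alpha> H)"
    using fin by (intro sum.union_disjoint) (auto simp: Phi0_def)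
  finally have 1: "2 * half_sum \<Phi> H = (\<Sum>\<alpha>\<in>Phi0. \<alpha> H) + (\<Sum>\<alpha>\<in>?P. \<alpha> H)" .
  have "\<kappa> Ec H = (\<Sum>\<alpha>\<in>Wt. \<alpha> Ec * \<alpha> H)"
    unfolding \<kappa>_h[OF Ec_h H]
  proof (intro sum.cong refl)
    fix \<alpha> assume "\<alpha> \<in> Wt"
    then show "root_mult \<alpha> * (\<alpha> Ec * \<alpha> H) = \<alpha> Ec * \<alpha> H" using root_mult_eq_1[of \<alpha>] by (cases "\<alpha> = 0") auto
  qed
  also have "\<dots> = (\<Sum>\<alpha>\<in>?P \<union> ?N. \<alpha> Ec * \<alpha> H)"
    using finite_Wt Wt_grade by (intro sum.mono_neutral_right) force+
  also have "\<dots> = (\<Sum>\<alpha>\<in>?P. \<alpha> Ec * \<alpha> H) + (\<Sum>\<alpha>\<in>?N. \<alpha> Ec * \<alpha> H)"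
    using fin by (intro sum.union_disjoint) auto
  also have "(\<Sum>\<alpha>\<in>?P. \<alpha> Ec * \<alpha> H) = (\<Sum>\<alpha>\<in>?P. \<alpha> H)" by (intro sum.cong) auto
  also have "(\<Sum>\<alpha>\<in>?N. \<alpha> Ec * \<alpha> H) = (\<Sum>\<alpha>\<in>?P. \<alpha> H)"
    by (rule sum.reindex_bij_witness[of _ uminus uminus]) (auto simp: Wt_minus)
  finally show ?thesis using 1 by simp
qed

lemma gp0_proj: "(grade_proj 0 (fst X), grade_proj 0 (snd X)) = (\<Sum>\<alpha>\<in>{\<alpha>\<in>Wt. \<alpha> Ec = 0}. proj \<alpha> X)"
proof -
  define G where "G X = (grade_proj 0 (fst X), grade_proj 0 (snd X))" for X
  have lin: "linear G" 
    by (simp add: G_def linear_iff linear_add[OF linear_grade_proj] linear_scale[OF linear_grade_proj])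
  have "G (proj \<alpha> X) = (if \<alpha> Ec = 0 then proj \<alpha> X else 0)" if \<alpha>: "\<alpha> \<in> Wt" for \<alpha>
  proof -
    obtain i where i: "i \<in> {-1, 0, 1}" "\<alpha> Ec = of_int i" "rs \<alpha> \<subseteq> gr i \<times> gr i" using Wt_grade[OF \<alpha>] by blast
    then have "proj \<alpha> X \<in> gr i \<times> gr i" using proj_rs by blast
    then have m: "fst (proj \<alpha> X) \<in> gr i" "snd (proj \<alpha> X) \<in> gr i" by auto
    show ?thesis using grade_proj_eq[OF m(1), of 0] grade_proj_eq[OF m(2), of 0] i(2) by (auto simp: G_def zero_prod_def)
  qed
  then have "(\<Sum>\<alpha>\<in>Wt. G (proj \<alpha> X)) = (\<Sum>\<alpha>\<in>Wt. if \<alpha> Ec = 0 then proj \<alpha> X else 0)" by simp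
  then have "G (\<Sum>\<alpha>\<in>Wt. proj \<alpha> X) = (\<Sum>\<alpha>\<in>{\<alpha>\<in>Wt. \<alpha> Ec = 0}. proj \<alpha> X)"
    using finite_Wt by (simp add: linear_sum[OF lin] sum.inter_filter)
  then show ?thesis by (simp add: sum_proj G_def)
qed

text \<open>Since \<open>\<gg>\<^sub>1\<close> and \<open>\<gg>\<^sub>-\<^sub>1\<close> are dual to each other under the Killing form, the trace of
  \<open>x \<in> \<gg>\<^sub>0\<close> on \<open>\<gg>\<^sub>1\<close> is minus its trace on \<open>\<gg>\<^sub>-\<^sub>1\<close>.\<close>

lemma killing_E_trace:
  assumes "x \<in> gr 0"
  shows "killing br E x = - 2 * trace_of (\<lambda>z. grade_proj (-1) (br x z))"
proof -
  have lin: "linear (br x)" for x using bilinear_br by (simp add: bilinear_def)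
  have DD: "killing br (D x) y = - killing br x (D y)" for x y
    using killing_invariant[of x E y] br_antisym[of E x] by (simp add: bilinear_lneg[OF bilinear_killing] flip: br_E)
  have gg: "killing br x y = 0" if "x \<in> gr i" "y \<in> gr j" "i + j \<noteq> 0" for x y i j
  proof -
    have "of_int i * killing br x y = - (of_int j * killing br x y)"
      using DD[of x y] by (simp add: D_gr[OF that(1)] D_gr[OF that(2)] killing_scaleR)
    then have "of_int (i + j) * killing br x y = 0" by (simp add: distrib_right)
    then show ?thesis using that(3) by (simp only: mult_eq_0_iff of_int_eq_0_iff) blast
  qed
  have lk: "linear (\<lambda>x. killing br x y)" "linear (killing br x)" for x y
    using bilinear_killing by (simp_all add: bilinear_def)
  have adj: "killing br (grade_proj 1 x) y = killing br x (grade_proj (-1) y)" for x y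
  proof -
    have "killing br (grade_proj 1 x) y = killing br (grade_proj 1 x) (grade_proj (-1) y)"
      by (subst grade_proj_sum[of y, symmetric]) (simp add: killing_add gg[OF grade_proj_gr grade_proj_gr])
    also have "\<dots> = killing br x (grade_proj (-1) y)"
      by (subst (2) grade_proj_sum[of x, symmetric]) (simp add: killing_add gg[OF grade_proj_gr grade_proj_gr])
    finally show ?thesis .
  qed
  have "trace_of (\<lambda>z. grade_proj 1 (br x z)) = trace_of (\<lambda>z. - br x (grade_proj (-1) z))"
  proof (rule trace_adjoint)
    show "linear (\<lambda>z. - br x (grade_proj (-1) z))"
      using linear_compose[OF linear_grade_proj lin] by (intro linear_compose_neg) (simp add: o_def)
    show "killing br (grade_proj 1 (br x u)) v = killing br u (- br x (grade_proj (-1) v))" for u v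
      using br_antisym[of x u] killing_invariant[of u x]
      by (simp add: adj bilinear_lneg[OF bilinear_killing] bilinear_rneg[OF bilinear_killing])
  qed
  also have "\<dots> = - trace_of (\<lambda>z. grade_proj (-1) (br x z))"
    using trace_of_commute[OF lin linear_grade_proj, of x "-1"] by (simp add: trace_of_def sum_negf)
  finally show ?thesis by (simp add: killing_E D_def trace_of_diff)
qed

end

section \<open>Eigenvectors in complexifications of finite-dimensional spaces\<close>

text \<open>The relation is indexed by positions and not by vectors, because the powers of an
  operator on a vector may repeat.\<close>

lemma dependent_sequence:
  fixes v :: "nat \<Rightarrow> 'x::real_vector"
  assumes S: "finite S" and v: "\<And>i. v i \<in> span S"
  shows "\<exists>u. (\<exists>i\<le>card S. u i \<noteq> 0) \<and> (\<Sum>i\<le>card S. u i *\<^sub>R v i) = 0"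
proof (cases "inj_on v {..card S}")
  case True
  have "dependent (v ` {..card S})"
  proof (rule ccontr)
    assume "independent (v ` {..card S})"
    then have "card (v ` {..card S}) \<le> card S"
      using independent_span_bound[OF S, of "v ` {..card S}"] v by blast
    then show False using card_image[OF True] by simp
  qed
  then obtain u where u: "\<exists>x\<in>v ` {..card S}. u x \<noteq> 0" "(\<Sum>x\<in>v ` {..card S}. u x *\<^sub>R x) = 0"
    using dependent_finite[of "v ` {..card S}"] by auto
  then show ?thesis using True by (intro exI[of _ "\<lambda>i. u (v i)"]) (auto simp: sum.reindex)
next
  case False
  then obtain i j where ij: "i \<le> card S" "j \<le> card S" "i \<noteq> j" "v i = v j" by (auto simp: inj_on_def)
  define u where "u = (\<lambda>l. (if l = i then 1 else 0) - (if l = j then 1 else (0::real)))"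
  have "(\<Sum>l\<le>card S. u l *\<^sub>R v l) = (\<Sum>l\<le>card S. if l = i then v i else 0) - (\<Sum>l\<le>card S. if l = j then v j else 0)"
    unfolding sum_subtractf[symmetric] by (intro sum.cong) (auto simp: u_def)
  then have "(\<Sum>l\<le>card S. u l *\<^sub>R v l) = 0" using ij by simp
  moreover have "\<exists>i\<le>card S. u i \<noteq> 0" using ij by (intro exI[of _ i]) (simp add: u_def)
  ultimately show ?thesis by (intro exI[of _ u] conjI)
qed

text \<open>Split off a root \<open>a\<close>, so that p = (x - a) q, and put Y = q(L) X. Then (L -
  a) Y = 0: either \<open>Y\<close> is the wanted eigenvector, or \<open>q\<close> annihilates
  \<open>X\<close> and has smaller degree.\<close>

lemma eigenvector_of_annihilator:
  fixes L :: "'x::real_vector \<times> 'x \<Rightarrow> 'x \<times> 'x"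
  assumes L: "clinear L" and U: "csubspace U" "\<And>X. X \<in> U \<Longrightarrow> L X \<in> U" and X: "X \<in> U" "X \<noteq> 0"
  shows "p \<noteq> 0 \<Longrightarrow> (\<Sum>i\<le>degree p. cscale (coeff p i) ((L ^^ i) X)) = 0 \<Longrightarrow>
    \<exists>Y\<in>U. Y \<noteq> 0 \<and> (\<exists>c. L Y = cscale c Y)"
proof (induction "degree p" arbitrary: p)
  case 0
  then have "cscale (coeff p 0) X = 0" "coeff p 0 \<noteq> 0" by (simp_all, metis leading_coeff_0_iff)
  then show ?case using X by simp
next
  case (Suc n)
  then obtain a where a: "poly p a = 0"
    using fundamental_theorem_of_algebra[of p] by (metis constant_degree nat.distinct(1))
  then obtain q where q: "p = [:-a, 1:] * q" by (metis poly_eq_0_iff_dvd dvdE)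
  have q0: "q \<noteq> 0" using Suc.prems(1) q by auto
  have "degree p = degree [:-a, 1:] + degree q" unfolding q by (rule degree_mult_eq) (simp_all add: q0)
  then have degq: "degree q = n" using Suc.hyps(2) by simp
  define Y where "Y = (\<Sum>i\<le>n. cscale (coeff q i) ((L ^^ i) X))"
  have cq: "coeff p i = coeff (pCons 0 q) i - a * coeff q i" for i by (simp add: q)
  have "(\<Sum>i\<le>degree p. cscale (coeff p i) ((L ^^ i) X)) =
      (\<Sum>i\<le>Suc n. cscale (coeff (pCons 0 q) i) ((L ^^ i) X)) - (\<Sum>i\<le>Suc n. cscale (a * coeff q i) ((L ^^ i) X))"
    unfolding Suc.hyps(2)[symmetric] sum_subtractf[symmetric] cq C.scale_left_diff_distrib ..
  also have "(\<Sum>i\<le>Suc n. cscale (coeff (pCons 0 q) i) ((L ^^ i) X)) = L Y"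
    unfolding sum.atMost_Suc_shift Y_def clinear_sum[OF L] clinear_cscale[OF L] by simp
  also have "(\<Sum>i\<le>Suc n. cscale (a * coeff q i) ((L ^^ i) X)) = cscale a Y"
    using degq by (simp add: Y_def coeff_eq_0 C.scale_sum_right)
  finally have LY: "L Y = cscale a Y" using Suc.prems(2) by simp
  have "(L ^^ i) X \<in> U" for i by (induction i) (simp_all add: X U(2))
  then have YU: "Y \<in> U"
    unfolding Y_def by (intro subspace_sum csubspaceD(1,5)[OF U(1)])
  show ?case
  proof (cases "Y = 0")
    case True
    then show ?thesis using Suc.hyps(1)[of q] degq q0 by (simp add: Y_def)
  next
    case False
    then show ?thesis using LY YU by blast
  qed
qed

text \<open>The ambient space may be an infinite-dimensional function space. A real linear relation
  between finitely many powers of \<open>L\<close> on \<open>X\<close> provides the annihilating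
  polynomial.\<close>

lemma eigenvector_exists:
  fixes L :: "'x::real_vector \<times> 'x \<Rightarrow> 'x \<times> 'x"
  assumes L: "clinear L" and U: "csubspace U" "\<And>X. X \<in> U \<Longrightarrow> L X \<in> U" and X: "X \<in> U" "X \<noteq> 0"
    and S: "finite S" "U \<subseteq> span S"
  shows "\<exists>Y\<in>U. Y \<noteq> 0 \<and> (\<exists>c. L Y = cscale c Y)"
proof -
  have mem: "(L ^^ i) X \<in> U" for i by (induction i) (simp_all add: X U(2))
  then have "(L ^^ i) X \<in> span S" for i using S(2) by blast
  from dependent_sequence[OF S(1) this] obtain u where
    u': "(\<exists>i\<le>card S. u i \<noteq> 0) \<and> (\<Sum>i\<le>card S. u i *\<^sub>R (L ^^ i) X) = 0" ..
  note u = conjunct1[OF u'] conjunct2[OF u']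
  define p where "p = (\<Sum>i\<le>card S. monom (complex_of_real (u i)) i)"
  have cp: "coeff p i = (if i \<le> card S then of_real (u i) else 0)" for i
    by (simp add: p_def coeff_sum)
  obtain i where i: "i \<le> card S" "u i \<noteq> 0" using u(1) by blast
  then have "coeff p i \<noteq> 0" by (simp add: cp)
  then have "p \<noteq> 0" by auto
  moreover have "degree p \<le> card S" by (rule degree_le) (simp add: cp)
  then have "(\<Sum>i\<le>degree p. cscale (coeff p i) ((L ^^ i) X)) = (\<Sum>i\<le>card S. cscale (coeff p i) ((L ^^ i) X))"
    by (intro sum.mono_neutral_left) (auto simp: coeff_eq_0)
  moreover have "\<dots> = 0" using u(2) by (simp add: cp cscale_of_real)
  ultimately show ?thesis using eigenvector_of_annihilator[OF L U X] by simp
qed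

text \<open>Eigenvectors for distinct eigenvalues are independent, over the reals as well, so there
  are at most \<open>card S\<close> of them.\<close>

lemma finite_eigenvalues:
  fixes L :: "'x::real_vector \<times> 'x \<Rightarrow> 'x \<times> 'x"
  assumes L: "clinear L" and S: "finite S" "V \<subseteq> span S"
  shows "finite {c. \<exists>X\<in>V. X \<noteq> 0 \<and> L X = cscale c X}"
proof (rule ccontr)
  assume "infinite {c. \<exists>X\<in>V. X \<noteq> 0 \<and> L X = cscale c X}"
  then obtain C where C: "finite C" "card C = Suc (card S)" "C \<subseteq> {c. \<exists>X\<in>V. X \<noteq> 0 \<and> L X = cscale c X}"
    using infinite_arbitrarily_large by blast
  have "\<forall>c\<in>C. \<exists>X. X \<in> V \<and> X \<noteq> 0 \<and> L X = cscale c X" using C(3) by blast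
  from bchoice[OF this] obtain v where v: "\<forall>c\<in>C. v c \<in> V \<and> v c \<noteq> 0 \<and> L (v c) = cscale c (v c)" ..
  have inj: "inj_on v C"
  proof (rule inj_onI)
    fix c c' assume c: "c \<in> C" "c' \<in> C" "v c = v c'"
    then have "cscale c (v c) = cscale c' (v c)" using v by metis
    then show "c = c'" using v c by simp
  qed
  have "independent (v ` C)"
  proof (rule independent_if_scalars_zero)
    show "finite (v ` C)" using C(1) by simp
    fix f x assume f: "(\<Sum>x\<in>v ` C. f x *\<^sub>R x) = 0" and x: "x \<in> v ` C"
    have "(\<Sum>c\<in>C. cscale (of_real (f (v c))) (v c)) = 0" using f inj by (simp add: sum.reindex cscale_of_real)
    moreover have "csubspace ({0} :: ('x \<times> 'x) set)" by (rule csubspaceI) simp_all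
    ultimately have z: "\<forall>c\<in>C. cscale (of_real (f (v c))) (v c) \<in> {0}"
      using v by (intro eigen_components[OF L _ _ C(1)])
        (simp_all add: clinear_0[OF L] clinear_cscale[OF L] C.scale_left_commute)
    obtain c where c: "c \<in> C" "x = v c" using x by blast
    then show "f x = 0" using bspec[OF z c(1)] bspec[OF v c(1)] by simp
  qed
  then have "card (v ` C) \<le> card S"
    using independent_span_bound[OF S(1), of "v ` C"] v S(2) by blast
  then show False using C(2) card_image[OF inj] by simp
qed

lemma complex_functional_of_eigenvector:
  assumes h: "csubspace h" and r: "\<And>H H'. r (H + H') X = r H X + r H' X" "\<And>c H. r (cscale c H) X = cscale c (r H X)"
    and eig: "\<And>H. H \<in> h \<Longrightarrow> \<exists>c. r H X = cscale c X" and X: "X \<noteq> 0"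
  shows "\<exists>\<mu>\<in>cdual h. \<forall>H\<in>h. r H X = cscale (\<mu> H) X"
proof -
  define \<mu> where "\<mu> H = (if H \<in> h then SOME c. r H X = cscale c X else 0)" for H
  have \<mu>: "r H X = cscale (\<mu> H) X" if "H \<in> h" for H
    using someI_ex[OF eig[OF that]] that by (simp add: \<mu>_def)
  have inj: "c = d" if "cscale c X = cscale d X" for c d using that X by simp
  have "\<mu> \<in> cdual h"
    unfolding cdual_def mem_Collect_eq
  proof (intro conjI ballI allI impI)
    fix H H' assume H: "H \<in> h" "H' \<in> h"
    have "cscale (\<mu> (H + H')) X = cscale (\<mu> H + \<mu> H') X"
      unfolding \<mu>[OF csubspaceD(3)[OF h H], symmetric] C.scale_left_distrib \<mu>[OF H(1), symmetric] \<mu>[OF H(2), symmetric]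
      by (rule r)
    then show "\<mu> (H + H') = \<mu> H + \<mu> H'" by (rule inj)
  next
    fix c H assume H: "H \<in> h"
    have "cscale (\<mu> (cscale c H)) X = cscale (c * \<mu> H) X"
      unfolding \<mu>[OF csubspaceD(5)[OF h H], symmetric] C.scale_scale[symmetric] \<mu>[OF H, symmetric]
      by (rule r)
    then show "\<mu> (cscale c H) = c * \<mu> H" by (rule inj)
  qed (simp add: \<mu>_def)
  then show ?thesis using \<mu> by blast
qed

section \<open>The Casimir operator\<close>

context graded_cartan begin

text \<open>For the canonical element built from dual bases, an operator in the first factor may be
  replaced by its Killing adjoint in the second.\<close>

lemma canonical_adjoint:
  fixes \<Psi> :: "'a \<times> 'a \<Rightarrow> 'a \<times> 'a \<Rightarrow> 'y::real_vector \<times> 'y"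
  assumes l: "\<And>Y. clinear (\<lambda>X. \<Psi> X Y)" and r: "\<And>X. clinear (\<Psi> X)"
    and adj: "\<And>X Y. \<kappa> (P X) Y = \<kappa> X (P' Y)"
  shows "(\<Sum>b\<in>Basis. \<Psi> (P (b, 0)) (killing_dual b, 0)) = (\<Sum>b\<in>Basis. \<Psi> (b, 0) (P' (killing_dual b, 0)))"
proof -
  have "\<Psi> (P (b, 0)) (killing_dual b, 0) = (\<Sum>c\<in>Basis. cscale (\<kappa> (P (b, 0)) (killing_dual c, 0)) (\<Psi> (c, 0) (killing_dual b, 0)))" for b
  proof -
    have "\<Psi> (P (b, 0)) (killing_dual b, 0) = \<Psi> (\<Sum>c\<in>Basis. cscale (coord c (P (b, 0))) (c, 0)) (killing_dual b, 0)"
      by (simp only: coord_expand)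
    also have "\<dots> = (\<Sum>c\<in>Basis. cscale (coord c (P (b, 0))) (\<Psi> (c, 0) (killing_dual b, 0)))"
      by (simp only: clinear_sum[OF l] clinear_cscale[OF l])
    finally show ?thesis by (simp only: \<kappa>_killing_dual[symmetric] \<kappa>_sym[of "P (b, 0)"])
  qed
  then have "(\<Sum>b\<in>Basis. \<Psi> (P (b, 0)) (killing_dual b, 0)) =
      (\<Sum>c\<in>Basis. \<Sum>b\<in>Basis. cscale (\<kappa> (P (b, 0)) (killing_dual c, 0)) (\<Psi> (c, 0) (killing_dual b, 0)))"
    by (simp only:) (rule sum.swap)
  also have "\<dots> = (\<Sum>c\<in>Basis. \<Psi> (c, 0) (\<Sum>b\<in>Basis. cscale (\<kappa> (P' (killing_dual c, 0)) (b, 0)) (killing_dual b, 0)))"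
    by (simp only: clinear_sum[OF r] clinear_cscale[OF r] adj \<kappa>_sym[of "P' _"])
  also have "\<dots> = (\<Sum>c\<in>Basis. \<Psi> (c, 0) (P' (killing_dual c, 0)))" by (simp only: killing_dual_expand)
  finally show ?thesis .
qed

lemma Ec_nonzero: "Ec \<noteq> 0"
proof
  assume "Ec = 0"
  obtain x where x: "x \<in> gr (- 1)" "x \<noteq> 0" using gr_minus1 subspace_0[OF subspace_gr] by blast
  have "bc Ec (x, 0) = (- x, 0)" using D_gr[OF x(1)] linear_0[OF linear_D] by (simp add: bc_Ec)
  then show False using \<open>Ec = 0\<close> x by (simp add: bc_simps prod_eq_iff)
qed

lemma zero_Wt: "0 \<in> Wt"
  using in_WtI[of Ec 0] Ec_h Ec_nonzero rs_0 cdual_0 by simp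

lemma proj_grade0: "\<alpha> \<in> Wt \<Longrightarrow> \<alpha> Ec = 0 \<Longrightarrow> proj \<alpha> X \<in> gr 0 \<times> gr 0"
  using Wt_grade[of \<alpha>] proj_rs[of \<alpha> X] by auto

end

lemma Times_subset_span:
  fixes Q :: "'x::real_vector set"
  assumes "Q \<subseteq> span S"
  shows "Q \<times> Q \<subseteq> span ((\<lambda>s. (s, 0)) ` S \<union> (\<lambda>s. (0, s)) ` S)"
proof -
  have l: "linear (\<lambda>s. (s, 0 :: 'x))" "linear (\<lambda>s. (0 :: 'x, s))" by (simp_all add: linear_iff)
  have "(a, b) \<in> span ((\<lambda>s. (s, 0)) ` S \<union> (\<lambda>s. (0, s)) ` S)" if "a \<in> Q" "b \<in> Q" for a b
  proof -
    have "(a, 0) \<in> span ((\<lambda>s. (s, 0 :: 'x)) ` S)" "(0, b) \<in> span ((\<lambda>s. (0 :: 'x, s)) ` S)"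
      unfolding linear_span_image[OF l(1)] linear_span_image[OF l(2)] using that assms by auto
    then have "(a, 0) + (0, b) \<in> span ((\<lambda>s. (s, 0)) ` S \<union> (\<lambda>s. (0, s)) ` S)"
      by (intro span_add) (auto intro: span_mono[THEN subsetD, rotated])
    then show ?thesis by simp
  qed
  then show ?thesis by auto
qed

text \<open>A representation of grade 0 on the carrier \<open>Q\<close>, given as the restriction of
  a bilinear map on an ambient type. In this form it applies to quotients realized inside a function
  space.\<close>

locale casimir_rep = graded_cartan br h gr \<Phi>
  for br :: "'a::euclidean_space \<Rightarrow> 'a \<Rightarrow> 'a" and h gr \<Phi> +
  fixes r :: "'a \<Rightarrow> 't::real_vector \<Rightarrow> 't" and Q S :: "'t set"
  assumes bilinear_r: "bilinear r" and subspace_Q: "subspace Q"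
    and S: "finite S" "Q \<subseteq> span S"
    and r_Q: "\<And>x q. x \<in> gr 0 \<Longrightarrow> q \<in> Q \<Longrightarrow> r x q \<in> Q"
    and r_br: "\<And>x y q. x \<in> gr 0 \<Longrightarrow> y \<in> gr 0 \<Longrightarrow> q \<in> Q \<Longrightarrow> r (br x y) q = r x (r y q) - r y (r x q)"
begin

abbreviation "rc \<equiv> cbil r"
abbreviation "g0c \<equiv> gr 0 \<times> gr 0"

lemmas clinear_rc = clinear_cbil(1)[OF bilinear_r] and clinear_rc' = clinear_cbil(2)[OF bilinear_r]
lemmas r_simps = bilinear_ladd[OF bilinear_r] bilinear_radd[OF bilinear_r] bilinear_lsub[OF bilinear_r]
  bilinear_rsub[OF bilinear_r] bilinear_lzero[OF bilinear_r] bilinear_rzero[OF bilinear_r]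
lemmas rc_simps = clinear_add[OF clinear_rc] clinear_add[OF clinear_rc'] clinear_cscale[OF clinear_rc]
  clinear_cscale[OF clinear_rc'] clinear_0[OF clinear_rc] clinear_0[OF clinear_rc']
  clinear_diff[OF clinear_rc] clinear_diff[OF clinear_rc']

lemma csubspace_QQ: "csubspace (Q \<times> Q)"
  using subspace_0[OF subspace_Q] subspace_add[OF subspace_Q] subspace_scale[OF subspace_Q] subspace_diff[OF subspace_Q]
  by (intro csubspaceI) (auto simp: cscale_def zero_prod_def mem_Times_iff)

definition "SS = (\<lambda>s. (s, 0)) ` S \<union> (\<lambda>s. (0, s)) ` S"

lemma QQ_span: "finite SS" "Q \<times> Q \<subseteq> span SS"
proof -
  show "finite SS" using S(1) by (simp add: SS_def)
  show "Q \<times> Q \<subseteq> span SS" unfolding SS_def by (rule Times_subset_span[OF S(2)])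
qed

lemma rc_QQ: "Z \<in> g0c \<Longrightarrow> X \<in> Q \<times> Q \<Longrightarrow> rc Z X \<in> Q \<times> Q"
  using r_Q subspace_add[OF subspace_Q] subspace_diff[OF subspace_Q] by (auto simp: cbil_def mem_Times_iff)

lemma rc_bc:
  assumes "Z \<in> g0c" "W \<in> g0c" "X \<in> Q \<times> Q"
  shows "rc (bc Z W) X = rc Z (rc W X) - rc W (rc Z X)"
  using assms by (simp add: cbil_def r_simps r_br mem_Times_iff prod_eq_iff)

lemma rc_h_commute:
  assumes "H \<in> h" "H' \<in> h" "X \<in> Q \<times> Q" shows "rc H (rc H' X) = rc H' (rc H X)"
proof -
  have "H \<in> g0c" "H' \<in> g0c" using assms h_gr0 by blast+
  from rc_bc[OF this assms(3)] bc_h[OF assms(1,2)] show ?thesis by (simp add: rc_simps)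
qed

definition lowest :: "'t \<times> 't \<Rightarrow> ('a \<times> 'a \<Rightarrow> complex) \<Rightarrow> bool" where
  "lowest X \<mu> \<longleftrightarrow> X \<in> Q \<times> Q \<and> X \<noteq> 0 \<and> \<mu> \<in> cdual h \<and> (\<forall>H\<in>h. rc H X = cscale (\<mu> H) X) \<and>
     (\<forall>\<alpha>\<in>\<Phi>. \<forall>Z\<in>rs (- \<alpha>) \<inter> g0c. rc Z X = 0)"

text \<open>Diagonalizability of \<open>h\<close> on \<open>Q\<close> is not given, so the subspace
  is shrunk to an eigenspace for one element at a time. Keeping it stable under all of
  \<open>h\<close> lets the next step start.\<close>

lemma joint_eigenspace:
  assumes U: "csubspace U" "U \<subseteq> Q \<times> Q" "\<exists>X\<in>U. X \<noteq> 0" "\<And>H X. H \<in> h \<Longrightarrow> X \<in> U \<Longrightarrow> rc H X \<in> U"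
    and Hs: "finite Hs" "Hs \<subseteq> h"
  shows "\<exists>V. csubspace V \<and> V \<subseteq> U \<and> (\<exists>X\<in>V. X \<noteq> 0) \<and> (\<forall>H\<in>h. \<forall>X\<in>V. rc H X \<in> V) \<and>
    (\<forall>H\<in>Hs. \<exists>c. \<forall>X\<in>V. rc H X = cscale c X)"
  using Hs
proof (induction Hs rule: finite_induct)
  case empty
  show ?case using U by (intro exI[of _ U]) simp
next
  case (insert H Hs)
  then obtain V where V: "csubspace V" "V \<subseteq> U" "\<exists>X\<in>V. X \<noteq> 0" "\<forall>H\<in>h. \<forall>X\<in>V. rc H X \<in> V"
    "\<forall>H\<in>Hs. \<exists>c. \<forall>X\<in>V. rc H X = cscale c X" by auto
  have H: "H \<in> h" using insert.prems by simp
  obtain X where X: "X \<in> V" "X \<noteq> 0" using V(3) by blast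
  have "V \<subseteq> span SS" using V(2) U(2) QQ_span(2) by blast
  then have "\<exists>Y\<in>V. Y \<noteq> 0 \<and> (\<exists>c. rc H Y = cscale c Y)"
    using V(4) H by (intro eigenvector_exists[OF clinear_rc V(1) _ X QQ_span(1)]) auto
  then obtain Y c where Y: "Y \<in> V" "Y \<noteq> 0" "rc H Y = cscale c Y" by blast
  let ?V = "{X\<in>V. rc H X = cscale c X}"
  have "csubspace ?V"
    using csubspaceD(2,3,5)[OF V(1)] by (intro csubspaceI) (simp_all add: rc_simps C.scale_right_distrib C.scale_left_commute)
  moreover have "\<forall>H\<in>h. \<forall>X\<in>?V. rc H X \<in> ?V"
  proof (intro ballI)
    fix H' X assume that: "H' \<in> h" "X \<in> ?V"
    have "X \<in> Q \<times> Q" using that V(2) U(2) by blast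
    then have "rc H (rc H' X) = cscale c (rc H' X)"
      using rc_h_commute[OF H that(1)] that(2) by (simp add: rc_simps)
    then show "rc H' X \<in> ?V" using V(4) that by blast
  qed
  moreover have "\<forall>H\<in>insert H Hs. \<exists>c. \<forall>X\<in>?V. rc H X = cscale c X"
  proof
    fix H' assume "H' \<in> insert H Hs"
    then consider "H' = H" | "H' \<in> Hs" by blast
    then show "\<exists>c. \<forall>X\<in>?V. rc H' X = cscale c X"
    proof cases
      case 1 then show ?thesis by (intro exI[of _ c]) simp
    next
      case 2
      then obtain c' where "\<forall>X\<in>V. rc H' X = cscale c' X" using V(5) by blast
      then show ?thesis by (intro exI[of _ c']) simp
    qed
  qed
  moreover have "?V \<subseteq> U" using V(2) by blast
  moreover have "\<exists>X\<in>?V. X \<noteq> 0" using Y by (intro bexI[of _ Y]) simp_all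
  ultimately show ?case by (intro exI[of _ ?V] conjI)
qed

lemma joint_eigenvector:
  assumes U: "csubspace U" "U \<subseteq> Q \<times> Q" "\<exists>X\<in>U. X \<noteq> 0" "\<And>H X. H \<in> h \<Longrightarrow> X \<in> U \<Longrightarrow> rc H X \<in> U"
  shows "\<exists>X\<in>U. X \<noteq> 0 \<and> (\<exists>\<mu>\<in>cdual h. \<forall>H\<in>h. rc H X = cscale (\<mu> H) X)"
proof -
  obtain B where B: "B \<subseteq> h" "independent B" "h \<subseteq> span B" "card B = dim h" using basis_exists[of h] .
  have fin: "finite B" using B(2) by (rule independent_imp_finite)
  from joint_eigenspace[OF U fin B(1)] obtain V where
    V': "csubspace V \<and> V \<subseteq> U \<and> (\<exists>X\<in>V. X \<noteq> 0) \<and> (\<forall>H\<in>h. \<forall>X\<in>V. rc H X \<in> V) \<and>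
      (\<forall>H\<in>B. \<exists>c. \<forall>X\<in>V. rc H X = cscale c X)" ..
  then have V: "V \<subseteq> U" "\<exists>X\<in>V. X \<noteq> 0" "\<forall>H\<in>B. \<exists>c. \<forall>X\<in>V. rc H X = cscale c X" by simp_all
  then obtain X where X: "X \<in> V" "X \<noteq> 0" by blast
  have "\<exists>c. rc H X = cscale c X" if H: "H \<in> h" for H
  proof -
    have "H \<in> span B" using H B by blast
    then show ?thesis
    proof (induction rule: span_induct_alt)
      case base show ?case by (rule exI[of _ 0]) (simp add: rc_simps)
    next
      case (step s x y)
      obtain c where c: "rc x X = cscale c X" using V(3) step(1) X(1) by blast
      obtain d where d: "rc y X = cscale d X" using step(2) by blast
      show ?case
        by (rule exI[of _ "of_real s * c + d"])
          (simp add: rc_simps c d C.scale_left_distrib flip: cscale_of_real)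
    qed
  qed
  from complex_functional_of_eigenvector[where r=rc and X=X, OF csubspace_h _ _ this X(2)]
  have "\<exists>\<mu>\<in>cdual h. \<forall>H\<in>h. rc H X = cscale (\<mu> H) X" by (simp add: rc_simps)
  then show ?thesis using X V(1) by blast
qed

text \<open>Take an eigenvalue \<open>c\<close> of the regular element \<open>H0\<close> with least
  real part. A vector of weight -\<alpha> with \<alpha> positive would carry the eigenspace to the
  eigenvalue c - \<alpha>(H0) of smaller real part, so it acts as 0.\<close>

lemma lowest_exists:
  assumes "\<exists>q\<in>Q. q \<noteq> 0"
  shows "\<exists>X \<mu>. lowest X \<mu>"
proof -
  have H0g: "H0 \<in> g0c" using H0(1) h_gr0 by blast
  define Ev where "Ev = {c. \<exists>X\<in>Q \<times> Q. X \<noteq> 0 \<and> rc H0 X = cscale c X}"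
  have fin: "finite Ev" unfolding Ev_def by (rule finite_eigenvalues[OF clinear_rc QQ_span])
  obtain q where "q \<in> Q" "q \<noteq> 0" using assms by blast
  then have q: "(q, 0) \<in> Q \<times> Q" "(q, 0) \<noteq> (0 :: 't \<times> 't)"
    using subspace_0[OF subspace_Q] by (simp_all add: zero_prod_def)
  have "\<exists>Y\<in>Q \<times> Q. Y \<noteq> 0 \<and> (\<exists>c. rc H0 Y = cscale c Y)"
    using rc_QQ[OF H0g] by (intro eigenvector_exists[OF clinear_rc csubspace_QQ _ q QQ_span]) auto
  then have "Ev \<noteq> {}" unfolding Ev_def by blast
  then obtain c where c: "c \<in> Ev" "\<And>d. d \<in> Ev \<Longrightarrow> Re c \<le> Re d"
    using ex_min_if_finite[of "Re ` Ev"] fin by (metis (mono_tags, lifting) finite_imageI image_iff image_is_empty linorder_not_less)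
  define U where "U = {X\<in>Q \<times> Q. rc H0 X = cscale c X}"
  have "\<exists>X\<in>U. X \<noteq> 0 \<and> (\<exists>\<mu>\<in>cdual h. \<forall>H\<in>h. rc H X = cscale (\<mu> H) X)"
  proof (rule joint_eigenvector)
    show "csubspace U" unfolding U_def
      using csubspaceD(2,3,5)[OF csubspace_QQ]
      by (intro csubspaceI) (simp_all add: rc_simps C.scale_right_distrib C.scale_left_commute)
    show "U \<subseteq> Q \<times> Q" by (auto simp: U_def)
    show "\<exists>X\<in>U. X \<noteq> 0" using c(1) by (auto simp: U_def Ev_def)
    fix H X assume H: "H \<in> h" and X: "X \<in> U"
    then have g: "H \<in> g0c" using h_gr0 by blast
    have XQ: "X \<in> Q \<times> Q" and eq: "rc H0 X = cscale c X" using X unfolding U_def by blast+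
    have "rc H X \<in> Q \<times> Q" by (rule rc_QQ[OF g XQ])
    moreover have "rc H0 (rc H X) = cscale c (rc H X)"
      using rc_h_commute[OF H0(1) H XQ] by (simp only: eq rc_simps)
    ultimately show "rc H X \<in> U" unfolding U_def by blast
  qed
  then obtain X \<mu> where X': "X \<in> U" "X \<noteq> 0" "\<mu> \<in> cdual h" "\<forall>H\<in>h. rc H X = cscale (\<mu> H) X" by blast
  then have X: "X \<in> Q \<times> Q" "rc H0 X = cscale c X" "X \<noteq> 0" "\<mu> \<in> cdual h"
    "\<forall>H\<in>h. rc H X = cscale (\<mu> H) X" unfolding U_def by blast+
  have "rc Z X = 0" if \<alpha>: "\<alpha> \<in> \<Phi>" and Z: "Z \<in> rs (- \<alpha>)" "Z \<in> g0c" for \<alpha> Z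
  proof (rule ccontr)
    assume nz: "rc Z X \<noteq> 0"
    have 0: "rc (bc H0 Z) X = cscale (- \<alpha> H0) (rc Z X)"
      using rs_bc[OF Z(1) H0(1)] by (simp only: rc_simps fun_Compl_def)
    have 1: "rc (bc H0 Z) X = rc H0 (rc Z X) - cscale c (rc Z X)"
      using rc_bc[OF H0g Z(2) X(1)] by (simp only: X(2) rc_simps)
    have "rc H0 (rc Z X) = (rc H0 (rc Z X) - cscale c (rc Z X)) + cscale c (rc Z X)" by simp
    also have "\<dots> = cscale (- \<alpha> H0 + c) (rc Z X)" by (simp only: 1[symmetric] 0 C.scale_left_distrib)
    finally have eig: "rc H0 (rc Z X) = cscale (- \<alpha> H0 + c) (rc Z X)" .
    have "- \<alpha> H0 + c \<in> Ev" unfolding Ev_def mem_Collect_eq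
      by (rule bexI[OF _ rc_QQ[OF Z(2) X(1)]], rule conjI[OF nz eig])
    then have "Re c \<le> Re (- \<alpha> H0 + c)" by (rule c(2))
    then show False using \<alpha> by (simp add: \<Phi>_iff)
  qed
  then have "lowest X \<mu>" using X by (simp add: lowest_def)
  then show ?thesis by blast
qed

text \<open>The Casimir element of grade 0 for the restricted Killing form. Projecting dual bases of
  the whole algebra avoids a choice of dual bases of grade 0.\<close>

definition Cas :: "'t \<Rightarrow> 't" where
  "Cas q = (\<Sum>b\<in>Basis. r (grade_proj 0 b) (r (grade_proj 0 (killing_dual b)) q))"

definition CasC :: "'t \<times> 't \<Rightarrow> 't \<times> 't" where
  "CasC X = (\<Sum>b\<in>Basis. rc (grade_proj 0 b, 0) (rc (grade_proj 0 (killing_dual b), 0) X))"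

lemma clinear_CasC: "clinear CasC"
  unfolding CasC_def by (rule clinear_sum_fun) (rule clinear_compose[OF clinear_rc clinear_rc])

lemma CasC_eq: "CasC X = (Cas (fst X), Cas (snd X))"
  by (simp add: CasC_def Cas_def cbil_def r_simps sum_prod)

text \<open>The canonical element is split by weights \<alpha> of grade 0. For \<alpha> = 0 it gives
  \<mu>(T) with \<open>T\<close> the dual of \<mu>; for a positive \<alpha> the lowering vector acts
  first and gives 0; for a negative one only the commutator of the two root vectors, an element of
  \<open>h\<close>, survives.\<close>

lemma CasC_lowest:
  assumes X: "lowest X \<mu>"
  shows "CasC X = cscale (\<mu> (weight_dual br h \<mu>) - (\<Sum>\<beta>\<in>Phi0. \<beta> (weight_dual br h \<mu>))) X"
proof -
  have XQ: "X \<in> Q \<times> Q" and \<mu>: "\<mu> \<in> cdual h" and wt: "\<And>H. H \<in> h \<Longrightarrow> rc H X = cscale (\<mu> H) X"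
    and kill: "\<And>\<alpha> Z. \<alpha> \<in> \<Phi> \<Longrightarrow> Z \<in> rs (- \<alpha>) \<Longrightarrow> Z \<in> g0c \<Longrightarrow> rc Z X = 0"
    using X unfolding lowest_def by blast+
  define T where "T = weight_dual br h \<mu>"
  have T: "T \<in> h" "\<And>H. H \<in> h \<Longrightarrow> \<kappa> T H = \<mu> H"
    using weight_dual_h[OF \<mu>] \<kappa>_weight_dual[OF \<mu>] by (simp_all add: T_def)
  define W0 where "W0 = {\<alpha>\<in>Wt. \<alpha> Ec = 0}"
  have gp0: "(grade_proj 0 x, 0) = (\<Sum>\<alpha>\<in>W0. proj \<alpha> (x, 0))" for x
    using gp0_proj[of "(x, 0)"] linear_0[OF linear_grade_proj] by (simp add: W0_def)
  define pz where "pz X = (\<Sum>\<alpha>\<in>W0. proj \<alpha> X)" for X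
  have cpz: "clinear pz" unfolding pz_def by (intro clinear_sum_fun clinear_proj)
  have finW0: "finite W0" using finite_Wt by (simp add: W0_def)
  have pz_proj: "pz (proj \<alpha> Y) = proj \<alpha> Y" if "\<alpha> \<in> W0" for \<alpha> Y
    using that finW0 by (simp add: pz_def proj_proj)
  define t where "t \<alpha> = (\<Sum>b\<in>Basis. rc (proj \<alpha> (b, 0)) (rc (proj (- \<alpha>) (killing_dual b, 0)) X))" for \<alpha>
  have W0_minus: "- \<alpha> \<in> W0" if "\<alpha> \<in> W0" for \<alpha> using that Wt_minus by (simp add: W0_def)
  have "CasC X = (\<Sum>b\<in>Basis. \<Sum>\<alpha>\<in>W0. rc (proj \<alpha> (b, 0)) (rc (pz (killing_dual b, 0)) X))"
    unfolding CasC_def gp0 pz_def by (simp only: clinear_sum[OF clinear_rc'])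
  \<comment> \<open>The projection is doubled so that \<open>canonical_adjoint\<close> can move one
    copy to the dual factor, where it becomes \<open>proj (- \<alpha>)\<close>.\<close>
  also have "\<dots> = (\<Sum>\<alpha>\<in>W0. \<Sum>b\<in>Basis. rc (proj \<alpha> (proj \<alpha> (b, 0))) (rc (pz (killing_dual b, 0)) X))"
    by (subst sum.swap) (simp add: proj_proj)
  also have "\<dots> = (\<Sum>\<alpha>\<in>W0. \<Sum>b\<in>Basis. rc (proj \<alpha> (b, 0)) (rc (pz (proj (- \<alpha>) (killing_dual b, 0))) X))"
  proof (rule sum.cong[OF refl])
    fix \<alpha>
    show "(\<Sum>b\<in>Basis. rc (proj \<alpha> (proj \<alpha> (b, 0))) (rc (pz (killing_dual b, 0)) X)) =
        (\<Sum>b\<in>Basis. rc (proj \<alpha> (b, 0)) (rc (pz (proj (- \<alpha>) (killing_dual b, 0))) X))"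
    proof (rule canonical_adjoint[where \<Psi>="\<lambda>Z W. rc (proj \<alpha> Z) (rc (pz W) X)"])
      show "clinear (\<lambda>Z. rc (proj \<alpha> Z) (rc (pz Y) X))" for Y
        by (rule clinear_compose[OF clinear_rc' clinear_proj])
      show "clinear (\<lambda>W. rc (proj \<alpha> Z) (rc (pz W) X))" for Z
        by (rule clinear_compose[OF clinear_rc clinear_compose[OF clinear_rc' cpz]])
    qed (rule \<kappa>_proj)
  qed
  also have "\<dots> = (\<Sum>\<alpha>\<in>W0. t \<alpha>)"
    unfolding t_def by (intro sum.cong refl) (simp add: pz_proj W0_minus)
  finally have C1: "CasC X = (\<Sum>\<alpha>\<in>W0. t \<alpha>)" .
  have p0: "proj 0 Z \<in> h" for Z using proj_rs[of 0 Z] rs_0 by simp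
  have Tp: "\<mu> (proj 0 Z) = \<kappa> T Z" for Z
    using T(2)[OF p0, of Z] \<kappa>_proj[of 0 T Z] proj_same[of T 0] T(1) rs_0 cdual_0 by simp
  have t0: "t 0 = cscale (\<mu> T) X"
  proof -
    have "t 0 = (\<Sum>b\<in>Basis. cscale (\<kappa> T (b, 0) * \<kappa> T (killing_dual b, 0)) X)"
      by (simp add: t_def wt p0 rc_simps Tp mult.commute)
    also have "\<dots> = cscale (\<kappa> T (\<Sum>b\<in>Basis. cscale (\<kappa> T (b, 0)) (killing_dual b, 0))) X"
      by (simp add: \<kappa>_sum \<kappa>_cscale C.scale_sum_left)
    finally show ?thesis by (simp add: killing_dual_expand T)
  qed
  have tpos: "t \<beta> = 0" if \<beta>: "\<beta> \<in> Phi0" for \<beta>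
  proof -
    have "\<beta> \<in> Wt" "\<beta> \<in> \<Phi>" "\<beta> Ec = 0" using \<beta> \<Phi>_Wt by (auto simp: Phi0_def)
    then have "rc (proj (- \<beta>) Z) X = 0" for Z
      using kill[OF _ proj_rs] proj_grade0[of "- \<beta>"] Wt_minus by simp
    then show ?thesis by (simp add: t_def rc_simps)
  qed
  have tneg: "t (- \<beta>) = cscale (- \<beta> T) X" if \<beta>: "\<beta> \<in> Phi0" for \<beta>
  proof -
    have \<beta>': "\<beta> \<in> Wt" "\<beta> \<in> \<Phi>" "\<beta> Ec = 0" "\<beta> \<noteq> 0" using \<beta> \<Phi>_Wt by (auto simp: Phi0_def)
    have g: "proj (- \<beta>) Z \<in> g0c" "proj \<beta> Z \<in> g0c" for Z
      using proj_grade0[of "- \<beta>"] proj_grade0[of "\<beta>"] \<beta>' Wt_minus by auto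
    have z: "rc (proj (- \<beta>) Z) X = 0" for Z using kill[OF \<beta>'(2) proj_rs g(1)] .
    \<comment> \<open>Here the raising vector acts first. The lowering vector kills
      \<open>X\<close>, so the product equals the action of the bracket, which is in
      \<open>h\<close>.\<close>
    have "rc (proj (- \<beta>) Z) (rc (proj \<beta> Y) X) = cscale (- \<beta> T * \<kappa> Y (proj (- \<beta>) Z)) X" for Y Z
    proof -
      define H where "H = bc (proj (- \<beta>) Z) (proj \<beta> Y)"
      have H: "H \<in> h" using bc_rs[OF proj_rs proj_rs, of "- \<beta>" Z \<beta> Y] rs_0 by (simp add: H_def)
      have "rc (proj (- \<beta>) Z) (rc (proj \<beta> Y) X) = rc H X"
        using rc_bc[OF g XQ, of Z Y] by (simp add: z rc_simps H_def)
      also have "\<dots> = cscale (\<mu> H) X" by (rule wt[OF H])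
      also have "\<mu> H = \<kappa> H T" using T(2)[OF H] \<kappa>_sym by simp
      also have "\<dots> = (- \<beta>) T * \<kappa> (proj (- \<beta>) Z) (proj \<beta> Y)"
        unfolding H_def by (rule \<kappa>_bracket[where \<alpha>="- \<beta>"]) (simp_all only: minus_minus proj_rs T(1))
      also have "\<kappa> (proj (- \<beta>) Z) (proj \<beta> Y) = \<kappa> Y (proj (- \<beta>) Z)"
        using \<kappa>_proj[of "- \<beta>" "proj (- \<beta>) Z" Y] \<kappa>_sym[of Y] by (simp add: proj_proj)
      finally show ?thesis unfolding uminus_apply .
    qed
    then have "t (- \<beta>) = (\<Sum>b\<in>Basis. cscale (- \<beta> T * coord b (proj (- \<beta>) (b, 0))) X)"
      by (simp only: t_def minus_minus \<kappa>_killing_dual)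
    \<comment> \<open>The diagonal coordinates of the weight projection add up to its trace, the
      root multiplicity.\<close>
    also have "\<dots> = cscale (- \<beta> T * root_mult (- \<beta>)) X"
      by (simp only: root_mult_def ctrace_def sum_distrib_left C.scale_sum_left)
    finally show ?thesis using root_mult_eq_1[of "- \<beta>"] \<beta>' Wt_minus by simp
  qed
  have fin: "finite Phi0" using finite_\<Phi> by (simp add: Phi0_def)
  have split: "W0 = insert 0 (Phi0 \<union> uminus ` Phi0)"
  proof (intro equalityI subsetI)
    fix \<alpha> assume \<alpha>: "\<alpha> \<in> W0"
    show "\<alpha> \<in> insert 0 (Phi0 \<union> uminus ` Phi0)"
    proof (cases "\<alpha> = 0 \<or> \<alpha> \<in> \<Phi>")
      case True then show ?thesis using \<alpha> by (auto simp: W0_def Phi0_def)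
    next
      case False
      then have "- \<alpha> \<in> Phi0" using \<alpha> \<Phi>_minus[of \<alpha>] by (simp add: W0_def Phi0_def)
      then have "- (- \<alpha>) \<in> uminus ` Phi0" by (rule imageI)
      then show ?thesis by simp
    qed
  next
    fix \<alpha> assume "\<alpha> \<in> insert 0 (Phi0 \<union> uminus ` Phi0)"
    then show "\<alpha> \<in> W0" using zero_Wt \<Phi>_Wt(1) Wt_minus by (auto simp: W0_def Phi0_def)
  qed
  have disj: "Phi0 \<inter> uminus ` Phi0 = {}" "0 \<notin> Phi0 \<union> uminus ` Phi0"
    using \<Phi>_minus \<Phi>_Wt by (auto simp: Phi0_def)
  have "(\<Sum>\<alpha>\<in>W0. t \<alpha>) = t 0 + ((\<Sum>\<alpha>\<in>Phi0. t \<alpha>) + (\<Sum>\<alpha>\<in>uminus ` Phi0. t \<alpha>))"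
    unfolding split using fin disj by (simp add: sum.union_disjoint)
  also have "(\<Sum>\<alpha>\<in>uminus ` Phi0. t \<alpha>) = (\<Sum>\<beta>\<in>Phi0. cscale (- \<beta> T) X)"
    by (simp add: sum.reindex tneg)
  finally show ?thesis
    using t0 by (simp add: C1 tpos C.scale_left_diff_distrib C.scale_sum_left sum_negf zero_fun_def flip: T_def)
qed

end

section \<open>Values of weights, shifts along the grading element, and invariance of dual
  bases\<close>

context graded_cartan begin

definition wt_value :: "('a \<times> 'a \<Rightarrow> complex) \<Rightarrow> real" where
  "wt_value \<nu> = weight_inner br h \<nu> (\<lambda>H. \<nu> H + 2 * half_sum \<Phi> H)"

text \<open>Evaluating \<open>two_half_sum\<close> at the dual of \<nu> turns the contribution of
  the roots of grade 1 into \<nu>(E) / 2.\<close>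

lemma wt_value_eq:
  assumes \<nu>: "\<nu> \<in> cdual h"
  shows "wt_value \<nu> = Re (\<nu> (weight_dual br h \<nu>) + (\<Sum>\<beta>\<in>Phi0. \<beta> (weight_dual br h \<nu>)) + \<nu> Ec / 2)"
proof -
  let ?T = "weight_dual br h \<nu>"
  have T: "?T \<in> h" using weight_dual_h[OF \<nu>] .
  have "(\<lambda>H. \<Sum>\<alpha>\<in>\<Phi>. \<alpha> H) \<in> cdual h" using Wt_cdual \<Phi>_Wt(1) by (intro cdual_sum) blast
  then have "(\<lambda>H. 2 * half_sum \<Phi> H) \<in> cdual h" by (simp add: half_sum_def)
  from cdual_add[OF \<nu> this] have "(\<lambda>H. \<nu> H + 2 * half_sum \<Phi> H) \<in> cdual h" by (simp add: plus_fun_def)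
  then have "wt_value \<nu> = Re (\<nu> ?T + 2 * half_sum \<Phi> ?T)" by (simp only: wt_value_def weight_inner_eq[OF \<nu>])
  also have "2 * half_sum \<Phi> ?T = (\<Sum>\<beta>\<in>Phi0. \<beta> ?T) + \<nu> Ec / 2"
    using two_half_sum[OF T] \<kappa>_weight_dual[OF \<nu> Ec_h] \<kappa>_sym[of Ec ?T] by simp
  finally show ?thesis by (simp add: add.assoc)
qed

lemma weight_dual_eqI:
  assumes "\<nu> \<in> cdual h" "T \<in> h" "\<And>H. H \<in> h \<Longrightarrow> \<kappa> T H = \<nu> H"
  shows "weight_dual br h \<nu> = T"
  unfolding weight_dual_def by (rule the1_equality[OF weight_dual_ex1[OF assms(1)]]) (use assms in blast)

lemma cdual_minus_arg: "\<beta> \<in> cdual h \<Longrightarrow> T \<in> h \<Longrightarrow> \<beta> (- T) = - \<beta> T"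
proof -
  assume *: "\<beta> \<in> cdual h" "T \<in> h"
  then have "\<beta> (cscale (-1) T) = (-1) * \<beta> T" unfolding cdual_def by blast
  then show ?thesis by (simp only: cscale_numeral_minus_1) simp
qed

lemma Phi0_cdual: "\<beta> \<in> Phi0 \<Longrightarrow> \<beta> \<in> cdual h" 
  using \<Phi>_Wt(1) Wt_cdual by (simp add: Phi0_def)

lemma weight_dual_uminus:
  assumes \<nu>: "\<nu> \<in> cdual h"
  shows "weight_dual br h (- \<nu>) = - weight_dual br h \<nu>"
proof (rule weight_dual_eqI[OF cdual_minus[OF \<nu>]])
  show "- weight_dual br h \<nu> \<in> h"
    by (rule subspace_neg[OF csubspaceD(1)[OF csubspace_h] weight_dual_h[OF \<nu>]])
  show "\<kappa> (- weight_dual br h \<nu>) H = (- \<nu>) H" if "H \<in> h" for H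
    using \<kappa>_weight_dual[OF \<nu> that] by (simp add: \<kappa>_minus)
qed

text \<open>The effect of a twist by a density character on a weight: the derivative of such a
  character is a multiple of \<kappa>(E, H). The value 0 off \<open>h\<close> keeps the result in
  \<open>cdual h\<close>.\<close>

definition wt_shift :: "real \<Rightarrow> ('a \<times> 'a \<Rightarrow> complex) \<Rightarrow> 'a \<times> 'a \<Rightarrow> complex" where
  "wt_shift s \<nu> H = (if H \<in> h then \<nu> H + of_real s * \<kappa> Ec H else 0)"

lemma wt_shift_cdual: "\<nu> \<in> cdual h \<Longrightarrow> wt_shift s \<nu> \<in> cdual h"
  using csubspaceD(3,5)[OF csubspace_h]
  by (simp add: cdual_def wt_shift_def \<kappa>_add \<kappa>_cscale algebra_simps)

text \<open>The dual of the shifted weight moves by s E. The roots in \<open>Phi0\<close> vanish on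
  E, so their sum stays fixed; the norm contributes 2 s \<nu>(E) + s^2 \<kappa>(E, E), and the
  summand \<nu>(E) / 2 contributes s \<kappa>(E, E) / 2.\<close>

lemma wt_value_shift:
  assumes \<nu>: "\<nu> \<in> cdual h"
  shows "wt_value (wt_shift s \<nu>) = wt_value \<nu> + 2 * s * Re (\<nu> Ec) + (s\<^sup>2 + s / 2) * Re (\<kappa> Ec Ec)"
proof -
  let ?T = "weight_dual br h \<nu>"
  let ?sE = "cscale (of_real s) Ec"
  have T: "?T \<in> h" using weight_dual_h[OF \<nu>] .
  have sE: "?sE \<in> h" using csubspaceD(5)[OF csubspace_h Ec_h] .
  have T': "weight_dual br h (wt_shift s \<nu>) = ?T + ?sE"
    using csubspaceD(3)[OF csubspace_h T sE] \<kappa>_weight_dual[OF \<nu>]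
    by (intro weight_dual_eqI[OF wt_shift_cdual[OF \<nu>]]) (simp_all add: \<kappa>_add \<kappa>_cscale wt_shift_def)
  have add: "\<beta> (?T + ?sE) = \<beta> ?T + of_real s * \<beta> Ec" if "\<beta> \<in> cdual h" for \<beta>
    using that T sE Ec_h unfolding cdual_def by simp
  have "(\<Sum>\<beta>\<in>Phi0. \<beta> (?T + ?sE)) = (\<Sum>\<beta>\<in>Phi0. \<beta> ?T)"
  proof (rule sum.cong[OF refl])
    fix \<beta> assume \<beta>: "\<beta> \<in> Phi0"
    then have "\<beta> Ec = 0" by (simp add: Phi0_def)
    then show "\<beta> (?T + ?sE) = \<beta> ?T" by (simp add: add[OF Phi0_cdual[OF \<beta>]])
  qed
  moreover have "\<kappa> Ec ?T = \<nu> Ec" using \<kappa>_weight_dual[OF \<nu> Ec_h] \<kappa>_sym[of Ec ?T] by simp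
  then have "wt_shift s \<nu> (?T + ?sE) = \<nu> ?T + 2 * of_real s * \<nu> Ec + of_real (s\<^sup>2) * \<kappa> Ec Ec"
    using csubspaceD(3)[OF csubspace_h T sE]
    by (simp add: wt_shift_def add[OF \<nu>] \<kappa>_add \<kappa>_cscale algebra_simps power2_eq_square)
  moreover have "wt_shift s \<nu> Ec = \<nu> Ec + of_real s * \<kappa> Ec Ec" using Ec_h by (simp add: wt_shift_def)
  ultimately show ?thesis
    unfolding wt_value_eq[OF \<nu>] wt_value_eq[OF wt_shift_cdual[OF \<nu>]] T'
    by (simp add: algebra_simps add_divide_distrib del: of_real_power)
qed

lemma killing_dual_expand_real: "(\<Sum>b\<in>Basis. killing br x b *\<^sub>R killing_dual b) = x"
proof -
  have "(\<Sum>b\<in>Basis. cscale (\<kappa> (x, 0) (b, 0)) (killing_dual b, 0)) = (\<Sum>b\<in>Basis. (killing br x b *\<^sub>R killing_dual b, 0))"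
    by (simp add: \<kappa>_real cscale_def)
  then have "(x, 0 :: 'a) = (\<Sum>b\<in>Basis. killing br x b *\<^sub>R killing_dual b, 0)" by (simp add: killing_dual_expand sum_prod)
  then show ?thesis by simp
qed

text \<open>A Killing isometry carries one pair of dual bases to another, and the canonical element
  does not depend on the pair.\<close>

lemma canonical_invariant:
  fixes \<Psi> :: "'a \<Rightarrow> 'a \<Rightarrow> 'y::real_vector"
  assumes \<Psi>: "bilinear \<Psi>" and a: "linear a" "\<And>x y. killing br (a x) (a y) = killing br x y"
  shows "(\<Sum>b\<in>Basis. \<Psi> (a b) (a (killing_dual b))) = (\<Sum>b\<in>Basis. \<Psi> b (killing_dual b))"
proof -
  have l: "linear (\<Psi> x)" "linear (\<lambda>x. \<Psi> x y)" for x y using \<Psi> by (simp_all add: bilinear_def)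
  have "x = 0" if "a x = 0" for x
  proof (rule killing_nondegenerate)
    show "killing br x y = 0" for y using a(2)[of x y] that by (simp add: bilinear_lzero[OF bilinear_killing])
  qed
  then have surj: "surj a" using a(1) by (intro linear_injective_imp_surjective) (auto simp: linear_injective_0)
  have "\<Psi> (a b) (a (killing_dual b)) = (\<Sum>c\<in>Basis. killing br (killing_dual c) (a b) *\<^sub>R \<Psi> c (a (killing_dual b)))" for b
  proof -
    have "\<Psi> (a b) (a (killing_dual b)) = \<Psi> (\<Sum>c\<in>Basis. (a b \<bullet> c) *\<^sub>R c) (a (killing_dual b))" by (simp only: euclidean_representation)
    then show ?thesis by (simp only: linear_sum[OF l(2)] linear_scale[OF l(2)] killing_killing_dual inner_commute)
  qed
  then have "(\<Sum>b\<in>Basis. \<Psi> (a b) (a (killing_dual b))) = (\<Sum>c\<in>Basis. \<Sum>b\<in>Basis. killing br (killing_dual c) (a b) *\<^sub>R \<Psi> c (a (killing_dual b)))"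
    by (simp only:) (rule sum.swap)
  also have "\<dots> = (\<Sum>c\<in>Basis. \<Psi> c (killing_dual c))"
  proof (rule sum.cong[OF refl])
    fix c
    obtain u where u: "killing_dual c = a u" using surjD[OF surj] by blast
    have "(\<Sum>b\<in>Basis. killing br (killing_dual c) (a b) *\<^sub>R \<Psi> c (a (killing_dual b))) = \<Psi> c (a (\<Sum>b\<in>Basis. killing br u b *\<^sub>R killing_dual b))"
      by (simp only: u a(2) linear_sum[OF a(1)] linear_scale[OF a(1)] linear_sum[OF l(1)] linear_scale[OF l(1)])
    then show "(\<Sum>b\<in>Basis. killing br (killing_dual c) (a b) *\<^sub>R \<Psi> c (a (killing_dual b))) = \<Psi> c (killing_dual c)"
      by (simp only: killing_dual_expand_real u)
  qed
  finally show ?thesis .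
qed

end

section \<open>Symmetries of the Casimir operator and the real part of its eigenvalues\<close>

context casimir_rep begin

lemma linear_Cas: "linear Cas"
proof -
  have "linear (r x)" for x using bilinear_r by (simp add: bilinear_def)
  then show ?thesis unfolding Cas_def
    by (intro linear_compose_sum ballI) (use linear_compose in \<open>auto simp: o_def\<close>)
qed

lemma Cas_Q: "q \<in> Q \<Longrightarrow> Cas q \<in> Q"
  unfolding Cas_def by (intro subspace_sum[OF subspace_Q] r_Q grade_proj_gr)

text \<open>Passing from the lowest weight to its negative \<nu> leaves the norm unchanged and
  reverses the sign of the root sum. The Casimir eigenvalue thus differs from the value of \<nu>
  only by the part \<nu>(E) / 2 that stems from grade 1.\<close>

lemma lowest_value:
  assumes X: "lowest X (- \<nu>)"
  shows "\<exists>c. CasC X = cscale c X \<and> wt_value \<nu> = Re c + Re (\<nu> Ec) / 2"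
proof -
  have m: "- \<nu> \<in> cdual h" using X by (simp add: lowest_def)
  have \<nu>: "\<nu> \<in> cdual h" using cdual_minus[OF m] by simp
  let ?T = "weight_dual br h \<nu>"
  have T: "?T \<in> h" using weight_dual_h[OF \<nu>] .
  have "(- \<nu>) (- ?T) = \<nu> ?T" by (simp add: cdual_minus_arg[OF \<nu> T])
  moreover have "(\<Sum>\<beta>\<in>Phi0. \<beta> (- ?T)) = - (\<Sum>\<beta>\<in>Phi0. \<beta> ?T)"
    unfolding sum_negf[symmetric] by (intro sum.cong refl cdual_minus_arg[OF Phi0_cdual T])
  ultimately have "CasC X = cscale (\<nu> ?T + (\<Sum>\<beta>\<in>Phi0. \<beta> ?T)) X"
    using CasC_lowest[OF X] unfolding weight_dual_uminus[OF \<nu>] by simp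
  then show ?thesis
    by (intro exI[of _ "\<nu> ?T + (\<Sum>\<beta>\<in>Phi0. \<beta> ?T)"]) (simp add: wt_value_eq[OF \<nu>])
qed

text \<open>\<open>T\<close> intertwines the action only up to the map \<open>a\<close> of the Lie
  algebra, in the application \<open>Ad K g\<close>; \<open>canonical_invariant\<close> absorbs
  \<open>a\<close>.\<close>

lemma Cas_commute:
  assumes T: "linear T" "\<And>q. q \<in> Q \<Longrightarrow> T q \<in> Q"
    and a: "linear a" "\<And>x y. killing br (a x) (a y) = killing br x y" "\<And>x. grade_proj 0 (a x) = a (grade_proj 0 x)"
    and eq: "\<And>x q. x \<in> gr 0 \<Longrightarrow> q \<in> Q \<Longrightarrow> T (r x q) = r (a x) (T q)"
    and q: "q \<in> Q"
  shows "T (Cas q) = Cas (T q)"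
proof -
  have "T (Cas q) = (\<Sum>b\<in>Basis. r (grade_proj 0 (a b)) (r (grade_proj 0 (a (killing_dual b))) (T q)))"
    unfolding Cas_def linear_sum[OF T(1)]
    by (intro sum.cong refl) (simp add: eq grade_proj_gr r_Q q a(3))
  also have "\<dots> = Cas (T q)"
    unfolding Cas_def
    by (rule canonical_invariant[where \<Psi>="\<lambda>x y. r (grade_proj 0 x) (r (grade_proj 0 y) (T q))", OF _ a(1,2)])
      (simp add: bilinear_def linear_iff linear_add[OF linear_grade_proj] linear_scale[OF linear_grade_proj]
        r_simps bilinear_lmul[OF bilinear_r] bilinear_rmul[OF bilinear_r])
  finally show ?thesis .
qed

text \<open>Schur's lemma for the real operator \<open>Cas\<close>: if \<open>c\<close> is an eigenvalue on the complexification, then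
  \<open>Cas\<^sup>2 - 2 Re c Cas + \<bar>c\<bar>\<^sup>2\<close> vanishes, so \<open>c\<close> and its conjugate are the only eigenvalues.\<close>

lemma Re_eigenvalue_unique:
  assumes schur: "\<And>U. subspace U \<Longrightarrow> U \<subseteq> Q \<Longrightarrow> (\<forall>T\<in>\<T>. \<forall>u\<in>U. T u \<in> U) \<Longrightarrow> U = {0} \<or> U = Q"
    and \<T>: "\<And>T. T \<in> \<T> \<Longrightarrow> linear T" "\<And>T q. T \<in> \<T> \<Longrightarrow> q \<in> Q \<Longrightarrow> T q \<in> Q"
      "\<And>T q. T \<in> \<T> \<Longrightarrow> q \<in> Q \<Longrightarrow> T (Cas q) = Cas (T q)"
    and X: "X \<in> Q \<times> Q" "X \<noteq> 0" "CasC X = cscale c X"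
    and Y: "Y \<in> Q \<times> Q" "Y \<noteq> 0" "CasC Y = cscale d Y"
  shows "Re c = Re d"
proof -
  define N where "N q = Cas (Cas q) - (2 * Re c) *\<^sub>R Cas q + (cmod c)\<^sup>2 *\<^sub>R q" for q
  have lin: "linear N"
    by (simp add: N_def linear_iff linear_add[OF linear_Cas] linear_scale[OF linear_Cas] algebra_simps)
  define U where "U = {q\<in>Q. N q = 0}"
  have U: "U = {0} \<or> U = Q"
  proof (rule schur)
    show "subspace U" unfolding U_def subspace_def
      using subspace_0[OF subspace_Q] subspace_add[OF subspace_Q] subspace_scale[OF subspace_Q]
      by (simp add: linear_0[OF lin] linear_add[OF lin] linear_scale[OF lin])
    show "U \<subseteq> Q" by (auto simp: U_def)
    show "\<forall>T\<in>\<T>. \<forall>u\<in>U. T u \<in> U"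
    proof (intro ballI)
      fix T u assume T: "T \<in> \<T>" and u: "u \<in> U"
      have uQ: "u \<in> Q" "N u = 0" using u by (simp_all add: U_def)
      have "N (T u) = T (N u)"
        by (simp add: N_def \<T>(3)[OF T] uQ Cas_Q linear_add[OF \<T>(1)[OF T]] linear_diff[OF \<T>(1)[OF T]]
            linear_scale[OF \<T>(1)[OF T]] flip: \<T>(3)[OF T])
      then show "T u \<in> U" using \<T>(2)[OF T uQ(1)] uQ(2) linear_0[OF \<T>(1)[OF T]] by (simp add: U_def)
    qed
  qed
  have NC: "(N (fst Z), N (snd Z)) = cscale (e\<^sup>2 - 2 * of_real (Re c) * e + of_real ((cmod c)\<^sup>2)) Z"
    if "CasC Z = cscale e Z" for Z e
  proof -
    have "(N (fst Z), N (snd Z)) = CasC (CasC Z) - cscale (of_real (2 * Re c)) (CasC Z) + cscale (of_real ((cmod c)\<^sup>2)) Z"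
      unfolding cscale_of_real by (simp add: N_def CasC_eq prod_eq_iff)
    then show ?thesis
      by (simp add: that clinear_cscale[OF clinear_CasC] C.scale_left_distrib C.scale_left_diff_distrib power2_eq_square)
  qed
  have factor: "e\<^sup>2 - 2 * of_real (Re c) * e + of_real ((cmod c)\<^sup>2) = (e - c) * (e - cnj c)" for e
  proof -
    have "2 * of_real (Re c) = c + cnj c" by (simp add: complex_add_cnj)
    then show ?thesis by (simp only: complex_norm_square) (simp add: algebra_simps power2_eq_square)
  qed
  have "(N (fst X), N (snd X)) = 0" using NC[OF X(3)] unfolding factor by simp
  then have "N (fst X) = 0" "N (snd X) = 0" by (simp_all add: prod_eq_iff)
  then have "fst X \<in> U" "snd X \<in> U" using X(1) by (simp_all add: U_def mem_Times_iff)
  moreover have "fst X \<noteq> 0 \<or> snd X \<noteq> 0" using X(2) by (simp add: prod_eq_iff)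
  ultimately have "U = Q" using U by blast
  then have "fst Y \<in> U" "snd Y \<in> U" using Y(1) by (simp_all add: mem_Times_iff)
  then have "(N (fst Y), N (snd Y)) = 0" by (simp add: U_def zero_prod_def)
  then have "(d - c) * (d - cnj c) = 0" using NC[OF Y(3)] Y(2) unfolding factor by simp
  then have "d = c \<or> d = cnj c" by simp
  then show ?thesis by auto
qed

end

section \<open>The grading element in the group, the Levi projection, and derivatives at the
  unit\<close>

context lie_pair begin

sublocale L: graded_cartan br "cartan K" gr "posroots K"
  using setting by unfold_locales (auto simp: graded_pair_setting_def)

abbreviation "grade_proj \<equiv> L.grade_proj"
abbreviation "E \<equiv> L.E"

lemma grade_proj_Ad:
  assumes g: "g \<in> G0 K"
  shows "grade_proj i (Ad K g x) = Ad K g (grade_proj i x)"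
proof -
  have lin: "linear (Ad K g)" using linear_Ad G0_carrier g by blast
  have "Ad K g x = Ad K g (grade_proj (-1) x + grade_proj 0 x + grade_proj 1 x)" by (simp only: L.grade_proj_sum)
  then have "Ad K g x = Ad K g (grade_proj (-1) x) + Ad K g (grade_proj 0 x) + Ad K g (grade_proj 1 x)"
    by (simp only: linear_add[OF lin])
  note u = L.grade_proj_unique[OF Ad_G0[OF g L.grade_proj_gr] Ad_G0[OF g L.grade_proj_gr] Ad_G0[OF g L.grade_proj_gr] this]
  consider "i = -1" | "i = 0" | "i = 1" | "i \<notin> {-1, 0, 1}" by blast
  then show ?thesis by cases (use u L.grade_proj_out linear_0[OF lin] in simp_all)
qed

text \<open>\<open>E\<close> is determined by ad E = D because the center is trivial, and
  \<open>Ad K g\<close> commutes with \<open>D\<close> when \<open>g\<close> preserves the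
  grading.\<close>

lemma Ad_E:
  assumes g: "g \<in> G0 K" shows "Ad K g E = E"
proof -
  have gc: "g \<in> carrier G" using G0_carrier g by blast
  have lin: "linear (Ad K g)" using linear_Ad gc by blast
  have "br (Ad K g E - E) z = 0" for z
  proof -
    define y where "y = Ad K (inv\<^bsub>G\<^esub> g) z"
    have z: "z = Ad K g y" by (simp add: y_def Ad_inv gc)
    have "br (Ad K g E) z = Ad K g (L.D y)" by (simp add: z L.br_E flip: Ad_br[OF gc])
    also have "\<dots> = L.D z" by (simp add: L.D_def grade_proj_Ad[OF g] linear_diff[OF lin] z)
    also have "\<dots> = br E z" by (simp add: L.br_E)
    finally show ?thesis by (simp add: L.br_simps)
  qed
  then have "Ad K g E - E = 0" by (rule L.center_trivial_real)
  then show ?thesis by simp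
qed

lemma killing_Ad:
  assumes g: "g \<in> carrier G"
  shows "killing br (Ad K g x) (Ad K g y) = killing br x y"
proof -
  have lin: "linear (Ad K g)" "linear (Ad K (inv\<^bsub>G\<^esub> g))" "linear (br x)" for x
    using linear_Ad g br_linear_right by auto
  have "br (Ad K g x) (br (Ad K g y) z) = Ad K g (br x (br y (Ad K (inv\<^bsub>G\<^esub> g) z)))" for z
    by (simp add: Ad_br[OF g] Ad_inv[OF g])
  then have "killing br (Ad K g x) (Ad K g y) = trace_of (\<lambda>z. Ad K g (br x (br y (Ad K (inv\<^bsub>G\<^esub> g) z))))"
    by (simp add: killing_def)
  also have "\<dots> = trace_of (\<lambda>z. br x (br y (Ad K (inv\<^bsub>G\<^esub> g) (Ad K g z))))"
    using linear_compose[OF lin(2) linear_compose[OF lin(3)[of y] lin(3)[of x]]]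
    by (intro trace_of_commute[OF lin(1)]) (simp add: o_def)
  finally show ?thesis by (simp add: Ad_inv[OF g] killing_def)
qed

lemma expo_E_commute:
  assumes g: "g \<in> G0 K"
  shows "expo K (t *\<^sub>R E) \<otimes>\<^bsub>G\<^esub> g = g \<otimes>\<^bsub>G\<^esub> expo K (t *\<^sub>R E)"
proof -
  have gc: "g \<in> carrier G" using G0_carrier g by blast
  have "g \<otimes>\<^bsub>G\<^esub> expo K (t *\<^sub>R E) \<otimes>\<^bsub>G\<^esub> inv\<^bsub>G\<^esub> g = expo K (t *\<^sub>R E)"
    using expo_conj[OF gc, of t E] by (simp only: Ad_E[OF g])
  then have "expo K (t *\<^sub>R E) \<otimes>\<^bsub>G\<^esub> g = g \<otimes>\<^bsub>G\<^esub> expo K (t *\<^sub>R E) \<otimes>\<^bsub>G\<^esub> inv\<^bsub>G\<^esub> g \<otimes>\<^bsub>G\<^esub> g" by simp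
  also have "\<dots> = g \<otimes>\<^bsub>G\<^esub> expo K (t *\<^sub>R E)" using gc expo_carrier by (simp add: m_assoc)
  finally show ?thesis .
qed

lemma expo_scale_G0: "x \<in> gr 0 \<Longrightarrow> expo K (t *\<^sub>R x) \<in> G0 K"
  by (intro expo_G0 subspace_scale[OF subspace_gr])

lemma expo_E_center: "expo K (t *\<^sub>R E) \<in> center_G0 K"
  using expo_scale_G0[OF L.E_gr0] expo_E_commute by (simp add: center_G0_def)

text \<open>Since [z, E] = - z and [z, z] = 0, the curve E - s z solves the same linear equation as
  Ad(exp(s z)) E, with the same start.\<close>

lemma Ad_expo_E:
  assumes z: "z \<in> gr 1" shows "Ad K (expo K z) E = E - z"
proof -
  define w where "w s = Ad K (expo K (s *\<^sub>R z)) E - (E - s *\<^sub>R z)" for s :: real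
  have brzE: "br z E = - z" using L.br_E_gr[OF z] L.br_antisym[of z E] by simp
  have wd: "(w has_vector_derivative br z (w s)) (at s)" for s
  proof -
    have eq: "br z (w s) = br z (Ad K (expo K (s *\<^sub>R z)) E) - (0 - z)"
      by (simp add: w_def L.br_simps brzE L.br_self)
    have d: "((\<lambda>s. E - s *\<^sub>R z) has_vector_derivative 0 - z) (at s)"
      by (auto intro!: derivative_eq_intros)
    show ?thesis
      unfolding eq unfolding w_def by (rule has_vector_derivative_diff[OF Ad_expo_deriv d])
  qed
  have w0: "w 0 = 0" by (simp add: w_def expo_0 Ad_one)
  have "w 1 = 0" by (rule linear_ode_zero[OF br_linear_right wd w0])
  then show ?thesis by (simp add: w_def)
qed

text \<open>Uniqueness of the factorization: an element exp(z) of \<open>G0\<close> fixes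
  \<open>E\<close>, but moves it to E - z, so z = 0.\<close>

lemma levi_part_G0:
  assumes g: "g \<in> G0 K" shows "levi_part K g = g"
  unfolding levi_part_def
proof (rule the_equality)
  have gc: "g \<in> carrier G" using G0_carrier g by blast
  show "g \<in> G0 K \<and> (\<exists>z\<in>gr 1. g = g \<otimes>\<^bsub>G\<^esub> expo K z)"
    using g gc subspace_0[OF subspace_gr] by (intro conjI bexI[of _ 0]) (simp_all add: expo_0)
  fix g' assume g': "g' \<in> G0 K \<and> (\<exists>z\<in>gr 1. g = g' \<otimes>\<^bsub>G\<^esub> expo K z)"
  then obtain z where z: "z \<in> gr 1" "g = g' \<otimes>\<^bsub>G\<^esub> expo K z" by blast
  have gc': "g' \<in> carrier G" using G0_carrier g' by blast
  have "inv\<^bsub>G\<^esub> g' \<otimes>\<^bsub>G\<^esub> g = expo K z"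
    using z(2) gc' expo_carrier[of z] by (simp flip: m_assoc)
  then have "expo K z \<in> G0 K" using mult_G0[OF inv_G0 g] g' by metis
  then have "E - z = E" using Ad_expo_E[OF z(1)] Ad_E by simp
  then have "z = 0" by simp
  then show "g' = g" using z(2) gc' by (simp add: expo_0)
qed

text \<open>Besides the derivatives along exp(t x) this records that they are linear in
  \<open>x\<close>, which their existence alone would not give. Linearity of the infinitesimal
  action rests on it.\<close>

definition diff_at_1 :: "('g \<Rightarrow> 'b::real_normed_vector) \<Rightarrow> bool" where
  "diff_at_1 f \<longleftrightarrow> (\<exists>D. linear D \<and>
     (\<forall>x\<in>gr 0. ((\<lambda>t. f (expo K (t *\<^sub>R x))) has_vector_derivative D x) (at 0)))"

lemma diff_at_1_const: "diff_at_1 (\<lambda>g. c)"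
  unfolding diff_at_1_def by (intro exI[of _ "\<lambda>x. 0"]) (simp add: linear_zero)

lemma diff_at_1_bounded_bilinear:
  assumes B: "bounded_bilinear B" and "diff_at_1 f" "diff_at_1 f'"
  shows "diff_at_1 (\<lambda>g. B (f g) (f' g))"
proof -
  obtain D where D: "linear D" "\<And>x. x \<in> gr 0 \<Longrightarrow> ((\<lambda>t. f (expo K (t *\<^sub>R x))) has_vector_derivative D x) (at 0)"
    using assms(2) unfolding diff_at_1_def by blast
  obtain D' where D': "linear D'" "\<And>x. x \<in> gr 0 \<Longrightarrow> ((\<lambda>t. f' (expo K (t *\<^sub>R x))) has_vector_derivative D' x) (at 0)"
    using assms(3) unfolding diff_at_1_def by blast
  have "linear (\<lambda>x. B (f \<one>\<^bsub>G\<^esub>) (D' x) + B (D x) (f' \<one>\<^bsub>G\<^esub>))"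
    using D(1) D'(1) by (simp add: linear_iff bounded_bilinear.add_left[OF B] bounded_bilinear.add_right[OF B]
        bounded_bilinear.scaleR_left[OF B] bounded_bilinear.scaleR_right[OF B] algebra_simps)
  moreover have "((\<lambda>t. B (f (expo K (t *\<^sub>R x))) (f' (expo K (t *\<^sub>R x)))) has_vector_derivative
      B (f \<one>\<^bsub>G\<^esub>) (D' x) + B (D x) (f' \<one>\<^bsub>G\<^esub>)) (at 0)" if "x \<in> gr 0" for x
    using bounded_bilinear.has_vector_derivative[OF B D(2)[OF that] D'(2)[OF that]] by (simp add: expo_0)
  ultimately show ?thesis unfolding diff_at_1_def by blast
qed

lemma diff_at_1_add:
  assumes "diff_at_1 f" "diff_at_1 f'"
  shows "diff_at_1 (\<lambda>g. f g + f' g)"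
proof -
  obtain D where D: "linear D" "\<And>x. x \<in> gr 0 \<Longrightarrow> ((\<lambda>t. f (expo K (t *\<^sub>R x))) has_vector_derivative D x) (at 0)"
    using assms(1) unfolding diff_at_1_def by blast
  obtain D' where D': "linear D'" "\<And>x. x \<in> gr 0 \<Longrightarrow> ((\<lambda>t. f' (expo K (t *\<^sub>R x))) has_vector_derivative D' x) (at 0)"
    using assms(2) unfolding diff_at_1_def by blast
  show ?thesis
    unfolding diff_at_1_def
    by (intro exI[of _ "\<lambda>x. D x + D' x"]) (simp add: linear_compose_add D(1) D'(1) has_vector_derivative_add D(2) D'(2))
qed

lemma diff_at_1_bounded_linear:
  assumes "bounded_linear L" "diff_at_1 f"
  shows "diff_at_1 (\<lambda>g. L (f g))"
proof -
  obtain D where D: "linear D" "\<And>x. x \<in> gr 0 \<Longrightarrow> ((\<lambda>t. f (expo K (t *\<^sub>R x))) has_vector_derivative D x) (at 0)"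
    using assms(2) unfolding diff_at_1_def by blast
  have "linear (\<lambda>x. L (D x))"
    using linear_compose[OF D(1) bounded_linear.linear[OF assms(1)]] by (simp add: o_def)
  then show ?thesis
    unfolding diff_at_1_def using bounded_linear.has_vector_derivative[OF assms(1) D(2)] by blast
qed

lemma diff_at_1_inv:
  assumes "diff_at_1 f"
  shows "diff_at_1 (\<lambda>g. f (inv\<^bsub>G\<^esub> g))"
proof -
  obtain D where D: "linear D" "\<And>x. x \<in> gr 0 \<Longrightarrow> ((\<lambda>t. f (expo K (t *\<^sub>R x))) has_vector_derivative D x) (at 0)"
    using assms unfolding diff_at_1_def by blast
  have "((\<lambda>t. f (inv\<^bsub>G\<^esub> expo K (t *\<^sub>R x))) has_vector_derivative - D x) (at 0)" if "x \<in> gr 0" for x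
    using D(2)[OF subspace_neg[OF subspace_gr that]]
    by (simp add: linear_neg[OF D(1)] flip: expo_minus)
  then show ?thesis
    unfolding diff_at_1_def using linear_compose_neg[OF D(1)] by blast
qed

lemma diff_at_1_Ad: "diff_at_1 (\<lambda>g. Ad K g y)"
  unfolding diff_at_1_def using Ad_expo_deriv_0 br_linear_left by blast

text \<open>The chart that witnesses smoothness at the unit may differ from \<open>chart1\<close>.
  \<open>M\<close> is the derivative of the change of charts, so the derivative in direction
  \<open>x\<close> is \<open>F' (M x)\<close>, linear in \<open>x\<close>.\<close>

lemma diff_at_1_smooth:
  assumes "smooth_on_subset (charts K) (G0 K) f"
  shows "diff_at_1 f"
proof -
  have "\<forall>g\<in>G0 K. \<exists>c\<in>charts K. \<exists>N F. g \<in> fst c \<and> open N \<and> snd c g \<in> N \<and>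
     N \<subseteq> snd c ` fst c \<and> smooth_on N F \<and> (\<forall>x\<in>G0 K \<inter> fst c. snd c x \<in> N \<longrightarrow> F (snd c x) = f x)"
    using assms by (simp add: smooth_on_subset_def case_prod_beta)
  from bspec[OF this one_G0] obtain c N F where c: "c \<in> charts K" "\<one>\<^bsub>G\<^esub> \<in> fst c" "open N" "snd c \<one>\<^bsub>G\<^esub> \<in> N"
    "smooth_on N F" "\<forall>x\<in>G0 K \<inter> fst c. snd c x \<in> N \<longrightarrow> F (snd c x) = f x" by blast
  define U \<phi> where "U = fst c" and "\<phi> = snd c"
  have U: "(U, \<phi>) \<in> charts K" "\<one>\<^bsub>G\<^esub> \<in> U" using c by (simp_all add: U_def \<phi>_def)
  obtain F' where F': "(F has_derivative F') (at (\<phi> \<one>\<^bsub>G\<^esub>))"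
    using smooth_on_imp_has_derivative[OF c(5,4)] \<phi>_def by blast
  obtain M where M: "((\<lambda>u. \<phi> (param_at_1 K u)) has_derivative M) (at e1)"
    using smooth_into_differentiable[OF smooth_into_param param_e1(2) U(1)] U(2) param_e1(1) by metis
  have lin: "linear (\<lambda>x. F' (M x))"
    using linear_compose[OF has_derivative_linear[OF M] has_derivative_linear[OF F']] by (simp add: o_def)
  have "((\<lambda>t. f (expo K (t *\<^sub>R x))) has_vector_derivative F' (M x)) (at 0)" if x: "x \<in> gr 0" for x
  proof -
    have "((\<lambda>t. \<phi> (param_at_1 K (chart_at_1 K (expo K (t *\<^sub>R x))))) has_derivative (\<lambda>t. M (t *\<^sub>R x))) (at 0)"
      by (rule has_derivative_compose[OF expo_velocity[unfolded has_vector_derivative_def]])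
        (use M in \<open>simp add: expo_0 e1_def\<close>)
    then have d: "((\<lambda>t. \<phi> (expo K (t *\<^sub>R x))) has_derivative (\<lambda>t. M (t *\<^sub>R x))) (at 0)"
      by (rule has_derivative_transform_nhds)
        (use eventually_expo_U1[of x] in \<open>rule eventually_mono\<close>, simp add: param_chart)
    have "((\<lambda>t. F (\<phi> (expo K (t *\<^sub>R x)))) has_derivative (\<lambda>t. F' (M (t *\<^sub>R x)))) (at 0)"
      by (rule has_derivative_compose[OF d]) (use F' in \<open>simp add: expo_0\<close>)
    \<comment> \<open>The local extension \<open>F\<close> agrees with \<open>f\<close> only on
      points of \<open>G0\<close> in this chart domain whose images lie in \<open>N\<close>; for
      small t the curve satisfies all these conditions.\<close>
    moreover have "eventually (\<lambda>t. F (\<phi> (expo K (t *\<^sub>R x))) = f (expo K (t *\<^sub>R x))) (nhds 0)"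
    proof -
      have "open {s \<in> UNIV. expo K (s *\<^sub>R x) \<in> U}"
        by (rule open_preimage[OF open_UNIV _ chart_openin[OF U(1)]])
          (use expo_smooth[of x] in \<open>simp add: smooth_into_def\<close>)
      then have 1: "eventually (\<lambda>t. expo K (t *\<^sub>R x) \<in> U) (nhds 0)"
        using eventually_nhds_in_open[of "{s \<in> UNIV. expo K (s *\<^sub>R x) \<in> U}" 0] U(2) by (simp add: expo_0)
      have "isCont (\<lambda>t. \<phi> (expo K (t *\<^sub>R x))) 0" using d by (rule has_derivative_continuous)
      then have "eventually (\<lambda>t. \<phi> (expo K (t *\<^sub>R x)) \<in> N) (nhds 0)"
        using c(3,4) unfolding continuous_at_open eventually_nhds by (simp add: expo_0 \<phi>_def)
      with 1 show ?thesis
        by eventually_elim (use c(6) expo_scale_G0[OF x] in \<open>simp add: U_def \<phi>_def\<close>)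
    qed
    ultimately have "((\<lambda>t. f (expo K (t *\<^sub>R x))) has_derivative (\<lambda>t. F' (M (t *\<^sub>R x)))) (at 0)"
      by (rule has_derivative_transform_nhds)
    then show ?thesis using linear_scale[OF lin] by (simp add: has_vector_derivative_def)
  qed
  then show ?thesis using lin unfolding diff_at_1_def by blast
qed

end

section \<open>Finite-dimensional function spaces\<close>

text \<open>Applied to evaluations, the following shows that a finite-dimensional space of functions is
  closed under pointwise limits.\<close>

lemma reconstruction:
  fixes \<Lambda> :: "('t::real_vector \<Rightarrow> real) set"
  assumes lin: "\<And>l. l \<in> \<Lambda> \<Longrightarrow> linear l" and sep: "\<And>t. (\<forall>l\<in>\<Lambda>. l t = 0) \<Longrightarrow> t = 0"
    and B: "finite B"
  shows "\<exists>I g. finite I \<and> I \<subseteq> \<Lambda> \<and> (\<forall>l\<in>I. g l \<in> span B) \<and>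
    (\<forall>l\<in>I. \<forall>\<mu>\<in>I. l (g \<mu>) = (if l = \<mu> then 1 else 0)) \<and> (\<forall>t\<in>span B. t = (\<Sum>l\<in>I. l t *\<^sub>R g l))"
  using B
proof (induction B rule: finite_induct)
  case empty
  show ?case by (intro exI[of _ "{}"]) simp
next
  case (insert b B)
  then obtain I g where I: "finite I" "I \<subseteq> \<Lambda>" "\<forall>l\<in>I. g l \<in> span B"
    "\<forall>l\<in>I. \<forall>\<mu>\<in>I. l (g \<mu>) = (if l = \<mu> then 1 else 0)" "\<forall>t\<in>span B. t = (\<Sum>l\<in>I. l t *\<^sub>R g l)"
    by auto
  have linI: "linear l" if "l \<in> I" for l using that I(2) lin by blast
  \<comment> \<open>The part of \<open>b\<close> not yet reconstructed; all functionals in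
    \<open>I\<close> vanish on it. If it is nonzero, some functional detects it and joins
    \<open>I\<close>.\<close>
  define b' where "b' = b - (\<Sum>l\<in>I. l b *\<^sub>R g l)"
  have sumB: "(\<Sum>l\<in>I. c l *\<^sub>R g l) \<in> span B" for c
    using I(3) by (intro span_sum span_scale) blast
  have b'_eq: "b = b' + (\<Sum>l\<in>I. l b *\<^sub>R g l)" by (simp add: b'_def)
  show ?case
  proof (cases "b' = 0")
    case True
    then have "b \<in> span B" by (subst b'_eq) (simp add: sumB)
    then have "span (insert b B) = span B" by (rule span_redundant)
    then show ?thesis using I by (intro exI[of _ I] exI[of _ g]) simp
  next
    case False
    have b'I: "\<mu> b' = 0" if \<mu>: "\<mu> \<in> I" for \<mu>
    proof -
      have "\<mu> (\<Sum>l\<in>I. l b *\<^sub>R g l) = (\<Sum>l\<in>I. l b * \<mu> (g l))"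
        by (simp add: linear_sum[OF linI[OF \<mu>]] linear_scale[OF linI[OF \<mu>]])
      also have "\<dots> = (\<Sum>l\<in>I. if l = \<mu> then \<mu> b else 0)"
        using I(4) \<mu> by (intro sum.cong) auto
      also have "\<dots> = \<mu> b" using I(1) \<mu> by simp
      finally show ?thesis by (simp add: b'_def linear_diff[OF linI[OF \<mu>]])
    qed
    obtain \<epsilon> where \<epsilon>: "\<epsilon> \<in> \<Lambda>" "\<epsilon> b' \<noteq> 0" using sep False by blast
    have \<epsilon>I: "\<epsilon> \<notin> I" using \<epsilon>(2) b'I by blast
    have lin\<epsilon>: "linear \<epsilon>" by (rule lin[OF \<epsilon>(1)])
    define g0 where "g0 = (1 / \<epsilon> b') *\<^sub>R b'"
    \<comment> \<open>The old dual vectors are corrected by multiples of \<open>g0\<close> so that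
      the new functional vanishes on them.\<close>
    define g' where "g' l = (if l = \<epsilon> then g0 else g l - \<epsilon> (g l) *\<^sub>R g0)" for l
    have \<epsilon>g0: "\<epsilon> g0 = 1" using \<epsilon>(2) by (simp add: g0_def linear_scale[OF lin\<epsilon>])
    have \<mu>g0: "\<mu> g0 = 0" if "\<mu> \<in> I" for \<mu> using b'I[OF that] by (simp add: g0_def linear_scale[OF linI[OF that]])
    have sub: "span B \<subseteq> span (insert b B)" by (intro span_mono) blast
    have "b' \<in> span (insert b B)" unfolding b'_def
      by (rule span_diff[OF span_base subsetD[OF sub sumB]]) simp
    then have g0S: "g0 \<in> span (insert b B)" unfolding g0_def by (rule span_scale)
    have g'S: "\<forall>l\<in>insert \<epsilon> I. g' l \<in> span (insert b B)"
      using g0S I(3) sub by (auto simp: g'_def intro!: span_diff span_scale)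
    have dual: "\<forall>l\<in>insert \<epsilon> I. \<forall>\<mu>\<in>insert \<epsilon> I. l (g' \<mu>) = (if l = \<mu> then 1 else 0)"
    proof (intro ballI)
      fix l \<mu> assume *: "l \<in> insert \<epsilon> I" "\<mu> \<in> insert \<epsilon> I"
      consider "l = \<epsilon>" "\<mu> = \<epsilon>" | "l = \<epsilon>" "\<mu> \<in> I" "\<mu> \<noteq> \<epsilon>" | "l \<in> I" "\<mu> = \<epsilon>" "l \<noteq> \<epsilon>"
        | "l \<in> I" "\<mu> \<in> I" "\<mu> \<noteq> \<epsilon>" using * \<epsilon>I by auto
      then show "l (g' \<mu>) = (if l = \<mu> then 1 else 0)"
      proof cases
        case 1 then show ?thesis by (simp add: g'_def \<epsilon>g0)
      next
        case 2 then show ?thesis by (simp add: g'_def linear_diff[OF lin\<epsilon>] linear_scale[OF lin\<epsilon>] \<epsilon>g0)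
      next
        case 3 then show ?thesis by (simp add: g'_def \<mu>g0)
      next
        case 4 then show ?thesis
          using I(4) by (simp add: g'_def linear_diff[OF linI] linear_scale[OF linI] \<mu>g0)
      qed
    qed
    define R where "R t = (\<Sum>l\<in>insert \<epsilon> I. l t *\<^sub>R g' l)" for t
    have linR: "linear R"
      unfolding R_def
    proof (intro linear_compose_sum ballI)
      fix l assume "l \<in> insert \<epsilon> I"
      then have "linear l" using lin I(2) \<epsilon>(1) by blast
      then show "linear (\<lambda>t. l t *\<^sub>R g' l)" by (simp add: linear_iff scaleR_add_left)
    qed
    have R: "R t = \<epsilon> t *\<^sub>R g0 + (\<Sum>l\<in>I. l t *\<^sub>R g l) - (\<Sum>l\<in>I. l t * \<epsilon> (g l)) *\<^sub>R g0" for t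
    proof -
      have "(\<Sum>l\<in>I. l t *\<^sub>R g' l) = (\<Sum>l\<in>I. l t *\<^sub>R g l - (l t * \<epsilon> (g l)) *\<^sub>R g0)"
        using \<epsilon>I by (intro sum.cong) (auto simp: g'_def scaleR_diff_right)
      moreover have "g' \<epsilon> = g0" by (simp add: g'_def)
      ultimately show "R t = \<epsilon> t *\<^sub>R g0 + (\<Sum>l\<in>I. l t *\<^sub>R g l) - (\<Sum>l\<in>I. l t * \<epsilon> (g l)) *\<^sub>R g0"
        using I(1) \<epsilon>I by (simp add: R_def sum_subtractf scaleR_sum_left)
    qed
    have R_B: "R t = t" if t: "t \<in> span B" for t
    proof -
      have eq: "(\<Sum>l\<in>I. l t *\<^sub>R g l) = t" using bspec[OF I(5) t] by (rule sym)
      have "\<epsilon> t = (\<Sum>l\<in>I. l t * \<epsilon> (g l))"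
        by (subst eq[symmetric]) (simp add: linear_sum[OF lin\<epsilon>] linear_scale[OF lin\<epsilon>])
      then show ?thesis by (simp add: R eq)
    qed
    have "(\<Sum>l\<in>I. l b' *\<^sub>R g l) = 0" "(\<Sum>l\<in>I. l b' * \<epsilon> (g l)) = 0"
      using b'I by (auto intro!: sum.neutral)
    then have Rb': "R b' = b'" using \<epsilon>(2) by (simp add: R g0_def)
    have "R b = R b' + R (\<Sum>l\<in>I. l b *\<^sub>R g l)"
      using arg_cong[OF b'_eq, of R] unfolding linear_add[OF linR] .
    then have Rb: "R b = b" unfolding Rb' R_B[OF sumB] b'_eq[symmetric] .
    have "R t = t" if t: "t \<in> span (insert b B)" for t
    proof (rule linear_eq_on[OF linR linear_ident t])
      fix x assume "x \<in> insert b B"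
      then show "R x = x" using Rb R_B[OF span_base] by blast
    qed
    then have "\<forall>t\<in>span (insert b B). t = R t" by simp
    then show ?thesis
      using I(1,2) \<epsilon>(1) g'S dual unfolding R_def by (intro exI[of _ "insert \<epsilon> I"] exI[of _ g']) auto
  qed
qed

lemma finite_basis_of_subspace:
  assumes "subspace A" "A \<subseteq> span S" "finite S"
  shows "\<exists>B. finite B \<and> A = span B"
proof -
  obtain B where B: "B \<subseteq> A" "independent B" "A \<subseteq> span B" "card B = dim A" using basis_exists[of A] .
  have "B \<subseteq> span S" using B(1) assms(2) by blast
  then have "finite B" using independent_span_bound[OF assms(3) B(2)] by blast
  moreover have "A = span B" using B(1,3) span_minimal[OF B(1) assms(1)] by blast
  ultimately show ?thesis by blast
qed

definition evaluations :: "(('x \<Rightarrow> 'y \<Rightarrow> 'w::euclidean_space) \<Rightarrow> real) set" where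
  "evaluations = {\<lambda>F. F \<xi> v \<bullet> e | \<xi> v e. True}"

lemma linear_evaluations: "l \<in> evaluations \<Longrightarrow> linear l"
  by (auto simp: evaluations_def linear_iff plus_fun_def scaleR_fun_def inner_add_left)

lemma evaluations_separate: assumes "\<forall>l\<in>evaluations. l F = 0" shows "F = 0"
proof (intro ext)
  fix \<xi> v
  have "(\<lambda>G. G \<xi> v \<bullet> F \<xi> v) \<in> evaluations" by (auto simp: evaluations_def)
  from bspec[OF assms this] have "F \<xi> v \<bullet> F \<xi> v = 0" .
  then show "F \<xi> v = 0 \<xi> v" by simp
qed

lemma function_space_reconstruction:
  fixes A :: "('x \<Rightarrow> 'y \<Rightarrow> 'w::euclidean_space) set"
  assumes "subspace A" "A \<subseteq> span S" "finite S"
  shows "\<exists>I g. finite I \<and> I \<subseteq> evaluations \<and> (\<forall>l\<in>I. g l \<in> A) \<and> (\<forall>t\<in>A. t = (\<Sum>l\<in>I. l t *\<^sub>R g l))"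
proof -
  obtain B where B: "finite B" "A = span B" using finite_basis_of_subspace[OF assms] by blast
  have "\<exists>I g. finite I \<and> I \<subseteq> evaluations \<and> (\<forall>l\<in>I. g l \<in> span B) \<and>
    (\<forall>l\<in>I. \<forall>\<mu>\<in>I. l (g \<mu>) = (if l = \<mu> then 1 else 0)) \<and> (\<forall>t\<in>span B. t = (\<Sum>l\<in>I. l t *\<^sub>R g l))"
    by (rule reconstruction[OF _ _ B(1)], erule linear_evaluations, erule evaluations_separate)
  then show ?thesis unfolding B(2) by (elim exE conjE, intro exI conjI) assumption+
qed

text \<open>Derivatives at 0 of curves in a function space that carries no norm. On
  finite-dimensional subspaces finitely many evaluations determine them.\<close>

definition has_pointwise_derivative :: "(real \<Rightarrow> 'x \<Rightarrow> 'y \<Rightarrow> 'w::real_normed_vector) \<Rightarrow> ('x \<Rightarrow> 'y \<Rightarrow> 'w) \<Rightarrow> bool" where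
  "has_pointwise_derivative F F' \<longleftrightarrow> (\<forall>\<xi> v. ((\<lambda>t. F t \<xi> v) has_vector_derivative F' \<xi> v) (at 0))"

lemma has_pointwise_derivative_evaluation:
  assumes "has_pointwise_derivative F F'" "l \<in> evaluations"
  shows "((\<lambda>t. l (F t)) has_real_derivative l F') (at 0)"
proof -
  obtain \<xi> v e where l: "l = (\<lambda>F. F \<xi> v \<bullet> e)" using assms(2) by (auto simp: evaluations_def)
  have "((\<lambda>t. F t \<xi> v) has_vector_derivative F' \<xi> v) (at 0)"
    using assms(1) by (simp add: has_pointwise_derivative_def)
  from bounded_linear.has_vector_derivative[OF bounded_linear_inner_left this, of e]
  show ?thesis by (simp add: l has_real_derivative_iff_has_vector_derivative)
qed

lemma has_pointwise_derivative_sum: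
  fixes g :: "'i \<Rightarrow> 'x \<Rightarrow> 'y \<Rightarrow> 'w::real_normed_vector"
  assumes "\<And>i. i \<in> I \<Longrightarrow> ((\<lambda>t. c i t) has_real_derivative c' i) (at 0)"
  shows "has_pointwise_derivative (\<lambda>t. \<Sum>i\<in>I. c i t *\<^sub>R g i) (\<Sum>i\<in>I. c' i *\<^sub>R g i)"
  unfolding has_pointwise_derivative_def
proof (intro allI)
  fix \<xi> v
  have ev: "(\<Sum>i\<in>I. a i *\<^sub>R g i) \<xi> v = (\<Sum>i\<in>I. a i *\<^sub>R g i \<xi> v)" for a
    by (induction I rule: infinite_finite_induct) (simp_all add: scaleR_fun_def)
  show "((\<lambda>t. (\<Sum>i\<in>I. c i t *\<^sub>R g i) \<xi> v) has_vector_derivative (\<Sum>i\<in>I. c' i *\<^sub>R g i) \<xi> v) (at 0)"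
    unfolding ev
  proof (rule has_vector_derivative_sum)
    fix i assume "i \<in> I"
    then have "(c i has_vector_derivative c' i) (at 0)"
      using assms by (simp add: has_real_derivative_iff_has_vector_derivative)
    from bounded_linear.has_vector_derivative[OF bounded_linear_scaleR_left this]
    show "((\<lambda>t. c i t *\<^sub>R g i \<xi> v) has_vector_derivative c' i *\<^sub>R g i \<xi> v) (at 0)" .
  qed
qed

lemma has_pointwise_derivative_unique:
  assumes "has_pointwise_derivative F F'" "has_pointwise_derivative F F''" shows "F' = F''"
  using assms vector_derivative_unique_at unfolding has_pointwise_derivative_def by (intro ext) blast

text \<open>The curve is a combination of fixed \<open>g l\<close> with scalar coefficients
  \<open>l (F t)\<close>; differentiating the coefficients exhibits the derivative in the span of
  the same vectors.\<close>

lemma pointwise_derivative_in_subspace: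
  fixes A :: "('x \<Rightarrow> 'y \<Rightarrow> 'w::euclidean_space) set"
  assumes A: "subspace A" "A \<subseteq> span S" "finite S" and F: "\<And>t. F t \<in> A" "has_pointwise_derivative F F'"
  shows "F' \<in> A"
proof -
  from function_space_reconstruction[OF A] obtain I where
    "\<exists>g. finite I \<and> I \<subseteq> evaluations \<and> (\<forall>l\<in>I. g l \<in> A) \<and> (\<forall>t\<in>A. t = (\<Sum>l\<in>I. l t *\<^sub>R g l))" ..
  then obtain g where
    I': "finite I \<and> I \<subseteq> evaluations \<and> (\<forall>l\<in>I. g l \<in> A) \<and> (\<forall>t\<in>A. t = (\<Sum>l\<in>I. l t *\<^sub>R g l))" ..
  note I = conjunct1[OF I'] conjunct1[OF conjunct2[OF I']] conjunct1[OF conjunct2[OF conjunct2[OF I']]]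
    conjunct2[OF conjunct2[OF conjunct2[OF I']]]
  have d: "has_pointwise_derivative (\<lambda>t. \<Sum>l\<in>I. l (F t) *\<^sub>R g l) (\<Sum>l\<in>I. l F' *\<^sub>R g l)"
    using I(2) by (intro has_pointwise_derivative_sum has_pointwise_derivative_evaluation[OF F(2)]) blast
  have eqF: "(\<lambda>t. \<Sum>l\<in>I. l (F t) *\<^sub>R g l) = F" by (rule ext) (rule bspec[OF I(4) F(1), symmetric])
  have eq: "F' = (\<Sum>l\<in>I. l F' *\<^sub>R g l)"
    by (rule has_pointwise_derivative_unique[OF F(2) d[unfolded eqF]])
  show ?thesis
    by (subst eq) (use I(3) in \<open>intro subspace_sum[OF A(1)] subspace_scale[OF A(1)], blast\<close>)
qed

section \<open>Infinitesimal action on the tensor module\<close>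

lemma scaleR_fun_apply: "(c *\<^sub>R F) x = c *\<^sub>R F x"
  by (simp add: scaleR_fun_def)

lemma tensor_linear_slot:
  "tensor (pre @ (c *\<^sub>R a + b) # as) f w = c *\<^sub>R tensor (pre @ a # as) f w + tensor (pre @ b # as) f w"
  by (simp add: tensor_def fun_eq_iff plus_fun_def scaleR_fun_def blinfun.add_right blinfun.scaleR_right
      algebra_simps scaleR_add_left)

text \<open>Passes from generators to spans in all slots. The prefix \<open>pre\<close> holds the
  slots already specialized to generators, so that the induction on the remaining slots can be used
  before the first one is made general.\<close>

lemma tensor_multilinear:
  assumes W: "subspace W"
    and gen: "\<And>bs. list_all2 (\<in>) bs Gs \<Longrightarrow> tensor (pre @ bs) f w \<in> W"
    and as: "list_all2 (\<lambda>a S. a \<in> span S) as Gs"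
  shows "tensor (pre @ as) f w \<in> W"
  using as gen
proof (induction as Gs arbitrary: pre rule: list_all2_induct)
  case Nil
  then show ?case by simp
next
  case (Cons a as S Gs)
  have IH: "tensor (pre @ x # as) f w \<in> W" if x: "x \<in> S" for x
  proof -
    have "tensor ((pre @ [x]) @ as) f w \<in> W"
    proof (rule Cons.IH)
      fix bs assume "list_all2 (\<in>) bs Gs"
      then have "tensor (pre @ x # bs) f w \<in> W" using x by (intro Cons.prems) simp
      then show "tensor ((pre @ [x]) @ bs) f w \<in> W" by simp
    qed
    then show ?thesis by simp
  qed
  show ?case
    using Cons.hyps(1)
  proof (induction rule: span_induct_alt)
    case base
    have eq: "tensor (pre @ 0 # as) f w = 0" by (simp add: tensor_def fun_eq_iff)
    show ?case unfolding eq by (rule subspace_0[OF W])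
  next
    case (step c x y)
    show ?case
      unfolding tensor_linear_slot
      by (rule subspace_add[OF W subspace_scale[OF W IH[OF step(1)]] step(2)])
  qed
qed

locale lie_rep = lie_pair K for K :: "('g, 'a::euclidean_space) graded_pair" +
  fixes \<sigma> :: "'g \<Rightarrow> 'v::euclidean_space \<Rightarrow> 'v" and \<tau> :: "'g \<Rightarrow> 'w::euclidean_space \<Rightarrow> 'w" and k :: nat
  assumes \<sigma>: "irreducible_G0_rep K \<sigma>" and \<tau>: "irreducible_G0_rep K \<tau>"
begin

lemma \<sigma>_linear: "g \<in> G0 K \<Longrightarrow> linear (\<sigma> g)" and \<sigma>_one: "\<sigma> \<one>\<^bsub>G\<^esub> = id"
  and \<sigma>_mult: "g \<in> G0 K \<Longrightarrow> g' \<in> G0 K \<Longrightarrow> \<sigma> (g \<otimes>\<^bsub>G\<^esub> g') = \<sigma> g \<circ> \<sigma> g'"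
  and \<sigma>_smooth: "smooth_on_subset (charts K) (G0 K) (\<lambda>g. \<sigma> g v)"
  using \<sigma> by (simp_all add: irreducible_G0_rep_def G0_rep_def)

lemma \<tau>_linear: "g \<in> G0 K \<Longrightarrow> linear (\<tau> g)" and \<tau>_one: "\<tau> \<one>\<^bsub>G\<^esub> = id"
  and \<tau>_mult: "g \<in> G0 K \<Longrightarrow> g' \<in> G0 K \<Longrightarrow> \<tau> (g \<otimes>\<^bsub>G\<^esub> g') = \<tau> g \<circ> \<tau> g'"
  and \<tau>_smooth: "smooth_on_subset (charts K) (G0 K) (\<lambda>g. \<tau> g v')"
  using \<tau> by (simp_all add: irreducible_G0_rep_def G0_rep_def)

definition Ads :: "'g \<Rightarrow> ('a \<Rightarrow>\<^sub>L real) \<Rightarrow> 'a \<Rightarrow>\<^sub>L real" where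
  "Ads g \<xi> = Blinfun (\<lambda>x. \<xi> (Ad K g x))"

lemma Ads_apply: "g \<in> G0 K \<Longrightarrow> Ads g \<xi> x = \<xi> (Ad K g x)"
proof -
  assume "g \<in> G0 K"
  then have "linear (\<lambda>x. \<xi> (Ad K g x))"
    using linear_compose[OF linear_Ad[OF G0_carrier] bounded_linear.linear[OF blinfun.bounded_linear_right, of \<xi>]]
    by (simp add: o_def)
  then show ?thesis
    unfolding Ads_def by (simp add: linear_conv_bounded_linear bounded_linear_Blinfun_apply)
qed

text \<open>The action of \<open>G0\<close> without its density factor. All weights share it, so
  invariant subspaces and the infinitesimal action can be studied once for all weights.\<close>

definition act0 :: "'g \<Rightarrow> ('a, 'v, 'w) tens \<Rightarrow> ('a, 'v, 'w) tens" where
  "act0 g F = (\<lambda>\<xi> v. \<tau> g (F (Ads g \<xi>) (\<sigma> (inv\<^bsub>G\<^esub> g) v)))"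

lemma act_eq: "g \<in> G0 K \<Longrightarrow> act K \<sigma> \<tau> \<delta> g F = density_char K \<delta> g *\<^sub>R act0 g F"
  by (simp add: act_def levi_part_G0 act0_def Ads_def scaleR_fun_def Let_def)

lemma linear_act0: "g \<in> G0 K \<Longrightarrow> linear (act0 g)"
  using \<tau>_linear[of g]
  by (simp add: linear_iff act0_def plus_fun_def scaleR_fun_def fun_eq_iff)

lemma act0_mult:
  assumes "g \<in> G0 K" "h \<in> G0 K"
  shows "act0 (g \<otimes>\<^bsub>G\<^esub> h) F = act0 g (act0 h F)"
proof -
  have "Ads (g \<otimes>\<^bsub>G\<^esub> h) \<xi> = Ads h (Ads g \<xi>)" for \<xi>
    using assms by (intro blinfun_eqI) (simp add: Ads_apply mult_G0 Ad_mult G0_carrier)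
  moreover have "\<sigma> (inv\<^bsub>G\<^esub> (g \<otimes>\<^bsub>G\<^esub> h)) = \<sigma> (inv\<^bsub>G\<^esub> h) \<circ> \<sigma> (inv\<^bsub>G\<^esub> g)"
    using assms by (simp add: inv_mult_group G0_carrier \<sigma>_mult inv_G0)
  ultimately show ?thesis using assms by (simp add: act0_def \<tau>_mult)
qed

lemma act0_one: "act0 \<one>\<^bsub>G\<^esub> F = F"
proof -
  have "Ads \<one>\<^bsub>G\<^esub> \<xi> = \<xi>" for \<xi> by (intro blinfun_eqI) (simp add: Ads_apply one_G0 Ad_one)
  then show ?thesis by (simp add: act0_def \<tau>_one \<sigma>_one)
qed

definition tensor_space :: "('a, 'v, 'w) tens set" where
  "tensor_space = span {tensor as f w | as f w. length as = k \<and> linear f}"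

lemma subspace_tensor_space: "subspace tensor_space" by (simp add: tensor_space_def)

lemma tensor_space_finite: "\<exists>S. finite S \<and> tensor_space \<subseteq> span S"
proof -
  define S where "S = (\<lambda>(as, b, e). tensor as (\<lambda>v. v \<bullet> b) e) ` ({as. set as \<subseteq> (Basis :: 'a set) \<and> length as = k} \<times> (Basis :: 'v set) \<times> (Basis :: 'w set))"
  have "finite S" unfolding S_def by (intro finite_imageI finite_cartesian_product finite_lists_length_eq finite_Basis)
  moreover have "tensor as f w \<in> span S" if as: "length as = k" and f: "linear f" for as and f :: "'v \<Rightarrow> real" and w
  proof -
    have 1: "tensor as (\<lambda>v. v \<bullet> b) e \<in> span S" if be: "b \<in> Basis" "e \<in> Basis" for b e
    proof -
      have "tensor ([] @ as) (\<lambda>v. v \<bullet> b) e \<in> span S"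
      proof (rule tensor_multilinear)
        show "list_all2 (\<lambda>a S. a \<in> span S) as (replicate k Basis)"
          using as by (simp add: list_all2_conv_all_nth)
        fix bs :: "'a list" assume "list_all2 (\<in>) bs (replicate k Basis)"
        then have "set bs \<subseteq> Basis" "length bs = k" by (auto simp: list_all2_conv_all_nth set_conv_nth)
        then show "tensor ([] @ bs) (\<lambda>v. v \<bullet> b) e \<in> span S"
          using be by (intro span_base) (auto simp: S_def intro!: image_eqI[where x="(bs, b, e)"])
      qed simp
      then show ?thesis by simp
    qed
    have fv: "f v = (\<Sum>b\<in>Basis. f b * (v \<bullet> b))" for v
      by (subst euclidean_representation[of v, symmetric]) (simp add: linear_sum[OF f] linear_scale[OF f] mult.commute del: euclidean_representation)
    have ev: "(\<Sum>i\<in>I. F i) \<xi> v = (\<Sum>i\<in>I. F i \<xi> v)" for I :: "'i set" and F :: "'i \<Rightarrow> ('a, 'v, 'w) tens" and \<xi> v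
      by (induction I rule: infinite_finite_induct) simp_all
    have "tensor as f w = (\<Sum>b\<in>Basis. \<Sum>e\<in>Basis. (f b * (w \<bullet> e)) *\<^sub>R tensor as (\<lambda>v. v \<bullet> b) e)"
    proof (intro ext)
      fix \<xi> :: "'a \<Rightarrow>\<^sub>L real" and v
      let ?p = "prod_list (map (blinfun_apply \<xi>) as)"
      have "(\<Sum>b\<in>Basis. \<Sum>e\<in>Basis. (f b * (w \<bullet> e)) *\<^sub>R tensor as (\<lambda>v. v \<bullet> b) e) \<xi> v
        = (\<Sum>b\<in>Basis. \<Sum>e\<in>Basis. (?p * (f b * (v \<bullet> b))) *\<^sub>R ((w \<bullet> e) *\<^sub>R e))"
        by (simp add: ev scaleR_fun_def tensor_def mult_ac)
      also have "\<dots> = (\<Sum>b\<in>Basis. (?p * (f b * (v \<bullet> b))) *\<^sub>R w)"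
        by (simp only: scaleR_sum_right[symmetric] euclidean_representation)
      also have "\<dots> = tensor as f w \<xi> v"
        by (simp only: scaleR_sum_left[symmetric] sum_distrib_left[symmetric] fv[symmetric] tensor_def)
      finally show "tensor as f w \<xi> v = (\<Sum>b\<in>Basis. \<Sum>e\<in>Basis. (f b * (w \<bullet> e)) *\<^sub>R tensor as (\<lambda>v. v \<bullet> b) e) \<xi> v" by simp
    qed
    then show ?thesis using 1 by (simp add: span_sum span_scale)
  qed
  then have "tensor_space \<subseteq> span S" unfolding tensor_space_def by (intro span_minimal) auto
  ultimately show ?thesis by blast
qed

lemma act0_tensor:
  assumes "g \<in> G0 K"
  shows "act0 g (tensor as f w) = tensor (map (Ad K g) as) (\<lambda>v. f (\<sigma> (inv\<^bsub>G\<^esub> g) v)) (\<tau> g w)"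
proof -
  have "blinfun_apply (Ads g \<xi>) = (\<lambda>x. \<xi> (Ad K g x))" for \<xi> using Ads_apply[OF assms] by (rule ext)
  then show ?thesis
    using linear_scale[OF \<tau>_linear[OF assms]] by (simp add: act0_def tensor_def o_def)
qed

lemma act0_tensor_space:
  assumes g: "g \<in> G0 K" and F: "F \<in> tensor_space" shows "act0 g F \<in> tensor_space"
  using F unfolding tensor_space_def
proof (induction rule: span_induct_alt)
  case base
  show ?case unfolding linear_0[OF linear_act0[OF g]] by (rule span_0)
next
  case (step c x y)
  then obtain as f w where x: "x = tensor as f w" "length as = k" "linear f" by blast
  have "linear (\<lambda>v. f (\<sigma> (inv\<^bsub>G\<^esub> g) v))"
    using linear_compose[OF \<sigma>_linear[OF inv_G0[OF g]] x(3)] by (simp add: o_def)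
  then have "act0 g x \<in> span {tensor as f w | as f w. length as = k \<and> linear f}"
    unfolding x(1) act0_tensor[OF g] using x(2)
    by (intro span_base CollectI exI[of _ "map (Ad K g) as"] exI[of _ "\<lambda>v. f (\<sigma> (inv\<^bsub>G\<^esub> g) v)"] exI[of _ "\<tau> g w"]) simp
  then show ?case
    unfolding linear_add[OF linear_act0[OF g]] linear_scale[OF linear_act0[OF g]]
    by (rule span_add[OF span_scale step(2)])
qed

lemma diff_at_1_scaleR_const: "diff_at_1 f \<Longrightarrow> diff_at_1 (\<lambda>g. c *\<^sub>R f g)"
  by (rule diff_at_1_bounded_linear[OF bounded_linear_scaleR_right])

lemma diff_at_1_cong:
  assumes "\<And>g. g \<in> G0 K \<Longrightarrow> f g = f' g" "diff_at_1 f" shows "diff_at_1 f'"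
  using assms(2) unfolding diff_at_1_def by (simp add: assms(1) expo_scale_G0)

lemma diff_at_1_act0:
  assumes F: "F \<in> tensor_space" shows "diff_at_1 (\<lambda>g. act0 g F \<xi> v)"
  using F unfolding tensor_space_def
proof (induction rule: span_induct_alt)
  case base
  show ?case
  proof (rule diff_at_1_cong[OF _ diff_at_1_const[of 0]])
    fix g assume "g \<in> G0 K"
    from linear_0[OF linear_act0[OF this]] show "0 = act0 g 0 \<xi> v" by (simp only:) simp
  qed
next
  case (step c x y)
  then obtain as f w where x: "x = tensor as f w" "linear f" by blast
  have 1: "diff_at_1 (\<lambda>g. prod_list (map (\<lambda>a. \<xi> (Ad K g a)) as))"
  proof (induction as)
    case Nil show ?case by (simp add: diff_at_1_const)
  next
    case (Cons a as)
    have "diff_at_1 (\<lambda>g. \<xi> (Ad K g a))"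
      by (rule diff_at_1_bounded_linear[OF blinfun.bounded_linear_right diff_at_1_Ad])
    from diff_at_1_bounded_bilinear[OF bounded_bilinear_mult this Cons] show ?case by simp
  qed
  have 2: "diff_at_1 (\<lambda>g. f (\<sigma> (inv\<^bsub>G\<^esub> g) v))"
    by (rule diff_at_1_bounded_linear[OF _ diff_at_1_inv[OF diff_at_1_smooth[OF \<sigma>_smooth]]])
      (use x(2) in \<open>simp add: linear_conv_bounded_linear\<close>)
  have "diff_at_1 (\<lambda>g. (prod_list (map (\<lambda>a. \<xi> (Ad K g a)) as) * f (\<sigma> (inv\<^bsub>G\<^esub> g) v)) *\<^sub>R \<tau> g w)"
    by (rule diff_at_1_bounded_bilinear[OF bounded_bilinear_scaleR
          diff_at_1_bounded_bilinear[OF bounded_bilinear_mult 1 2] diff_at_1_smooth[OF \<tau>_smooth]])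
  then have "diff_at_1 (\<lambda>g. c *\<^sub>R ((prod_list (map (\<lambda>a. \<xi> (Ad K g a)) as) * f (\<sigma> (inv\<^bsub>G\<^esub> g) v)) *\<^sub>R \<tau> g w) + act0 g y \<xi> v)"
    by (rule diff_at_1_add[OF diff_at_1_scaleR_const step(2)])
  then show ?case
  proof (rule diff_at_1_cong[rotated])
    fix g assume g: "g \<in> G0 K"
    have "act0 g (c *\<^sub>R x + y) \<xi> v = c *\<^sub>R act0 g x \<xi> v + act0 g y \<xi> v"
      unfolding linear_add[OF linear_act0[OF g]] linear_scale[OF linear_act0[OF g]] plus_fun_apply scaleR_fun_apply ..
    also have "act0 g x \<xi> v = (prod_list (map (\<lambda>a. \<xi> (Ad K g a)) as) * f (\<sigma> (inv\<^bsub>G\<^esub> g) v)) *\<^sub>R \<tau> g w"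
      unfolding x(1) act0_tensor[OF g] by (simp add: tensor_def o_def)
    finally show "c *\<^sub>R ((prod_list (map (\<lambda>a. \<xi> (Ad K g a)) as) * f (\<sigma> (inv\<^bsub>G\<^esub> g) v)) *\<^sub>R \<tau> g w) + act0 g y \<xi> v
      = act0 g (c *\<^sub>R x + y) \<xi> v" by (rule sym)
  qed
qed

definition dact0 :: "'a \<Rightarrow> ('a, 'v, 'w) tens \<Rightarrow> ('a, 'v, 'w) tens" where
  "dact0 x F = (\<lambda>\<xi> v. vector_derivative (\<lambda>t. act0 (expo K (t *\<^sub>R x)) F \<xi> v) (at 0))"

lemma dact0_derivative:
  assumes "F \<in> tensor_space" "x \<in> gr 0"
  shows "has_pointwise_derivative (\<lambda>t. act0 (expo K (t *\<^sub>R x)) F) (dact0 x F)"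
  unfolding has_pointwise_derivative_def dact0_def
  using diff_at_1_act0[OF assms(1)] assms(2) vector_derivative_works differentiableI_vector
  unfolding diff_at_1_def by blast

lemma dact0_eqI:
  "has_pointwise_derivative (\<lambda>t. act0 (expo K (t *\<^sub>R x)) F) F' \<Longrightarrow> dact0 x F = F'"
  unfolding has_pointwise_derivative_def dact0_def by (intro ext) (simp add: vector_derivative_at)

lemma dact0_linear_x:
  assumes F: "F \<in> tensor_space" shows "\<exists>D. linear D \<and> (\<forall>x\<in>gr 0. dact0 x F \<xi> v = D x)"
proof -
  obtain D where D: "linear D" "\<And>x. x \<in> gr 0 \<Longrightarrow> ((\<lambda>t. act0 (expo K (t *\<^sub>R x)) F \<xi> v) has_vector_derivative D x) (at 0)"
    using diff_at_1_act0[OF F, of \<xi> v] unfolding diff_at_1_def by blast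
  then show ?thesis using vector_derivative_at unfolding dact0_def by blast
qed

lemma dact0_add_x:
  assumes F: "F \<in> tensor_space" and x: "x \<in> gr 0" and y: "y \<in> gr 0"
  shows "dact0 (x + y) F = dact0 x F + dact0 y F"
proof (intro ext)
  fix \<xi> v
  obtain D where D: "linear D" "\<forall>x\<in>gr 0. dact0 x F \<xi> v = D x" using dact0_linear_x[OF F] by blast
  show "dact0 (x + y) F \<xi> v = (dact0 x F + dact0 y F) \<xi> v"
    using bspec[OF D(2) x] bspec[OF D(2) y] bspec[OF D(2) subspace_add[OF subspace_gr x y]] linear_add[OF D(1)]
    by simp
qed

lemma dact0_scale_x:
  assumes F: "F \<in> tensor_space" and x: "x \<in> gr 0"
  shows "dact0 (c *\<^sub>R x) F = c *\<^sub>R dact0 x F"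
proof (intro ext)
  fix \<xi> v
  obtain D where D: "linear D" "\<forall>x\<in>gr 0. dact0 x F \<xi> v = D x" using dact0_linear_x[OF F] by blast
  show "dact0 (c *\<^sub>R x) F \<xi> v = (c *\<^sub>R dact0 x F) \<xi> v"
    using bspec[OF D(2) x] bspec[OF D(2) subspace_scale[OF subspace_gr x]] linear_scale[OF D(1)]
    by (simp add: scaleR_fun_apply)
qed

lemma dact0_combine:
  assumes "F \<in> tensor_space" "F' \<in> tensor_space" "x \<in> gr 0"
  shows "dact0 x (c *\<^sub>R F + F') = c *\<^sub>R dact0 x F + dact0 x F'"
proof (rule dact0_eqI)
  show "has_pointwise_derivative (\<lambda>t. act0 (expo K (t *\<^sub>R x)) (c *\<^sub>R F + F')) (c *\<^sub>R dact0 x F + dact0 x F')"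
    unfolding has_pointwise_derivative_def
  proof (intro allI)
    fix \<xi> v
    have eq: "act0 (expo K (t *\<^sub>R x)) (c *\<^sub>R F + F') \<xi> v = c *\<^sub>R act0 (expo K (t *\<^sub>R x)) F \<xi> v + act0 (expo K (t *\<^sub>R x)) F' \<xi> v" for t
      unfolding linear_add[OF linear_act0[OF expo_scale_G0[OF assms(3)]]]
        linear_scale[OF linear_act0[OF expo_scale_G0[OF assms(3)]]] plus_fun_apply scaleR_fun_apply ..
    have "((\<lambda>t. act0 (expo K (t *\<^sub>R x)) F \<xi> v) has_vector_derivative dact0 x F \<xi> v) (at 0)"
      "((\<lambda>t. act0 (expo K (t *\<^sub>R x)) F' \<xi> v) has_vector_derivative dact0 x F' \<xi> v) (at 0)"
      using dact0_derivative assms unfolding has_pointwise_derivative_def by blast+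
    then show "((\<lambda>t. act0 (expo K (t *\<^sub>R x)) (c *\<^sub>R F + F') \<xi> v) has_vector_derivative (c *\<^sub>R dact0 x F + dact0 x F') \<xi> v) (at 0)"
      unfolding eq plus_fun_apply scaleR_fun_apply
      by (intro has_vector_derivative_add bounded_linear.has_vector_derivative[OF bounded_linear_scaleR_right])
  qed
qed

lemma dact0_add: "F \<in> tensor_space \<Longrightarrow> F' \<in> tensor_space \<Longrightarrow> x \<in> gr 0 \<Longrightarrow> dact0 x (F + F') = dact0 x F + dact0 x F'"
  using dact0_combine[of F F' x 1] by (simp only: scaleR_one)

lemma dact0_0:
  assumes "x \<in> gr 0" shows "dact0 x 0 = 0"
proof -
  have "dact0 x 0 + 0 = dact0 x 0 + dact0 x 0"
    using dact0_combine[OF subspace_0[OF subspace_tensor_space] subspace_0[OF subspace_tensor_space] assms, of 1]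
    unfolding scaleR_one add_0_right .
  then show ?thesis by (rule add_left_imp_eq[symmetric])
qed

lemma dact0_scale: "F \<in> tensor_space \<Longrightarrow> x \<in> gr 0 \<Longrightarrow> dact0 x (c *\<^sub>R F) = c *\<^sub>R dact0 x F"
  using dact0_combine[OF _ subspace_0[OF subspace_tensor_space], of F x c] by (simp only: add_0_right dact0_0)

lemma dact0_sum:
  assumes "x \<in> gr 0" "\<And>i. i \<in> I \<Longrightarrow> F i \<in> tensor_space"
  shows "dact0 x (\<Sum>i\<in>I. c i *\<^sub>R F i) = (\<Sum>i\<in>I. c i *\<^sub>R dact0 x (F i))"
  using assms(2)
proof (induction I rule: infinite_finite_induct)
  case (insert i I)
  have "F i \<in> tensor_space" "(\<Sum>i\<in>I. c i *\<^sub>R F i) \<in> tensor_space"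
    by (rule insert.prems, rule insertI1) (rule subspace_sum[OF subspace_tensor_space], rule subspace_scale[OF subspace_tensor_space], rule insert.prems, rule insertI2)
  note 1 = dact0_combine[OF this assms(1)]
  have "dact0 x (\<Sum>i\<in>I. c i *\<^sub>R F i) = (\<Sum>i\<in>I. c i *\<^sub>R dact0 x (F i))"
    by (rule insert.IH) (rule insert.prems, rule insertI2)
  then show ?case unfolding sum.insert[OF insert.hyps] 1 by (rule arg_cong)
next
  case (infinite I)
  then show ?case by (simp only: sum.infinite[OF infinite(1)] dact0_0[OF assms(1)])
qed (simp only: sum.empty dact0_0[OF assms(1)])

lemma dact0_in:
  assumes A: "subspace A" "A \<subseteq> tensor_space" and inv: "\<And>g F. g \<in> G0 K \<Longrightarrow> F \<in> A \<Longrightarrow> act0 g F \<in> A"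
    and F: "F \<in> A" and x: "x \<in> gr 0"
  shows "dact0 x F \<in> A"
proof -
  obtain S where S: "finite S" "tensor_space \<subseteq> span S" using tensor_space_finite by blast
  show ?thesis
  proof (rule pointwise_derivative_in_subspace[OF A(1) _ S(1)])
    show "A \<subseteq> span S" using A(2) S(2) by blast
    show "act0 (expo K (t *\<^sub>R x)) F \<in> A" for t by (rule inv[OF expo_scale_G0[OF x] F])
    show "has_pointwise_derivative (\<lambda>t. act0 (expo K (t *\<^sub>R x)) F) (dact0 x F)"
      using dact0_derivative A(2) F x by blast
  qed
qed

lemma dact0_tensor_space: "F \<in> tensor_space \<Longrightarrow> x \<in> gr 0 \<Longrightarrow> dact0 x F \<in> tensor_space"
  by (rule dact0_in[OF subspace_tensor_space subset_refl act0_tensor_space])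

lemma dact0_equivariant:
  assumes g: "g \<in> G0 K" and F: "F \<in> tensor_space" and x: "x \<in> gr 0"
  shows "act0 g (dact0 x F) = dact0 (Ad K g x) (act0 g F)"
proof (rule sym, rule dact0_eqI)
  have gc: "g \<in> carrier G" using G0_carrier g by blast
  have eq: "act0 (expo K (t *\<^sub>R Ad K g x)) (act0 g F) = act0 g (act0 (expo K (t *\<^sub>R x)) F)" for t
  proof -
    have "expo K (t *\<^sub>R Ad K g x) \<otimes>\<^bsub>G\<^esub> g = g \<otimes>\<^bsub>G\<^esub> expo K (t *\<^sub>R x)"
      using expo_conj[OF gc, of t x, symmetric] gc expo_carrier by (simp add: m_assoc)
    then show ?thesis
      using act0_mult[OF expo_scale_G0[OF Ad_G0[OF g x]] g] act0_mult[OF g expo_scale_G0[OF x]] by metis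
  qed
  show "has_pointwise_derivative (\<lambda>t. act0 (expo K (t *\<^sub>R Ad K g x)) (act0 g F)) (act0 g (dact0 x F))"
    unfolding eq has_pointwise_derivative_def
  proof (intro allI)
    fix \<xi> v
    have "((\<lambda>t. act0 (expo K (t *\<^sub>R x)) F (Ads g \<xi>) (\<sigma> (inv\<^bsub>G\<^esub> g) v)) has_vector_derivative
        dact0 x F (Ads g \<xi>) (\<sigma> (inv\<^bsub>G\<^esub> g) v)) (at 0)"
      using dact0_derivative[OF F x] unfolding has_pointwise_derivative_def by blast
    from bounded_linear.has_vector_derivative[OF _ this, of "\<tau> g"]
    show "((\<lambda>t. act0 g (act0 (expo K (t *\<^sub>R x)) F) \<xi> v) has_vector_derivative act0 g (dact0 x F) \<xi> v) (at 0)"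
      using \<tau>_linear[OF g] by (simp add: act0_def linear_conv_bounded_linear)
  qed
qed

text \<open>Differentiate \<open>act0 g (dact0 y F) = dact0 (Ad g y) (act0 g F)\<close> along \<open>g = exp (s x)\<close>.\<close>

lemma dact0_br:
  assumes F: "F \<in> tensor_space" and x: "x \<in> gr 0" and y: "y \<in> gr 0"
  shows "dact0 (br x y) F = dact0 x (dact0 y F) - dact0 y (dact0 x F)"
proof -
  obtain S where S: "finite S" "tensor_space \<subseteq> span S" using tensor_space_finite by blast
  from function_space_reconstruction[OF subspace_tensor_space S(2,1)] obtain I where
    "\<exists>g. finite I \<and> I \<subseteq> evaluations \<and> (\<forall>l\<in>I. g l \<in> tensor_space) \<and> (\<forall>t\<in>tensor_space. t = (\<Sum>l\<in>I. l t *\<^sub>R g l))" ..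
  then obtain g where
    I': "finite I \<and> I \<subseteq> evaluations \<and> (\<forall>l\<in>I. g l \<in> tensor_space) \<and> (\<forall>t\<in>tensor_space. t = (\<Sum>l\<in>I. l t *\<^sub>R g l))" ..
  note I = conjunct1[OF I'] conjunct1[OF conjunct2[OF I']] conjunct1[OF conjunct2[OF conjunct2[OF I']]]
    conjunct2[OF conjunct2[OF conjunct2[OF I']]]
  let ?e = "\<lambda>s. expo K (s *\<^sub>R x)"
  have e: "?e s \<in> G0 K" for s by (rule expo_scale_G0[OF x])
  have brxy: "br x y \<in> gr 0" using br_gr[OF x y] by simp
  have ev: "(\<Sum>l\<in>I. c l *\<^sub>R h l) \<xi> v = (\<Sum>l\<in>I. c l *\<^sub>R h l \<xi> v)" for c and h :: "_ \<Rightarrow> ('a, 'v, 'w) tens" and \<xi> v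
    by (induction I rule: infinite_finite_induct) (simp_all add: scaleR_fun_def)
  \<comment> \<open>In the curve below both the Lie algebra element and the tensor move. Expanding
    the tensor in the fixed vectors \<open>g l\<close> reduces its derivative to the product rule
    for scalar coefficients.\<close>
  have expand: "dact0 z F' = (\<Sum>l\<in>I. l F' *\<^sub>R dact0 z (g l))" if "z \<in> gr 0" "F' \<in> tensor_space" for z F'
  proof -
    have "dact0 z F' = dact0 z (\<Sum>l\<in>I. l F' *\<^sub>R g l)" by (rule arg_cong[OF bspec[OF I(4) that(2)]])
    also have "\<dots> = (\<Sum>l\<in>I. l F' *\<^sub>R dact0 z (g l))" using I(3) by (intro dact0_sum that(1)) blast
    finally show ?thesis .
  qed
  have "has_pointwise_derivative (\<lambda>s. dact0 (Ad K (?e s) y) (act0 (?e s) F)) (dact0 (br x y) F + dact0 y (dact0 x F))"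
    unfolding has_pointwise_derivative_def
  proof (intro allI)
    fix \<xi> v
    have summand: "((\<lambda>s. l (act0 (?e s) F) *\<^sub>R dact0 (Ad K (?e s) y) (g l) \<xi> v) has_vector_derivative
        l F *\<^sub>R dact0 (br x y) (g l) \<xi> v + l (dact0 x F) *\<^sub>R dact0 y (g l) \<xi> v) (at 0)" if l: "l \<in> I" for l
    proof -
      obtain D where D: "linear D" "\<forall>x\<in>gr 0. dact0 x (g l) \<xi> v = D x"
        using dact0_linear_x[of "g l" \<xi> v] I(3) l by blast
      have "((\<lambda>s. D (Ad K (?e s) y)) has_vector_derivative D (br x y)) (at 0)"
        by (rule bounded_linear.has_vector_derivative[OF _ Ad_expo_deriv_0])
          (use D(1) in \<open>simp add: linear_conv_bounded_linear\<close>)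
      then have 1: "((\<lambda>s. dact0 (Ad K (?e s) y) (g l) \<xi> v) has_vector_derivative dact0 (br x y) (g l) \<xi> v) (at 0)"
        using D(2) Ad_G0[OF e y] brxy by simp
      have "((\<lambda>s. l (act0 (?e s) F)) has_real_derivative l (dact0 x F)) (at 0)"
        using I(2) l by (intro has_pointwise_derivative_evaluation[OF dact0_derivative[OF F x]]) blast
      from has_vector_derivative_scaleR[OF this 1] show ?thesis
        by (simp add: expo_0 Ad_one act0_one)
    qed
    have "((\<lambda>s. \<Sum>l\<in>I. l (act0 (?e s) F) *\<^sub>R dact0 (Ad K (?e s) y) (g l) \<xi> v) has_vector_derivative
        (\<Sum>l\<in>I. l F *\<^sub>R dact0 (br x y) (g l) \<xi> v + l (dact0 x F) *\<^sub>R dact0 y (g l) \<xi> v)) (at 0)"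
      by (rule has_vector_derivative_sum[OF summand])
    moreover have "dact0 (Ad K (?e s) y) (act0 (?e s) F) \<xi> v = (\<Sum>l\<in>I. l (act0 (?e s) F) *\<^sub>R dact0 (Ad K (?e s) y) (g l) \<xi> v)" for s
      by (simp only: expand[OF Ad_G0[OF e y] act0_tensor_space[OF e F]] ev)
    moreover have "(dact0 (br x y) F + dact0 y (dact0 x F)) \<xi> v =
        (\<Sum>l\<in>I. l F *\<^sub>R dact0 (br x y) (g l) \<xi> v + l (dact0 x F) *\<^sub>R dact0 y (g l) \<xi> v)"
      by (simp only: plus_fun_apply expand[OF brxy F] expand[OF y dact0_tensor_space[OF F x]] ev sum.distrib)
    ultimately show "((\<lambda>s. dact0 (Ad K (?e s) y) (act0 (?e s) F) \<xi> v) has_vector_derivative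
        (dact0 (br x y) F + dact0 y (dact0 x F)) \<xi> v) (at 0)" by simp
  qed
  then have "has_pointwise_derivative (\<lambda>s. act0 (?e s) (dact0 y F)) (dact0 (br x y) F + dact0 y (dact0 x F))"
    by (simp only: dact0_equivariant[OF e F y])
  then have "dact0 x (dact0 y F) = dact0 (br x y) F + dact0 y (dact0 x F)" by (rule dact0_eqI)
  then show ?thesis by simp
qed

end

section \<open>The density character\<close>

text \<open>The range lies in \<open>span B\<close>, so the trace on the whole space is already seen
  on \<open>B\<close>; this turns a trace of projected operators into a trace on one grade.\<close>

lemma trace_of_basis:
  fixes f :: "'a::euclidean_space \<Rightarrow> 'a"
  assumes f: "linear f" and B: "independent B" "finite B" "\<And>x. f x \<in> span B"
  shows "trace_of f = (\<Sum>b\<in>B. representation B (f b) b)"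
proof -
  have "trace_of f = (\<Sum>e\<in>Basis. \<Sum>b\<in>B. representation B (f e) b * (b \<bullet> e))"
    unfolding trace_of_def
  proof (intro sum.cong refl)
    fix e :: 'a
    have "f e \<bullet> e = (\<Sum>b\<in>B. representation B (f e) b *\<^sub>R b) \<bullet> e"
      using sum_representation_eq[OF B(1) B(3) B(2) subset_refl, of e] by simp
    then show "f e \<bullet> e = (\<Sum>b\<in>B. representation B (f e) b * (b \<bullet> e))" by (simp add: inner_sum_left)
  qed
  also have "\<dots> = (\<Sum>b\<in>B. \<Sum>e\<in>Basis. representation B (f e) b * (b \<bullet> e))" by (rule sum.swap)
  also have "\<dots> = (\<Sum>b\<in>B. representation B (f b) b)"
  proof (intro sum.cong refl)
    fix b
    have "f b = (\<Sum>e\<in>Basis. (b \<bullet> e) *\<^sub>R f e)"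
      by (subst euclidean_representation[of b, symmetric])
        (simp only: linear_sum[OF f] linear_scale[OF f])
    then have "representation B (f b) b = representation B (\<Sum>e\<in>Basis. (b \<bullet> e) *\<^sub>R f e) b" by (rule arg_cong)
    also have "\<dots> = (\<Sum>e\<in>Basis. (b \<bullet> e) * representation B (f e) b)"
      by (simp add: representation_sum[OF B(1)] representation_scale[OF B(1)] B(3) span_scale)
    finally show "(\<Sum>e\<in>Basis. representation B (f e) b * (b \<bullet> e)) = representation B (f b) b"
      by (simp add: mult.commute)
  qed
  finally show ?thesis .
qed

context lie_pair
begin

definition dim_neg :: real where "dim_neg = real (dim (gr (-1)))"

lemma dim_neg_pos: "dim_neg > 0"
proof -
  have "gr (-1) \<noteq> {0}" using setting by (simp add: graded_pair_setting_def one_grading_def)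
  then have "\<not> gr (-1) \<subseteq> {0}" using subspace_0[OF subspace_gr] by blast
  then have "dim (gr (-1)) \<noteq> 0" by (metis dim_eq_0)
  then show ?thesis by (simp only: dim_neg_def of_nat_0_less_iff neq0_conv)
qed

text \<open>The trace of \<open>ad x\<close> on \<open>\<gg>\<^sub>-\<^sub>1\<close> divided by its dimension, expressed by the Killing form.\<close>

definition density_deriv :: "'a \<Rightarrow> real" where "density_deriv x = - killing br E x / (2 * dim_neg)"

text \<open>Jacobi's formula at the identity, read off the Leibniz expansion: the derivative is the
  trace of ad x on \<open>gr (-1)\<close>, which \<open>killing_E_trace\<close> converts into the
  Killing form.\<close>

lemma det_on_expo:
  assumes x: "x \<in> gr 0"
  shows "((\<lambda>t. det_on (gr (-1)) (Ad K (expo K (t *\<^sub>R x)))) has_real_derivative dim_neg * density_deriv x) (at 0)"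
    and det_on_expo_0: "det_on (gr (-1)) (Ad K (expo K (0 *\<^sub>R x))) = 1"
proof -
  define B where "B = (SOME B. independent B \<and> span B = gr (-1))"
  have "\<exists>B. independent B \<and> span B = gr (-1)"
    using basis_exists[of "gr (-1)"] span_subspace[OF _ _ subspace_gr] by metis
  from someI_ex[OF this] have B: "independent B" "span B = gr (-1)" unfolding B_def by blast+
  have fin: "finite B" using B(1) independent_imp_finite by blast
  \<comment> \<open>Coordinates with respect to \<open>B\<close> are meaningful on
    \<open>span B\<close>; composing with the grade projection makes them linear on the whole
    algebra.\<close>
  define l where "l b y = representation B (grade_proj (-1) y) b" for b y
  have gpB: "grade_proj (-1) y \<in> span B" for y using L.grade_proj_gr B(2) by blast
  have lin: "linear (l b)" for b
    using linear_add[OF L.linear_grade_proj] linear_scale[OF L.linear_grade_proj]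
    by (simp add: linear_iff l_def representation_add[OF B(1)] representation_scale[OF B(1)] gpB)
  have e: "expo K (t *\<^sub>R x) \<in> G0 K" for t by (rule expo_scale_G0[OF x])
  have Bgr: "b \<in> gr (-1)" if "b \<in> B" for b using that B(2) span_base by blast
  define m where "m t b c = l c (Ad K (expo K (t *\<^sub>R x)) b)" for t b c
  have rep: "representation B (Ad K (expo K (t *\<^sub>R x)) b) c = m t b c" if "b \<in> B" for t b c
    using L.grade_proj_eq[OF Ad_G0[OF e Bgr[OF that]], of "-1"] by (simp add: m_def l_def)
  have m0: "m 0 b c = (if b = c then 1 else 0)" if "b \<in> B" for b c
    using L.grade_proj_eq[OF Bgr[OF that], of "-1"] representation_basis[OF B(1) that]
    by (simp add: m_def l_def expo_0 Ad_one)
  have det: "det_on (gr (-1)) (Ad K (expo K (t *\<^sub>R x))) =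
      (\<Sum>p | p permutes B. of_int (sign p) * (\<Prod>b\<in>B. m t b (p b)))" for t
    unfolding det_on_def B_def[symmetric] Let_def by (intro sum.cong arg_cong2[of _ _ _ _ times] prod.cong refl rep)
  \<comment> \<open>A permutation other than \<open>id\<close> moves at least two points. Even after
    the product rule removes one factor, an off-diagonal entry remains, and it is 0 at t =
    0.\<close>
  have moved: "\<exists>b\<in>B - {a}. p b \<noteq> b" if p: "p permutes B" "p \<noteq> id" for p a
  proof -
    from p(2) obtain b where b: "p b \<noteq> b" by (auto simp: fun_eq_iff)
    have 1: "b \<in> B" "p b \<in> B" "p (p b) \<noteq> p b"
      using b p(1) permutes_not_in[OF p(1)] permutes_in_image[OF p(1)] permutes_inj[OF p(1)]
      by (blast, metis, metis injD)
    show ?thesis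
    proof (cases "a = b")
      case True
      show ?thesis by (rule bexI[of _ "p b"]) (use 1 b True in auto)
    next
      case False
      show ?thesis by (rule bexI[of _ b]) (use 1 b False in auto)
    qed
  qed
  have vanish: "(\<Prod>b\<in>B - {a}. m 0 b (p b)) = 0" if "p permutes B" "p \<noteq> id" for p a
  proof -
    from moved[OF that, of a] obtain b where b: "b \<in> B - {a}" "p b \<noteq> b" by blast
    then show ?thesis using fin m0[of b "p b"] by (intro prod_zero) auto
  qed
  have finp: "finite {p. p permutes B}" using fin by (rule finite_permutations)
  have dm: "((\<lambda>t. m t b c) has_real_derivative l c (br x b)) (at 0)" for b c
    unfolding m_def has_real_derivative_iff_has_vector_derivative
    by (rule bounded_linear.has_vector_derivative[OF _ Ad_expo_deriv_0])
      (use lin in \<open>simp add: linear_conv_bounded_linear\<close>)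
  have dprod: "((\<lambda>t. \<Prod>b\<in>B. m t b (p b)) has_real_derivative
      (\<Sum>b\<in>B. l (p b) (br x b) * (\<Prod>a\<in>B - {b}. m 0 a (p a)))) (at 0)" for p
  proof -
    have "((\<lambda>t. \<Prod>b\<in>B. m t b (p b)) has_derivative
      (\<lambda>y. \<Sum>b\<in>B. l (p b) (br x b) * y * (\<Prod>a\<in>B - {b}. m 0 a (p a)))) (at 0)"
      using dm unfolding has_field_derivative_def by (rule has_derivative_prod)
    moreover have "(\<lambda>y. \<Sum>b\<in>B. l (p b) (br x b) * y * (\<Prod>a\<in>B - {b}. m 0 a (p a)))
      = (*) (\<Sum>b\<in>B. l (p b) (br x b) * (\<Prod>a\<in>B - {b}. m 0 a (p a)))"
      by (simp add: fun_eq_iff sum_distrib_left mult_ac)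
    ultimately show ?thesis unfolding has_field_derivative_def by (simp only:)
  qed
  have tr: "(\<Sum>b\<in>B. l b (br x b)) = dim_neg * density_deriv x"
  proof -
    have "(\<Sum>b\<in>B. l b (br x b)) = trace_of (\<lambda>z. grade_proj (-1) (br x z))"
      unfolding l_def
      by (rule trace_of_basis[OF _ B(1) fin gpB, symmetric])
        (use linear_compose[OF br_linear_right L.linear_grade_proj] in \<open>simp add: o_def\<close>)
    then show ?thesis using L.killing_E_trace[OF x] dim_neg_pos by (simp add: density_deriv_def)
  qed
  have id: "(\<Sum>b\<in>B. l (id b) (br x b) * (\<Prod>a\<in>B - {b}. m 0 a (id a))) = dim_neg * density_deriv x"
    by (subst tr[symmetric]) (simp add: m0)
  have "((\<lambda>t. \<Sum>p | p permutes B. of_int (sign p) * (\<Prod>b\<in>B. m t b (p b))) has_real_derivative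
      (\<Sum>p | p permutes B. of_int (sign p) * (\<Sum>b\<in>B. l (p b) (br x b) * (\<Prod>a\<in>B - {b}. m 0 a (p a))))) (at 0)"
    by (intro DERIV_sum DERIV_cmult dprod)
  also have "(\<Sum>p | p permutes B. of_int (sign p) * (\<Sum>b\<in>B. l (p b) (br x b) * (\<Prod>a\<in>B - {b}. m 0 a (p a)))) = dim_neg * density_deriv x"
  proof (subst sum.remove[OF finp, of id])
    show "id \<in> {p. p permutes B}" by (simp add: permutes_id)
    have "(\<Sum>p\<in>{p. p permutes B} - {id}. of_int (sign p) * (\<Sum>b\<in>B. l (p b) (br x b) * (\<Prod>a\<in>B - {b}. m 0 a (p a)))) = 0"
      by (intro sum.neutral) (simp add: vanish)
    then show "of_int (sign id) * (\<Sum>b\<in>B. l (id b) (br x b) * (\<Prod>a\<in>B - {b}. m 0 a (id a))) +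
      (\<Sum>p\<in>{p. p permutes B} - {id}. of_int (sign p) * (\<Sum>b\<in>B. l (p b) (br x b) * (\<Prod>a\<in>B - {b}. m 0 a (p a)))) = dim_neg * density_deriv x"
      by (simp only: id) (simp add: sign_id)
  qed
  finally show "((\<lambda>t. det_on (gr (-1)) (Ad K (expo K (t *\<^sub>R x)))) has_real_derivative dim_neg * density_deriv x) (at 0)"
    unfolding det .
  have "(\<Prod>b\<in>B. m 0 b (p b)) = 0" if p: "p permutes B" "p \<noteq> id" for p
  proof -
    from moved[OF p] obtain b where "b \<in> B" "p b \<noteq> b" by blast
    then show ?thesis using fin m0[of b "p b"] by (intro prod_zero) auto
  qed
  then have "(\<Sum>p\<in>{p. p permutes B} - {id}. of_int (sign p) * (\<Prod>b\<in>B. m 0 b (p b))) = 0"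
    by (intro sum.neutral) simp
  then show "det_on (gr (-1)) (Ad K (expo K (0 *\<^sub>R x))) = 1"
    unfolding det by (subst sum.remove[OF finp, of id]) (simp_all add: permutes_id sign_id m0)
qed

text \<open>The determinant is 1 at t = 0 and hence positive nearby, so the absolute value
  disappears; the exponent \<delta> / \<open>dim_neg\<close> cancels the dimension in the
  derivative.\<close>

lemma density_expo:
  assumes x: "x \<in> gr 0"
  shows "((\<lambda>t. density_char K \<delta> (expo K (t *\<^sub>R x))) has_real_derivative \<delta> * density_deriv x) (at 0)"
    and density_expo_0: "density_char K \<delta> (expo K (0 *\<^sub>R x)) = 1"
proof -
  let ?f = "\<lambda>t. det_on (gr (-1)) (Ad K (expo K (t *\<^sub>R x)))"
  note f = det_on_expo[OF x] det_on_expo_0[OF x]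
  have "((\<lambda>t. ?f t powr (\<delta> / dim_neg)) has_real_derivative (\<delta> / dim_neg) * ?f 0 powr (\<delta> / dim_neg - of_nat 1) * (dim_neg * density_deriv x)) (at 0)"
    by (rule DERIV_fun_powr[OF f(1)]) (simp add: f(2)[simplified])
  then have 1: "((\<lambda>t. ?f t powr (\<delta> / dim_neg)) has_real_derivative \<delta> * density_deriv x) (at 0)"
    using dim_neg_pos f(2) by simp
  have "\<forall>\<^sub>F t in nhds 0. ?f t > 0"
    using order_tendstoD(1)[OF DERIV_isCont[OF f(1), unfolded isCont_def], of 0] f(2)
    by (auto simp: eventually_nhds_conv_at)
  then have ev: "\<forall>\<^sub>F t in nhds 0. ?f t powr (\<delta> / dim_neg) = density_char K \<delta> (expo K (t *\<^sub>R x))"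
    by eventually_elim (simp add: density_char_def dim_neg_def)
  show "((\<lambda>t. density_char K \<delta> (expo K (t *\<^sub>R x))) has_real_derivative \<delta> * density_deriv x) (at 0)"
    using 1 DERIV_cong_ev[OF refl ev refl] by blast
  show "density_char K \<delta> (expo K (0 *\<^sub>R x)) = 1"
    using f(2) by (simp add: density_char_def)
qed

end

context lie_rep
begin

lemma act_derivative:
  assumes F: "F \<in> tensor_space" and x: "x \<in> gr 0"
  shows "has_pointwise_derivative (\<lambda>t. act K \<sigma> \<tau> \<delta> (expo K (t *\<^sub>R x)) F) ((\<delta> * density_deriv x) *\<^sub>R F + dact0 x F)"
  unfolding has_pointwise_derivative_def
proof (intro allI)
  fix \<xi> v
  have "((\<lambda>t. density_char K \<delta> (expo K (t *\<^sub>R x)) *\<^sub>R act0 (expo K (t *\<^sub>R x)) F \<xi> v) has_vector_derivative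
     density_char K \<delta> (expo K (0 *\<^sub>R x)) *\<^sub>R dact0 x F \<xi> v + (\<delta> * density_deriv x) *\<^sub>R act0 (expo K (0 *\<^sub>R x)) F \<xi> v) (at 0)"
    using dact0_derivative[OF F x] unfolding has_pointwise_derivative_def
    by (intro has_vector_derivative_scaleR density_expo[OF x]) blast
  then show "((\<lambda>t. act K \<sigma> \<tau> \<delta> (expo K (t *\<^sub>R x)) F \<xi> v) has_vector_derivative ((\<delta> * density_deriv x) *\<^sub>R F + dact0 x F) \<xi> v) (at 0)"
    unfolding act_eq[OF expo_scale_G0[OF x]] scaleR_fun_apply plus_fun_apply density_expo_0[OF x]
    by (simp add: expo_0 act0_one add.commute)
qed

lemma dact_eq:
  "F \<in> tensor_space \<Longrightarrow> x \<in> gr 0 \<Longrightarrow> dact K \<sigma> \<tau> \<delta> x F = (\<delta> * density_deriv x) *\<^sub>R F + dact0 x F"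
  unfolding dact_def using act_derivative[of F x \<delta>] unfolding has_pointwise_derivative_def
  by (intro ext vector_derivative_at) blast

end

section \<open>The action of the grading element\<close>

context lie_pair
begin

text \<open>Schur's lemma over the reals: diagonalizability of central elements provides a real
  eigenvalue, and the eigenspace is invariant under \<open>G0\<close>.\<close>

lemma center_scalar:
  assumes \<rho>: "irreducible_G0_rep K (\<rho> :: 'g \<Rightarrow> 'x::euclidean_space \<Rightarrow> 'x)" and z: "z \<in> center_G0 K"
  shows "\<exists>c. \<forall>v. \<rho> z v = c *\<^sub>R v"
proof -
  have lin: "linear (\<rho> g)" if "g \<in> G0 K" for g using \<rho> that by (simp add: irreducible_G0_rep_def G0_rep_def)
  have zG: "z \<in> G0 K" and comm: "\<And>g. g \<in> G0 K \<Longrightarrow> z \<otimes>\<^bsub>G\<^esub> g = g \<otimes>\<^bsub>G\<^esub> z"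
    using z by (simp_all add: center_G0_def)
  have "\<exists>c v. v \<noteq> 0 \<and> \<rho> z v = c *\<^sub>R v"
  proof (rule ccontr)
    assume none: "\<nexists>c v. v \<noteq> 0 \<and> \<rho> z v = c *\<^sub>R v"
    then have "{v. \<exists>c. \<rho> z v = c *\<^sub>R v} \<subseteq> {0}" by blast
    from span_mono[OF this] have "span {v. \<exists>c. \<rho> z v = c *\<^sub>R v} \<subseteq> {0}" by simp
    moreover have "span {v. \<exists>c. \<rho> z v = c *\<^sub>R v} = UNIV"
      using \<rho> z by (simp add: irreducible_G0_rep_def G0_rep_def diagonalizable_def)
    ultimately have "(SOME b. b \<in> Basis) = (0 :: 'x)" by blast
    then show False using nonzero_Basis[OF SOME_Basis] by blast
  qed
  then obtain c v where v: "v \<noteq> 0" "\<rho> z v = c *\<^sub>R v" by blast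
  define U where "U = {v. \<rho> z v = c *\<^sub>R v}"
  have "subspace U"
    using linear_add[OF lin[OF zG]] linear_scale[OF lin[OF zG]] linear_0[OF lin[OF zG]]
    by (simp add: subspace_def U_def algebra_simps)
  moreover have "\<rho> g ` U \<subseteq> U" if g: "g \<in> G0 K" for g
  proof (rule image_subsetI)
    fix u assume u: "u \<in> U"
    have m: "\<rho> (a \<otimes>\<^bsub>G\<^esub> b) = \<rho> a \<circ> \<rho> b" if "a \<in> G0 K" "b \<in> G0 K" for a b
      using \<rho> that by (simp add: irreducible_G0_rep_def G0_rep_def)
    have "\<rho> z (\<rho> g u) = \<rho> g (\<rho> z u)"
      using fun_cong[OF m[OF zG g], of u] fun_cong[OF m[OF g zG], of u] comm[OF g] by simp
    then show "\<rho> g u \<in> U" using u linear_scale[OF lin[OF g]] by (simp add: U_def)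
  qed
  ultimately have "U = {0} \<or> U = UNIV" using \<rho> by (simp add: irreducible_G0_rep_def)
  then have "U = UNIV" using v by (auto simp: U_def)
  then show ?thesis by (auto simp: U_def)
qed

lemma expo_E_derivative:
  assumes \<rho>: "irreducible_G0_rep K (\<rho> :: 'g \<Rightarrow> 'x::euclidean_space \<Rightarrow> 'x)"
  shows "\<exists>s. \<forall>v. ((\<lambda>t. \<rho> (expo K (t *\<^sub>R E)) v) has_vector_derivative s *\<^sub>R v) (at 0)"
proof -
  have "\<exists>c. \<forall>v. \<rho> (expo K (t *\<^sub>R E)) v = c *\<^sub>R v" for t by (rule center_scalar[OF \<rho> expo_E_center])
  then obtain c where c: "\<And>t v. \<rho> (expo K (t *\<^sub>R E)) v = c t *\<^sub>R v" by metis
  \<comment> \<open>Pairing with a unit vector turns smoothness of the representation into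
    differentiability of the scalar \<open>c\<close>.\<close>
  define e :: 'x where "e = (SOME b. b \<in> Basis)"
  have e: "e \<in> Basis" unfolding e_def by (rule SOME_Basis)
  have "smooth_on_subset (charts K) (G0 K) (\<lambda>g. \<rho> g e)"
    using \<rho> by (simp add: irreducible_G0_rep_def G0_rep_def)
  from diff_at_1_smooth[OF this] obtain D where
    "\<forall>x\<in>gr 0. ((\<lambda>t. \<rho> (expo K (t *\<^sub>R x)) e) has_vector_derivative D x) (at 0)"
    unfolding diff_at_1_def by blast
  from bspec[OF this L.E_gr0] have "((\<lambda>t. c t *\<^sub>R e) has_vector_derivative D E) (at 0)" by (simp only: c)
  from bounded_linear.has_vector_derivative[OF bounded_linear_inner_left this, of e]
  have "(c has_vector_derivative D E \<bullet> e) (at 0)" using e by (simp add: inner_same_Basis)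
  from bounded_linear.has_vector_derivative[OF bounded_linear_scaleR_left this]
  show ?thesis unfolding c by blast
qed

end

section \<open>Degrees of tensors and the filtration\<close>

context lie_rep
begin

definition s\<sigma> :: real where
  "s\<sigma> = (SOME s. \<forall>v. ((\<lambda>t. \<sigma> (expo K (t *\<^sub>R E)) v) has_vector_derivative s *\<^sub>R v) (at 0))"

definition s\<tau> :: real where
  "s\<tau> = (SOME s. \<forall>v. ((\<lambda>t. \<tau> (expo K (t *\<^sub>R E)) v) has_vector_derivative s *\<^sub>R v) (at 0))"

lemma s\<sigma>: "((\<lambda>t. \<sigma> (expo K (t *\<^sub>R E)) v) has_vector_derivative s\<sigma> *\<^sub>R v) (at 0)"
  unfolding s\<sigma>_def by (rule spec[OF someI_ex[OF expo_E_derivative[OF \<sigma>]]])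

lemma s\<tau>: "((\<lambda>t. \<tau> (expo K (t *\<^sub>R E)) w) has_vector_derivative s\<tau> *\<^sub>R w) (at 0)"
  unfolding s\<tau>_def by (rule spec[OF someI_ex[OF expo_E_derivative[OF \<tau>]]])

lemma s\<sigma>_inv: "((\<lambda>t. \<sigma> (inv\<^bsub>G\<^esub> expo K (t *\<^sub>R E)) v) has_vector_derivative - s\<sigma> *\<^sub>R v) (at 0)"
proof -
  have "((\<lambda>t. \<sigma> (expo K (- t *\<^sub>R E)) v) has_vector_derivative (-1) *\<^sub>R s\<sigma> *\<^sub>R v) (at 0)"
    by (rule vector_diff_chain_at[of uminus "-1" 0 "\<lambda>t. \<sigma> (expo K (t *\<^sub>R E)) v", unfolded o_def])
      (use s\<sigma>[of v] in \<open>auto intro!: derivative_eq_intros simp: has_vector_derivative_minus\<close>)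
  moreover have "expo K (- t *\<^sub>R E) = inv\<^bsub>G\<^esub> expo K (t *\<^sub>R E)" for t
    using expo_minus[of "t *\<^sub>R E"] by simp
  ultimately show ?thesis by simp
qed

text \<open>The scalar by which \<open>E\<close> acts on the factor built from \<open>V\<close> and
  \<open>W\<close> at weight 0; \<open>V\<close> enters through its dual, hence the minus
  sign.\<close>

definition degree_shift :: real where "degree_shift = s\<tau> - s\<sigma>"

lemma dact0_E_tensor:
  assumes as: "list_all2 (\<lambda>a i. a \<in> gr i) as is" "length as = k" and f: "linear f"
  shows "dact0 E (tensor as f w) = (of_int (sum_list is) + degree_shift) *\<^sub>R tensor as f w"
proof (rule dact0_eqI, unfold has_pointwise_derivative_def, intro allI)
  fix \<xi> :: "'a \<Rightarrow>\<^sub>L real" and v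
  let ?e = "\<lambda>t. expo K (t *\<^sub>R E)"
  let ?p = "prod_list (map (blinfun_apply \<xi>) as)"
  have e: "?e t \<in> G0 K" for t by (rule expo_scale_G0[OF L.E_gr0])
  have e0: "?e 0 = \<one>\<^bsub>G\<^esub>" by (simp add: expo_0)
  have 1: "((\<lambda>t. prod_list (map (\<lambda>a. \<xi> (Ad K (?e t) a)) as)) has_vector_derivative of_int (sum_list is) * ?p) (at 0)"
    using as(1)
  proof (induction as "is" rule: list_all2_induct)
    case Nil show ?case by simp
  next
    case (Cons a as i "is")
    have "((\<lambda>t. \<xi> (Ad K (?e t) a)) has_vector_derivative \<xi> (br E a)) (at 0)"
      by (rule bounded_linear.has_vector_derivative[OF blinfun.bounded_linear_right Ad_expo_deriv_0])
    then have "((\<lambda>t. \<xi> (Ad K (?e t) a)) has_vector_derivative of_int i * \<xi> a) (at 0)"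
      using L.br_E_gr[OF Cons.hyps(1)] by (simp add: blinfun.scaleR_right)
    from has_vector_derivative_mult[OF this Cons.IH] show ?case
      by (simp add: expo_0 Ad_one algebra_simps)
  qed
  have 2: "((\<lambda>t. f (\<sigma> (inv\<^bsub>G\<^esub> ?e t) v)) has_vector_derivative - s\<sigma> * f v) (at 0)"
    using bounded_linear.has_vector_derivative[OF _ s\<sigma>_inv, of f v] f
    by (simp add: linear_conv_bounded_linear linear_scale linear_neg)
  have inv1: "\<sigma> (inv\<^bsub>G\<^esub> ?e 0) v = v" by (simp add: expo_0 \<sigma>_one)
  have "((\<lambda>t. prod_list (map (\<lambda>a. \<xi> (Ad K (?e t) a)) as) * f (\<sigma> (inv\<^bsub>G\<^esub> ?e t) v)) has_vector_derivative
      (of_int (sum_list is) - s\<sigma>) * (?p * f v)) (at 0)"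
    using has_vector_derivative_mult[OF 1 2]
    by (simp add: expo_0 Ad_one \<sigma>_one algebra_simps)
  from has_vector_derivative_scaleR[OF this[folded has_real_derivative_iff_has_vector_derivative] s\<tau>[of w]]
  have "((\<lambda>t. (prod_list (map (\<lambda>a. \<xi> (Ad K (?e t) a)) as) * f (\<sigma> (inv\<^bsub>G\<^esub> ?e t) v)) *\<^sub>R \<tau> (?e t) w) has_vector_derivative
      (of_int (sum_list is) + degree_shift) *\<^sub>R (?p * f v) *\<^sub>R w) (at 0)"
    by (simp add: expo_0 Ad_one \<sigma>_one \<tau>_one degree_shift_def algebra_simps)
  then show "((\<lambda>t. act0 (?e t) (tensor as f w) \<xi> v) has_vector_derivative
      ((of_int (sum_list is) + degree_shift) *\<^sub>R tensor as f w) \<xi> v) (at 0)"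
    unfolding act0_tensor[OF e] scaleR_fun_apply by (simp add: tensor_def o_def)
qed

text \<open>Each factor lies in a single grade, so \<open>E\<close> acts on every such generator by
  a scalar, in contrast to the generators in the definition of \<open>filtration\<close>. Level
  \<open>l\<close> collects all total degrees from \<open>l\<close> upwards.\<close>

definition homogeneous :: "int \<Rightarrow> ('a, 'v, 'w) tens set" where
  "homogeneous l = {tensor as f w | as f w. length as = k \<and> linear f \<and>
     (\<exists>is. list_all2 (\<lambda>a i. a \<in> gr i \<and> i \<in> {-1, 0, 1}) as is \<and> sum_list is \<ge> l)}"

lemma homogeneous_I:
  "length as = k \<Longrightarrow> linear f \<Longrightarrow> list_all2 (\<lambda>a i. a \<in> gr i \<and> i \<in> {-1, 0, 1}) as is \<Longrightarrow> l \<le> sum_list is \<Longrightarrow>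
   tensor as f w \<in> homogeneous l"
  unfolding homogeneous_def by (rule CollectI, intro exI conjI, rule refl, assumption+)

lemma homogeneous_E:
  assumes "x \<in> homogeneous l"
  obtains as f w "is" where "x = tensor as f w" "length as = k" "linear f"
    "list_all2 (\<lambda>a i. a \<in> gr i \<and> i \<in> {-1, 0, 1}) as is" "sum_list is \<ge> l"
  using assms unfolding homogeneous_def by (elim CollectE exE conjE) (rule that)

lemma tensor_space_I: "length as = k \<Longrightarrow> linear f \<Longrightarrow> tensor as f w \<in> tensor_space"
  unfolding tensor_space_def by (rule span_base, rule CollectI, intro exI conjI, rule refl)

lemma homogeneous_tensor_space: "homogeneous l \<subseteq> tensor_space"
proof
  fix x assume "x \<in> homogeneous l"
  then show "x \<in> tensor_space" by (rule homogeneous_E) (simp only: tensor_space_I)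
qed

lemma filtration_I:
  assumes "length as = k" "linear f" "length is = k" "l \<le> sum_list is"
    "\<forall>j<k. is ! j \<in> {-1, 0, 1} \<and> as ! j \<in> filtr gr (is ! j)"
  shows "tensor as f w \<in> filtration K k l"
  unfolding filtration_def
  by (rule span_base, rule CollectI, intro exI conjI) (rule refl assms)+

lemma homogeneous_filtration: "homogeneous l \<subseteq> filtration K k l"
proof
  fix x assume "x \<in> homogeneous l"
  then obtain as f w "is" where x: "x = tensor as f w" "length as = k" "linear f"
    "list_all2 (\<lambda>a i. a \<in> gr i \<and> i \<in> {-1, 0, 1}) as is" "sum_list is \<ge> l"
    by (rule homogeneous_E)
  have len: "length is = k" using list_all2_lengthD[OF x(4)] x(2) by simp
  have "is ! j \<in> {-1, 0, 1} \<and> as ! j \<in> filtr gr (is ! j)" if jk: "j < k" for j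
  proof -
    have "j < length as" using jk x(2) by simp
    note j = list_all2_nthD[OF x(4) this]
    then have "is ! j \<le> 1" by auto
    then have "as ! j \<in> (\<Union>i\<in>{is ! j..1}. gr i)" using j by (intro UN_I[of "is ! j"]) simp_all
    then show ?thesis unfolding filtr_def using j by (intro conjI span_base) simp_all
  qed
  then show "x \<in> filtration K k l" unfolding x(1) by (intro filtration_I[OF x(2,3) len x(5)] allI impI)
qed

text \<open>A factor in the filtration component of degree i is a sum of elements of grades i and
  higher, so expanding all slots can only raise the total degree.\<close>

lemma filtration_homogeneous: "filtration K k l \<subseteq> span (homogeneous l)"
  unfolding filtration_def
proof (rule span_minimal[OF subsetI subspace_span])
  fix x :: "('a, 'v, 'w) tens"
  assume "x \<in> {tensor as f w | as f w. length as = k \<and> linear f \<and> (\<exists>is. length is = k \<and> sum_list is \<ge> l \<and>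
        (\<forall>j<k. is ! j \<in> {-1, 0, 1} \<and> as ! j \<in> filtr gr (is ! j)))}"
  then obtain as f w "is" where x: "x = tensor as f w" "length as = k" "linear f" "length is = k" "sum_list is \<ge> l"
    "\<forall>j<k. is ! j \<in> {-1, 0, 1} \<and> as ! j \<in> filtr gr (is ! j)" by (elim CollectE exE conjE)
  let ?U = "\<lambda>i. \<Union>j\<in>{i..1}. gr j"
  have "tensor ([] @ as) f w \<in> span (homogeneous l)"
  proof (rule tensor_multilinear[OF subspace_span])
    show "list_all2 (\<lambda>a S. a \<in> span S) as (map ?U is)"
      using x(2,4,6) by (simp add: list_all2_conv_all_nth filtr_def)
    fix bs assume bs: "list_all2 (\<in>) bs (map ?U is)"
    have len: "length bs = k" using list_all2_lengthD[OF bs] x(4) by simp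
    have "\<exists>i. i \<in> {is ! j..1} \<and> bs ! j \<in> gr i" if "j < k" for j
      using list_all2_nthD2[OF bs, of j] x(4) that by auto
    then obtain d where d: "\<And>j. j < k \<Longrightarrow> d j \<in> {is ! j..1} \<and> bs ! j \<in> gr (d j)" by metis
    have "d j \<in> {-1, 0, 1}" if "j < k" for j
    proof -
      have "-1 \<le> is ! j" using x(6) that by auto
      then show ?thesis using d[OF that] by auto
    qed
    then have "list_all2 (\<lambda>a i. a \<in> gr i \<and> i \<in> {-1, 0, 1}) bs (map d [0..<k])"
      using d len by (simp add: list_all2_conv_all_nth)
    moreover have "sum_list (map d [0..<k]) \<ge> l"
    proof -
      have "l \<le> (\<Sum>j<k. is ! j)" using x(4,5) by (simp add: sum_list_sum_nth atLeast0LessThan)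
      also have "\<dots> \<le> (\<Sum>j<k. d j)" using d by (intro sum_mono) auto
      finally show ?thesis by (simp add: sum_list_sum_nth atLeast0LessThan)
    qed
    ultimately show "tensor ([] @ bs) f w \<in> span (homogeneous l)"
      unfolding append_Nil by (intro span_base homogeneous_I[OF len x(3)])
  qed
  then show "x \<in> span (homogeneous l)" by (simp add: x(1))
qed

lemma filtration_tensor_space: "filtration K k l \<subseteq> tensor_space"
  using filtration_homogeneous span_minimal[OF homogeneous_tensor_space subspace_tensor_space] by blast

lemma subspace_filtration: "subspace (filtration K k l)" by (simp add: filtration_def)

lemma dact0_E_span:
  assumes gen: "\<And>F. F \<in> T \<Longrightarrow> F \<in> tensor_space \<and> dact0 E F - c *\<^sub>R F \<in> W" and W: "subspace W" and F: "F \<in> span T"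
  shows "dact0 E F - c *\<^sub>R F \<in> W"
proof -
  have "F \<in> tensor_space \<and> dact0 E F - c *\<^sub>R F \<in> W"
    using F
  proof (induction rule: span_induct_alt)
    case base
    show ?case unfolding dact0_0[OF L.E_gr0] scaleR_zero_right diff_zero
      by (rule conjI[OF subspace_0[OF subspace_tensor_space] subspace_0[OF W]])
  next
    case (step a x y)
    note x = gen[OF step(1)]
    have 1: "a *\<^sub>R x + y \<in> tensor_space"
      by (rule subspace_add[OF subspace_tensor_space subspace_scale[OF subspace_tensor_space conjunct1[OF x]] conjunct1[OF step(2)]])
    have "dact0 E (a *\<^sub>R x + y) - c *\<^sub>R (a *\<^sub>R x + y) = a *\<^sub>R (dact0 E x - c *\<^sub>R x) + (dact0 E y - c *\<^sub>R y)"
      unfolding dact0_combine[OF conjunct1[OF x] conjunct1[OF step(2)] L.E_gr0]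
      by (simp only: scaleR_right_distrib scaleR_diff_right scaleR_scaleR mult.commute add_diff_add)
    moreover have "\<dots> \<in> W"
      by (rule subspace_add[OF W subspace_scale[OF W conjunct2[OF x]] conjunct2[OF step(2)]])
    ultimately show ?case using 1 by (simp only: conj_assoc)
  qed
  then show ?thesis ..
qed

text \<open>On a generator of degree j the difference is (j - l) times the generator: 0 for j = l,
  and in the next filtration component otherwise.\<close>

lemma dact0_E_filtration:
  assumes F: "F \<in> filtration K k l"
  shows "dact0 E F - (of_int l + degree_shift) *\<^sub>R F \<in> filtration K k (l + 1)"
proof (rule dact0_E_span[OF _ subspace_filtration subsetD[OF filtration_homogeneous F]])
  fix F :: "('a, 'v, 'w) tens" assume FH: "F \<in> homogeneous l"
  then obtain as f w "is" where x: "F = tensor as f w" "length as = k" "linear f"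
    "list_all2 (\<lambda>a i. a \<in> gr i \<and> i \<in> {-1, 0, 1}) as is" "sum_list is \<ge> l"
    by (rule homogeneous_E)
  have "list_all2 (\<lambda>a i. a \<in> gr i) as is" using x(4) by (rule list_all2_mono) blast
  from dact0_E_tensor[OF this x(2,3), of w]
  have eq: "dact0 E F - (of_int l + degree_shift) *\<^sub>R F = of_int (sum_list is - l) *\<^sub>R F"
    unfolding x(1) by (simp only: scaleR_diff_left[symmetric]) simp
  have "of_int (sum_list is - l) *\<^sub>R F \<in> filtration K k (l + 1)"
  proof (cases "sum_list is = l")
    case True
    have "of_int (sum_list is - l) *\<^sub>R F = 0" unfolding True by (simp only: diff_self of_int_0 scaleR_zero_left)
    then show ?thesis using subspace_0[OF subspace_filtration] by (simp only:)
  next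
    case False
    then have "l + 1 \<le> sum_list is" using x(5) by simp
    then have "F \<in> homogeneous (l + 1)" unfolding x(1) by (rule homogeneous_I[OF x(2-4)])
    then show ?thesis by (intro subspace_scale[OF subspace_filtration] subsetD[OF homogeneous_filtration])
  qed
  then show "F \<in> tensor_space \<and> dact0 E F - (of_int l + degree_shift) *\<^sub>R F \<in> filtration K k (l + 1)"
    unfolding eq using homogeneous_tensor_space FH by blast
qed

lemma symbol_space_tensor_space: "symbol_space K k \<subseteq> tensor_space"
  unfolding symbol_space_def tensor_space_def by (rule span_mono) blast

lemma dact0_E_symbol_space:
  assumes F: "F \<in> symbol_space K k"
  shows "dact0 E F - (degree_shift - real k) *\<^sub>R F \<in> {0}"
proof (rule dact0_E_span[OF _ subspace_single_0 F[unfolded symbol_space_def]])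
  fix F :: "('a, 'v, 'w) tens"
  assume "F \<in> {tensor as f w | as f w. length as = k \<and> linear f \<and> set as \<subseteq> gr (-1)}"
  then obtain as f w where x: "F = tensor as f w" "length as = k" "linear f" "set as \<subseteq> gr (-1)" by (elim CollectE exE conjE)
  have "list_all2 (\<lambda>a i. a \<in> gr i) as (replicate k (-1))"
    using x(2,4) by (auto simp: list_all2_conv_all_nth)
  from dact0_E_tensor[OF this x(2,3), of w]
  have "dact0 E F = (degree_shift - real k) *\<^sub>R F" unfolding x(1) by (simp add: sum_list_replicate algebra_simps)
  moreover have "F \<in> tensor_space" unfolding x(1) by (rule tensor_space_I[OF x(2,3)])
  ultimately show "F \<in> tensor_space \<and> dact0 E F - (degree_shift - real k) *\<^sub>R F \<in> {0}" by (simp only: diff_self singleton_iff)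
qed

end

section \<open>Casimir eigenvalues of irreducible quotients\<close>

lemma clinear_map_pair: "linear q \<Longrightarrow> clinear (\<lambda>X. (q (fst X), q (snd X)))"
  by (simp add: clinear_def cscale_def linear_add linear_diff linear_scale)

context lie_rep
begin

lemma act_equivariant:
  assumes g: "g \<in> G0 K" and F: "F \<in> tensor_space" and x: "x \<in> gr 0"
  shows "act K \<sigma> \<tau> \<delta> g (dact0 x F) = dact0 (Ad K g x) (act K \<sigma> \<tau> \<delta> g F)"
  unfolding act_eq[OF g] dact0_equivariant[OF g F x]
  by (rule dact0_scale[OF act0_tensor_space[OF g F] Ad_G0[OF g x], symmetric])

lemma linear_act: "g \<in> G0 K \<Longrightarrow> linear (act K \<sigma> \<tau> \<delta> g)"
  using linear_compose_scale_right[OF linear_act0] act_eq by presburger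

lemma act_tensor_space: "g \<in> G0 K \<Longrightarrow> F \<in> tensor_space \<Longrightarrow> act K \<sigma> \<tau> \<delta> g F \<in> tensor_space"
  using act_eq subspace_scale[OF subspace_tensor_space act0_tensor_space] by presburger

text \<open>Invariance is given for the action at weight \<delta>. Its derivative differs from
  \<open>dact0\<close> by a scalar multiple of \<open>F\<close>, which stays in
  \<open>U\<close>.\<close>

lemma dact0_invariant:
  assumes U: "invariant_subspace K \<sigma> \<tau> \<delta> (G0 K) U" "U \<subseteq> tensor_space" and F: "F \<in> U" and x: "x \<in> gr 0"
  shows "dact0 x F \<in> U"
proof -
  obtain S where S: "finite S" "tensor_space \<subseteq> span S" using tensor_space_finite by blast
  have sub: "subspace U" using U(1) by (simp add: invariant_subspace_def)
  have "(\<delta> * density_deriv x) *\<^sub>R F + dact0 x F \<in> U"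
  proof (rule pointwise_derivative_in_subspace[OF sub _ S(1) _ act_derivative[OF subsetD[OF U(2) F] x]])
    show "U \<subseteq> span S" using U(2) S(2) by blast
    show "act K \<sigma> \<tau> \<delta> (expo K (t *\<^sub>R x)) F \<in> U" for t
      using U(1) F expo_scale_G0[OF x, of t] unfolding invariant_subspace_def by blast
  qed
  from subspace_diff[OF sub this subspace_scale[OF sub F, of "\<delta> * density_deriv x"]]
  show ?thesis by (simp only: add_diff_cancel_left')
qed

end

text \<open>The quotient by \<open>B\<close> is realized as the range of \<open>q\<close>; the projection \<open>p\<close> onto the tensor module
  makes the action \<open>r\<close> below bilinear on the whole function space.\<close>

locale module_quotient = lie_rep K \<sigma> \<tau> k
  for K :: "('g, 'a::euclidean_space) graded_pair"
    and \<sigma> :: "'g \<Rightarrow> 'v::euclidean_space \<Rightarrow> 'v" and \<tau> :: "'g \<Rightarrow> 'w::euclidean_space \<Rightarrow> 'w" and k +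
  fixes d :: real and B :: "('a, 'v, 'w) tens set" and q p :: "('a, 'v, 'w) tens \<Rightarrow> ('a, 'v, 'w) tens"
  assumes B: "invariant_subspace K \<sigma> \<tau> d (G0 K) B" "B \<subseteq> tensor_space"
    and q: "linear q" "\<And>x. x \<in> B \<Longrightarrow> q x = 0" "\<And>x. x - q x \<in> B"
    and p: "linear p" "\<And>x. p x \<in> tensor_space" "\<And>x. x \<in> tensor_space \<Longrightarrow> p x = x"
begin

lemma subspace_B: "subspace B" using B(1) by (simp add: invariant_subspace_def)

lemma q_0_iff: "q x = 0 \<longleftrightarrow> x \<in> B"
  using q(2,3)[of x] by (metis diff_zero)

lemma q_tensor_space: assumes "x \<in> tensor_space" shows "q x \<in> tensor_space"
proof -
  have "x - (x - q x) \<in> tensor_space" by (rule subspace_diff[OF subspace_tensor_space assms subsetD[OF B(2) q(3)]])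
  then show ?thesis by (simp only: diff_diff_eq2 add_diff_cancel_left')
qed

text \<open>An operator that preserves \<open>B\<close> descends to the quotient, here to the range
  of \<open>q\<close>. The inner \<open>p\<close> does nothing on tensors.\<close>

lemma q_lift:
  assumes \<Lambda>: "\<And>F b. F \<in> tensor_space \<Longrightarrow> b \<in> B \<Longrightarrow> \<Lambda> (F - b) = \<Lambda> F - \<Lambda> b" "\<And>b. b \<in> B \<Longrightarrow> \<Lambda> b \<in> B"
    and F: "F \<in> tensor_space"
  shows "q (\<Lambda> (p (q F))) = q (\<Lambda> F)"
proof -
  have "p (q F) = F - (F - q F)" unfolding p(3)[OF q_tensor_space[OF F]] by (simp only: diff_diff_eq2 add_diff_cancel_left')
  then have "q (\<Lambda> (p (q F))) = q (\<Lambda> F - \<Lambda> (F - q F))" using \<Lambda>(1)[OF F q(3)] by (simp only:)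
  also have "\<dots> = q (\<Lambda> F)"
    unfolding linear_diff[OF q(1)] q(2)[OF \<Lambda>(2)[OF q(3)]] by (rule diff_zero)
  finally show ?thesis .
qed

text \<open>\<open>dact0\<close> is known to be linear only for elements of grade 0;
  \<open>grade_proj 0\<close> extends this to the Lie algebra argument as a whole.\<close>

definition r :: "'a \<Rightarrow> ('a, 'v, 'w) tens \<Rightarrow> ('a, 'v, 'w) tens" where
  "r x t = q (dact0 (grade_proj 0 x) (p t))"

lemma bilinear_r: "bilinear r"
proof -
  have "linear (r x)" for x
  proof
    show "r x (s + t) = r x s + r x t" for s t
      unfolding r_def linear_add[OF p(1)] dact0_add[OF p(2) p(2) L.grade_proj_gr] by (rule linear_add[OF q(1)])
    show "r x (c *\<^sub>R t) = c *\<^sub>R r x t" for c t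
      unfolding r_def linear_scale[OF p(1)] dact0_scale[OF p(2) L.grade_proj_gr] by (rule linear_scale[OF q(1)])
  qed
  moreover have "linear (\<lambda>x. r x t)" for t
  proof
    show "r (x + y) t = r x t + r y t" for x y
      unfolding r_def linear_add[OF L.linear_grade_proj] dact0_add_x[OF p(2) L.grade_proj_gr L.grade_proj_gr] by (rule linear_add[OF q(1)])
    show "r (c *\<^sub>R x) t = c *\<^sub>R r x t" for c x
      unfolding r_def linear_scale[OF L.linear_grade_proj] dact0_scale_x[OF p(2) L.grade_proj_gr] by (rule linear_scale[OF q(1)])
  qed
  ultimately show ?thesis by (simp only: bilinear_def simp_thms)
qed

lemma r_q:
  assumes x: "x \<in> gr 0" and F: "F \<in> tensor_space" shows "r x (q F) = q (dact0 x F)"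
proof -
  have gx: "grade_proj 0 x = x" using L.grade_proj_eq[OF x, of 0] by simp
  show ?thesis unfolding r_def gx
  proof (rule q_lift[OF _ _ F])
    fix F b assume F: "F \<in> tensor_space" and b: "b \<in> B"
    note b' = subsetD[OF B(2) b]
    have "dact0 x (F - b) = dact0 x (F + (-1) *\<^sub>R b)" by (simp only: scaleR_minus1_left add_uminus_conv_diff)
    also have "\<dots> = dact0 x F + (-1) *\<^sub>R dact0 x b"
      unfolding dact0_add[OF F subspace_scale[OF subspace_tensor_space b'] x] dact0_scale[OF b' x] ..
    also have "\<dots> = dact0 x F - dact0 x b" by (simp only: scaleR_minus1_left add_uminus_conv_diff)
    finally show "dact0 x (F - b) = dact0 x F - dact0 x b" .
  qed (rule dact0_invariant[OF B _ x])
qed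

lemma act_q:
  assumes g: "g \<in> G0 K" and F: "F \<in> tensor_space"
  shows "q (act K \<sigma> \<tau> d g (p (q F))) = q (act K \<sigma> \<tau> d g F)"
proof (rule q_lift[OF _ _ F])
  show "act K \<sigma> \<tau> d g (F - b) = act K \<sigma> \<tau> d g F - act K \<sigma> \<tau> d g b" for F b
    by (rule linear_diff[OF linear_act[OF g]])
  show "act K \<sigma> \<tau> d g b \<in> B" if "b \<in> B" for b
    using B(1) g that unfolding invariant_subspace_def by blast
qed

abbreviation "Casimir \<equiv> casimir_rep.CasC br gr r"

text \<open>\<open>casimir_rep.CasC\<close> does not depend on the invariant subspace, so its general properties can be
  read off from the zero subspace.\<close>

lemma casimir_rep_0: "casimir_rep br (cartan K) gr (posroots K) r {0} {}"
proof
  show "r x t \<in> {0}" if "t \<in> {0}" for x t using that bilinear_rzero[OF bilinear_r] by (simp only: singleton_iff)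
  show "r (br x y) t = r x (r y t) - r y (r x t)" if "t \<in> {0}" for x y t
    using that bilinear_rzero[OF bilinear_r] by (simp only: singleton_iff diff_self)
qed (use bilinear_r in simp_all)

end

text \<open>\<open>e0\<close> is the scalar by which the grading element acts on the quotient at
  weight 0; the two sets called \<open>A\<close> and \<open>B\<close> are its numerator and
  denominator.\<close>

locale irreducible_module_quotient = module_quotient K \<sigma> \<tau> k d B q p
  for K :: "('g, 'a::euclidean_space) graded_pair"
    and \<sigma> :: "'g \<Rightarrow> 'v::euclidean_space \<Rightarrow> 'v" and \<tau> :: "'g \<Rightarrow> 'w::euclidean_space \<Rightarrow> 'w" and k d B q p +
  fixes A :: "('a, 'v, 'w) tens set" and e0 :: real and S :: "('a, 'v, 'w) tens set"
  assumes A: "irreducible_quotient K \<sigma> \<tau> d A B" "A \<subseteq> tensor_space"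
    and e0: "\<And>F. F \<in> A \<Longrightarrow> dact0 E F - e0 *\<^sub>R F \<in> B"
    and S: "finite S" "tensor_space \<subseteq> span S"
begin

lemma invariant_A: "invariant_subspace K \<sigma> \<tau> d (G0 K) A" and B_A: "B \<subset> A"
  and irreducible: "invariant_subspace K \<sigma> \<tau> d (G0 K) U \<Longrightarrow> B \<subseteq> U \<Longrightarrow> U \<subseteq> A \<Longrightarrow> U = B \<or> U = A"
  using A(1) unfolding irreducible_quotient_def by blast+

lemma subspace_A: "subspace A" using invariant_A by (simp add: invariant_subspace_def)

lemmas dact0_A = dact0_invariant[OF invariant_A A(2)]

sublocale C: casimir_rep br "cartan K" gr "posroots K" r "q ` A" S
proof
  show "subspace (q ` A)" by (rule linear_subspace_image[OF q(1) subspace_A])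
  show "q ` A \<subseteq> span S" using q_tensor_space A(2) S(2) by blast
  show "r x t \<in> q ` A" if x: "x \<in> gr 0" and t: "t \<in> q ` A" for x t
  proof -
    from t obtain F where F: "t = q F" "F \<in> A" by blast
    show ?thesis unfolding F(1) r_q[OF x subsetD[OF A(2) F(2)]] by (rule imageI[OF dact0_A[OF F(2) x]])
  qed
  show "r (br x y) t = r x (r y t) - r y (r x t)" if x: "x \<in> gr 0" and y: "y \<in> gr 0" and t: "t \<in> q ` A" for x y t
  proof -
    from t obtain F where F: "t = q F" "F \<in> A" by blast
    have tensor_space: "F \<in> tensor_space" using F(2) A(2) by blast
    have xy: "br x y \<in> gr 0" using br_gr[OF x y] by simp
    show ?thesis
      unfolding F(1) r_q[OF xy tensor_space] r_q[OF x tensor_space] r_q[OF y tensor_space] r_q[OF x dact0_tensor_space[OF tensor_space y]] r_q[OF y dact0_tensor_space[OF tensor_space x]]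
        dact0_br[OF tensor_space x y] by (rule linear_diff[OF q(1)])
  qed
qed (rule bilinear_r, rule S(1))

definition qc :: "('a, 'v, 'w) tens \<times> ('a, 'v, 'w) tens \<Rightarrow> ('a, 'v, 'w) tens \<times> ('a, 'v, 'w) tens" where
  "qc X = (q (fst X), q (snd X))"

lemma clinear_qc: "clinear qc" unfolding qc_def by (rule clinear_map_pair[OF q(1)])

lemma qc_0_iff: "qc X = 0 \<longleftrightarrow> X \<in> B \<times> B"
  by (simp only: qc_def zero_prod_def prod.inject q_0_iff mem_Times_iff)

lemma qc_image: "Y \<in> q ` A \<times> q ` A \<Longrightarrow> \<exists>X\<in>A \<times> A. Y = qc X"
  by (auto simp: qc_def)

definition density_derivC :: "'a \<times> 'a \<Rightarrow> complex" where "density_derivC Z = - L.\<kappa> L.Ec Z / (2 * of_real dim_neg)"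

lemma density_derivC_eq: "density_derivC Z = Complex (density_deriv (fst Z)) (density_deriv (snd Z))"
  by (simp add: density_derivC_def density_deriv_def L.Ec_def ckilling_def cbil_def bilinear_lzero[OF L.bilinear_killing] complex_eq_iff)

text \<open>A character vanishes on brackets, and a root vector is a multiple of [H, Z]; here this
  is \<kappa>(E, [H, Z]) = \<kappa>([E, H], Z) = 0.\<close>

lemma density_derivC_root:
  assumes \<alpha>: "\<alpha> \<in> posroots K" and Z: "Z \<in> L.rs (- \<alpha>)"
  shows "density_derivC Z = 0"
proof -
  from L.\<Phi>_iff \<alpha> have "\<alpha> \<in> roots br (cartan K)" by blast
  then obtain H where H: "H \<in> cartan K" "\<alpha> H \<noteq> 0" unfolding roots_def by blast
  have "L.\<kappa> L.Ec (L.bc H Z) = L.\<kappa> (L.bc L.Ec H) Z" by (rule L.\<kappa>_invariant[symmetric])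
  also have "\<dots> = 0" by (simp only: L.bc_h[OF L.Ec_h H(1)] L.\<kappa>_0)
  also have "L.bc H Z = cscale (- \<alpha> H) Z" using Z H(1) by (simp add: root_space_def)
  finally have "\<alpha> H * L.\<kappa> L.Ec Z = 0" by (simp add: L.\<kappa>_cscale L.\<kappa>_minus C.scale_minus_left)
  then show ?thesis using H(2) by (simp add: density_derivC_def)
qed

lemma qc_dact:
  assumes Z: "Z \<in> gr 0 \<times> gr 0" and X: "X \<in> A \<times> A"
  shows "qc (cbil (dact K \<sigma> \<tau> \<delta>) Z X) = C.rc Z (qc X) + cscale (of_real \<delta> * density_derivC Z) (qc X)"
proof -
  have q1: "q (dact K \<sigma> \<tau> \<delta> x F) = (\<delta> * density_deriv x) *\<^sub>R q F + r x (q F)" if x: "x \<in> gr 0" and F: "F \<in> A" for x F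
    unfolding dact_eq[OF subsetD[OF A(2) F] x] linear_add[OF q(1)] linear_scale[OF q(1)] r_q[OF x subsetD[OF A(2) F]] ..
  have "fst Z \<in> gr 0" "snd Z \<in> gr 0" "fst X \<in> A" "snd X \<in> A" using Z X by (auto simp: mem_Times_iff)
  note q1 = q1[OF this(1,3)] q1[OF this(1,4)] q1[OF this(2,3)] q1[OF this(2,4)]
  show ?thesis
    unfolding qc_def cbil_def fst_conv snd_conv linear_diff[OF q(1)] linear_add[OF q(1)] q1
    by (simp only: cscale_def density_derivC_eq prod_eq_iff fst_conv snd_conv fst_add snd_add Re_complex_of_real
        Im_complex_of_real times_complex.sel complex.sel mult_zero_left diff_zero add_0_right) (simp add: algebra_simps)
qed

text \<open>Twisting adds \<delta> times \<open>density_derivC\<close> to every weight and changes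
  nothing on root vectors. Lowest weights at all \<delta> are thereby shifts of those of one fixed
  representation at weight 0.\<close>

lemma lowest_weight_iff:
  "lowest_weight K \<sigma> \<tau> \<delta> A B (\<lambda>H. - \<nu> H) \<longleftrightarrow>
    \<nu> \<in> cdual (cartan K) \<and> (\<exists>Y. C.lowest Y (- L.wt_shift (- \<delta> / (2 * dim_neg)) \<nu>))"
proof (cases "\<nu> \<in> cdual (cartan K)")
  case False
  have "(\<lambda>H. - \<nu> H) \<notin> cdual (cartan K)"
    using L.cdual_minus[of "\<lambda>H. - \<nu> H"] False by (auto simp: fun_Compl_def)
  then show ?thesis using False by (simp add: lowest_weight_def)
next
  case True
  let ?\<nu> = "L.wt_shift (- \<delta> / (2 * dim_neg)) \<nu>"
  have mu: "(\<lambda>H. - \<nu> H) \<in> cdual (cartan K)" using L.cdual_minus[OF True] by (simp add: fun_Compl_def)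
  have mu': "- ?\<nu> \<in> cdual (cartan K)" by (rule L.cdual_minus[OF L.wt_shift_cdual[OF True]])
  have shift: "(- ?\<nu>) H = - \<nu> H - of_real \<delta> * density_derivC H" if "H \<in> cartan K" for H
    using that by (simp add: L.wt_shift_def density_derivC_def)
  have g0: "H \<in> gr 0 \<times> gr 0" if "H \<in> cartan K" for H using that L.h_gr0 by blast
  have 1: "cbil (dact K \<sigma> \<tau> \<delta>) H X - cscale (- \<nu> H) X \<in> B \<times> B \<longleftrightarrow> C.rc H (qc X) = cscale ((- ?\<nu>) H) (qc X)"
    if H: "H \<in> cartan K" and X: "X \<in> A \<times> A" for H X
  proof -
    have "cbil (dact K \<sigma> \<tau> \<delta>) H X - cscale (- \<nu> H) X \<in> B \<times> B \<longleftrightarrow>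
       C.rc H (qc X) + cscale (of_real \<delta> * density_derivC H) (qc X) - cscale (- \<nu> H) (qc X) = 0"
      unfolding qc_0_iff[symmetric] clinear_diff[OF clinear_qc] qc_dact[OF g0[OF H] X] clinear_cscale[OF clinear_qc] ..
    also have "\<dots> \<longleftrightarrow> C.rc H (qc X) = cscale (- \<nu> H) (qc X) - cscale (of_real \<delta> * density_derivC H) (qc X)"
      by (simp only: eq_diff_eq right_minus_eq)
    also have "\<dots> \<longleftrightarrow> C.rc H (qc X) = cscale ((- ?\<nu>) H) (qc X)"
      by (simp only: shift[OF H] C.scale_left_diff_distrib)
    finally show ?thesis .
  qed
  have 2: "cbil (dact K \<sigma> \<tau> \<delta>) Z X \<in> B \<times> B \<longleftrightarrow> C.rc Z (qc X) = 0"
    if \<alpha>: "\<alpha> \<in> posroots K" and Z: "Z \<in> L.rs (- \<alpha>) \<inter> (gr 0 \<times> gr 0)" and X: "X \<in> A \<times> A" for \<alpha> Z X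
  proof -
    have "density_derivC Z = 0" using density_derivC_root[OF \<alpha>] Z by blast
    then show ?thesis
      unfolding qc_0_iff[symmetric] using qc_dact[OF _ X, of Z \<delta>] Z by (simp only: IntD2 mult_zero_right C.scale_zero_left add_0_right)
  qed
  have m: "L.rs (\<lambda>H. - \<alpha> H) = L.rs (- \<alpha>)" for \<alpha> by (simp add: fun_Compl_def)
  show ?thesis
  proof
    assume "lowest_weight K \<sigma> \<tau> \<delta> A B (\<lambda>H. - \<nu> H)"
    then obtain X where X: "X \<in> A \<times> A" "X \<notin> B \<times> B"
      "\<forall>H\<in>cartan K. cbil (dact K \<sigma> \<tau> \<delta>) H X - cscale (- \<nu> H) X \<in> B \<times> B"
      "\<forall>\<alpha>\<in>posroots K. \<forall>Z \<in> L.rs (- \<alpha>) \<inter> (gr 0 \<times> gr 0). cbil (dact K \<sigma> \<tau> \<delta>) Z X \<in> B \<times> B"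
      unfolding lowest_weight_def m by blast
    have "C.lowest (qc X) (- ?\<nu>)"
      unfolding C.lowest_def
    proof (intro conjI ballI mu')
      show "qc X \<in> q ` A \<times> q ` A" using X(1) by (auto simp: qc_def mem_Times_iff)
      show "qc X \<noteq> 0" using X(2) by (simp only: qc_0_iff not_False_eq_True)
      show "C.rc H (qc X) = cscale ((- ?\<nu>) H) (qc X)" if "H \<in> cartan K" for H
        using 1[OF that X(1)] bspec[OF X(3) that] by (rule iffD1)
      show "C.rc Z (qc X) = 0" if "\<alpha> \<in> posroots K" "Z \<in> L.rs (- \<alpha>) \<inter> (gr 0 \<times> gr 0)" for \<alpha> Z
        using 2[OF that X(1)] bspec[OF bspec[OF X(4) that(1)] that(2)] by (rule iffD1)
    qed
    then show "\<nu> \<in> cdual (cartan K) \<and> (\<exists>Y. C.lowest Y (- ?\<nu>))" using True by blast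
  next
    assume "\<nu> \<in> cdual (cartan K) \<and> (\<exists>Y. C.lowest Y (- ?\<nu>))"
    then obtain Y where Y: "C.lowest Y (- ?\<nu>)" by blast
    then have "Y \<in> q ` A \<times> q ` A" by (simp only: C.lowest_def)
    from qc_image[OF this] obtain X where X: "X \<in> A \<times> A" "Y = qc X" by blast
    note Y = Y[unfolded C.lowest_def X(2)]
    have "X \<notin> B \<times> B" using Y qc_0_iff[of X] by blast
    moreover have "\<forall>H\<in>cartan K. cbil (dact K \<sigma> \<tau> \<delta>) H X - cscale (- \<nu> H) X \<in> B \<times> B"
    proof
      fix H assume H: "H \<in> cartan K"
      have "C.rc H (qc X) = cscale ((- ?\<nu>) H) (qc X)" using Y H by blast
      with 1[OF H X(1)] show "cbil (dact K \<sigma> \<tau> \<delta>) H X - cscale (- \<nu> H) X \<in> B \<times> B" by (rule iffD2)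
    qed
    moreover have "\<forall>\<alpha>\<in>posroots K. \<forall>Z \<in> L.rs (- \<alpha>) \<inter> (gr 0 \<times> gr 0). cbil (dact K \<sigma> \<tau> \<delta>) Z X \<in> B \<times> B"
    proof (intro ballI)
      fix \<alpha> Z assume Z: "\<alpha> \<in> posroots K" "Z \<in> L.rs (- \<alpha>) \<inter> (gr 0 \<times> gr 0)"
      have "C.rc Z (qc X) = 0" using Y Z by blast
      with 2[OF Z X(1)] show "cbil (dact K \<sigma> \<tau> \<delta>) Z X \<in> B \<times> B" by (rule iffD2)
    qed
    ultimately show "lowest_weight K \<sigma> \<tau> \<delta> A B (\<lambda>H. - \<nu> H)"
      unfolding lowest_weight_def m using mu X(1) by blast
  qed
qed

lemma lowest_Ec:
  assumes "C.lowest Y (- \<nu>)" shows "\<nu> L.Ec = - of_real e0"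
proof -
  have Y: "Y \<in> q ` A \<times> q ` A" "Y \<noteq> 0" "C.rc L.Ec Y = cscale ((- \<nu>) L.Ec) Y"
    using assms L.Ec_h unfolding C.lowest_def by blast+
  from qc_image[OF Y(1)] obtain X where X: "X \<in> A \<times> A" "Y = qc X" by blast
  have rE: "r E (q F) = e0 *\<^sub>R q F" if F: "F \<in> A" for F
  proof -
    have "r E (q F) = q (dact0 E F)" by (rule r_q[OF L.E_gr0 subsetD[OF A(2) F]])
    moreover have "q (dact0 E F) - e0 *\<^sub>R q F = 0"
      using q(2)[OF e0[OF F]] unfolding linear_diff[OF q(1)] linear_scale[OF q(1)] .
    ultimately show ?thesis by (simp only: right_minus_eq)
  qed
  have "C.rc L.Ec Y = cscale (of_real e0) Y"
    using X(1) unfolding X(2)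
    by (simp only: cbil_def L.Ec_def qc_def fst_conv snd_conv C.r_simps rE mem_Times_iff cscale_def Re_complex_of_real
        Im_complex_of_real scaleR_zero_left diff_zero add_0_right)
  with Y(3) have "cscale ((- \<nu>) L.Ec - of_real e0) Y = 0" by (simp only: C.scale_left_diff_distrib diff_self)
  then have "(- \<nu>) L.Ec - of_real e0 = 0" using Y(2) by (simp only: C.scale_eq_0_iff simp_thms)
  then show ?thesis by (simp add: minus_equation_iff)
qed

definition symmetries where "symmetries = (\<lambda>g t. q (act K \<sigma> \<tau> d g (p t))) ` G0 K"

lemma Re_casimir_unique:
  assumes "Y \<in> q ` A \<times> q ` A" "Y \<noteq> 0" "C.CasC Y = cscale c Y"
    and "Y' \<in> q ` A \<times> q ` A" "Y' \<noteq> 0" "C.CasC Y' = cscale c' Y'"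
  shows "Re c = Re c'"
proof (rule C.Re_eigenvalue_unique[OF _ _ _ _ assms])
  have actA: "act K \<sigma> \<tau> d g F \<in> A" if "g \<in> G0 K" "F \<in> A" for g F
    using invariant_A that unfolding invariant_subspace_def by blast
  have linT: "linear (\<lambda>t. q (act K \<sigma> \<tau> d g (p t)))" if g: "g \<in> G0 K" for g
    using linear_compose[OF linear_compose[OF p(1) linear_act[OF g]] q(1)] unfolding o_def .
  have TA: "q (act K \<sigma> \<tau> d g (p t)) \<in> q ` A" if g: "g \<in> G0 K" and t: "t \<in> q ` A" for g t
  proof -
    from t obtain F where F: "t = q F" "F \<in> A" by blast
    show ?thesis unfolding F(1) act_q[OF g subsetD[OF A(2) F(2)]] by (rule imageI[OF actA[OF g F(2)]])
  qed
  show "linear T" if "T \<in> symmetries" for T using that linT unfolding symmetries_def by blast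
  show "T t \<in> q ` A" if "T \<in> symmetries" "t \<in> q ` A" for T t using that TA unfolding symmetries_def by blast
  show "T (C.Cas t) = C.Cas (T t)" if T: "T \<in> symmetries" and t: "t \<in> q ` A" for T t
  proof -
    from T obtain g where g: "g \<in> G0 K" "T = (\<lambda>t. q (act K \<sigma> \<tau> d g (p t)))" unfolding symmetries_def by blast
    show ?thesis unfolding g(2)
    proof (rule C.Cas_commute[OF linT[OF g(1)] TA[OF g(1)] linear_Ad[OF G0_carrier[OF g(1)]] killing_Ad[OF G0_carrier[OF g(1)]] grade_proj_Ad[OF g(1)] _ t])
      fix x t assume x: "x \<in> gr 0" and t: "t \<in> q ` A"
      from t obtain F where F: "t = q F" "F \<in> A" by blast
      have tensor_space: "F \<in> tensor_space" using F(2) A(2) by blast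
      show "q (act K \<sigma> \<tau> d g (p (r x t))) = r (Ad K g x) (q (act K \<sigma> \<tau> d g (p t)))"
        unfolding F(1) r_q[OF x tensor_space] act_q[OF g(1) tensor_space] act_q[OF g(1) dact0_tensor_space[OF tensor_space x]]
          r_q[OF Ad_G0[OF g(1) x] act_tensor_space[OF g(1) tensor_space]] act_equivariant[OF g(1) tensor_space x] ..
    qed
  qed
  show "U = {0} \<or> U = q ` A" if U: "subspace U" "U \<subseteq> q ` A" "\<forall>T\<in>symmetries. \<forall>u\<in>U. T u \<in> U" for U
  proof -
    \<comment> \<open>A subspace of the quotient is pulled back to one between \<open>B\<close> and
      \<open>A\<close>, where irreducibility is stated.\<close>
    define U' where "U' = {F\<in>A. q F \<in> U}"
    have "U' = A \<inter> q -` U" unfolding U'_def by blast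
    then have sub: "subspace U'"
      using subspace_inter[OF subspace_A linear_subspace_vimage[OF q(1) U(1)]] by (simp only:)
    have "act K \<sigma> \<tau> d g F \<in> U'" if g: "g \<in> G0 K" and F: "F \<in> U'" for g F
    proof -
      have FA: "F \<in> A" "q F \<in> U" using F unfolding U'_def by blast+
      have "q (act K \<sigma> \<tau> d g (p (q F))) \<in> U" using bspec[OF bspec[OF U(3) imageI[OF g, where f="\<lambda>g t. q (act K \<sigma> \<tau> d g (p t))", folded symmetries_def]] FA(2)] .
      then show ?thesis unfolding U'_def act_q[OF g subsetD[OF A(2) FA(1)]] using actA[OF g FA(1)] by blast
    qed
    then have inv: "invariant_subspace K \<sigma> \<tau> d (G0 K) U'"
      using sub unfolding invariant_subspace_def by blast
    have "B \<subseteq> U'" unfolding U'_def using B_A q(2) subspace_0[OF U(1)] by (auto simp only:)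
    from irreducible[OF inv this] have "U' = B \<or> U' = A" unfolding U'_def by blast
    moreover have qU': "U = q ` U'" using U(2) unfolding U'_def by blast
    moreover have "q ` B = {0}"
    proof
      show "q ` B \<subseteq> {0}" by (rule image_subsetI) (simp only: q(2) singleton_iff)
      have "q 0 \<in> q ` B" by (rule imageI[OF subspace_0[OF subspace_B]])
      then show "{0} \<subseteq> q ` B" unfolding linear_0[OF q(1)] by (simp only: insert_subset empty_subsetI simp_thms)
    qed
    ultimately show ?thesis by (elim disjE) (simp_all only: simp_thms)
  qed
qed

text \<open>The second conjunct ties \<open>W\<close> to an eigenvalue of an operator built from
  \<open>B\<close> but not from \<open>A\<close>. It is what later limits the number of possible
  curves.\<close>

lemma casimir_eigenvalue_formula:
  "\<exists>W. (\<forall>\<delta>. casimir_eigenvalue K \<sigma> \<tau> \<delta> A B =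
       W - \<delta> * e0 / dim_neg + ((\<delta> / (2 * dim_neg))\<^sup>2 + \<delta> / (2 * dim_neg) / 2) * Re (L.\<kappa> L.Ec L.Ec)) \<and>
     (\<exists>c Y. Y \<in> tensor_space \<times> tensor_space \<and> Y \<noteq> 0 \<and> Casimir Y = cscale c Y \<and> W = Re c - e0 / 2)"
proof -
  obtain F where F: "F \<in> A" "F \<notin> B" using B_A by blast
  then have "\<exists>t\<in>q ` A. t \<noteq> 0" using q_0_iff by blast
  from C.lowest_exists[OF this] obtain Y \<mu> where Y\<mu>: "C.lowest Y \<mu>" by blast
  define \<nu> where "\<nu> = - \<mu>"
  have Y: "C.lowest Y (- \<nu>)" using Y\<mu> by (simp only: \<nu>_def minus_minus)
  have \<nu>: "\<nu> \<in> cdual (cartan K)" using Y\<mu> unfolding \<nu>_def C.lowest_def by (intro L.cdual_minus) blast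
  from C.lowest_value[OF Y] obtain c where c: "C.CasC Y = cscale c Y" "L.wt_value \<nu> = Re c + Re (\<nu> L.Ec) / 2" by blast
  have YQ: "Y \<in> q ` A \<times> q ` A" "Y \<noteq> 0" using Y by (simp_all only: C.lowest_def simp_thms)
  define W where "W = Re c - e0 / 2"
  have val: "L.wt_value \<nu>' = W" if Y': "C.lowest Y' (- \<nu>')" for Y' \<nu>'
  proof -
    from C.lowest_value[OF Y'] obtain c' where
      c': "C.CasC Y' = cscale c' Y'" "L.wt_value \<nu>' = Re c' + Re (\<nu>' L.Ec) / 2" by blast
    have "Y' \<in> q ` A \<times> q ` A" "Y' \<noteq> 0" using Y' by (simp_all only: C.lowest_def simp_thms)
    from Re_casimir_unique[OF this c'(1) YQ c(1)] show ?thesis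
      by (simp add: c'(2) lowest_Ec[OF Y'] W_def)
  qed
  have "casimir_eigenvalue K \<sigma> \<tau> \<delta> A B =
      W - \<delta> * e0 / dim_neg + ((\<delta> / (2 * dim_neg))\<^sup>2 + \<delta> / (2 * dim_neg) / 2) * Re (L.\<kappa> L.Ec L.Ec)" (is "_ = ?v") for \<delta>
  proof -
    define s where "s = \<delta> / (2 * dim_neg)"
    \<comment> \<open>The shifts by s and -s are inverse to each other, so lowest weights at weight
      \<delta> and at weight 0 correspond bijectively; existence and uniqueness of the value both
      use this.\<close>
    have inverse: "L.wt_shift s (L.wt_shift (- s) \<nu>') = \<nu>'" "L.wt_shift (- s) (L.wt_shift s \<nu>') = \<nu>'"
      if "\<nu>' \<in> cdual (cartan K)" for \<nu>'
      using that by (auto simp: L.wt_shift_def fun_eq_iff cdual_def)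
    have v: "L.wt_value (L.wt_shift s \<nu>') = ?v" if "C.lowest Y' (- \<nu>')" "\<nu>' \<in> cdual (cartan K)" for Y' \<nu>'
      using L.wt_value_shift[OF that(2), of s] val[OF that(1)] lowest_Ec[OF that(1)] dim_neg_pos by (simp add: s_def)
    show ?thesis
      unfolding casimir_eigenvalue_def L.wt_value_def[symmetric]
    proof (rule the_equality)
      have "C.lowest Y (- L.wt_shift (- \<delta> / (2 * dim_neg)) (L.wt_shift s \<nu>))"
        using Y inverse(2)[OF \<nu>] by (simp add: s_def)
      then have "lowest_weight K \<sigma> \<tau> \<delta> A B (\<lambda>H. - L.wt_shift s \<nu> H)"
        unfolding lowest_weight_iff using L.wt_shift_cdual[OF \<nu>] by blast
      then show "\<exists>\<nu>. lowest_weight K \<sigma> \<tau> \<delta> A B (\<lambda>H. - \<nu> H) \<and> ?v = L.wt_value \<nu>"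
        using v[OF Y \<nu>, symmetric] by blast
    next
      fix c assume "\<exists>\<nu>. lowest_weight K \<sigma> \<tau> \<delta> A B (\<lambda>H. - \<nu> H) \<and> c = L.wt_value \<nu>"
      then obtain \<nu>' where \<nu>': "lowest_weight K \<sigma> \<tau> \<delta> A B (\<lambda>H. - \<nu>' H)" "c = L.wt_value \<nu>'" by blast
      from \<nu>'(1) obtain Y' where Y': "\<nu>' \<in> cdual (cartan K)" "C.lowest Y' (- L.wt_shift (- s) \<nu>')"
        unfolding lowest_weight_iff s_def minus_divide_left by blast
      from v[OF Y'(2) L.wt_shift_cdual[OF Y'(1)]] show "c = ?v"
        by (simp only: inverse(1)[OF Y'(1)] \<nu>'(2))
    qed
  qed
  moreover have "Y \<in> tensor_space \<times> tensor_space" using YQ(1) q_tensor_space A(2) by (auto simp: mem_Times_iff)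
  ultimately show ?thesis using YQ(2) c(1) W_def by blast
qed

end

section \<open>Critical weights\<close>

context lie_rep
begin

definition quotient_at :: "real \<Rightarrow> real \<Rightarrow> ('a, 'v, 'w) tens set \<Rightarrow> ('a, 'v, 'w) tens set \<Rightarrow> bool" where
  "quotient_at d e0 A B \<longleftrightarrow> irreducible_quotient K \<sigma> \<tau> d A B \<and> A \<subseteq> tensor_space \<and>
     (\<forall>F\<in>A. dact0 E F - e0 *\<^sub>R F \<in> B)"

text \<open>The grading element acts by \<open>e0\<close> at weight \<open>0\<close>, and passing from weight \<open>0\<close> to \<open>\<delta>\<close> shifts highest
  weights \<open>\<nu>\<close> of the dual by \<open>\<delta> / (2 n)\<close> times the Killing dual of \<open>E\<close>, where \<open>\<nu> E = - e0\<close>. The quadratic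
  term is common to all quotients.\<close>

definition casimir_curve :: "real \<Rightarrow> real \<Rightarrow> real \<Rightarrow> real" where
  "casimir_curve e0 W = (\<lambda>\<delta>. W - \<delta> * e0 / dim_neg +
     ((\<delta> / (2 * dim_neg))\<^sup>2 + \<delta> / (2 * dim_neg) / 2) * Re (L.\<kappa> L.Ec L.Ec))"

text \<open>The finite set is chosen before \<open>A\<close>: all quotients with the same
  denominator \<open>B\<close> share one Casimir operator, which has finitely many eigenvalues on
  the complexified tensor module.\<close>

lemma casimir_curves:
  "\<exists>\<W>. finite \<W> \<and> (\<forall>A. quotient_at d e0 A B \<longrightarrow>
     (\<exists>W\<in>\<W>. (\<lambda>\<delta>. casimir_eigenvalue K \<sigma> \<tau> \<delta> A B) = casimir_curve e0 W))"
proof (cases "\<exists>A. quotient_at d e0 A B")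
  case True
  then obtain A where "quotient_at d e0 A B" ..
  then have B: "invariant_subspace K \<sigma> \<tau> d (G0 K) B" "B \<subseteq> tensor_space"
    unfolding quotient_at_def irreducible_quotient_def by blast+
  have "subspace B" using B(1) by (simp add: invariant_subspace_def)
  from subspace_quotient_map[OF this] obtain q where
    q: "linear q" "\<forall>x\<in>B. q x = 0" "\<forall>x. x - q x \<in> B" by blast
  \<comment> \<open>Subtracting \<open>q'\<close> from the identity gives a projection onto the
    tensor module, the map \<open>p\<close> of the locale.\<close>
  from subspace_quotient_map[OF subspace_tensor_space] obtain q' where
    q': "linear q'" "\<forall>x\<in>tensor_space. q' x = 0" "\<forall>x. x - q' x \<in> tensor_space" by blast
  obtain S where S: "finite S" "tensor_space \<subseteq> span S" using tensor_space_finite by blast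
  have "linear (\<lambda>x. x - q' x)" by (rule linear_compose_sub[OF linear_ident q'(1)])
  moreover have "x - q' x = x" if "x \<in> tensor_space" for x using bspec[OF q'(2) that] by (simp only: diff_zero)
  ultimately interpret M: module_quotient K \<sigma> \<tau> k d B q "\<lambda>x. x - q' x"
    by (intro module_quotient.intro[OF lie_rep_axioms] module_quotient_axioms.intro)
      (rule B q(1) bspec[OF q(2)] spec[OF q(3)] spec[OF q'(3)] | assumption)+
  let ?C = "{c. \<exists>Y\<in>tensor_space \<times> tensor_space. Y \<noteq> 0 \<and> M.Casimir Y = cscale c Y}"
  have cl: "clinear M.Casimir" by (rule casimir_rep.clinear_CasC[OF M.casimir_rep_0])
  have "finite ((\<lambda>s. (s, 0)) ` S \<union> (\<lambda>s. (0, s)) ` S :: (('a, 'v, 'w) tens \<times> _) set)"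
    using S(1) by (intro finite_UnI finite_imageI)
  from finite_eigenvalues[OF cl this Times_subset_span[OF S(2)]] have "finite ?C" .
  then have "finite ((\<lambda>c. Re c - e0 / 2) ` ?C)" by (rule finite_imageI)
  moreover have "\<exists>W\<in>(\<lambda>c. Re c - e0 / 2) ` ?C. (\<lambda>\<delta>. casimir_eigenvalue K \<sigma> \<tau> \<delta> A B) = casimir_curve e0 W"
    if A: "quotient_at d e0 A B" for A
  proof -
    interpret I: irreducible_module_quotient K \<sigma> \<tau> k d B q "\<lambda>x. x - q' x" A e0 S
      by unfold_locales (use A S in \<open>unfold quotient_at_def, blast+\<close>)
    from I.casimir_eigenvalue_formula obtain W where
      W: "\<forall>\<delta>. casimir_eigenvalue K \<sigma> \<tau> \<delta> A B = W - \<delta> * e0 / dim_neg +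
          ((\<delta> / (2 * dim_neg))\<^sup>2 + \<delta> / (2 * dim_neg) / 2) * Re (L.\<kappa> L.Ec L.Ec)"
        "\<exists>c Y. Y \<in> tensor_space \<times> tensor_space \<and> Y \<noteq> 0 \<and> M.Casimir Y = cscale c Y \<and> W = Re c - e0 / 2" by blast
    show ?thesis
    proof
      show "(\<lambda>\<delta>. casimir_eigenvalue K \<sigma> \<tau> \<delta> A B) = casimir_curve e0 W"
        unfolding casimir_curve_def using W(1) by blast
      show "W \<in> (\<lambda>c. Re c - e0 / 2) ` ?C" using W(2) by blast
    qed
  qed
  ultimately show ?thesis by blast
qed blast

lemma casimir_curve_exists:
  assumes "quotient_at d e0 A B"
  shows "\<exists>W. (\<lambda>\<delta>. casimir_eigenvalue K \<sigma> \<tau> \<delta> A B) = casimir_curve e0 W"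
proof -
  from casimir_curves[of d e0 B] obtain \<W> where "finite \<W> \<and> (\<forall>A. quotient_at d e0 A B \<longrightarrow>
     (\<exists>W\<in>\<W>. (\<lambda>\<delta>. casimir_eigenvalue K \<sigma> \<tau> \<delta> A B) = casimir_curve e0 W))" ..
  from mp[OF spec[OF conjunct2[OF this]] assms] obtain W where
    "(\<lambda>\<delta>. casimir_eigenvalue K \<sigma> \<tau> \<delta> A B) = casimir_curve e0 W" ..
  then show ?thesis ..
qed

lemma casimir_curve_eq_iff:
  "casimir_curve e W \<delta> = casimir_curve e' W' \<delta> \<longleftrightarrow> \<delta> * (e - e') = dim_neg * (W - W')"
proof -
  have "casimir_curve e W \<delta> = casimir_curve e' W' \<delta> \<longleftrightarrow> dim_neg * (W - \<delta> * e / dim_neg) = dim_neg * (W' - \<delta> * e' / dim_neg)"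
    using dim_neg_pos by (simp add: casimir_curve_def)
  also have "\<dots> \<longleftrightarrow> \<delta> * (e - e') = dim_neg * (W - W')" using dim_neg_pos by (simp add: right_diff_distrib) argo
  finally show ?thesis .
qed

lemma casimir_curve_meet: "e \<noteq> e' \<Longrightarrow> \<exists>!\<delta>. casimir_curve e W \<delta> = casimir_curve e' W' \<delta>"
  unfolding casimir_curve_eq_iff
  by (rule ex1I[of _ "dim_neg * (W - W') / (e - e')"]) (simp_all add: field_simps)

lemma other_casimirs_quotient:
  assumes "\<beta> \<in> other_casimirs K \<sigma> \<tau> k d R"
  obtains A l where "l \<in> {- int k<..0}"
    "quotient_at d (of_int l + degree_shift) A (generated_submodule K \<sigma> \<tau> k d R \<inter> filtration K k (l + 1))"
    "\<beta> = (\<lambda>\<delta>. casimir_eigenvalue K \<sigma> \<tau> \<delta> A (generated_submodule K \<sigma> \<tau> k d R \<inter> filtration K k (l + 1)))"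
proof -
  let ?S = "generated_submodule K \<sigma> \<tau> k d R"
  from assms obtain A B l where AB: "\<beta> = (\<lambda>\<delta>. casimir_eigenvalue K \<sigma> \<tau> \<delta> A B)" "l \<in> {- int k<..0}"
    "B = ?S \<inter> filtration K k (l + 1)" "A \<subseteq> ?S \<inter> filtration K k l" "irreducible_quotient K \<sigma> \<tau> d A B"
    unfolding other_casimirs_def by blast
  have inv: "invariant_subspace K \<sigma> \<tau> d (G0 K) A" using AB(5) by (simp add: irreducible_quotient_def)
  then have sub: "subspace A" by (simp add: invariant_subspace_def)
  have tensor_space: "A \<subseteq> tensor_space" using AB(4) filtration_tensor_space by blast
  have "dact0 E F - (of_int l + degree_shift) *\<^sub>R F \<in> B" if F: "F \<in> A" for F
  proof -
    have "dact0 E F - (of_int l + degree_shift) *\<^sub>R F \<in> A"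
      by (rule subspace_diff[OF sub dact0_invariant[OF inv tensor_space F L.E_gr0] subspace_scale[OF sub F]])
    moreover have "dact0 E F - (of_int l + degree_shift) *\<^sub>R F \<in> filtration K k (l + 1)"
      using AB(4) F by (intro dact0_E_filtration) blast
    ultimately show ?thesis unfolding AB(3) using AB(4) by blast
  qed
  then have "quotient_at d (of_int l + degree_shift) A B" unfolding quotient_at_def using AB(5) tensor_space by blast
  then show ?thesis using AB(1,2) unfolding AB(3) by (intro that)
qed

lemma finite_other_casimirs: "finite (other_casimirs K \<sigma> \<tau> k d R)"
proof -
  let ?B = "\<lambda>l. generated_submodule K \<sigma> \<tau> k d R \<inter> filtration K k (l + 1)"
  have "\<forall>l. \<exists>\<W>. finite \<W> \<and> (\<forall>A. quotient_at d (of_int l + degree_shift) A (?B l) \<longrightarrow>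
     (\<exists>W\<in>\<W>. (\<lambda>\<delta>. casimir_eigenvalue K \<sigma> \<tau> \<delta> A (?B l)) = casimir_curve (of_int l + degree_shift) W))"
    by (intro allI casimir_curves)
  from choice[OF this] obtain \<W> where \<W>: "\<forall>l. finite (\<W> l) \<and> (\<forall>A. quotient_at d (of_int l + degree_shift) A (?B l) \<longrightarrow>
     (\<exists>W\<in>\<W> l. (\<lambda>\<delta>. casimir_eigenvalue K \<sigma> \<tau> \<delta> A (?B l)) = casimir_curve (of_int l + degree_shift) W))" ..
  have "other_casimirs K \<sigma> \<tau> k d R \<subseteq> (\<Union>l\<in>{- int k<..0}. casimir_curve (of_int l + degree_shift) ` \<W> l)"
  proof
    fix \<beta> assume "\<beta> \<in> other_casimirs K \<sigma> \<tau> k d R"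
    then obtain A l where Al: "l \<in> {- int k<..0}" "quotient_at d (of_int l + degree_shift) A (?B l)"
      "\<beta> = (\<lambda>\<delta>. casimir_eigenvalue K \<sigma> \<tau> \<delta> A (?B l))" by (rule other_casimirs_quotient)
    note \<W>' = mp[OF spec[OF conjunct2[OF spec[OF \<W>]]] Al(2)]
    then obtain W where "W \<in> \<W> l" "(\<lambda>\<delta>. casimir_eigenvalue K \<sigma> \<tau> \<delta> A (?B l)) = casimir_curve (of_int l + degree_shift) W" ..
    then show "\<beta> \<in> (\<Union>l\<in>{- int k<..0}. casimir_curve (of_int l + degree_shift) ` \<W> l)"
      unfolding Al(3) by (intro UN_I[OF Al(1)]) (rule image_eqI)
  qed
  moreover have "finite (\<Union>l\<in>{- int k<..0}. casimir_curve (of_int l + degree_shift) ` \<W> l)"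
    by (intro finite_UN_I finite_imageI conjunct1[OF spec[OF \<W>]]) simp
  ultimately show ?thesis by (rule finite_subset)
qed

lemma casimir_meets_once:
  assumes R: "irreducible_quotient K \<sigma> \<tau> d R {0}" "R \<subseteq> symbol_space K k"
    and \<beta>: "\<beta> \<in> other_casimirs K \<sigma> \<tau> k d R"
  shows "\<exists>!\<delta>. casimir_eigenvalue K \<sigma> \<tau> \<delta> R {0} = \<beta> \<delta>"
proof -
  have "quotient_at d (degree_shift - real k) R {0}"
    unfolding quotient_at_def using R dact0_E_symbol_space symbol_space_tensor_space by blast
  from casimir_curve_exists[OF this] obtain W where
    W: "(\<lambda>\<delta>. casimir_eigenvalue K \<sigma> \<tau> \<delta> R {0}) = casimir_curve (degree_shift - real k) W" ..
  from \<beta> obtain A l where Al: "l \<in> {- int k<..0}"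
    "quotient_at d (of_int l + degree_shift) A (generated_submodule K \<sigma> \<tau> k d R \<inter> filtration K k (l + 1))"
    "\<beta> = (\<lambda>\<delta>. casimir_eigenvalue K \<sigma> \<tau> \<delta> A (generated_submodule K \<sigma> \<tau> k d R \<inter> filtration K k (l + 1)))"
    by (rule other_casimirs_quotient)
  from casimir_curve_exists[OF Al(2)] obtain W' where
    "(\<lambda>\<delta>. casimir_eigenvalue K \<sigma> \<tau> \<delta> A (generated_submodule K \<sigma> \<tau> k d R \<inter> filtration K k (l + 1))) =
      casimir_curve (of_int l + degree_shift) W'" ..
  then have W': "\<beta> = casimir_curve (of_int l + degree_shift) W'" unfolding Al(3) .
  \<comment> \<open>The omission of degree -k in \<open>other_casimirs\<close> enters here: it makes
    the two linear coefficients different.\<close>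
  have "degree_shift - real k \<noteq> of_int l + degree_shift"
  proof
    assume "degree_shift - real k = of_int l + degree_shift"
    then have "real_of_int (l + int k) = 0" by simp
    then have "l + int k = 0" by (simp only: of_int_eq_0_iff)
    then show False using Al(1) by simp
  qed
  from casimir_curve_meet[OF this] show ?thesis unfolding fun_cong[OF W] W' .
qed

end

text \<open>Each zero of the product is the unique meeting point of \<open>c\<close> with some
  function in \<open>T\<close>, so the zeros are covered by an image of \<open>T\<close>.\<close>

lemma zeros_of_prod_diff:
  fixes c :: "real \<Rightarrow> real"
  assumes T: "finite T" and once: "\<forall>\<beta>\<in>T. \<exists>!\<delta>. c \<delta> = \<beta> \<delta>"
  shows "finite {\<delta>. (\<Prod>\<beta>\<in>T. c \<delta> - \<beta> \<delta>) = 0} \<and> card {\<delta>. (\<Prod>\<beta>\<in>T. c \<delta> - \<beta> \<delta>) = 0} \<le> card T"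
proof -
  define z where "z \<beta> = (THE \<delta>. c \<delta> = \<beta> \<delta>)" for \<beta>
  have "{\<delta>. (\<Prod>\<beta>\<in>T. c \<delta> - \<beta> \<delta>) = 0} \<subseteq> z ` T"
  proof
    fix \<delta> assume "\<delta> \<in> {\<delta>. (\<Prod>\<beta>\<in>T. c \<delta> - \<beta> \<delta>) = 0}"
    then obtain \<beta> where \<beta>: "\<beta> \<in> T" "c \<delta> = \<beta> \<delta>" using T by auto
    have "z \<beta> = \<delta>" unfolding z_def by (rule the1_equality[OF bspec[OF once \<beta>(1)] \<beta>(2)])
    then show "\<delta> \<in> z ` T" using \<beta>(1) by blast
  qed
  then show ?thesis using finite_subset surj_card_le[OF T] T by blast
qed

theorem theorem7:
  fixes K :: "('g, 'a::euclidean_space) graded_pair"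
    and \<sigma> :: "'g \<Rightarrow> 'v::euclidean_space \<Rightarrow> 'v"
    and \<tau> :: "'g \<Rightarrow> 'w::euclidean_space \<Rightarrow> 'w"
    and k m :: nat and d :: real
    and R :: "nat \<Rightarrow> ('a, 'v, 'w) tens set"
  assumes "graded_pair_setting K"
    and "irreducible_G0_rep K \<sigma>" and "irreducible_G0_rep K \<tau>"
    and "k > 0"
    and "irreducible_decomposition K \<sigma> \<tau> k d m R"
  shows "(\<forall>i<m. \<forall>\<beta>\<in>other_casimirs K \<sigma> \<tau> k d (R i).
            \<exists>!\<delta>. casimir_eigenvalue K \<sigma> \<tau> \<delta> (R i) {0} = \<beta> \<delta>) \<and>
         (\<forall>i<m. finite (other_casimirs K \<sigma> \<tau> k d (R i)) \<and>
            finite {\<delta>. gamma_prod K \<sigma> \<tau> k d (R i) \<delta> = 0} \<and>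
            card {\<delta>. gamma_prod K \<sigma> \<tau> k d (R i) \<delta> = 0} \<le> card (other_casimirs K \<sigma> \<tau> k d (R i))) \<and>
         finite {\<delta>. critical_weight K \<sigma> \<tau> k d m R \<delta>} \<and>
         card {\<delta>. critical_weight K \<sigma> \<tau> k d m R \<delta>} \<le> (\<Sum>i<m. card (other_casimirs K \<sigma> \<tau> k d (R i)))"
proof -
  interpret lie_rep K \<sigma> \<tau> k using assms(1-3) by unfold_locales
  let ?O = "\<lambda>i. other_casimirs K \<sigma> \<tau> k d (R i)"
  let ?c = "\<lambda>i \<delta>. casimir_eigenvalue K \<sigma> \<tau> \<delta> (R i) {0}"
  let ?Z = "\<lambda>i. {\<delta>. gamma_prod K \<sigma> \<tau> k d (R i) \<delta> = 0}"
  note dec = assms(5)[unfolded irreducible_decomposition_def]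
  have once: "\<exists>!\<delta>. ?c i \<delta> = \<beta> \<delta>" if i: "i < m" and \<beta>: "\<beta> \<in> ?O i" for i \<beta>
  proof (rule casimir_meets_once[OF _ _ \<beta>])
    show "irreducible_quotient K \<sigma> \<tau> d (R i) {0}" using conjunct1[OF dec] i by blast
    have "R i \<subseteq> (\<Union>i<m. R i)" by (rule UN_upper) (simp only: lessThan_iff i)
    also have "\<dots> \<subseteq> span (\<Union>i<m. R i)" by (rule span_superset)
    also have "\<dots> = symbol_space K k" by (rule conjunct1[OF conjunct2[OF dec]])
    finally show "R i \<subseteq> symbol_space K k" .
  qed
  have Z: "finite (?Z i) \<and> card (?Z i) \<le> card (?O i)" if i: "i < m" for i
    unfolding gamma_prod_def by (rule zeros_of_prod_diff[OF finite_other_casimirs ballI[OF once[OF i]]])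
  have crit: "{\<delta>. critical_weight K \<sigma> \<tau> k d m R \<delta>} = (\<Union>i\<in>{..<m}. ?Z i)"
    unfolding critical_weight_def by blast
  have fin: "finite (\<Union>i\<in>{..<m}. ?Z i)"
    by (rule finite_UN_I[OF finite_lessThan conjunct1[OF Z]]) (simp only: lessThan_iff)
  have "card (\<Union>i\<in>{..<m}. ?Z i) \<le> (\<Sum>i<m. card (?Z i))" by (rule card_UN_le[OF finite_lessThan])
  also have "\<dots> \<le> (\<Sum>i<m. card (?O i))"
    by (rule sum_mono[OF conjunct2[OF Z]]) (simp only: lessThan_iff)
  finally have "card (\<Union>i\<in>{..<m}. ?Z i) \<le> (\<Sum>i<m. card (?O i))" .
  then show ?thesis
    unfolding crit
    by (intro conjI allI impI ballI once finite_other_casimirs Z[THEN conjunct1] Z[THEN conjunct2] fin)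
qed

end
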